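(* Let $n,N\in\mathbb{N}$, $\sigma_x,\sigma_k>0$ with $\sigma_x^2\leqslant2$. There is a suitable finite constant $M_2=M_2(n,N)\leqslant\min\{-n-1,-3\}$ with the following property. Let $V:\mathbb{R}^n\to\mathbb{R}$ be such that (A1) $\hat V(k)$ has no singular support outside $\{0\}$; (A2) there exist $C_1>0$ and $0\leqslant M_1\leqslant N+1$ such that $|\hat V(k)|\leqslant C_1|k|^{-M_1}$ for all $|k|\leqslant1$, $k\neq0$; (A3) there exists $C_2>0$ such that $|\hat V(k)|\leqslant C_2|k|^{M_2}$ for all $|k|>1$. Let $\{f^\varepsilon\}_{\varepsilon\in(0,1)}\subset\mathcal{S}(\mathbb{R}^n)$ be a family for which there exists $M_0>0$ with $\|f^\varepsilon\|_{L^2(\mathbb{R}^n)}\leqslant M_0$ for all $\varepsilon$, and let $\tilde w^\varepsilon(x,k)=\tilde W^\varepsilon[f^\varepsilon](x,k)$. Then the expression $$\tilde W^\varepsilon[Vf^\varepsilon,f^\varepsilon](x,k)=\int_{S\in\mathbb{R}^n}e^{2\pi i Sx-\frac{\varepsilon\pi}{2}\sigma_x^2S^2}\,\hat V(S)\,\tilde w^\varepsilon\left(x+\frac{i\varepsilon\sigma_x^2}{2}S,\;k-\frac{\varepsilon}{2}S\right)dS$$ can be approximated by differential operators: $$\tilde W^\varepsilon[Vf^\varepsilon,f^\varepsilon](x,k)=\sum_{m=0}^N\frac{\varepsilon^m}{(4\pi i)^m}\sum_{l=0}^m(i\sigma_x^2)^l(-1)^{m-l}\sum_{\substack{A\in(\mathbb{N}\cup\{0\})^n\\|A|=l}}\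 \sum_{\substack{B\in(\mathbb{N}\cup\{0\})^n\\|B|=m-l}}\frac{\partial_x^{A+B}\tilde V(x)}{A!\,B!}\,\partial_x^A\partial_k^B\tilde w^\varepsilon(x,k)+r_\varepsilon(x,k),$$ where $$\|r_\varepsilon\|_{L^\infty(\mathbb{R}^{2n})}=O\left(\varepsilon^{\frac{N+1}{2}-n}\right)$$ (as $\varepsilon\to0$), and $\tilde V$ is the smoothed potential $$\tilde V(x)=\left(\frac{\sqrt2}{\sqrt\varepsilon\,\sigma_x}\right)^n\int_{x'\in\mathbb{R}^n}e^{-\frac{2\pi|x-x'|^2}{\varepsilon\sigma_x^2}}V(x')\,dx'.$$
   Context: Fourier transform: $\hat V(k)=\int_{\mathbb{R}^n}e^{-2\pi i k\cdot x}V(x)\,dx$ (in the sense of tempered distributions; $V$ is regarded as a tempered distribution). The semiclassically scaled smoothed Wigner transform is $$\tilde W^\varepsilon[f,g](x,k)=\left(\frac{\sqrt2}{\sigma_x\sqrt\varepsilon}\right)^n\int_{u,y\in\mathbb{R}^n}e^{-2\pi i k y-\frac{\pi\varepsilon\sigma_k^2y^2}{2}-\frac{2\pi(u-x)^2}{\varepsilon\sigma_x^2}}\,f\left(u+\frac{\varepsilon y}{2}\right)\bar g\left(u-\frac{\varepsilon y}{2}\right)du\,dy,$$ and $\tilde W^\varepsilon[f]=\tilde W^\varepsilon[f,f]$. The function $\tilde w^\varepsilon$ extends to an entire function on $\mathbb{C}^{2n}$; values at complex arguments refer to this extension. Standard multi-index notation is used: $|A|=A_1+\dots+A_n$, $A!=A_1!\cdots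 A_n!$, $\partial_x^A=\partial_{x_1}^{A_1}\cdots\partial_{x_n}^{A_n}$, $\partial_k^B=\partial_{k_1}^{B_1}\cdots\partial_{k_n}^{B_n}$.
   Formalization: (A2) is also required of V̂ as a distribution: on test functions whose derivatives of order ≤ M_1 vanish at 0, V̂ acts by integrating its values. This excludes polynomial parts of V of degree > N+1; e.g. for n=1, V=x^{N+2} the claim as written fails. *)

theory Defs
  imports "HOL-Analysis.Analysis" "HOL-Probability.Essential_Supremum"
begin

section \<open>Partial derivatives and multi-indices on \<open>\<real>\<^sup>n\<close>\<close>

definition partial :: "'n \<Rightarrow> (real^'n \<Rightarrow> 'b) \<Rightarrow> real^'n \<Rightarrow> 'b::real_normed_vector" where
  "partial i f x = vector_derivative (\<lambda>t. f (x + t *\<^sub>R axis i 1)) (at 0)"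

text \<open>A multi-index is a function \<open>'n \<Rightarrow> nat\<close>. The partial derivatives are taken in the order
  of an arbitrary enumeration of the coordinates; for smooth functions the order is irrelevant.\<close>

definition coords :: "'n::finite list" where
  "coords = (SOME is. distinct is \<and> set is = UNIV)"

definition mderiv :: "('n \<Rightarrow> nat) \<Rightarrow> (real^'n \<Rightarrow> 'b) \<Rightarrow> real^'n \<Rightarrow> 'b::real_normed_vector" where
  "mderiv A f = fold (\<lambda>i. (partial i) ^^ (A i)) coords f"

definition msize :: "('n::finite \<Rightarrow> nat) \<Rightarrow> nat" where
  "msize A = (\<Sum>i\<in>UNIV. A i)"

definition mfact :: "('n::finite \<Rightarrow> nat) \<Rightarrow> nat" where
  "mfact A = (\<Prod>i\<in>UNIV. fact (A i))"

text \<open>\<open>Ck_on m U f\<close> is only meant for open \<open>U\<close>.\<close>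

primrec Ck_on :: "nat \<Rightarrow> (real^'n) set \<Rightarrow> (real^'n \<Rightarrow> 'b::real_normed_vector) \<Rightarrow> bool" where
  "Ck_on 0 U f \<longleftrightarrow> continuous_on U f"
| "Ck_on (Suc m) U f \<longleftrightarrow> f differentiable_on U \<and> (\<forall>i. Ck_on m U (partial i f))"

definition smooth_on :: "(real^'n) set \<Rightarrow> (real^'n \<Rightarrow> 'b::real_normed_vector) \<Rightarrow> bool" where
  "smooth_on U f \<longleftrightarrow> (\<forall>m. Ck_on m U f)"

section \<open>Schwartz functions and tempered distributions\<close>

definition schwartz :: "(real^'n \<Rightarrow> complex) \<Rightarrow> bool" where
  "schwartz \<phi> \<longleftrightarrow> smooth_on UNIV \<phi> \<and>
     (\<forall>m A. bounded (range (\<lambda>x. (1 + norm x) ^ m *\<^sub>R mderiv A \<phi> x)))"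

definition schwartz_seminorm :: "nat \<Rightarrow> (real^'n \<Rightarrow> complex) \<Rightarrow> real" where
  "schwartz_seminorm m \<phi> =
     (\<Sum>A | msize A \<le> m. SUP x. (1 + norm x) ^ m * norm (mderiv A \<phi> x))"

text \<open>Distributions are total functionals; only their values on Schwartz functions matter.\<close>

type_synonym 'n distr = "(real^'n \<Rightarrow> complex) \<Rightarrow> complex"

definition tempered_distr :: "'n::finite distr \<Rightarrow> bool" where
  "tempered_distr T \<longleftrightarrow>
     (\<forall>\<phi> \<psi>. schwartz \<phi> \<longrightarrow> schwartz \<psi> \<longrightarrow> T (\<lambda>x. \<phi> x + \<psi> x) = T \<phi> + T \<psi>) \<and>
     (\<forall>c \<phi>. schwartz \<phi> \<longrightarrow> T (\<lambda>x. c * \<phi> x) = c * T \<phi>) \<and>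
     (\<exists>C m. \<forall>\<phi>. schwartz \<phi> \<longrightarrow> norm (T \<phi>) \<le> C * schwartz_seminorm m \<phi>)"

definition distr_of :: "(real^'n \<Rightarrow> real) \<Rightarrow> 'n::finite distr" where
  "distr_of V \<phi> = (LINT x|lebesgue. complex_of_real (V x) * \<phi> x)"

definition tempered_fun :: "(real^'n \<Rightarrow> real) \<Rightarrow> bool" where
  "tempered_fun V \<longleftrightarrow>
     (\<forall>\<phi>. schwartz \<phi> \<longrightarrow> integrable lebesgue (\<lambda>x. complex_of_real (V x) * \<phi> x)) \<and>
     tempered_distr (distr_of V)"

definition fourier :: "(real^'n \<Rightarrow> complex) \<Rightarrow> real^'n \<Rightarrow> complex" where
  "fourier \<phi> k = (LINT x|lebesgue. exp (- 2 * pi * \<i> * complex_of_real (k \<bullet> x)) * \<phi> x)"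

definition distr_fourier :: "'n::finite distr \<Rightarrow> 'n distr" where
  "distr_fourier T \<phi> = T (fourier \<phi>)"

definition test_fun :: "(real^'n) set \<Rightarrow> (real^'n \<Rightarrow> complex) \<Rightarrow> bool" where
  "test_fun U \<phi> \<longleftrightarrow> smooth_on UNIV \<phi> \<and>
     compact (closure {x. \<phi> x \<noteq> 0}) \<and> closure {x. \<phi> x \<noteq> 0} \<subseteq> U"

definition represented_on ::
    "'n::finite distr \<Rightarrow> (real^'n) set \<Rightarrow> (real^'n \<Rightarrow> complex) \<Rightarrow> bool" where
  "represented_on T U g \<longleftrightarrow> (\<forall>\<phi>. test_fun U \<phi> \<longrightarrow> T \<phi> = (LINT x|lebesgue. g x * \<phi> x))"

definition sing_supp :: "'n::finite distr \<Rightarrow> (real^'n) set" where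
  "sing_supp T = {x. \<not> (\<exists>U g. open U \<and> x \<in> U \<and> smooth_on U g \<and> represented_on T U g)}"

text \<open>The value \<open>T(x)\<close> at a point \<open>x\<close> outside the singular support; unspecified elsewhere.\<close>

definition distr_value :: "'n::finite distr \<Rightarrow> real^'n \<Rightarrow> complex" where
  "distr_value T x =
     (THE c. \<exists>U g. open U \<and> x \<in> U \<and> smooth_on U g \<and> represented_on T U g \<and> g x = c)"

text \<open>
  A distribution \<open>T\<close> which is smooth outside the origin is \<open>O(|k|\<^sup>-\<^sup>M)\<close> at the origin.
  The first clause is the pointwise bound at \<open>k \<noteq> 0\<close>. It does not see distributions supported
  at \<open>0\<close>, i.e. derivatives of the delta distribution, which for \<open>T\<close> the transform of \<open>V\<close>
  amount to polynomial summands of \<open>V\<close> of unrestricted degree. The second clause expresses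
  that the bound concerns \<open>T\<close> as a distribution: on test functions vanishing at \<open>0\<close> together
  with their derivatives of order \<open>\<le> M\<close> (for which the integral converges by the first
  clause), \<open>T\<close> acts by integration against its pointwise values. This leaves room for
  derivatives of the delta distribution of order \<open>\<le> M\<close>, but not for higher ones.\<close>

definition bounded_at_origin :: "'n::finite distr \<Rightarrow> real \<Rightarrow> real \<Rightarrow> bool" where
  "bounded_at_origin T C M \<longleftrightarrow>
     (\<forall>k. norm k \<le> 1 \<and> k \<noteq> 0 \<longrightarrow> norm (distr_value T k) \<le> C * norm k powr (- M)) \<and>
     (\<forall>\<phi>. test_fun UNIV \<phi> \<and> (\<forall>A. real (msize A) \<le> M \<longrightarrow> mderiv A \<phi> 0 = 0) \<longrightarrow>
        T \<phi> = (LINT k|lebesgue. distr_value T k * \<phi> k))"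

section \<open>Norms\<close>

definition L2_norm_fun :: "(real^'n \<Rightarrow> complex) \<Rightarrow> real" where
  "L2_norm_fun f = sqrt (LINT x|lebesgue. (norm (f x))\<^sup>2)"

definition Linf_norm :: "(real^'n \<Rightarrow> real^'n \<Rightarrow> complex) \<Rightarrow> ereal" where
  "Linf_norm r = esssup lebesgue (\<lambda>z. ereal (norm (r (fst z) (snd z))))"

section \<open>Entire extension\<close>

text \<open>Entire functions on \<open>\<complex>\<^sup>2\<^sup>n = \<complex>\<^sup>n \<times> \<complex>\<^sup>n\<close>: everywhere Frechet differentiable with
  complex-linear derivative.\<close>

definition entire :: "((complex^'n) \<times> (complex^'n) \<Rightarrow> complex) \<Rightarrow> bool" where
  "entire F \<longleftrightarrow> (\<forall>z. \<exists>D. (F has_derivative D) (at z) \<and>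
     (\<forall>c v. D (c *s fst v, c *s snd v) = c * D v))"

definition cvec :: "real^'n \<Rightarrow> complex^'n" where
  "cvec x = (\<chi> i. complex_of_real (x $ i))"

definition entire_ext :: "(real^'n \<Rightarrow> real^'n \<Rightarrow> complex) \<Rightarrow> (complex^'n) \<times> (complex^'n) \<Rightarrow> complex" where
  "entire_ext w = (THE F. entire F \<and> (\<forall>x k. F (cvec x, cvec k) = w x k))"

section \<open>Smoothed Wigner transform and smoothed potential\<close>

definition smoothed_wigner ::
    "real \<Rightarrow> real \<Rightarrow> real \<Rightarrow> (real^'n \<Rightarrow> complex) \<Rightarrow> (real^'n \<Rightarrow> complex) \<Rightarrow> real^'n \<Rightarrow> real^'n \<Rightarrow> complex"
  where
  "smoothed_wigner \<sigma>x \<sigma>k \<epsilon> f g x k =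
     complex_of_real ((sqrt 2 / (\<sigma>x * sqrt \<epsilon>)) ^ CARD('n)) *
     (LINT p|lebesgue. (case p of (u, y) \<Rightarrow>
        exp (- 2 * pi * \<i> * complex_of_real (k \<bullet> y)
             - complex_of_real (pi * \<epsilon> * \<sigma>k\<^sup>2 * (norm y)\<^sup>2 / 2)
             - complex_of_real (2 * pi * (norm (u - x))\<^sup>2 / (\<epsilon> * \<sigma>x\<^sup>2))) *
        f (u + (\<epsilon> / 2) *\<^sub>R y) * cnj (g (u - (\<epsilon> / 2) *\<^sub>R y))))"

definition smoothed_potential :: "real \<Rightarrow> real \<Rightarrow> (real^'n \<Rightarrow> real) \<Rightarrow> real^'n \<Rightarrow> real" where
  "smoothed_potential \<sigma>x \<epsilon> V x = (sqrt 2 / (sqrt \<epsilon> * \<sigma>x)) ^ CARD('n) *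
     (LINT x'|lebesgue. exp (- 2 * pi * (norm (x - x'))\<^sup>2 / (\<epsilon> * \<sigma>x\<^sup>2)) * V x')"

text \<open>The Schwartz function of \<open>S\<close> against which the transform of \<open>V\<close> is paired.\<close>

definition wigner_symbol ::
    "real \<Rightarrow> real \<Rightarrow> (real^'n \<Rightarrow> real^'n \<Rightarrow> complex) \<Rightarrow> real^'n \<Rightarrow> real^'n \<Rightarrow> real^'n \<Rightarrow> complex" where
  "wigner_symbol \<sigma>x \<epsilon> w x k S =
     exp (2 * pi * \<i> * complex_of_real (S \<bullet> x)
          - complex_of_real (\<epsilon> * pi / 2 * \<sigma>x\<^sup>2 * (norm S)\<^sup>2)) *
     entire_ext w (cvec x + (\<i> * complex_of_real (\<epsilon> * \<sigma>x\<^sup>2 / 2)) *s cvec S,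
                   cvec (k - (\<epsilon> / 2) *\<^sub>R S))"

definition smoothed_expansion ::
    "nat \<Rightarrow> real \<Rightarrow> real \<Rightarrow> (real^'n \<Rightarrow> real) \<Rightarrow> (real^'n \<Rightarrow> real^'n \<Rightarrow> complex) \<Rightarrow>
     real^'n \<Rightarrow> real^'n \<Rightarrow> complex" where
  "smoothed_expansion N \<sigma>x \<epsilon> V w x k =
     (\<Sum>m=0..N. complex_of_real (\<epsilon> ^ m) / (4 * pi * \<i>) ^ m *
       (\<Sum>l=0..m. (\<i> * complex_of_real (\<sigma>x\<^sup>2)) ^ l * (- 1) ^ (m - l) *
         (\<Sum>A | msize A = l. \<Sum>B | msize B = m - l.
            complex_of_real (mderiv (\<lambda>i. A i + B i) (smoothed_potential \<sigma>x \<epsilon> V) x)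
              / of_nat (mfact A * mfact B) *
            mderiv A (\<lambda>x'. mderiv B (\<lambda>k'. w x' k') k) x)))"

end

theory Submission
  imports Defs "HOL-Probability.Probability" "HOL-Complex_Analysis.Complex_Analysis"
begin

text \<open>
  Why the expansion holds. Put \<open>a = \<epsilon> \<sigma>x\<^sup>2 / (4 \<pi>)\<close> and let \<open>G\<close> be the centred Gaussian density of
  variance \<open>a\<close> in each coordinate. The smoothed transform at \<open>(x, k)\<close> is the average of
  \<open>f (u + h) cnj (f (u - h))\<close>, \<open>h = \<epsilon> y / 2\<close>, against the kernel
  \<open>G (u - x) exp (- 2 \<pi> i k y) exp (- \<pi> \<epsilon> \<sigma>k\<^sup>2 |y|\<^sup>2 / 2)\<close>, and the smoothed potential is the
  convolution \<open>V * G\<close>. Replacing \<open>f\<close> by \<open>V f\<close> in the first slot inserts the factor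
  \<open>V (x + z + h)\<close> with \<open>z = u - x\<close>. On the other side, \<open>k\<close>-derivatives of the transform insert powers of
  \<open>y\<close> and \<open>x\<close>-derivatives insert Hermite polynomials \<open>He\<^sub>A z\<close> of variance \<open>a\<close>. The powers of \<open>\<epsilon>\<close>, \<open>i\<close> and
  \<open>\<sigma>x\<close> in the expansion are exactly the normalising factors of these insertions, so the expansion is
  the same average with \<open>V (x + z + h)\<close> replaced by
  \<open>\<Sum> (\<partial>\<^sup>A\<^sup>+\<^sup>B (V * G) x) He\<^sub>A z h\<^sup>B / (A! B!)\<close>, the sum being over \<open>|A| + |B| \<le> N\<close>
  (\<open>smoothed_expansion_moments\<close>). The derivative \<open>\<partial>\<^sup>D (V * G) x\<close> is the \<open>D\<close>-th Hermite
  coefficient of \<open>V (x + \<cdot>)\<close>, and by orthogonality this sum reproduces every polynomial of degree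
  at most \<open>N\<close> without error (\<open>hermite_expansion_polyn\<close>).

  Hence only the distance of \<open>V (x + \<cdot>)\<close> from polynomials of degree \<open>N\<close> matters. If it is at most
  \<open>C |z|\<^sup>N\<^sup>+\<^sup>1\<close> with \<open>C\<close> independent of \<open>x\<close>, then the two factors differ by
  \<open>O ((\<surd>a + |z| + |h|)\<^sup>N\<^sup>+\<^sup>1)\<close> (\<open>hermite_remainder\<close>). Under the Gaussian weights each of
  \<open>\<surd>a\<close>, \<open>z\<close>, \<open>h\<close> has size \<open>\<surd>\<epsilon>\<close>, which yields \<open>\<epsilon>\<close> to the power \<open>(N + 1) / 2\<close>; the supremum of \<open>G\<close> and the
  integral of the damping factor over \<open>y\<close> cost \<open>\<epsilon>\<close> to the power \<open>- n / 2\<close> each, while the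
  \<open>u\<close>-integral of \<open>|f (u + h) f (u - h)|\<close> is at most \<open>\<parallel>f\<parallel>\<^sup>2\<close>. This is the exponent of the theorem.

  The uniform Taylor bound is \<open>potential_representation\<close>. With \<open>M2 = - (2 n + N + 4)\<close> the function
  \<open>|k|\<^sup>N\<^sup>+\<^sup>1\<close> times the transform of \<open>V\<close> is integrable. Subtracting from \<open>exp (2 \<pi> i k p)\<close>, for
  \<open>|k| \<le> 1\<close>, its Taylor polynomial of degree \<open>N + 1\<close> makes the inverse Fourier integral of the
  transform converge absolutely to a function \<open>U\<close> with the required Taylor bound. The functionals
  \<open>V\<close> and \<open>U\<close> agree on transforms of test functions whose derivatives of order at most \<open>N + 1\<close> vanish
  at \<open>0\<close>. By linear algebra \<open>V - U\<close> acts on transforms of all test functions as a polynomial \<open>P\<close> of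
  degree at most \<open>N + 1\<close>, and an approximate identity extends this to all Schwartz functions. Since
  polynomials of degree \<open>N + 1\<close> satisfy the Taylor bound trivially, \<open>U + P\<close> can replace \<open>V\<close>.

  The distributional formula for the transform of \<open>(V f, f)\<close> holds because the symbol in the
  statement is the inverse Fourier transform of the density \<open>\<Phi>\<close> against which \<open>V\<close> is integrated. To
  see this, the entire extension is identified with the defining integral at complex arguments; an
  entire function on \<open>\<complex>\<^sup>2\<^sup>n\<close> is determined by its values at real points.\<close>

(* frees the dollar sign for vector components *)
unbundle no fps_syntax

section \<open>Partial derivatives\<close>

lemma vector_derivative_along_axis:
  fixes f :: "real^'n::finite \<Rightarrow> 'b::real_normed_vector"
  assumes "(f has_derivative D) (at (x + t *\<^sub>R axis i 1))"
  shows "((\<lambda>t. f (x + t *\<^sub>R axis i 1)) has_vector_derivative D (axis i 1)) (at t)"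
proof -
  have 1: "((\<lambda>t. x + t *\<^sub>R axis i (1::real)) has_derivative (\<lambda>t. t *\<^sub>R axis i 1)) (at t)"
    by (auto intro!: derivative_eq_intros)
  have "((f \<circ> (\<lambda>t. x + t *\<^sub>R axis i 1)) has_derivative (D \<circ> (\<lambda>t. t *\<^sub>R axis i 1))) (at t)"
    by (rule diff_chain_at[OF 1 assms])
  moreover have "linear D" using assms has_derivative_linear by blast
  ultimately show ?thesis
    by (simp add: has_vector_derivative_def o_def linear_scale)
qed

lemma partial_eqI:
  fixes f :: "real^'n::finite \<Rightarrow> 'b::real_normed_vector"
  assumes "(f has_derivative D) (at x)"
  shows "partial i f x = D (axis i 1)"
  unfolding partial_def
  by (rule vector_derivative_at, rule vector_derivative_along_axis) (simp add: assms)

lemma has_vector_derivative_partial: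
  fixes f :: "real^'n::finite \<Rightarrow> 'b::real_normed_vector"
  assumes "f differentiable_on UNIV"
  shows "((\<lambda>t. f (x + t *\<^sub>R axis i 1)) has_vector_derivative partial i f (x + t *\<^sub>R axis i 1)) (at t)"
proof -
  obtain D where D: "(f has_derivative D) (at (x + t *\<^sub>R axis i 1))"
    using assms by (auto simp: differentiable_on_def differentiable_def)
  show ?thesis using vector_derivative_along_axis[OF D] partial_eqI[OF D] by simp
qed

lemma differentiable_on_UNIV_E:
  assumes "f differentiable_on UNIV"
  obtains D where "(f has_derivative D) (at x)"
  using assms by (auto simp: differentiable_on_def differentiable_def)

lemma partial_add:
  fixes f g :: "real^'n::finite \<Rightarrow> 'b::real_normed_vector"
  assumes "f differentiable_on UNIV" "g differentiable_on UNIV"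
  shows "partial i (\<lambda>x. f x + g x) = (\<lambda>x. partial i f x + partial i g x)"
proof
  fix x
  obtain D where D: "(f has_derivative D) (at x)" by (rule differentiable_on_UNIV_E[OF assms(1)])
  obtain E where E: "(g has_derivative E) (at x)" by (rule differentiable_on_UNIV_E[OF assms(2)])
  show "partial i (\<lambda>x. f x + g x) x = partial i f x + partial i g x"
    using partial_eqI[OF has_derivative_add[OF D E]] partial_eqI[OF D] partial_eqI[OF E] by simp
qed

lemma partial_mult:
  fixes f g :: "real^'n::finite \<Rightarrow> complex"
  assumes "f differentiable_on UNIV" "g differentiable_on UNIV"
  shows "partial i (\<lambda>x. f x * g x) = (\<lambda>x. f x * partial i g x + partial i f x * g x)"
proof
  fix x
  obtain D where D: "(f has_derivative D) (at x)" by (rule differentiable_on_UNIV_E[OF assms(1)])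
  obtain E where E: "(g has_derivative E) (at x)" by (rule differentiable_on_UNIV_E[OF assms(2)])
  show "partial i (\<lambda>x. f x * g x) x = f x * partial i g x + partial i f x * g x"
    using partial_eqI[OF has_derivative_mult[OF D E]] partial_eqI[OF D] partial_eqI[OF E] by simp
qed

lemma partial_linear:
  fixes f :: "real^'n::finite \<Rightarrow> 'b::real_normed_vector"
  assumes "f differentiable_on UNIV" "bounded_linear L"
  shows "partial i (\<lambda>x. L (f x)) = (\<lambda>x. L (partial i f x))"
proof
  fix x
  obtain D where D: "(f has_derivative D) (at x)" by (rule differentiable_on_UNIV_E[OF assms(1)])
  have "((\<lambda>x. L (f x)) has_derivative (\<lambda>v. L (D v))) (at x)"
    by (rule bounded_linear.has_derivative[OF assms(2) D])
  from partial_eqI[OF this] partial_eqI[OF D]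
  show "partial i (\<lambda>x. L (f x)) x = L (partial i f x)" by simp
qed

lemma partial_const: "partial i (\<lambda>x::real^'n::finite. c) = (\<lambda>x. 0::'b::real_normed_vector)"
  by (rule ext, rule partial_eqI[where D="\<lambda>_. 0", simplified]) simp

section \<open>Symmetry of second partial derivatives\<close>

text \<open>
  The mixed second difference is one step in direction i of a step in direction j; applying the mean
  value theorem to each step turns it into a second partial derivative nearby. The expression is
  symmetric in i and j, so doing the steps in either order compares the two mixed derivatives.\<close>

lemma second_difference_mean_value:
  fixes F :: "real^'n::finite \<Rightarrow> real"
  assumes "F differentiable_on UNIV" "partial i F differentiable_on UNIV" "h > 0"
  shows "\<exists>y. dist y x \<le> 2 * h \<and>
    F (x + h *\<^sub>R axis j 1 + h *\<^sub>R axis i 1) - F (x + h *\<^sub>R axis i 1) - F (x + h *\<^sub>R axis j 1) + F x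
      = h * h * partial j (partial i F) y"
proof -
  let ?p = "partial i F"
  have d: "DERIV (\<lambda>t. F (x + h *\<^sub>R axis j 1 + t *\<^sub>R axis i 1) - F (x + t *\<^sub>R axis i 1)) t :>
      ?p (x + h *\<^sub>R axis j 1 + t *\<^sub>R axis i 1) - ?p (x + t *\<^sub>R axis i 1)" for t
    using has_vector_derivative_diff[OF has_vector_derivative_partial[OF assms(1)] has_vector_derivative_partial[OF assms(1)]]
    by (simp add: has_real_derivative_iff_has_vector_derivative)
  obtain s where s: "0 < s" "s < h" and
    e1: "(F (x + h *\<^sub>R axis j 1 + h *\<^sub>R axis i 1) - F (x + h *\<^sub>R axis i 1))
      - (F (x + h *\<^sub>R axis j 1) - F x) = h * (?p (x + h *\<^sub>R axis j 1 + s *\<^sub>R axis i 1) - ?p (x + s *\<^sub>R axis i 1))"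
    using MVT2[OF \<open>h > 0\<close> d] by auto
  have d2: "DERIV (\<lambda>t. ?p ((x + s *\<^sub>R axis i 1) + t *\<^sub>R axis j 1)) t :> partial j ?p ((x + s *\<^sub>R axis i 1) + t *\<^sub>R axis j 1)" for t
    using has_vector_derivative_partial[OF assms(2)]
    by (simp add: has_real_derivative_iff_has_vector_derivative)
  obtain t where t: "0 < t" "t < h" and
    e2: "?p ((x + s *\<^sub>R axis i 1) + h *\<^sub>R axis j 1) - ?p (x + s *\<^sub>R axis i 1) = h * partial j ?p ((x + s *\<^sub>R axis i 1) + t *\<^sub>R axis j 1)"
    using MVT2[OF \<open>h > 0\<close> d2] by auto
  have "dist ((x + s *\<^sub>R axis i 1) + t *\<^sub>R axis j 1) x = norm (s *\<^sub>R axis i (1::real) + t *\<^sub>R axis j (1::real) :: real^'n)"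
    by (simp add: dist_norm add.assoc)
  also have "\<dots> \<le> norm (s *\<^sub>R axis i (1::real) :: real^'n) + norm (t *\<^sub>R axis j (1::real) :: real^'n)"
    by (rule norm_triangle_ineq)
  also have "\<dots> \<le> 2 * h" using s t by (simp add: norm_axis_1)
  finally have "dist ((x + s *\<^sub>R axis i 1) + t *\<^sub>R axis j 1) x \<le> 2 * h" .
  moreover have "F (x + h *\<^sub>R axis j 1 + h *\<^sub>R axis i 1) - F (x + h *\<^sub>R axis i 1) - F (x + h *\<^sub>R axis j 1) + F x
      = h * h * partial j ?p ((x + s *\<^sub>R axis i 1) + t *\<^sub>R axis j 1)"
    using e1 e2 by (simp add: algebra_simps)
  ultimately show ?thesis by blast
qed

lemma partial_commute_real:
  fixes F :: "real^'n::finite \<Rightarrow> real"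
  assumes "F differentiable_on UNIV" "partial i F differentiable_on UNIV" "partial j F differentiable_on UNIV"
    "continuous_on UNIV (partial j (partial i F))" "continuous_on UNIV (partial i (partial j F))"
  shows "partial j (partial i F) x = partial i (partial j F) x"
proof -
  define h :: "nat \<Rightarrow> real" where "h n = inverse (real (Suc n))" for n
  have h0: "h \<longlonglongrightarrow> 0" unfolding h_def by (rule LIMSEQ_inverse_real_of_nat)
  have hp: "h n > 0" for n by (simp add: h_def)
  define \<Delta> where "\<Delta> n = (F (x + h n *\<^sub>R axis j 1 + h n *\<^sub>R axis i 1) - F (x + h n *\<^sub>R axis i 1) - F (x + h n *\<^sub>R axis j 1) + F x) / (h n * h n)" for n
  have "\<exists>y. dist y x \<le> 2 * h n \<and> \<Delta> n = partial j (partial i F) y" for n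
    using second_difference_mean_value[OF assms(1,2) hp[of n], of x j] hp[of n] by (auto simp: \<Delta>_def)
  then obtain y where y: "\<And>n. dist (y n) x \<le> 2 * h n" "\<And>n. \<Delta> n = partial j (partial i F) (y n)" by metis
  have "\<exists>y. dist y x \<le> 2 * h n \<and> \<Delta> n = partial i (partial j F) y" for n
    using second_difference_mean_value[OF assms(1,3) hp[of n], of x i] hp[of n]
    by (auto simp: \<Delta>_def algebra_simps)
  then obtain z where z: "\<And>n. dist (z n) x \<le> 2 * h n" "\<And>n. \<Delta> n = partial i (partial j F) (z n)" by metis
  have lim: "u \<longlonglongrightarrow> x" if "\<And>n. dist (u n) x \<le> 2 * h n" for u
  proof (rule metric_tendsto_imp_tendsto)
    show "(\<lambda>n. 2 * h n) \<longlonglongrightarrow> 0" using h0 by (auto intro: tendsto_eq_intros)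
    show "\<forall>\<^sub>F n in sequentially. dist (u n) x \<le> dist (2 * h n) 0" 
      using that hp by (auto simp: dist_norm abs_mult less_imp_le)
  qed
  have "\<Delta> \<longlonglongrightarrow> partial j (partial i F) x"
    using continuous_on_tendsto_compose[OF assms(4) lim[OF y(1)]] unfolding y(2)[symmetric] by simp
  moreover have "\<Delta> \<longlonglongrightarrow> partial i (partial j F) x"
    using continuous_on_tendsto_compose[OF assms(5) lim[OF z(1)]] unfolding z(2)[symmetric] by simp
  ultimately show ?thesis by (rule LIMSEQ_unique)
qed

section \<open>Function classes stable under differentiation\<close>

text \<open>
  Functions of class C^m all of whose derivatives of order at most m satisfy the growth condition G.
  Letting G vary gives at once C^m functions, Schwartz functions and functions of polynomial growth, and
  the closure properties below are proved for all of them by one induction on m.\<close>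

primrec regular :: "((real^'n::finite \<Rightarrow> complex) \<Rightarrow> bool) \<Rightarrow> nat \<Rightarrow> (real^'n \<Rightarrow> complex) \<Rightarrow> bool" where
  "regular G 0 f \<longleftrightarrow> continuous_on UNIV f \<and> G f"
| "regular G (Suc m) f \<longleftrightarrow> f differentiable_on UNIV \<and> G f \<and> (\<forall>i. regular G m (partial i f))"

lemma regular_continuous: "regular G m f \<Longrightarrow> continuous_on UNIV f"
  by (cases m) (auto intro: differentiable_imp_continuous_on)

lemma regular_class: "regular G m f \<Longrightarrow> G f"
  by (cases m) auto

lemma regular_mono: 
  assumes "\<And>f. G f \<Longrightarrow> G' f"
  shows "regular G m f \<Longrightarrow> regular G' m f"
proof (induction m arbitrary: f)
  case 0
  then show ?case unfolding regular.simps using assms by blast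
next
  case (Suc m)
  then show ?case unfolding regular.simps using assms by blast
qed

lemma regular_of_Suc: "regular G (Suc m) f \<Longrightarrow> regular G m f"
proof (induction m arbitrary: f)
  case 0
  then show ?case using regular_continuous[OF 0] regular_class[OF 0] by simp
next
  case (Suc m)
  then show ?case unfolding regular.simps(2)[of G "Suc m"] regular.simps(2)[of G m] by blast
qed

lemma regular_SucI:
  "f differentiable_on UNIV \<Longrightarrow> G f \<Longrightarrow> (\<And>i. regular G m (partial i f)) \<Longrightarrow> regular G (Suc m) f"
  by simp

lemma regular_SucD:
  assumes "regular G (Suc m) f"
  shows "f differentiable_on UNIV" "regular G m (partial i f)"
  using assms by simp_all

lemma regular_add:
  assumes add: "\<And>f g. G f \<Longrightarrow> G g \<Longrightarrow> G (\<lambda>x. f x + g x)"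
  shows "regular G m f \<Longrightarrow> regular G m g \<Longrightarrow> regular G m (\<lambda>x. f x + g x)"
proof (induction m arbitrary: f g)
  case 0
  have "G (\<lambda>x. f x + g x)" by (rule add) (fact regular_class[OF 0(1)] regular_class[OF 0(2)])+
  moreover have "continuous_on UNIV (\<lambda>x. f x + g x)"
    by (rule continuous_on_add) (fact regular_continuous[OF 0(1)] regular_continuous[OF 0(2)])+
  ultimately show ?case unfolding regular.simps by blast
next
  case (Suc m)
  show ?case
  proof (rule regular_SucI)
    note d = regular_SucD(1)[OF Suc.prems(1)] regular_SucD(1)[OF Suc.prems(2)]
    show "(\<lambda>x. f x + g x) differentiable_on UNIV" by (rule differentiable_on_add[OF d])
    show "G (\<lambda>x. f x + g x)" by (rule add) (fact regular_class[OF Suc.prems(1)] regular_class[OF Suc.prems(2)])+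
    show "regular G m (partial i (\<lambda>x. f x + g x))" for i
      unfolding partial_add[OF d]
      by (rule Suc.IH) (fact regular_SucD(2)[OF Suc.prems(1)] regular_SucD(2)[OF Suc.prems(2)])+
  qed
qed

text \<open>
  By the product rule the class of a product depends only on how the growth conditions multiply.\<close>

lemma regular_mult:
  assumes add: "\<And>f g. G f \<Longrightarrow> G g \<Longrightarrow> G (\<lambda>x. f x + g x)"
    and mult: "\<And>f g. G1 f \<Longrightarrow> G2 g \<Longrightarrow> G (\<lambda>x. f x * g x)"
  shows "regular G1 m f \<Longrightarrow> regular G2 m g \<Longrightarrow> regular G m (\<lambda>x. f x * g x)"
proof (induction m arbitrary: f g)
  case 0
  have "G (\<lambda>x. f x * g x)" by (rule mult) (fact regular_class[OF 0(1)] regular_class[OF 0(2)])+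
  moreover have "continuous_on UNIV (\<lambda>x. f x * g x)"
    by (rule continuous_on_mult) (fact regular_continuous[OF 0(1)] regular_continuous[OF 0(2)])+
  ultimately show ?case unfolding regular.simps by blast
next
  case (Suc m)
  note d = regular_SucD(1)[OF Suc.prems(1)] regular_SucD(1)[OF Suc.prems(2)]
  note r = regular_of_Suc[OF Suc.prems(1)] regular_of_Suc[OF Suc.prems(2)]
  note p = regular_SucD(2)[OF Suc.prems(1)] regular_SucD(2)[OF Suc.prems(2)]
  show ?case
  proof (rule regular_SucI)
    show "(\<lambda>x. f x * g x) differentiable_on UNIV" by (rule differentiable_on_mult[OF d])
    show "G (\<lambda>x. f x * g x)" by (rule mult) (fact regular_class[OF Suc.prems(1)] regular_class[OF Suc.prems(2)])+
    show "regular G m (partial i (\<lambda>x. f x * g x))" for i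
      unfolding partial_mult[OF d]
      using regular_add[where G=G, OF add Suc.IH[OF r(1) p(2)] Suc.IH[OF p(1) r(2)]] .
  qed
qed

lemma regular_const:
  fixes G :: "(real^'n::finite \<Rightarrow> complex) \<Rightarrow> bool"
  assumes "G (\<lambda>x. c)" "G (\<lambda>x. 0)" shows "regular G m (\<lambda>x. c)"
proof -
  have 0: "regular G m (\<lambda>x. 0)" for m
    by (induction m) (use assms(2) in \<open>simp_all add: partial_const\<close>)
  show ?thesis using assms(1) 0 by (cases m) (simp_all add: partial_const)
qed

lemma Ck_on_iff_regular: "Ck_on m UNIV f \<longleftrightarrow> regular (\<lambda>_. True) m f"
  by (induction m arbitrary: f) auto

lemma smooth_on_iff_regular: "smooth_on UNIV f \<longleftrightarrow> (\<forall>m. regular (\<lambda>_. True) m f)"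
  by (simp add: smooth_on_def Ck_on_iff_regular)

lemma regular_partial: "(\<And>m. regular G m f) \<Longrightarrow> regular G m (partial i f)"
  using regular.simps(2) by metis

lemma regular_partial_power: "(\<And>m. regular G m f) \<Longrightarrow> regular G m ((partial i ^^ k) f)"
  by (induction k arbitrary: m) (auto intro: regular_partial)

lemma regular_fold_partial: "(\<And>m. regular G m f) \<Longrightarrow> regular G m (fold (\<lambda>i. (partial i) ^^ (A i)) is f)"
  by (induction "is" arbitrary: f m) (auto intro: regular_partial_power)

lemma regular_mderiv: "(\<And>m. regular G m f) \<Longrightarrow> regular G m (mderiv A f)"
  unfolding mderiv_def by (rule regular_fold_partial)

lemma partial_commute:
  fixes f :: "real^'n::finite \<Rightarrow> complex"
  assumes "\<And>m. regular (\<lambda>_. True) m f"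
  shows "partial j (partial i f) = partial i (partial j f)"
proof -
  have d: "f differentiable_on UNIV" "partial i f differentiable_on UNIV" "partial j f differentiable_on UNIV"
    "partial i (partial j f) differentiable_on UNIV" "partial j (partial i f) differentiable_on UNIV"
    using assms regular_partial regular.simps(2) by metis+
  have R: "L (partial j (partial i f) x) = L (partial i (partial j f) x)"
    if L: "bounded_linear (L :: complex \<Rightarrow> real)" for L x
  proof -
    have dl: "(\<lambda>x. L (g x)) differentiable_on UNIV" if "g differentiable_on UNIV" for g :: "real^'n \<Rightarrow> complex"
      using that bounded_linear.has_derivative[OF L]
      unfolding differentiable_on_def differentiable_def by blast
    have p: "partial i (\<lambda>x. L (g x)) = (\<lambda>x. L (partial i g x))"  if "g differentiable_on UNIV" for g i
      by (rule partial_linear[OF that L])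
    have "partial j (partial i (\<lambda>x. L (f x))) x = partial i (partial j (\<lambda>x. L (f x))) x"
    proof (rule partial_commute_real)
      show "continuous_on UNIV (partial j (partial i (\<lambda>x. L (f x))))"
        unfolding p[OF d(1)] p[OF d(2)] by (intro differentiable_imp_continuous_on dl d)
      show "continuous_on UNIV (partial i (partial j (\<lambda>x. L (f x))))"
        unfolding p[OF d(1)] p[OF d(3)] by (intro differentiable_imp_continuous_on dl d)
    qed (auto simp: p d dl)
    then show ?thesis by (simp add: p d)
  qed
  show ?thesis using R[OF bounded_linear_Re] R[OF bounded_linear_Im] by (auto simp: complex_eq_iff fun_eq_iff)
qed

lemma partial_power_commute:
  fixes f :: "real^'n::finite \<Rightarrow> complex"
  assumes "\<And>m. regular (\<lambda>_. True) m f"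
  shows "partial i ((partial j ^^ k) f) = (partial j ^^ k) (partial i f)"
  using assms
proof (induction k)
  case (Suc k)
  have "partial i ((partial j ^^ Suc k) f) = partial j (partial i ((partial j ^^ k) f))"
    using partial_commute[OF regular_partial_power[OF Suc.prems]] by simp
  then show ?case using Suc by simp
qed simp

lemma partial_fold_commute:
  fixes f :: "real^'n::finite \<Rightarrow> complex"
  assumes "\<And>m. regular (\<lambda>_. True) m f"
  shows "partial i (fold (\<lambda>i. (partial i) ^^ (A i)) is f) = fold (\<lambda>i. (partial i) ^^ (A i)) is (partial i f)"
  using assms
  by (induction "is" arbitrary: f) (auto simp: regular_partial_power partial_power_commute)

lemma coords: "distinct (coords :: 'n::finite list)" "set (coords :: 'n list) = UNIV"
proof -
  have "\<exists>is::'n list. distinct is \<and> set is = UNIV"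
    using finite_distinct_list[of "UNIV::'n set"] by auto
  then have "distinct (coords :: 'n::finite list) \<and> set (coords :: 'n list) = UNIV"
    unfolding coords_def by (rule someI_ex)
  then show "distinct (coords :: 'n::finite list)" "set (coords :: 'n list) = UNIV" by auto
qed

text \<open>
  The fixed enumeration of the coordinates in the definition of iterated derivatives is immaterial
  for smooth functions, so a further partial derivative just raises one entry of the multi-index.\<close>

lemma partial_mderiv:
  fixes f :: "real^'n::finite \<Rightarrow> complex"
  assumes "\<And>m. regular (\<lambda>_. True) m f"
  shows "partial i (mderiv A f) = mderiv (A(i := Suc (A i))) f"
proof -
  obtain xs ys where c: "(coords :: 'n list) = xs @ i # ys" 
    using split_list[of i coords] coords by auto
  have "distinct (xs @ i # ys)" using coords(1)[where 'n='n] unfolding c .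
  then have "i \<notin> set xs" "i \<notin> set ys" by auto
  then have e: "fold (\<lambda>j. (partial j) ^^ (if j = i then Suc (A i) else A j)) xs g = fold (\<lambda>i. (partial i) ^^ (A i)) xs g"
    "fold (\<lambda>j. (partial j) ^^ (if j = i then Suc (A i) else A j)) ys g = fold (\<lambda>i. (partial i) ^^ (A i)) ys g" for g :: "real^'n \<Rightarrow> complex"
    by (auto intro!: fold_cong[THEN fun_cong])
  show ?thesis unfolding mderiv_def c using assms
    by (simp add: e partial_fold_commute regular_fold_partial regular_partial_power)
qed

definition decay :: "(real^'n::finite \<Rightarrow> complex) \<Rightarrow> bool" where
  "decay f \<longleftrightarrow> (\<forall>m. \<exists>C. \<forall>x. (1 + norm x) ^ m * norm (f x) \<le> C)"

definition moderate :: "(real^'n::finite \<Rightarrow> complex) \<Rightarrow> bool" where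
  "moderate f \<longleftrightarrow> (\<exists>m C. \<forall>x. norm (f x) \<le> C * (1 + norm x) ^ m)"

lemma decay_add: "decay f \<Longrightarrow> decay g \<Longrightarrow> decay (\<lambda>x. f x + g x)"
  unfolding decay_def
proof (rule allI)
  fix m assume "\<forall>m. \<exists>C. \<forall>x. (1 + norm x) ^ m * norm (f x) \<le> C" "\<forall>m. \<exists>C. \<forall>x. (1 + norm x) ^ m * norm (g x) \<le> C"
  then obtain C D where C: "\<And>x. (1 + norm x) ^ m * norm (f x) \<le> C" "\<And>x. (1 + norm x) ^ m * norm (g x) \<le> D" by metis
  have "(1 + norm x) ^ m * norm (f x + g x) \<le> C + D" for x
  proof -
    have "(1 + norm x) ^ m * norm (f x + g x) \<le> (1 + norm x) ^ m * (norm (f x) + norm (g x))"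
      by (intro mult_left_mono norm_triangle_ineq) auto
    also have "\<dots> \<le> C + D" using C[of x] by (simp add: distrib_left)
    finally show ?thesis .
  qed
  then show "\<exists>C. \<forall>x. (1 + norm x) ^ m * norm (f x + g x) \<le> C" by blast
qed

lemma decay_moderate_mult: "decay f \<Longrightarrow> moderate g \<Longrightarrow> decay (\<lambda>x. f x * g x)"
  unfolding decay_def moderate_def
proof (rule allI)
  fix m assume f: "\<forall>m. \<exists>C. \<forall>x. (1 + norm x) ^ m * norm (f x) \<le> C" and "\<exists>m C. \<forall>x. norm (g x) \<le> C * (1 + norm x) ^ m"
  then obtain k D where D: "\<And>x. norm (g x) \<le> D * (1 + norm x) ^ k" by metis
  from f obtain C where C: "\<And>x. (1 + norm x) ^ (m+k) * norm (f x) \<le> C" by metis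
  have "(1 + norm x) ^ m * norm (f x * g x) \<le> \<bar>D\<bar> * C" for x
  proof -
    have "(1 + norm x) ^ m * norm (f x * g x) \<le> (1 + norm x) ^ m * (norm (f x) * (\<bar>D\<bar> * (1 + norm x) ^ k))"
      unfolding norm_mult using order_trans[OF D[of x] mult_right_mono[of D "\<bar>D\<bar>" "(1 + norm x) ^ k"]]
      by (intro mult_left_mono) auto
    also have "\<dots> = \<bar>D\<bar> * ((1 + norm x) ^ (m+k) * norm (f x))" by (simp add: power_add mult_ac)
    also have "\<dots> \<le> \<bar>D\<bar> * C" using C[of x] by (intro mult_left_mono) auto
    finally show ?thesis .
  qed
  then show "\<exists>C. \<forall>x. (1 + norm x) ^ m * norm (f x * g x) \<le> C" by blast
qed

lemma decay_cmult: "decay f \<Longrightarrow> decay (\<lambda>x. c * f x)"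
  using decay_moderate_mult[of f "\<lambda>_. c"] unfolding moderate_def
  by (metis (no_types, lifting) ext mult.commute mult.right_neutral order_refl power_0)

lemma moderateI: "(\<And>x. norm (f x) \<le> C * (1 + norm x) ^ m) \<Longrightarrow> moderate f"
  by (auto simp: moderate_def)

lemma moderate_boundE:
  assumes "moderate f" obtains C m where "C \<ge> 0" "\<And>x k. k \<ge> m \<Longrightarrow> norm (f x) \<le> C * (1 + norm x) ^ k"
proof -
  obtain C m where C: "\<And>x. norm (f x) \<le> C * (1 + norm x) ^ m" using assms by (auto simp: moderate_def)
  have "norm (f x) \<le> \<bar>C\<bar> * (1 + norm x) ^ k" if "k \<ge> m" for x k
  proof -
    have "norm (f x) \<le> C * (1 + norm x) ^ m" by fact
    also have "\<dots> \<le> \<bar>C\<bar> * (1 + norm x) ^ k"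
      using that by (intro mult_mono power_increasing) auto
    finally show ?thesis .
  qed
  then show thesis using that[of "\<bar>C\<bar>" m] by auto
qed

lemma moderate_add: "moderate f \<Longrightarrow> moderate g \<Longrightarrow> moderate (\<lambda>x. f x + g x)"
proof -
  assume "moderate f" "moderate g"
  then obtain C m D k where C: "\<And>x l. l \<ge> m \<Longrightarrow> norm (f x) \<le> C * (1 + norm x) ^ l"
    "\<And>x l. l \<ge> k \<Longrightarrow> norm (g x) \<le> D * (1 + norm x) ^ l" using moderate_boundE by metis
  have "norm (f x + g x) \<le> (C + D) * (1 + norm x) ^ (m + k)" for x
    using C(1)[of "m+k" x] C(2)[of "m+k" x] norm_triangle_ineq[of "f x" "g x"] by (simp add: distrib_right)
  then show ?thesis by (rule moderateI)
qed

lemma moderate_mult: "moderate f \<Longrightarrow> moderate g \<Longrightarrow> moderate (\<lambda>x. f x * g x)"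
proof -
  assume "moderate f" "moderate g"
  then obtain C m D k where "C \<ge> 0" "D \<ge> 0" and C: "\<And>x l. l \<ge> m \<Longrightarrow> norm (f x) \<le> C * (1 + norm x) ^ l"
    "\<And>x l. l \<ge> k \<Longrightarrow> norm (g x) \<le> D * (1 + norm x) ^ l" using moderate_boundE by metis
  have "norm (f x * g x) \<le> (C * D) * (1 + norm x) ^ (m + k)" for x
    using mult_mono[OF C(1)[of m x] C(2)[of k x]] \<open>C \<ge> 0\<close> by (simp add: norm_mult power_add mult_ac)
  then show ?thesis by (rule moderateI)
qed

lemma moderate_bounded: "(\<And>x. norm (f x) \<le> C) \<Longrightarrow> moderate f"
  by (rule moderateI[where m=0 and C=C]) simp

lemma moderate_const: "moderate (\<lambda>x. c)"
  by (rule moderate_bounded) auto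

lemma moderate_coord: "moderate (\<lambda>x. complex_of_real (x $ i))"
  by (rule moderateI[where m=1 and C=1]) (auto simp: component_le_norm_cart add_increasing)

text \<open>
  The decay conditions on iterated derivatives are traded for the inductive class, in which closure
  under products and derivatives is available.\<close>

lemma schwartz_iff_regular: "schwartz f \<longleftrightarrow> (\<forall>m. regular decay m f)"
proof
  assume s: "schwartz f"
  then have sm: "\<And>m. regular (\<lambda>_. True) m f" by (simp add: schwartz_def smooth_on_iff_regular)
  have d: "decay (mderiv A f)" for A
    unfolding decay_def
  proof
    fix m
    obtain C where "\<And>x. norm ((1 + norm x) ^ m *\<^sub>R mderiv A f x) \<le> C"
      using s unfolding schwartz_def bounded_iff by blast
    then show "\<exists>C. \<forall>x. (1 + norm x) ^ m * norm (mderiv A f x) \<le> C" by auto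
  qed
  have "regular decay m (mderiv A f)" for m A
  proof (induction m arbitrary: A)
    case 0
    then show ?case using d regular_continuous[OF regular_mderiv[OF sm]] by auto
  next
    case (Suc m)
    have "mderiv A f differentiable_on UNIV" using regular_mderiv[OF sm] regular.simps(2) by metis
    then show ?case using Suc d by (auto simp: partial_mderiv[OF sm])
  qed
  moreover have "mderiv (\<lambda>_. 0) f = f"
  proof -
    have "fold (\<lambda>i. (partial i :: _ \<Rightarrow> real^'a \<Rightarrow> complex) ^^ 0) is f = f" for "is" by (induction "is") auto
    then show ?thesis by (simp add: mderiv_def)
  qed
  ultimately show "\<forall>m. regular decay m f" by metis
next
  assume r: "\<forall>m. regular decay m f"
  then have "smooth_on UNIV f" unfolding smooth_on_iff_regular using regular_mono by metis
  moreover have "bounded (range (\<lambda>x. (1 + norm x) ^ m *\<^sub>R mderiv A f x))" for m A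
  proof -
    have "decay (mderiv A f)" using regular_class regular_mderiv r by metis
    then show ?thesis unfolding decay_def bounded_iff by fastforce
  qed
  ultimately show "schwartz f" by (simp add: schwartz_def)
qed

lemma schwartz_decay: "schwartz f \<Longrightarrow> decay f"
  using schwartz_iff_regular regular_class by metis

lemma schwartz_continuous: "schwartz f \<Longrightarrow> continuous_on UNIV f"
  using schwartz_iff_regular regular_continuous by metis

lemma schwartz_differentiable: "schwartz f \<Longrightarrow> f differentiable_on UNIV"
  using schwartz_iff_regular regular.simps(2) by metis

lemma schwartz_partial: "schwartz f \<Longrightarrow> schwartz (partial i f)"
  using schwartz_iff_regular regular_partial by metis

lemma schwartz_mult:
  assumes "schwartz f" "\<And>m. regular moderate m g"
  shows "schwartz (\<lambda>x. f x * g x)"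
  unfolding schwartz_iff_regular
  using regular_mult[where G=decay and ?G1.0=decay and ?G2.0=moderate, OF decay_add decay_moderate_mult]
    assms schwartz_iff_regular by blast

lemma regular_moderate_mult: "regular moderate m f \<Longrightarrow> regular moderate m g \<Longrightarrow> regular moderate m (\<lambda>x. f x * g x)"
  by (rule regular_mult[where G=moderate and ?G1.0=moderate and ?G2.0=moderate, OF moderate_add moderate_mult])

lemma regular_moderate_add: "regular moderate m f \<Longrightarrow> regular moderate m g \<Longrightarrow> regular moderate m (\<lambda>x. f x + g x)"
  by (rule regular_add[where G=moderate, OF moderate_add])

lemma regular_moderate_const: "regular moderate m (\<lambda>x. c)"
  by (rule regular_const) (auto simp: moderate_const)

lemma partial_coord: "partial i (\<lambda>x::real^'n::finite. complex_of_real (x $ j)) = (\<lambda>x. if i = j then 1 else 0)"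
proof
  fix x
  have "((\<lambda>x::real^'n. complex_of_real (x $ j)) has_derivative (\<lambda>v. complex_of_real (v $ j))) (at x)"
    by (intro has_derivative_of_real bounded_linear.has_derivative[OF bounded_linear_vec_nth] has_derivative_ident)
  from partial_eqI[OF this] show "partial i (\<lambda>x. complex_of_real (x $ j)) x = (if i = j then 1 else 0)"
    by (auto simp: axis_def)
qed

lemma coord_differentiable: "(\<lambda>x::real^'n::finite. complex_of_real (x $ j)) differentiable_on UNIV"
proof -
  have "((\<lambda>x::real^'n. complex_of_real (x $ j)) has_derivative (\<lambda>v. complex_of_real (v $ j))) (at x)" for x
    by (intro has_derivative_of_real bounded_linear.has_derivative[OF bounded_linear_vec_nth] has_derivative_ident)
  then show ?thesis unfolding differentiable_on_def differentiable_def by auto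
qed

lemma regular_moderate_coord: "regular moderate m (\<lambda>x. complex_of_real (x $ j))"
proof (cases m)
  case (Suc n)
  then show ?thesis 
    by (auto simp: partial_coord moderate_coord coord_differentiable intro: regular_moderate_const)
qed (simp add: moderate_coord continuous_on_of_real continuous_on_component)

lemma schwartz_coord_mult: "schwartz f \<Longrightarrow> schwartz (\<lambda>x. complex_of_real (x $ i) * f x)"
  using schwartz_mult[OF _ regular_moderate_coord, of f i] by (simp add: mult.commute)

lemma schwartz_cmult: "schwartz f \<Longrightarrow> schwartz (\<lambda>x. c * f x)"
  using schwartz_mult[OF _ regular_moderate_const, of f c] by (simp add: mult.commute)

section \<open>Integration on Euclidean space\<close>

text \<open>
  Lebesgue measure on the space of vectors is the image of a product measure on the coordinates.\<close>

lemma product_integral_vec: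
  fixes f :: "'n::finite \<Rightarrow> real \<Rightarrow> 'b::{real_normed_field,banach,second_countable_topology}"
  assumes "\<And>i. integrable lborel (f i)"
  shows "integrable lborel (\<lambda>x::real^'n. \<Prod>i\<in>UNIV. f i (x $ i))"
    and "(LINT x|lborel. (\<Prod>i\<in>UNIV. f i ((x::real^'n) $ i))) = (\<Prod>i\<in>UNIV. LINT t|lborel. f i t)"
proof -
  have inj: "inj (\<lambda>i::'n. axis i (1::real))" by (auto simp: inj_on_def axis_eq_axis)
  have B: "(Basis :: (real^'n) set) = range (\<lambda>i. axis i 1)" by (auto simp: Basis_vec_def)
  define g where "g b = f (inv (\<lambda>i::'n. axis i (1::real)) b)" for b :: "real^'n"
  have g: "g (axis i 1) = f i" for i by (simp add: g_def inv_f_f[OF inj])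
  have P: "(\<Prod>b\<in>Basis. h b) = (\<Prod>i\<in>UNIV. h (axis i 1))" for h :: "real^'n \<Rightarrow> 'b"
    unfolding B by (subst prod.reindex[OF inj]) simp
  have gi: "integrable (interval_measure (\<lambda>x. x)) (g b)" for b
    using assms by (simp add: g_def lborel_eq_real[symmetric])
  interpret product_sigma_finite "\<lambda>b::real^'n. interval_measure (\<lambda>x. x)"
    by (simp add: product_sigma_finite_def lborel_eq_real[symmetric] lborel.sigma_finite_measure_axioms)
  let ?T = "\<lambda>f. \<Sum>b\<in>Basis. f b *\<^sub>R (b::real^'n)"
  have T[measurable]: "?T \<in> (\<Pi>\<^sub>M b\<in>Basis. interval_measure (\<lambda>x. x)) \<rightarrow>\<^sub>M borel"
    by measurable
  have [measurable]: "g b \<in> borel_measurable borel" for b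
    using gi[of b] by auto
  have m: "(\<lambda>x::real^'n. \<Prod>i\<in>UNIV. f i (x $ i)) \<in> borel_measurable borel"
  proof -
    have [measurable]: "f i \<in> borel_measurable borel" for i using assms[of i] by auto
    show ?thesis by measurable
  qed
  have e: "(\<Prod>i\<in>UNIV. f i (?T h $ i)) = (\<Prod>b\<in>Basis. g b (h b))" for h
  proof -
    have "?T h $ i = h (axis i 1)" for i
      using inner_sum_left_Basis[of "axis i 1 :: real^'n" h] by (simp add: inner_axis)
    then show ?thesis unfolding P by (simp add: g)
  qed
  show "integrable lborel (\<lambda>x::real^'n. \<Prod>i\<in>UNIV. f i (x $ i))"
    unfolding lborel_def using product_integrable_prod[of Basis g] gi
    unfolding integrable_distr_eq[OF T m] e by simp
  show "(LINT x|lborel. (\<Prod>i\<in>UNIV. f i ((x::real^'n) $ i))) = (\<Prod>i\<in>UNIV. LINT t|lborel. f i t)"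
    unfolding lborel_def[where 'a="real^'n"] using product_integral_prod[of Basis g] gi
    unfolding integral_distr[OF T m] e by (simp add: P g lborel_eq_real)
qed

lemma integrable_inverse_square: "integrable lborel (\<lambda>t::real. 1 / (1 + \<bar>t\<bar>)\<^sup>2)"
proof (rule Bochner_Integration.integrable_bound)
  show "integrable lborel (\<lambda>t::real. inverse (1 + t\<^sup>2))"
    using integrable_inverse_1_plus_square unfolding set_integrable_def by simp
  have "1 / (1 + \<bar>t\<bar>)\<^sup>2 \<le> inverse (1 + t\<^sup>2)" for t :: real
    unfolding inverse_eq_divide
    by (rule divide_left_mono) (auto simp: power2_sum intro!: mult_pos_pos add_pos_nonneg)
  then show "AE t in lborel. norm (1 / (1 + \<bar>t\<bar>)\<^sup>2) \<le> norm (inverse (1 + t\<^sup>2) :: real)"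
    by (simp add: add_nonneg_nonneg)
qed simp

text \<open>
  A fixed integrable weight of inverse polynomial type. The exponent 2 n is chosen so that the weight is
  dominated by the product of the integrable factors (1 + |x_i|)^(-2) of the single coordinates.\<close>

definition weight :: "real^'n::finite \<Rightarrow> real" where
  "weight x = 1 / (1 + norm x) ^ (2 * CARD('n))"

lemma weight_pos: "weight x > 0"
proof -
  have "1 + norm x > 0" by (simp add: add_pos_nonneg)
  then show ?thesis by (simp add: weight_def)
qed

lemma weight_measurable[measurable]: "weight \<in> borel_measurable borel"
  unfolding weight_def[abs_def] by measurable

lemma integrable_weight: "integrable lborel (weight :: real^'n::finite \<Rightarrow> real)"
proof (rule Bochner_Integration.integrable_bound)
  show "integrable lborel (\<lambda>x::real^'n. \<Prod>i\<in>UNIV. 1 / (1 + \<bar>x $ i\<bar>)\<^sup>2)"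
    by (rule product_integral_vec(1)) (rule integrable_inverse_square)
  have "weight x \<le> (\<Prod>i\<in>UNIV. 1 / (1 + \<bar>x $ i\<bar>)\<^sup>2)" for x :: "real^'n"
  proof -
    have p: "1 + norm x > 0" "1 + \<bar>x $ i\<bar> > 0" for i by (simp_all add: add_pos_nonneg)
    have "(\<Prod>i\<in>UNIV. 1 / (1 + \<bar>x $ i\<bar>)\<^sup>2) \<ge> (\<Prod>i\<in>(UNIV::'n set). 1 / (1 + norm x)\<^sup>2)"
      by (rule prod_mono) (use p in \<open>auto intro!: divide_left_mono power_mono component_le_norm_cart\<close>)
    then show ?thesis by (simp add: weight_def power_mult power_one_over)
  qed
  then show "AE x in lborel. norm (weight x) \<le> norm (\<Prod>i\<in>UNIV. 1 / (1 + \<bar>(x::real^'n) $ i\<bar>)\<^sup>2)"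
    by (simp add: abs_of_pos[OF weight_pos] abs_prod)
qed simp

lemma integrable_of_weight_bound:
  fixes f :: "real^'n::finite \<Rightarrow> 'b::{banach,second_countable_topology}"
  assumes [measurable]: "f \<in> borel_measurable borel" and "\<And>x. norm (f x) \<le> C * weight x"
  shows "integrable lborel f"
proof (rule Bochner_Integration.integrable_bound)
  show "integrable lborel (\<lambda>x::real^'n. C * weight x)" by (rule integrable_mult_right[OF integrable_weight])
  show "AE x in lborel. norm (f x) \<le> norm (C * weight x)"
    using assms(2) by (auto intro: order_trans[OF _ abs_ge_self])
qed simp

lemma decay_weight_bound:
  assumes "decay f" obtains C where "C \<ge> 0" "\<And>x. norm (f x) * (1 + norm x) ^ m \<le> C * weight x"
proof -
  obtain C where C: "\<And>x. (1 + norm x) ^ (m + 2 * CARD('a)) * norm (f x) \<le> C"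
    using assms unfolding decay_def by metis
  have "norm (f x) * (1 + norm x) ^ m \<le> \<bar>C\<bar> * weight x" for x
  proof -
    have p: "1 + norm x > 0" by (simp add: add_pos_nonneg)
    have "norm (f x) * (1 + norm x) ^ m * (1 + norm x) ^ (2 * CARD('a)) \<le> \<bar>C\<bar>"
      using order_trans[OF C[of x] abs_ge_self] by (simp add: power_add mult_ac)
    then show ?thesis using p by (simp add: weight_def pos_le_divide_eq)
  qed
  then show thesis using that[of "\<bar>C\<bar>"] by auto
qed

lemma integrable_decay:
  assumes [measurable]: "f \<in> borel_measurable borel" and "decay f"
  shows "integrable lborel f"
proof -
  obtain C where "\<And>x. norm (f x) * (1 + norm x) ^ 0 \<le> C * weight x" using decay_weight_bound[OF assms(2)] by blast
  then show ?thesis by (intro integrable_of_weight_bound[of _ C]) auto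
qed

lemma lborel_integral_affine:
  fixes f :: "'a::euclidean_space \<Rightarrow> 'b::{banach, second_countable_topology}"
  assumes c: "c \<noteq> 0" and [measurable]: "f \<in> borel_measurable borel"
  shows "(LINT x|lborel. f x) = \<bar>c\<bar> ^ DIM('a) *\<^sub>R (LINT x|lborel. f (t + c *\<^sub>R x))"
    and "integrable lborel (\<lambda>x. f (t + c *\<^sub>R x)) \<longleftrightarrow> integrable lborel f"
proof -
  have T: "(\<lambda>x. t + c *\<^sub>R x) \<in> lborel \<rightarrow>\<^sub>M (borel :: 'a measure)" by measurable
  show "(LINT x|lborel. f x) = \<bar>c\<bar> ^ DIM('a) *\<^sub>R (LINT x|lborel. f (t + c *\<^sub>R x))"
    by (subst lborel_affine[OF c, of t], subst integral_density)
      (auto simp: integral_distr)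
  show "integrable lborel (\<lambda>x. f (t + c *\<^sub>R x)) \<longleftrightarrow> integrable lborel f"
  proof -
    have "integrable lborel f \<longleftrightarrow> integrable lborel (\<lambda>x. \<bar>c\<bar> ^ DIM('a) *\<^sub>R f (t + c *\<^sub>R x))"
      by (subst lborel_affine[OF c, of t], subst integrable_density) (auto simp: integrable_distr_eq)
    also have "\<dots> \<longleftrightarrow> integrable lborel (\<lambda>x. f (t + c *\<^sub>R x))"
    proof
      assume "integrable lborel (\<lambda>x. \<bar>c\<bar> ^ DIM('a) *\<^sub>R f (t + c *\<^sub>R x))"
      then have "integrable lborel (\<lambda>x. inverse (\<bar>c\<bar> ^ DIM('a)) *\<^sub>R (\<bar>c\<bar> ^ DIM('a) *\<^sub>R f (t + c *\<^sub>R x)))"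
        by (rule integrable_scaleR_right)
      then show "integrable lborel (\<lambda>x. f (t + c *\<^sub>R x))" using c by simp
    qed (rule integrable_scaleR_right)
    finally show ?thesis ..
  qed
qed

lemma lborel_integral_translate:
  fixes f :: "'a::euclidean_space \<Rightarrow> 'b::{banach, second_countable_topology}"
  assumes "f \<in> borel_measurable borel"
  shows "(LINT x|lborel. f (x + t)) = (LINT x|lborel. f x)"
    "integrable lborel (\<lambda>x. f (x + t)) \<longleftrightarrow> integrable lborel f"
  using lborel_integral_affine[of 1 f t, OF _ assms] by (simp_all add: add.commute)

text \<open>
  Differentiation under the integral sign: near x the difference quotients are dominated by g by the
  mean value inequality, so dominated convergence applies.\<close>

lemma has_derivative_integral:
  fixes h :: "'a::real_normed_vector \<Rightarrow> 'w \<Rightarrow> 'b::{banach, second_countable_topology}"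
  assumes r: "r > 0"
    and int: "\<And>y. integrable M (h y)"
    and der: "\<And>y w. w \<in> space M \<Longrightarrow> ((\<lambda>y. h y w) has_derivative D y w) (at y)"
    and bnd: "\<And>y w v. w \<in> space M \<Longrightarrow> y \<in> ball x r \<Longrightarrow> norm (D y w v) \<le> g w * norm v"
    and g: "integrable M g"
    and meas: "\<And>v. (\<lambda>w. D x w v) \<in> borel_measurable M"
  shows "((\<lambda>y. LINT w|M. h y w) has_derivative (\<lambda>v. LINT w|M. D x w v)) (at x)"
proof -
  have x: "x \<in> ball x r" using r by simp
  have g0: "g w \<ge> 0" if "w \<in> space M" and nz: "\<exists>v::'a. v \<noteq> 0" for w
  proof -
    obtain v :: 'a where "v \<noteq> 0" using nz by blast
    then show ?thesis using bnd[OF that(1) x, of v] norm_ge_zero[of "D x w v"]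
      by (metis mult_neg_pos norm_ge_zero not_le order_trans zero_less_norm_iff)
  qed
  have lin: "bounded_linear (D x w)" if "w \<in> space M" for w
    using der[OF that] has_derivative_bounded_linear by blast
  have Dint: "integrable M (\<lambda>w. D x w v)" for v
  proof (rule Bochner_Integration.integrable_bound)
    show "integrable M (\<lambda>w. g w * norm v)" using g by simp
    show "AE w in M. norm (D x w v) \<le> norm (g w * norm v)"
      using bnd[OF _ x, of _ v] by (auto intro: order_trans[OF _ abs_ge_self])
  qed (rule meas)
  have bl: "bounded_linear (\<lambda>v. LINT w|M. D x w v)"
  proof (rule bounded_linear_intro[where K="LINT w|M. g w"])
    show "(LINT w|M. D x w (v + u)) = (LINT w|M. D x w v) + (LINT w|M. D x w u)" for v u
      unfolding Bochner_Integration.integral_add[OF Dint Dint, symmetric]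
      by (rule Bochner_Integration.integral_cong) (use lin in \<open>auto simp: linear_add bounded_linear.linear\<close>)
    show "(LINT w|M. D x w (c *\<^sub>R v)) = c *\<^sub>R (LINT w|M. D x w v)" for c v
      unfolding Bochner_Integration.integral_scaleR_right[symmetric]
      by (rule Bochner_Integration.integral_cong) (use lin in \<open>auto simp: linear_scale bounded_linear.linear\<close>)
    show "norm (LINT w|M. D x w v) \<le> norm v * (LINT w|M. g w)" for v
    proof -
      have "norm (LINT w|M. D x w v) \<le> (LINT w|M. g w * norm v)"
      proof (rule order_trans[OF integral_norm_bound], rule integral_mono)
        show "integrable M (\<lambda>w. norm (D x w v))" using Dint by simp
        show "integrable M (\<lambda>w. g w * norm v)" using g by simp
      qed (use bnd[OF _ x] in auto)
      then show ?thesis by (simp add: mult.commute)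
    qed
  qed
  show ?thesis unfolding has_derivative_iff_norm
  proof (intro conjI bl)
    show "((\<lambda>y. norm ((LINT w|M. h y w) - (LINT w|M. h x w) - (LINT w|M. D x w (y - x))) / norm (y - x)) \<longlongrightarrow> 0) (at x)"
      unfolding tendsto_at_iff_sequentially
    proof (intro allI impI)
      fix X assume X: "\<forall>i. X i \<in> UNIV - {x}" "X \<longlonglongrightarrow> x"
      define q where "q n w = (h (X n) w - h x w - D x w (X n - x)) /\<^sub>R norm (X n - x)" for n w
      have nz: "\<exists>v::'a. v \<noteq> 0" using X(1) by (auto intro!: exI[of _ "X 0 - x"])
      have qi: "integrable M (q n)" for n unfolding q_def using int Dint by auto
      from X(2) r have "\<forall>\<^sub>F n in sequentially. X n \<in> ball x r"
        by (metis centre_in_ball open_ball topological_tendstoD)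
      then obtain n0 where n0: "\<And>n. n \<ge> n0 \<Longrightarrow> X n \<in> ball x r" by (auto simp: eventually_sequentially)
      have q2: "norm (q (n + n0) w) \<le> 2 * g w" if w: "w \<in> space M" for n w
      proof -
        let ?y = "X (n + n0)"
        have y: "?y \<in> ball x r" using n0 by auto
        have "norm (h ?y w - h x w) \<le> g w * norm (?y - x)"
        proof (rule differentiable_bound[where S="ball x r" and f'="\<lambda>y. D y w"])
          show "((\<lambda>y. h y w) has_derivative D u w) (at u within ball x r)" for u
            using der[OF w] has_derivative_at_withinI by blast
          show "onorm (D u w) \<le> g w" if "u \<in> ball x r" for u
            using bnd[OF w that] g0[OF w nz] by (intro onorm_bound) auto
        qed (use x y in auto)
        moreover have "norm (D x w (?y - x)) \<le> g w * norm (?y - x)" by (rule bnd[OF w x])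
        ultimately have "norm (h ?y w - h x w - D x w (?y - x)) \<le> 2 * g w * norm (?y - x)"
          using norm_triangle_ineq4[of "h ?y w - h x w" "D x w (?y - x)"] by linarith
        moreover have "norm (?y - x) > 0" using X(1) by auto
        moreover have "norm (q (n + n0) w) = norm (h ?y w - h x w - D x w (?y - x)) / norm (?y - x)"
          by (simp add: q_def divide_inverse mult.commute)
        ultimately show ?thesis by (simp only: pos_divide_le_eq)
      qed
      have q0: "(\<lambda>n. q n w) \<longlonglongrightarrow> 0" if w: "w \<in> space M" for w
      proof -
        have "((\<lambda>y. norm (h y w - h x w - D x w (y - x)) / norm (y - x)) \<longlongrightarrow> 0) (at x)"
          using der[OF w, of x] unfolding has_derivative_iff_norm by blast
        then have "(\<lambda>n. norm (h (X n) w - h x w - D x w (X n - x)) / norm (X n - x)) \<longlonglongrightarrow> 0"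
          using X unfolding tendsto_at_iff_sequentially by (auto simp: o_def)
        then show ?thesis
          by (subst tendsto_norm_zero_iff[symmetric]) (simp add: q_def divide_inverse mult.commute)
      qed
      have "(\<lambda>n. LINT w|M. q (n + n0) w) \<longlonglongrightarrow> (LINT w|M. 0)"
      proof (rule integral_dominated_convergence[where w="\<lambda>w. 2 * g w"])
        show "AE w in M. (\<lambda>n. q (n + n0) w) \<longlonglongrightarrow> 0" by (intro AE_I2 LIMSEQ_ignore_initial_segment q0)
        show "AE w in M. norm (q (n + n0) w) \<le> 2 * g w" for n using q2 by auto
      qed (use g qi in auto)
      then have "(\<lambda>n. LINT w|M. q n w) \<longlonglongrightarrow> 0" by (simp add: LIMSEQ_offset)
      moreover have "(LINT w|M. q n w) = ((LINT w|M. h (X n) w) - (LINT w|M. h x w) - (LINT w|M. D x w (X n - x))) /\<^sub>R norm (X n - x)" for n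
        unfolding q_def using int Dint by simp
      ultimately have "(\<lambda>n. norm (((LINT w|M. h (X n) w) - (LINT w|M. h x w) - (LINT w|M. D x w (X n - x))) /\<^sub>R norm (X n - x))) \<longlonglongrightarrow> 0"
        by (simp only: tendsto_norm_zero)
      then show "((\<lambda>y. norm ((LINT w|M. h y w) - (LINT w|M. h x w) - (LINT w|M. D x w (y - x))) / norm (y - x)) \<circ> X) \<longlonglongrightarrow> 0"
        by (simp add: o_def divide_inverse mult.commute)
    qed
  qed
qed

section \<open>Gaussians\<close>

lemma power_le_fact_exp:
  fixes t :: real assumes "t \<ge> 0" shows "t ^ m \<le> fact m * exp t"
proof -
  have "t ^ m /\<^sub>R fact m \<le> (\<Sum>n. t ^ n /\<^sub>R fact n)"
    using sum_le_suminf[OF summable_exp_generic[of t], of "{m}"] assms by simp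
  then have "t ^ m / fact m \<le> exp t" unfolding exp_def by (simp add: divide_inverse mult.commute)
  then show ?thesis by (simp add: divide_le_eq mult.commute)
qed

text \<open>
  The constant is explicit because it is needed uniformly in t, and later in the scaling parameter:
  (1 + t)^m \<le> m! exp (1 + t), and t - c t^2 is at most 1 / (4 c).\<close>

lemma power_gaussian_bound:
  fixes t :: real assumes c: "c > 0" and t: "t \<ge> 0"
  shows "(1 + t) ^ m * exp (- c * t\<^sup>2) \<le> fact m * exp (1 + 1 / (4 * c))"
proof -
  have "(1 + t) ^ m \<le> fact m * exp (1 + t)" by (rule power_le_fact_exp) (use t in simp)
  then have "(1 + t) ^ m * exp (- c * t\<^sup>2) \<le> fact m * exp (1 + t) * exp (- c * t\<^sup>2)"
    by (rule mult_right_mono) auto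
  also have "\<dots> = fact m * exp (1 + t - c * t\<^sup>2)" by (simp add: exp_add[symmetric] exp_diff exp_minus divide_inverse mult.assoc)
  also have "\<dots> \<le> fact m * exp (1 + 1 / (4 * c))"
  proof -
    have "0 \<le> c * (t - 1 / (2 * c))\<^sup>2" using c by simp
    also have "\<dots> = c * t\<^sup>2 - t + 1 / (4 * c)" using c by (simp add: power2_eq_square field_simps)
    finally show ?thesis by simp
  qed
  finally show ?thesis .
qed

lemma decay_gaussian_bound:
  assumes "c > 0" "\<And>x. norm (f x) \<le> C * (1 + norm x) ^ k * exp (- c * (norm x)\<^sup>2)"
  shows "decay f"
  unfolding decay_def
proof
  fix m
  have "(1 + norm x) ^ m * norm (f x) \<le> \<bar>C\<bar> * (fact (m + k) * exp (1 + 1 / (4 * c)))" for x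
  proof -
    have "(1 + norm x) ^ m * norm (f x) \<le> (1 + norm x) ^ m * (\<bar>C\<bar> * (1 + norm x) ^ k * exp (- c * (norm x)\<^sup>2))"
      by (rule mult_left_mono) (auto intro!: order_trans[OF assms(2)] mult_right_mono)
    also have "\<dots> = \<bar>C\<bar> * ((1 + norm x) ^ (m+k) * exp (- c * (norm x)\<^sup>2))" by (simp add: power_add mult_ac)
    also have "\<dots> \<le> \<bar>C\<bar> * (fact (m + k) * exp (1 + 1 / (4 * c)))"
      by (intro mult_left_mono power_gaussian_bound assms) auto
    finally show ?thesis .
  qed
  then show "\<exists>C. \<forall>x. (1 + norm x) ^ m * norm (f x) \<le> C" by blast
qed

text \<open>
  A function whose logarithmic derivatives L i have polynomial growth reproduces itself under
  differentiation up to such factors, so the growth of all derivatives reduces to that of q E. This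
  covers Gaussians.\<close>

lemma regular_exponential:
  assumes d: "E differentiable_on UNIV"
    and G: "\<And>q. (\<And>m. regular moderate m q) \<Longrightarrow> G (\<lambda>x. q x * E x)"
    and p: "\<And>i. partial i E = (\<lambda>x. L i x * E x)" and L: "\<And>i m. regular moderate m (L i)"
  shows "(\<And>m. regular moderate m q) \<Longrightarrow> regular G m (\<lambda>x. q x * E x)"
proof (induction m arbitrary: q)
  case 0
  have "continuous_on UNIV (\<lambda>x. q x * E x)"
    by (intro continuous_on_mult differentiable_imp_continuous_on[OF d] regular_continuous[OF 0])
  then show ?case using G[OF 0] by simp
next
  case (Suc m)
  have qd: "q differentiable_on UNIV" using Suc.prems regular_SucD(1) by blast
  show ?case
  proof (rule regular_SucI)
    show "(\<lambda>x. q x * E x) differentiable_on UNIV" by (rule differentiable_on_mult[OF qd d])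
    show "G (\<lambda>x. q x * E x)" by (rule G[OF Suc.prems])
    fix i
    have "regular moderate k (\<lambda>x. q x * L i x + partial i q x)" for k
      by (intro regular_moderate_add regular_moderate_mult Suc.prems L regular_partial)
    then have "regular G m (\<lambda>x. (q x * L i x + partial i q x) * E x)" by (rule Suc.IH)
    then show "regular G m (partial i (\<lambda>x. q x * E x))"
      unfolding partial_mult[OF qd d] p by (simp add: algebra_simps)
  qed
qed

lemma has_derivative_gaussian:
  "((\<lambda>x::real^'n::finite. complex_of_real (exp (- c * (norm (x - a))\<^sup>2))) has_derivative
     (\<lambda>v. complex_of_real (- 2 * c * ((x - a) \<bullet> v) * exp (- c * (norm (x - a))\<^sup>2)))) (at x)"
  unfolding power2_norm_eq_inner
  by (rule has_derivative_of_real) (auto intro!: derivative_eq_intros simp: inner_commute algebra_simps)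

lemma schwartz_gaussian:
  fixes a :: "real^'n::finite"
  assumes c: "c > 0"
  shows "schwartz (\<lambda>x. complex_of_real (exp (- c * (norm (x - a))\<^sup>2)))"
proof -
  let ?E = "\<lambda>x. complex_of_real (exp (- c * (norm (x - a))\<^sup>2))"
  let ?L = "\<lambda>i x. complex_of_real (- 2 * c) * (complex_of_real (x $ i) + complex_of_real (- (a $ i)))"
  have "regular decay m (\<lambda>x. 1 * ?E x)" for m
  proof (rule regular_exponential)
    show "?E differentiable_on UNIV"
      using has_derivative_gaussian unfolding differentiable_on_def differentiable_def by blast
    show "partial i ?E = (\<lambda>x. ?L i x * ?E x)" for i
      by (rule ext, subst partial_eqI[OF has_derivative_gaussian]) (simp add: inner_axis)
    show "regular moderate m (?L i)" for i m
      by (intro regular_moderate_mult regular_moderate_add regular_moderate_const regular_moderate_coord)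
    have dE: "decay ?E"
    proof (rule decay_gaussian_bound[where c="c/2" and k=0 and C="exp (c * (norm a)\<^sup>2)"])
      show "norm (?E x) \<le> exp (c * (norm a)\<^sup>2) * (1 + norm x) ^ 0 * exp (- (c/2) * (norm x)\<^sup>2)" for x
      proof -
        have "norm x \<le> norm (x - a) + norm a" by (metis diff_add_cancel norm_triangle_ineq)
        then have "(norm x)\<^sup>2 \<le> (norm (x - a) + norm a)\<^sup>2" by (rule power_mono) auto
        also have "\<dots> \<le> 2 * (norm (x - a))\<^sup>2 + 2 * (norm a)\<^sup>2"
          using sum_squares_bound[of "norm (x - a)" "norm a"] by (simp add: power2_sum)
        finally have "c * (norm x)\<^sup>2 \<le> c * (2 * (norm (x - a))\<^sup>2 + 2 * (norm a)\<^sup>2)" using c by simp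
        then show ?thesis by (simp add: exp_add[symmetric] algebra_simps)
      qed
    qed (use c in auto)
    show "decay (\<lambda>x. q x * ?E x)" if "\<And>m. regular moderate m q" for q
      using decay_moderate_mult[OF dE] regular_class[OF that] by (simp add: mult.commute)
  qed (rule regular_moderate_const)
  then show ?thesis unfolding schwartz_iff_regular by simp
qed

section \<open>The Fourier transform of Schwartz functions\<close>

definition chi :: "real^'n::finite \<Rightarrow> real^'n \<Rightarrow> complex" where
  "chi k x = exp (2 * pi * \<i> * complex_of_real (k \<bullet> x))"

lemma norm_chi[simp]: "norm (chi k x) = 1"
  by (simp add: chi_def norm_exp_eq_Re)

lemma chi_commute: "chi k x = chi x k"
  by (simp add: chi_def inner_commute)

lemma chi_add: "chi (k + l) x = chi k x * chi l x"
  by (simp add: chi_def inner_add_left distrib_left exp_add)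

lemma chi_add_right: "chi k (x + y) = chi k x * chi k y"
  by (metis chi_add chi_commute)

lemma chi_0[simp]: "chi 0 x = 1" "chi x 0 = 1"
  by (simp_all add: chi_def)

lemma chi_minus: "chi (- k) (- x) = chi k x" "chi k (- x) = chi (- k) x"
  by (simp_all add: chi_def)

lemma chi_measurable_pair[measurable]: "case_prod chi \<in> borel_measurable (borel \<Otimes>\<^sub>M borel)"
  unfolding chi_def[abs_def] by measurable

lemma chi_measurable: "chi k \<in> borel_measurable borel"
  unfolding chi_def[abs_def] by measurable

lemma has_derivative_exp_complex:
  fixes g :: "'a::real_normed_vector \<Rightarrow> complex"
  assumes "(g has_derivative g') (at x)"
  shows "((\<lambda>x. exp (g x)) has_derivative (\<lambda>v. g' v * exp (g x))) (at x)"
proof -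
  have "(exp has_derivative (\<lambda>v. exp (g x) * v)) (at (g x))"
    using DERIV_exp[of "g x"] by (simp add: has_field_derivative_def)
  from has_derivative_compose[OF assms this] show ?thesis by (simp add: mult.commute)
qed

lemma chi_has_derivative:
  "(chi k has_derivative (\<lambda>v. 2 * pi * \<i> * complex_of_real (k \<bullet> v) * chi k x)) (at x)"
  unfolding chi_def[abs_def]
  by (intro has_derivative_exp_complex has_derivative_mult_right has_derivative_of_real has_derivative_inner_right has_derivative_ident)

lemma partial_chi: "partial i (chi k) = (\<lambda>x. 2 * pi * \<i> * complex_of_real (k $ i) * chi k x)"
  by (rule ext, subst partial_eqI[OF chi_has_derivative]) (simp add: inner_axis)

lemma regular_chi: "regular moderate m (chi k)"
proof -
  have "regular moderate m (\<lambda>x. 1 * chi k x)"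
  proof (rule regular_exponential)
    show "chi k differentiable_on UNIV"
      using chi_has_derivative unfolding differentiable_on_def differentiable_def by blast
    show "moderate (\<lambda>x. q x * chi k x)" if "\<And>m. regular moderate m q" for q
      by (intro moderate_mult regular_class[OF that] moderate_bounded[where C=1]) simp
  qed (rule partial_chi regular_moderate_const)+
  then show ?thesis by simp
qed

lemma pair_integrable_bound:
  fixes F :: "'a::euclidean_space \<times> 'b::euclidean_space \<Rightarrow> 'c::{banach, second_countable_topology}"
  assumes f: "integrable lborel f" and g: "integrable lborel g"
    and [measurable]: "F \<in> borel_measurable (borel \<Otimes>\<^sub>M borel)"
    and b: "\<And>x y. norm (F (x, y)) \<le> f x * (g y :: real)"
  shows "integrable (lborel \<Otimes>\<^sub>M lborel) F"
proof (rule Bochner_Integration.integrable_bound)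
  have [measurable]: "f \<in> borel_measurable borel" "g \<in> borel_measurable borel" using f g by auto
  show "integrable (lborel \<Otimes>\<^sub>M lborel) (\<lambda>(x,y). f x * g y)"
  proof (rule lborel_pair.Fubini_integrable)
    show "integrable lborel (\<lambda>x. LINT y|lborel. norm (case (x, y) of (x, y) \<Rightarrow> f x * g y))"
      using f by (simp add: abs_mult)
    show "AE x in lborel. integrable lborel (\<lambda>y. case (x, y) of (x, y) \<Rightarrow> f x * g y)"
      using g by simp
  qed measurable
  show "AE x in lborel \<Otimes>\<^sub>M lborel. norm (F x) \<le> norm (case x of (x, y) \<Rightarrow> f x * g y)"
    using b by (auto intro!: AE_I2 order_trans[OF _ abs_ge_self])
qed simp

lemma fourier_exchange:
  fixes f g :: "real^'n::finite \<Rightarrow> complex"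
  assumes f: "integrable lborel f" and g: "integrable lborel g"
  shows "(LINT x|lborel. f x * (LINT k|lborel. chi (- k) x * g k)) =
    (LINT k|lborel. g k * (LINT x|lborel. chi (- k) x * f x))"
proof -
  have [measurable]: "f \<in> borel_measurable borel" "g \<in> borel_measurable borel" using f g by auto
  have "integrable (lborel \<Otimes>\<^sub>M lborel) (\<lambda>(x, k). f x * chi (- k) x * g k)"
    by (rule pair_integrable_bound[OF integrable_norm[OF f] integrable_norm[OF g]])
      (measurable, auto simp: norm_mult)
  from lborel_pair.Fubini_integral[OF this]
  have "(LINT k|lborel. LINT x|lborel. f x * chi (- k) x * g k) = (LINT x|lborel. LINT k|lborel. f x * chi (- k) x * g k)"
    by (simp only: prod.case)
  moreover have "(LINT k|lborel. f x * chi (- k) x * g k) = f x * (LINT k|lborel. chi (- k) x * g k)" for x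
    by (simp add: mult.assoc)
  moreover have "(LINT x|lborel. f x * chi (- k) x * g k) = g k * (LINT x|lborel. chi (- k) x * f x)" for k
    by (subst integral_mult_right_zero[symmetric], rule Bochner_Integration.integral_cong) (auto simp: mult_ac)
  ultimately show ?thesis by (simp only:)
qed

lemma fourier_lborel:
  assumes [measurable]: "f \<in> borel_measurable borel"
  shows "fourier f k = (LINT x|lborel. chi (- k) x * f x)"
proof -
  note [measurable] = chi_measurable
  have "fourier f k = (LINT x|lebesgue. chi (- k) x * f x)"
    unfolding fourier_def chi_def by simp
  also have "\<dots> = (LINT x|lborel. chi (- k) x * f x)" by (rule integral_completion) measurable
  finally show ?thesis .
qed

lemma chi_mult_integrable:
  assumes "integrable lborel f" shows "integrable lborel (\<lambda>x. chi k x * f x)"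
  by (rule Bochner_Integration.integrable_bound[OF assms])
    (use assms chi_measurable in \<open>auto simp: norm_mult intro!: borel_measurable_times\<close>)

lemma norm_fourier_le:
  assumes "f \<in> borel_measurable borel"
  shows "norm (fourier f k) \<le> (LINT x|lborel. norm (f x))"
  using integral_norm_bound[of lborel "\<lambda>x. chi (- k) x * f x"]
  by (simp add: fourier_lborel[OF assms] norm_mult)

lemma decay_coord_mult: "decay f \<Longrightarrow> decay (\<lambda>x. complex_of_real (x $ i) * f x)"
  using decay_moderate_mult[OF _ moderate_coord] by (simp add: mult.commute)

lemma fourier_has_derivative:
  fixes f :: "real^'n::finite \<Rightarrow> complex"
  assumes [measurable]: "f \<in> borel_measurable borel" and d: "decay f"
  shows "(fourier f has_derivative (\<lambda>v. LINT x|lborel. chi (- k) x * (- 2 * pi * \<i> * complex_of_real (v \<bullet> x)) * f x)) (at k)"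
proof -
  note [measurable] = chi_measurable
  have i: "integrable lborel f" by (rule integrable_decay) fact+
  obtain C where C: "C \<ge> 0" "\<And>x. norm (f x) * (1 + norm x) ^ 1 \<le> C * weight x" using decay_weight_bound[OF d] by metis
  have "((\<lambda>k. LINT x|lborel. chi (- k) x * f x) has_derivative
    (\<lambda>v. LINT x|lborel. chi (- k) x * (- 2 * pi * \<i> * complex_of_real (v \<bullet> x)) * f x)) (at k)"
  proof (rule has_derivative_integral[where r=1 and g="\<lambda>x. 2 * pi * (C * weight x)"])
    show "integrable lborel (\<lambda>x. chi (- y) x * f x)" for y by (rule chi_mult_integrable[OF i])
    show "((\<lambda>k. chi (- k) x * f x) has_derivative (\<lambda>v. chi (- y) x * (- 2 * pi * \<i> * complex_of_real (v \<bullet> x)) * f x)) (at y)" for x y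
    proof -
      have "((\<lambda>k. exp (2 * pi * \<i> * complex_of_real (- k \<bullet> x)) * f x) has_derivative
        (\<lambda>v. 2 * pi * \<i> * complex_of_real (- v \<bullet> x) * exp (2 * pi * \<i> * complex_of_real (- y \<bullet> x)) * f x)) (at y)"
        by (intro has_derivative_mult_left has_derivative_exp_complex has_derivative_mult_right has_derivative_of_real
          has_derivative_inner_left has_derivative_minus has_derivative_ident)
      then show ?thesis unfolding chi_def by (simp add: mult_ac)
    qed
    show "norm (chi (- y) x * (- 2 * pi * \<i> * complex_of_real (v \<bullet> x)) * f x) \<le> 2 * pi * (C * weight x) * norm v" for x y v
    proof -
      have "norm (chi (- y) x * (- 2 * pi * \<i> * complex_of_real (v \<bullet> x)) * f x) = 2 * pi * (\<bar>v \<bullet> x\<bar> * norm (f x))"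
        by (simp add: norm_mult)
      also have "\<dots> \<le> 2 * pi * (norm v * norm x * norm (f x))"
        by (intro mult_left_mono mult_right_mono Cauchy_Schwarz_ineq2) auto
      also have "\<dots> \<le> 2 * pi * (norm v * (norm (f x) * (1 + norm x) ^ 1))"
        unfolding mult.assoc by (intro mult_left_mono) (auto simp: algebra_simps)
      also have "\<dots> \<le> 2 * pi * (norm v * (C * weight x))"
        by (intro mult_left_mono C) auto
      finally show ?thesis by (simp add: mult_ac)
    qed
    show "integrable lborel (\<lambda>x::real^'n. 2 * pi * (C * weight x))"
      by (intro integrable_mult_right integrable_weight)
  qed (simp, measurable)
  moreover have "fourier f = (\<lambda>k. LINT x|lborel. chi (- k) x * f x)" by (rule ext, rule fourier_lborel) measurable
  ultimately show ?thesis by simp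
qed

lemma partial_fourier:
  fixes f :: "real^'n::finite \<Rightarrow> complex"
  assumes [measurable]: "f \<in> borel_measurable borel" and d: "decay f"
  shows "partial i (fourier f) = fourier (\<lambda>x. (- 2 * pi * \<i>) * (complex_of_real (x $ i) * f x))"
proof
  fix k
  show "partial i (fourier f) k = fourier (\<lambda>x. (- 2 * pi * \<i>) * (complex_of_real (x $ i) * f x)) k"
    by (subst partial_eqI[OF fourier_has_derivative[OF assms]], subst fourier_lborel, measurable)
      (auto intro!: Bochner_Integration.integral_cong simp: inner_axis' mult_ac)
qed

lemma fourier_differentiable:
  fixes f :: "real^'n::finite \<Rightarrow> complex"
  assumes "f \<in> borel_measurable borel" and "decay f"
  shows "fourier f differentiable_on UNIV"
  using fourier_has_derivative[OF assms] unfolding differentiable_on_def differentiable_def by blast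

lemma schwartz_measurable[measurable_dest]: "schwartz f \<Longrightarrow> f \<in> borel_measurable borel"
  by (simp add: borel_measurable_continuous_onI schwartz_continuous)

lemma schwartz_integrable: "schwartz f \<Longrightarrow> integrable lborel f"
  by (simp add: integrable_decay schwartz_decay schwartz_measurable)

text \<open>
  The integral of a translate does not depend on the translation; differentiating it under the integral
  sign gives the integral of the partial derivative.\<close>

lemma integral_partial_schwartz:
  fixes f :: "real^'n::finite \<Rightarrow> complex"
  assumes f: "schwartz f"
  shows "(LINT x|lborel. partial i f x) = 0"
proof -
  note [measurable] = schwartz_measurable[OF f] schwartz_measurable[OF schwartz_partial[OF f]]
  let ?a = "axis i 1 :: real^'n"
  obtain C where C: "C \<ge> 0" "\<And>x. norm (partial i f x) * (1 + norm x) ^ 0 \<le> C * weight x"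
    using decay_weight_bound[OF schwartz_decay[OF schwartz_partial[OF f]]] by metis
  have "((\<lambda>t. LINT x|lborel. f (x + t *\<^sub>R ?a)) has_derivative
      (\<lambda>v. LINT x|lborel. v *\<^sub>R partial i f (x + 0 *\<^sub>R ?a))) (at 0)"
  proof (rule has_derivative_integral[where r=1 and g="\<lambda>x. C * 2 ^ (2 * CARD('n)) * weight x"])
    show "integrable lborel (\<lambda>x. f (x + t *\<^sub>R ?a))" for t
      by (subst lborel_integral_translate) (measurable, rule schwartz_integrable[OF f])
    show "((\<lambda>t. f (x + t *\<^sub>R ?a)) has_derivative (\<lambda>v. v *\<^sub>R partial i f (x + t *\<^sub>R ?a))) (at t)" for t x
      using has_vector_derivative_partial[OF schwartz_differentiable[OF f]] by (simp add: has_vector_derivative_def)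
    show "norm (v *\<^sub>R partial i f (x + t *\<^sub>R ?a)) \<le> C * 2 ^ (2 * CARD('n)) * weight x * norm v" if t: "t \<in> ball 0 1" for x t v
    proof -
      have "norm x \<le> norm (x + t *\<^sub>R ?a) + norm (t *\<^sub>R ?a)"
        using norm_triangle_ineq4[of "x + t *\<^sub>R ?a" "t *\<^sub>R ?a"] by simp
      moreover have "norm (t *\<^sub>R ?a) \<le> 1" using t by (simp add: norm_axis_1)
      ultimately have "1 + norm x \<le> 2 * (1 + norm (x + t *\<^sub>R ?a))"
        using norm_ge_zero[of "x + t *\<^sub>R ?a"] unfolding distrib_left by linarith
      then have "(1 + norm x) ^ (2 * CARD('n)) \<le> (2 * (1 + norm (x + t *\<^sub>R ?a))) ^ (2 * CARD('n))"
        by (rule power_mono) auto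
      then have "(1 + norm x) ^ (2 * CARD('n)) \<le> 2 ^ (2 * CARD('n)) * (1 + norm (x + t *\<^sub>R ?a)) ^ (2 * CARD('n))"
        by (simp only: power_mult_distrib)
      moreover have "0 < (1 + norm x) ^ (2 * CARD('n))" "0 < (1 + norm (x + t *\<^sub>R ?a)) ^ (2 * CARD('n))"
        by (simp_all add: add_pos_nonneg)
      moreover have frac: "1 / b \<le> c * (1 / a)" if "a \<le> c * b" "0 < a" "0 < b" for a b c :: real
        using that by (simp add: field_simps)
      ultimately have "weight (x + t *\<^sub>R ?a) \<le> 2 ^ (2 * CARD('n)) * weight x"
        unfolding weight_def by (intro frac)
      then have "C * weight (x + t *\<^sub>R ?a) \<le> C * (2 ^ (2 * CARD('n)) * weight x)" using C(1) by (rule mult_left_mono)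
      then have "norm (partial i f (x + t *\<^sub>R ?a)) \<le> C * (2 ^ (2 * CARD('n)) * weight x)"
        using C(2)[of "x + t *\<^sub>R ?a"] by simp
      from mult_left_mono[OF this, of "norm v"] show ?thesis by (simp add: mult_ac)
    qed
    show "integrable lborel (\<lambda>x::real^'n. C * 2 ^ (2 * CARD('n)) * weight x)"
      by (intro integrable_mult_right integrable_weight)
  qed (simp, measurable)
  moreover have "(LINT x|lborel. f (x + t *\<^sub>R ?a)) = (LINT x|lborel. f x)" for t
    by (rule lborel_integral_translate) measurable
  ultimately have "((\<lambda>t::real. LINT x|lborel. f x) has_derivative (\<lambda>v. v *\<^sub>R (LINT x|lborel. partial i f x))) (at 0)"
    by simp
  from fun_cong[OF has_derivative_unique[OF this has_derivative_const], of 1] show ?thesis by simp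
qed

lemma fourier_partial:
  fixes f :: "real^'n::finite \<Rightarrow> complex"
  assumes f: "schwartz f"
  shows "fourier (partial i f) k = 2 * pi * \<i> * complex_of_real (k $ i) * fourier f k"
proof -
  note [measurable] = schwartz_measurable[OF f] schwartz_measurable[OF schwartz_partial[OF f]]
  have s: "schwartz (\<lambda>x. f x * chi (- k) x)" by (rule schwartz_mult[OF f regular_chi])
  have cd: "chi (- k) differentiable_on UNIV" using regular_SucD(1)[OF regular_chi] .
  have "0 = (LINT x|lborel. partial i (\<lambda>x. f x * chi (- k) x) x)"
    by (simp add: integral_partial_schwartz[OF s])
  also have "\<dots> = (LINT x|lborel. chi (- k) x * partial i f x + (- (2 * pi * \<i> * complex_of_real (k $ i))) * (chi (- k) x * f x))"
    unfolding partial_mult[OF schwartz_differentiable[OF f] cd] partial_chi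
    by (rule Bochner_Integration.integral_cong) (auto simp: algebra_simps)
  also have "\<dots> = fourier (partial i f) k + (- (2 * pi * \<i> * complex_of_real (k $ i))) * fourier f k"
    unfolding fourier_lborel[OF schwartz_measurable[OF f]] fourier_lborel[OF schwartz_measurable[OF schwartz_partial[OF f]]]
    by (subst Bochner_Integration.integral_add)
      (intro integrable_mult_right chi_mult_integrable schwartz_integrable f schwartz_partial, simp)+
  finally show ?thesis by simp
qed

text \<open>
  Each power of k is absorbed by a derivative of f, whose transform is bounded.\<close>

lemma decay_fourier:
  fixes f :: "real^'n::finite \<Rightarrow> complex"
  assumes "schwartz f" shows "decay (fourier f)"
  unfolding decay_def
proof
  fix m
  show "\<exists>C. \<forall>k. (1 + norm k) ^ m * norm (fourier f k) \<le> C" using assms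
  proof (induction m arbitrary: f)
    case 0
    then show ?case using norm_fourier_le[OF schwartz_measurable] by auto
  next
    case (Suc m)
    obtain C where C: "\<And>k. (1 + norm k) ^ m * norm (fourier f k) \<le> C" using Suc by metis
    have "\<forall>i. \<exists>D. \<forall>k. (1 + norm k) ^ m * norm (fourier (partial i f) k) \<le> D"
      using Suc.IH schwartz_partial[OF Suc.prems] by blast
    then obtain D where D: "\<And>i k. (1 + norm k) ^ m * norm (fourier (partial i f) k) \<le> D i" by metis
    have "(1 + norm k) ^ Suc m * norm (fourier f k) \<le> C + (\<Sum>i\<in>UNIV. D i)" for k
    proof -
      have "norm k * norm (fourier f k) \<le> (\<Sum>i\<in>UNIV. \<bar>k $ i\<bar>) * norm (fourier f k)"
        by (intro mult_right_mono norm_le_l1_cart) auto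
      also have "\<dots> \<le> (\<Sum>i\<in>UNIV. norm (fourier (partial i f) k))"
        unfolding sum_distrib_right
      proof (rule sum_mono)
        fix i
        have "1 * (\<bar>k $ i\<bar> * norm (fourier f k)) \<le> (2 * pi) * (\<bar>k $ i\<bar> * norm (fourier f k))"
          using pi_gt3 by (intro mult_right_mono) auto
        then show "\<bar>k $ i\<bar> * norm (fourier f k) \<le> norm (fourier (partial i f) k)"
          by (simp add: fourier_partial[OF Suc.prems] norm_mult)
      qed
      finally have "(1 + norm k) ^ m * (norm (fourier f k) + norm k * norm (fourier f k)) \<le>
        (1 + norm k) ^ m * (norm (fourier f k) + (\<Sum>i\<in>UNIV. norm (fourier (partial i f) k)))"
        by (intro mult_left_mono) auto
      also have "\<dots> = (1 + norm k) ^ m * norm (fourier f k) + (\<Sum>i\<in>UNIV. (1 + norm k) ^ m * norm (fourier (partial i f) k))"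
        by (simp add: distrib_left sum_distrib_left)
      also have "\<dots> \<le> C + (\<Sum>i\<in>UNIV. D i)" by (intro add_mono sum_mono C D)
      finally show ?thesis by (simp add: algebra_simps)
    qed
    then show ?case by blast
  qed
qed

lemma schwartz_fourier:
  assumes "schwartz f" shows "schwartz (fourier f)"
proof -
  have "regular decay m (fourier f)" if "schwartz f" for m f using that
  proof (induction m arbitrary: f)
    case 0
    then show ?case
      using differentiable_imp_continuous_on[OF fourier_differentiable] decay_fourier schwartz_measurable schwartz_decay
      by auto
  next
    case (Suc m)
    show ?case
    proof (rule regular_SucI)
      show "fourier f differentiable_on UNIV" 
        by (intro fourier_differentiable schwartz_measurable schwartz_decay Suc.prems)
      show "regular decay m (partial i (fourier f))" for i
        unfolding partial_fourier[OF schwartz_measurable[OF Suc.prems] schwartz_decay[OF Suc.prems]]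
        by (intro Suc.IH schwartz_cmult schwartz_coord_mult Suc.prems)
    qed (rule decay_fourier[OF Suc.prems])
  qed
  then show ?thesis using assms schwartz_iff_regular by blast
qed

lemma regular_reflect:
  assumes "\<And>f. G f \<Longrightarrow> G (\<lambda>x. f (- x))" "\<And>f. G f \<Longrightarrow> G (\<lambda>x. - f x)"
  shows "regular G m f \<Longrightarrow> regular G m (\<lambda>x. f (- x))"
proof -
  have neg: "regular G m (\<lambda>x. - f x)" if "regular G m f" for m f using that
  proof (induction m arbitrary: f)
    case 0
    then show ?case using assms(2) by (simp add: continuous_on_minus)
  next
    case (Suc m)
    have "partial i (\<lambda>x. - f x) = (\<lambda>x. - partial i f x)" for i
      by (rule partial_linear[OF regular_SucD(1)[OF Suc.prems]]) (rule bounded_linear_minus[OF bounded_linear_ident])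
    then show ?case using Suc assms(2) by (simp add: differentiable_on_minus)
  qed
  show "regular G m f \<Longrightarrow> regular G m (\<lambda>x. f (- x))"
  proof (induction m arbitrary: f)
    case 0
    have "continuous_on UNIV (\<lambda>x. f (- x))"
      by (rule continuous_on_compose2[OF regular_continuous[OF 0]]) (auto intro: continuous_intros)
    then show ?case using assms(1) 0 by simp
  next
    case (Suc m)
    have d: "((\<lambda>x. f (- x)) has_derivative (\<lambda>v. D (- v))) (at x)" if "(f has_derivative D) (at (- x))" for D x
      by (rule has_derivative_compose[where f=uminus and g=f, OF has_derivative_minus[OF has_derivative_ident] that])
    have "(\<lambda>x. f (- x)) differentiable_on UNIV"
      unfolding differentiable_on_def differentiable_def
    proof
      fix x
      obtain D where "(f has_derivative D) (at (- x))"
        by (rule differentiable_on_UNIV_E[OF regular_SucD(1)[OF Suc.prems]])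
      from d[OF this] show "\<exists>D. ((\<lambda>x. f (- x)) has_derivative D) (at x)" by blast
    qed
    moreover have "partial i (\<lambda>x. f (- x)) = (\<lambda>x. - partial i f (- x))" for i
    proof
      fix x
      obtain D where D: "(f has_derivative D) (at (- x))"
        by (rule differentiable_on_UNIV_E[OF regular_SucD(1)[OF Suc.prems]])
      then have "linear D" using has_derivative_linear by blast
      then show "partial i (\<lambda>x. f (- x)) x = - partial i f (- x)"
        using partial_eqI[OF d[OF D]] partial_eqI[OF D] by (simp add: linear_neg)
    qed
    ultimately show ?case using Suc assms(1) neg[OF Suc.IH] by simp
  qed
qed

lemma schwartz_reflect: "schwartz f \<Longrightarrow> schwartz (\<lambda>x. f (- x))"
  unfolding schwartz_iff_regular
proof (intro allI regular_reflect)
  show "decay f \<Longrightarrow> decay (\<lambda>x. f (- x))" for f :: "real^'a \<Rightarrow> complex"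
    unfolding decay_def by (metis norm_minus_cancel)
  show "decay f \<Longrightarrow> decay (\<lambda>x. - f x)" for f :: "real^'a \<Rightarrow> complex"
    unfolding decay_def by simp
qed simp

section \<open>Fourier inversion\<close>

definition std_gauss :: "real^'n::finite \<Rightarrow> real" where
  "std_gauss x = (\<Prod>i\<in>UNIV. std_normal_density (x $ i))"

lemma std_gauss_eq: "std_gauss (x::real^'n::finite) = (1 / sqrt (2 * pi)) ^ CARD('n) * exp (- (norm x)\<^sup>2 / 2)"
proof -
  have "std_gauss x = (\<Prod>i\<in>(UNIV::'n set). 1 / sqrt (2 * pi)) * (\<Prod>i\<in>UNIV. exp (- (x $ i)\<^sup>2 / 2))"
    unfolding std_gauss_def std_normal_density_def prod.distrib[symmetric] by simp
  also have "(\<Prod>i\<in>UNIV. exp (- (x $ i)\<^sup>2 / 2)) = exp (- (norm x)\<^sup>2 / 2)"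
    by (simp add: exp_sum[symmetric] norm_vec_def L2_set_def sum_nonneg sum_negf sum_divide_distrib)
  finally show ?thesis by simp
qed

lemma std_gauss_measurable[measurable]: "std_gauss \<in> borel_measurable borel"
  unfolding std_gauss_def[abs_def] by measurable

lemma iexp_std_normal: 
  "integrable lborel (\<lambda>t. exp (2 * pi * \<i> * complex_of_real (s * t)) * complex_of_real (std_normal_density t))"
  "(LINT t|lborel. exp (2 * pi * \<i> * complex_of_real (s * t)) * complex_of_real (std_normal_density t)) = complex_of_real (exp (- (2 * pi * s)\<^sup>2 / 2))"
proof -
  have "integrable lborel (\<lambda>t. complex_of_real (std_normal_density t))"
    by (intro integrable_of_real integrable_normal_density) simp
  then show "integrable lborel (\<lambda>t. exp (2 * pi * \<i> * complex_of_real (s * t)) * complex_of_real (std_normal_density t))"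
    by (rule Bochner_Integration.integrable_bound) (auto simp: norm_mult norm_exp_eq_Re)
  have "complex_of_real (exp (- (2 * pi * s)\<^sup>2 / 2)) = char std_normal_distribution (2 * pi * s)"
    by (simp add: char_std_normal_distribution)
  also have "\<dots> = (LINT t|lborel. std_normal_density t *\<^sub>R iexp ((2 * pi * s) * t))"
    unfolding char_def by (subst integral_density) auto
  also have "\<dots> = (LINT t|lborel. exp (2 * pi * \<i> * complex_of_real (s * t)) * complex_of_real (std_normal_density t))"
    by (rule Bochner_Integration.integral_cong) (auto simp: scaleR_conv_of_real mult_ac)
  finally show "(LINT t|lborel. exp (2 * pi * \<i> * complex_of_real (s * t)) * complex_of_real (std_normal_density t)) = complex_of_real (exp (- (2 * pi * s)\<^sup>2 / 2))" ..
qed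

lemma chi_std_gauss:
  "integrable lborel (\<lambda>x. chi v x * complex_of_real (std_gauss x))"
  "(LINT x|lborel. chi v x * complex_of_real (std_gauss x)) = complex_of_real (exp (- 2 * pi\<^sup>2 * (norm v)\<^sup>2))"
proof -
  have e: "chi v x * complex_of_real (std_gauss x) =
    (\<Prod>i\<in>UNIV. exp (2 * pi * \<i> * complex_of_real (v $ i * x $ i)) * complex_of_real (std_normal_density (x $ i)))" for x
    by (simp add: prod.distrib std_gauss_def chi_def inner_vec_def exp_sum[symmetric] sum_distrib_left)
  show "integrable lborel (\<lambda>x. chi v x * complex_of_real (std_gauss x))"
    unfolding e by (rule product_integral_vec(1)) (rule iexp_std_normal)
  have "(LINT x|lborel. chi v x * complex_of_real (std_gauss x)) = (\<Prod>i\<in>UNIV. complex_of_real (exp (- (2 * pi * v $ i)\<^sup>2 / 2)))"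
    unfolding e product_integral_vec(2)[OF iexp_std_normal(1)] iexp_std_normal(2) by (rule refl)
  also have "\<dots> = complex_of_real (exp (- 2 * pi\<^sup>2 * (norm v)\<^sup>2))"
    unfolding of_real_prod[symmetric] exp_sum[OF finite, symmetric]
    by (simp add: norm_vec_def L2_set_def sum_nonneg sum_negf sum_distrib_left power_mult_distrib mult.assoc)
  finally show "(LINT x|lborel. chi v x * complex_of_real (std_gauss x)) = complex_of_real (exp (- 2 * pi\<^sup>2 * (norm v)\<^sup>2))" .
qed

lemma std_gauss_integral: "integrable lborel std_gauss" "(LINT x|lborel. std_gauss x) = 1"
proof -
  have "integrable lborel (\<lambda>x. complex_of_real (std_gauss x))" using chi_std_gauss(1)[of 0] by simp
  then show "integrable lborel std_gauss" using integrable_Re by fastforce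
  have "(LINT x|lborel. complex_of_real (std_gauss x)) = 1" using chi_std_gauss(2)[of 0] by simp
  then show "(LINT x|lborel. std_gauss x) = 1" unfolding integral_complex_of_real by simp
qed

lemma std_gauss_rescaled:
  "integrable lborel (\<lambda>v::real^'n::finite. exp (- 2 * pi\<^sup>2 * (norm v)\<^sup>2))"
  "(LINT v|lborel. exp (- 2 * pi\<^sup>2 * (norm (v::real^'n::finite))\<^sup>2)) = std_gauss (0::real^'n)"
proof -
  have e: "exp (- 2 * pi\<^sup>2 * (norm v)\<^sup>2) = sqrt (2 * pi) ^ CARD('n) * std_gauss ((2 * pi) *\<^sub>R v)" for v :: "real^'n"
    by (simp add: std_gauss_eq power_mult_distrib power_one_over)
  have i: "integrable lborel (\<lambda>v::real^'n. std_gauss ((2 * pi) *\<^sub>R v))"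
    using lborel_integral_affine(2)[of "2 * pi" "std_gauss :: real^'n \<Rightarrow> real" 0] std_gauss_integral(1) by simp
  then show "integrable lborel (\<lambda>v::real^'n::finite. exp (- 2 * pi\<^sup>2 * (norm v)\<^sup>2))"
    unfolding e by simp
  have "(2 * pi) ^ CARD('n) * (LINT v|lborel. std_gauss ((2 * pi) *\<^sub>R (v::real^'n))) = 1"
    using lborel_integral_affine(1)[of "2 * pi" "std_gauss :: real^'n \<Rightarrow> real" 0, unfolded std_gauss_integral(2)] by simp
  then have 1: "(LINT v|lborel. std_gauss ((2 * pi) *\<^sub>R (v::real^'n))) = (1 / (2 * pi)) ^ CARD('n)"
    by (simp add: field_simps)
  have "(LINT v|lborel. exp (- 2 * pi\<^sup>2 * (norm (v::real^'n::finite))\<^sup>2)) = (sqrt (2 * pi) * (1 / (2 * pi))) ^ CARD('n)"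
    unfolding e by (simp add: 1 power_mult_distrib[symmetric])
  also have "sqrt (2 * pi) * (1 / (2 * pi)) = 1 / sqrt (2 * pi)"
  proof -
    have "sqrt (2 * pi) / (2 * pi) = 1 / sqrt (2 * pi)" by (subst frac_eq_eq) auto
    then show ?thesis by simp
  qed
  finally show "(LINT v|lborel. exp (- 2 * pi\<^sup>2 * (norm (v::real^'n::finite))\<^sup>2)) = std_gauss (0::real^'n)"
    by (simp add: std_gauss_eq)
qed

lemma std_gauss_le: "std_gauss (x::real^'n::finite) \<le> std_gauss (0::real^'n)" "std_gauss x \<ge> 0" "std_gauss (0::real^'n) > 0"
  by (auto simp: std_gauss_eq mult_left_le)

text \<open>
  Gaussian regularisation: inserting a wide Gaussian in k makes Fubini applicable and turns the inner
  integral into a narrow Gaussian around x. Both sides converge as the Gaussian widens, the left one by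
  integrability of the transform and the right one by continuity of f.\<close>

theorem fourier_inversion:
  fixes f :: "real^'n::finite \<Rightarrow> complex"
  assumes f: "schwartz f"
  shows "(LINT k|lborel. chi x k * fourier f k) = f x"
proof -
  note [measurable] = schwartz_measurable[OF f] schwartz_measurable[OF schwartz_fourier[OF f]] chi_measurable
  note fi = schwartz_integrable[OF f] and Fi = schwartz_integrable[OF schwartz_fourier[OF f]]
  have cont: "continuous_on UNIV f" by (rule schwartz_continuous[OF f])
  obtain B where B: "\<And>x. norm (f x) \<le> B"
    using schwartz_decay[OF f] unfolding decay_def by (metis mult_1 power_0)
  define g where "g \<delta> k = chi x k * complex_of_real (std_gauss (\<delta> *\<^sub>R k))" for \<delta> k
  have gi: "integrable lborel (g \<delta>)" if "\<delta> > 0" for \<delta>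
  proof -
    have "integrable lborel (\<lambda>k. complex_of_real (std_gauss (\<delta> *\<^sub>R k :: real^'n)))"
      using lborel_integral_affine(2)[of \<delta> "std_gauss :: real^'n \<Rightarrow> real" 0] std_gauss_integral(1) that
      by (intro integrable_of_real) simp
    then show ?thesis unfolding g_def[abs_def] by (rule chi_mult_integrable)
  qed
  have inner: "(LINT k|lborel. chi (- k) y * g \<delta> k) = (1 / \<delta>) ^ CARD('n) *\<^sub>R complex_of_real (exp (- 2 * pi\<^sup>2 * (norm ((1/\<delta>) *\<^sub>R (x - y)))\<^sup>2))"
    if \<delta>: "\<delta> > 0" for \<delta> y
  proof -
    have "chi (- k) y * g \<delta> k = chi ((1/\<delta>) *\<^sub>R (x - y)) (\<delta> *\<^sub>R k) * complex_of_real (std_gauss (\<delta> *\<^sub>R k))" for k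
      using \<delta> by (simp add: g_def chi_def exp_add[symmetric] inner_diff_left inner_commute[of k y] algebra_simps)
    then have "(LINT k|lborel. chi (- k) y * g \<delta> k) = (LINT k|lborel. chi ((1/\<delta>) *\<^sub>R (x - y)) (0 + \<delta> *\<^sub>R k) * complex_of_real (std_gauss (0 + \<delta> *\<^sub>R k)))"
      by simp
    moreover have "complex_of_real (exp (- 2 * pi\<^sup>2 * (norm ((1/\<delta>) *\<^sub>R (x - y)))\<^sup>2)) = \<delta> ^ CARD('n) *\<^sub>R \<dots>"
      unfolding chi_std_gauss(2)[symmetric]
      using \<delta> by (subst lborel_integral_affine(1)[of \<delta> _ 0]) auto
    ultimately show ?thesis using \<delta> by (simp add: power_one_over)
  qed
  (* exchange the integrals, then substitute y = x + delta v *)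
  have A: "(LINT k|lborel. g \<delta> k * fourier f k) = (LINT v|lborel. f (x + \<delta> *\<^sub>R v) * complex_of_real (exp (- 2 * pi\<^sup>2 * (norm v)\<^sup>2)))"
    if \<delta>: "\<delta> > 0" for \<delta>
  proof -
    have "(LINT k|lborel. g \<delta> k * fourier f k) = (LINT y|lborel. f y * (LINT k|lborel. chi (- k) y * g \<delta> k))"
      unfolding fourier_lborel[OF schwartz_measurable[OF f]] by (rule fourier_exchange[OF fi gi[OF \<delta>], symmetric])
    also have "\<dots> = \<bar>\<delta>\<bar> ^ DIM(real^'n) *\<^sub>R (LINT v|lborel. f (x + \<delta> *\<^sub>R v) * ((1 / \<delta>) ^ CARD('n) *\<^sub>R complex_of_real (exp (- 2 * pi\<^sup>2 * (norm ((1/\<delta>) *\<^sub>R (x - (x + \<delta> *\<^sub>R v))))\<^sup>2))))"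
      unfolding inner[OF \<delta>] using \<delta> by (subst lborel_integral_affine(1)[of \<delta> _ x]) auto
    also have "\<dots> = \<delta> ^ CARD('n) *\<^sub>R ((1 / \<delta>) ^ CARD('n) *\<^sub>R (LINT v|lborel. f (x + \<delta> *\<^sub>R v) * complex_of_real (exp (- 2 * pi\<^sup>2 * (norm v)\<^sup>2))))"
      using \<delta> by (simp add: power_one_over)
    finally show ?thesis using \<delta> by (simp add: power_one_over)
  qed
  define d where "d n = inverse (real (Suc n))" for n
  have d0: "d \<longlonglongrightarrow> 0" unfolding d_def by (rule LIMSEQ_inverse_real_of_nat)
  have dp: "d n > 0" for n by (simp add: d_def)
  have gc: "(\<lambda>n. std_gauss (d n *\<^sub>R k)) \<longlonglongrightarrow> std_gauss (0 :: real^'n)" for k :: "real^'n"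
    unfolding std_gauss_eq by (auto intro!: tendsto_eq_intros d0)
  have L1: "(\<lambda>n. LINT k|lborel. g (d n) k * fourier f k) \<longlonglongrightarrow> (LINT k|lborel. chi x k * complex_of_real (std_gauss (0::real^'n)) * fourier f k)"
  proof (rule integral_dominated_convergence[where w="\<lambda>k. std_gauss (0::real^'n) * norm (fourier f k)"])
    show "AE k in lborel. (\<lambda>n. g (d n) k * fourier f k) \<longlonglongrightarrow> chi x k * complex_of_real (std_gauss (0::real^'n)) * fourier f k"
      unfolding g_def by (intro AE_I2 tendsto_intros gc)
    show "AE k in lborel. norm (g (d n) k * fourier f k) \<le> std_gauss (0::real^'n) * norm (fourier f k)" for n
      by (intro AE_I2) (simp add: g_def norm_mult abs_of_nonneg std_gauss_le mult_right_mono)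
    show "(\<lambda>k. g (d n) k * fourier f k) \<in> borel_measurable lborel" for n unfolding g_def by measurable
  qed (use Fi in auto)
  have L2: "(\<lambda>n. LINT v|lborel. f (x + d n *\<^sub>R v) * complex_of_real (exp (- 2 * pi\<^sup>2 * (norm v)\<^sup>2))) \<longlonglongrightarrow> 
    (LINT v|lborel. f x * complex_of_real (exp (- 2 * pi\<^sup>2 * (norm (v::real^'n))\<^sup>2)))"
  proof (rule integral_dominated_convergence[where w="\<lambda>v. B * exp (- 2 * pi\<^sup>2 * (norm v)\<^sup>2)"])
    have "(\<lambda>n. f (x + d n *\<^sub>R v)) \<longlonglongrightarrow> f x" for v
    proof -
      have "(\<lambda>n. x + d n *\<^sub>R v) \<longlonglongrightarrow> x" by (auto intro!: tendsto_eq_intros d0)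
      then show ?thesis using continuous_on_tendsto_compose[OF cont] by auto
    qed
    then show "AE v in lborel. (\<lambda>n. f (x + d n *\<^sub>R v) * complex_of_real (exp (- 2 * pi\<^sup>2 * (norm v)\<^sup>2))) \<longlonglongrightarrow> f x * complex_of_real (exp (- 2 * pi\<^sup>2 * (norm v)\<^sup>2))"
      by (intro AE_I2 tendsto_intros)
    show "AE v in lborel. norm (f (x + d n *\<^sub>R v) * complex_of_real (exp (- 2 * pi\<^sup>2 * (norm v)\<^sup>2))) \<le> B * exp (- 2 * pi\<^sup>2 * (norm v)\<^sup>2)" for n
      by (intro AE_I2) (simp add: norm_mult B mult_right_mono)
    show "integrable lborel (\<lambda>v::real^'n. B * exp (- 2 * pi\<^sup>2 * (norm v)\<^sup>2))"
      using std_gauss_rescaled(1) by (intro integrable_mult_right) 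
  qed auto
  have "(LINT k|lborel. chi x k * complex_of_real (std_gauss (0::real^'n)) * fourier f k) = 
    (LINT v|lborel. f x * complex_of_real (exp (- 2 * pi\<^sup>2 * (norm (v::real^'n))\<^sup>2)))"
    using L1 L2 unfolding A[OF dp] by (rule LIMSEQ_unique)
  moreover have "(LINT v|lborel. f x * complex_of_real (exp (- 2 * pi\<^sup>2 * (norm (v::real^'n))\<^sup>2))) = f x * complex_of_real (std_gauss (0::real^'n))"
    using std_gauss_rescaled(2)[where 'n='n] by simp
  moreover have "(LINT k|lborel. chi x k * complex_of_real (std_gauss (0::real^'n)) * fourier f k) = complex_of_real (std_gauss (0::real^'n)) * (LINT k|lborel. chi x k * fourier f k)"
    by (subst integral_mult_right_zero[symmetric], rule Bochner_Integration.integral_cong) (auto simp: mult_ac)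
  ultimately have "complex_of_real (std_gauss (0::real^'n)) * (LINT k|lborel. chi x k * fourier f k) = f x * complex_of_real (std_gauss (0::real^'n))"
    by (simp only:)
  then show ?thesis using std_gauss_le(3)[where 'n='n] by (simp add: mult.commute)
qed

definition ifourier :: "(real^'n::finite \<Rightarrow> complex) \<Rightarrow> real^'n \<Rightarrow> complex" where
  "ifourier f x = fourier f (- x)"

lemma ifourier_lborel: "f \<in> borel_measurable borel \<Longrightarrow> ifourier f x = (LINT k|lborel. chi x k * f k)"
  by (simp add: ifourier_def fourier_lborel)

lemma schwartz_ifourier: "schwartz f \<Longrightarrow> schwartz (ifourier f)"
  unfolding ifourier_def[abs_def] by (intro schwartz_reflect schwartz_fourier)

lemma ifourier_fourier: "schwartz f \<Longrightarrow> ifourier (fourier f) = f"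
  by (rule ext) (simp add: ifourier_lborel schwartz_measurable schwartz_fourier fourier_inversion)

lemma fourier_ifourier: 
  assumes f: "schwartz f" shows "fourier (ifourier f) = f"
proof
  fix x
  note [measurable] = schwartz_measurable[OF schwartz_fourier[OF f]] schwartz_measurable[OF schwartz_ifourier[OF f]] chi_measurable
  have "f x = (LINT k|lborel. chi x k * fourier f k)" by (simp add: fourier_inversion[OF f])
  also have "\<dots> = (LINT k|lborel. chi x (0 + (-1) *\<^sub>R k) * fourier f (0 + (-1) *\<^sub>R k))"
    by (subst lborel_integral_affine(1)[of "-1" _ 0]) auto
  also have "\<dots> = (LINT k|lborel. chi (- x) k * ifourier f k)"
    by (simp add: ifourier_def chi_minus)
  finally show "fourier (ifourier f) x = f x" by (subst fourier_lborel) auto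
qed

section \<open>Test functions\<close>

text \<open>
  The powers of t in the denominator close the family under differentiation.\<close>

definition flat :: "nat \<Rightarrow> real \<Rightarrow> real" where
  "flat m t = (if t > 0 then exp (- 1 / t) / t ^ m else 0)"

lemma flat_nonneg: "flat m t \<ge> 0" by (simp add: flat_def)

text \<open>
  Quadratic vanishing at 0 is what differentiability there needs.\<close>

lemma flat_le: "flat m t \<le> fact (m + 2) * t\<^sup>2"
proof (cases "t > 0")
  case True
  have "(1 / t) ^ (m + 2) \<le> fact (m + 2) * exp (1 / t)" by (rule power_le_fact_exp) (use True in simp)
  then have "(1 / t) ^ (m + 2) * exp (- 1 / t) \<le> fact (m + 2) * exp (1 / t) * exp (- 1 / t)"
    by (rule mult_right_mono) simp
  then have "(1 / t) ^ (m + 2) * exp (- 1 / t) \<le> fact (m + 2)"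
    by (simp add: mult.assoc exp_add[symmetric])
  then have "(1 / t) ^ (m + 2) * exp (- 1 / t) * t\<^sup>2 \<le> fact (m + 2) * t\<^sup>2" by (rule mult_right_mono) simp
  moreover have "(1 / t) ^ (m + 2) * exp (- 1 / t) * t\<^sup>2 = flat m t"
    using True by (simp add: flat_def power_add power_one_over power2_eq_square)
  ultimately show ?thesis by simp
qed (simp add: flat_def)

lemma flat_DERIV: "DERIV (flat m) t :> flat (m + 2) t - real m * flat (m + 1) t"
proof -
  consider "t > 0" | "t = 0" | "t < 0" by linarith
  then show ?thesis
  proof cases
    case 1
    have "DERIV (\<lambda>t. exp (- 1 / t) * inverse t ^ m) t :> flat (m + 2) t - real m * flat (m + 1) t"
    proof -
      have d: "DERIV (\<lambda>t. inverse t ^ m) t :> - real m * inverse t ^ (m + 1)"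
      proof (cases m)
        case (Suc k)
        from DERIV_power_Suc[OF DERIV_inverse, of t k] 1 show ?thesis
          unfolding Suc by (simp add: algebra_simps)
      qed simp
      have e: "DERIV (\<lambda>t. exp (- 1 / t)) t :> exp (- 1 / t) * inverse t ^ 2"
        using 1 by (auto intro!: derivative_eq_intros simp: power2_eq_square field_simps)
      have "exp (- 1 / t) * inverse t ^ 2 * inverse t ^ m + - real m * inverse t ^ (m + 1) * exp (- 1 / t)
        = flat (m + 2) t - real m * flat (m + 1) t"
        using 1 by (simp add: flat_def divide_inverse power_inverse power_add power2_eq_square algebra_simps)
      then show ?thesis using DERIV_mult[OF e d] by simp
    qed
    then show ?thesis
    proof (rule has_field_derivative_transform_within_open[where S="{0<..}"])
      show "exp (- 1 / x) * inverse x ^ m = flat m x" if "x \<in> {0<..}" for x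
        using that by (simp add: flat_def divide_inverse power_inverse)
    qed (use 1 in auto)
  next
    case 2
    have "((\<lambda>h. (flat m (0 + h) - flat m 0) / h) \<longlongrightarrow> 0) (at 0)"
    proof (rule Lim_null_comparison)
      have "norm ((flat m (0 + h) - flat m 0) / h) \<le> fact (m + 2) * \<bar>h\<bar>" for h
      proof (cases "h = 0")
        case False
        then show ?thesis using flat_le[of m h] flat_nonneg[of m h]
          by (simp add: flat_def[of m 0] pos_divide_le_eq power2_eq_square mult.assoc)
      qed simp
      then show "\<forall>\<^sub>F h in at 0. norm ((flat m (0 + h) - flat m 0) / h) \<le> fact (m + 2) * \<bar>h\<bar>" by simp
      show "((\<lambda>h. fact (m + 2) * \<bar>h\<bar>) \<longlongrightarrow> (0::real)) (at 0)" by (auto intro!: tendsto_eq_intros)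
    qed
    then show ?thesis using 2 by (simp add: DERIV_def flat_def[of _ 0])
  next
    case 3
    have "DERIV (\<lambda>t::real. 0::real) t :> 0" by simp
    then have "DERIV (flat m) t :> 0"
      by (rule has_field_derivative_transform_within_open[where S="{..<0}"]) (use 3 in \<open>auto simp: flat_def\<close>)
    then show ?thesis using 3 by (simp add: flat_def)
  qed
qed

definition bump :: "nat \<Rightarrow> real^'n::finite \<Rightarrow> real \<Rightarrow> real^'n \<Rightarrow> complex" where
  "bump m c r x = complex_of_real (flat m (r\<^sup>2 - (norm (x - c))\<^sup>2))"

lemma bump_has_derivative:
  "(bump m c r has_derivative (\<lambda>v. (bump (m + 2) c r x - of_nat m * bump (m + 1) c r x) * complex_of_real (- 2 * ((x - c) \<bullet> v)))) (at x)"
proof -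
  have 1: "((\<lambda>x. r\<^sup>2 - (norm (x - c))\<^sup>2) has_derivative (\<lambda>v. - 2 * ((x - c) \<bullet> v))) (at x)"
    unfolding power2_norm_eq_inner by (auto intro!: derivative_eq_intros simp: inner_commute algebra_simps)
  have "((\<lambda>x. flat m (r\<^sup>2 - (norm (x - c))\<^sup>2)) has_derivative
     (\<lambda>v. (- 2 * ((x - c) \<bullet> v)) * (flat (m + 2) (r\<^sup>2 - (norm (x - c))\<^sup>2) - real m * flat (m + 1) (r\<^sup>2 - (norm (x - c))\<^sup>2)))) (at x)"
    by (rule DERIV_compose_FDERIV[OF flat_DERIV 1])
  from has_derivative_of_real[OF this] show ?thesis unfolding bump_def[abs_def] by (simp add: mult.commute)
qed

text \<open>
  The prefactor q collects the polynomial factors produced by the chain rule, and the index m grows with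
  each derivative; both have to be arbitrary for the induction.\<close>

lemma regular_bump:
  "(\<And>m. regular (\<lambda>_. True) m q) \<Longrightarrow> regular (\<lambda>_. True) n (\<lambda>x. q x * bump m c r x)"
proof (induction n arbitrary: q m)
  case 0
  have "bump m c r differentiable_on UNIV"
    using bump_has_derivative unfolding differentiable_on_def differentiable_def by blast
  from continuous_on_mult[OF regular_continuous[OF 0] differentiable_imp_continuous_on[OF this]]
  show ?case by simp
next
  case (Suc n)
  have qd: "q differentiable_on UNIV" using regular_SucD(1)[OF Suc.prems] .
  have bd: "bump m c r differentiable_on UNIV" for m
    using bump_has_derivative unfolding differentiable_on_def differentiable_def by blast
  show ?case
  proof (rule regular_SucI)
    show "(\<lambda>x. q x * bump m c r x) differentiable_on UNIV" by (rule differentiable_on_mult[OF qd bd])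
    fix i
    let ?l = "\<lambda>x. (- 2) * (complex_of_real (x $ i) + complex_of_real (- (c $ i)))"
    note add = regular_add[where G="\<lambda>_. True"] and mult = regular_mult[where G="\<lambda>_. True" and ?G1.0="\<lambda>_. True" and ?G2.0="\<lambda>_. True"]
    have l: "regular (\<lambda>_. True) k ?l" for k
      by (rule regular_mono[of moderate], rule TrueI, intro regular_moderate_mult regular_moderate_add regular_moderate_const regular_moderate_coord)
    have ql: "regular (\<lambda>_. True) k (\<lambda>x. q x * ?l x)" for k using mult[OF _ _ Suc.prems l] by simp
    have mql: "regular (\<lambda>_. True) k (\<lambda>x. (q x * ?l x) * (- of_nat m))" for k
      by (rule mult[OF _ _ ql]) (auto intro: regular_const)
    have "partial i (\<lambda>x. q x * bump m c r x) = (\<lambda>x. ((q x * ?l x) * bump (m+2) c r x + ((q x * ?l x) * (- of_nat m)) * bump (m+1) c r x) + partial i q x * bump m c r x)"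
      unfolding partial_mult[OF qd bd] partial_eqI[OF bump_has_derivative]
      by (rule ext) (simp add: inner_axis algebra_simps)
    moreover have "regular (\<lambda>_. True) n \<dots>"
      by (intro add TrueI Suc.IH ql mql regular_partial Suc.prems)
    ultimately show "regular (\<lambda>_. True) n (partial i (\<lambda>x. q x * bump m c r x))" by simp
  qed simp
qed

lemma bump_nonzero_iff: "bump 0 c r x \<noteq> 0 \<longleftrightarrow> norm (x - c) < \<bar>r\<bar>"
  using abs_le_square_iff[of r "norm (x - c)"] by (auto simp: bump_def flat_def not_less not_le)

lemma test_fun_bump:
  assumes "r > 0" "cball c r \<subseteq> U" shows "test_fun U (bump 0 c r)"
proof -
  have s: "{x. bump 0 c r x \<noteq> 0} = ball c r"
    using assms(1) by (auto simp: bump_nonzero_iff dist_norm norm_minus_commute)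
  have "regular (\<lambda>_. True) m (\<lambda>x. 1 * bump 0 c r x)" for m
    by (rule regular_bump) (auto intro: regular_const)
  then show ?thesis using assms by (simp add: test_fun_def smooth_on_iff_regular s)
qed

lemma bump_measurable[measurable]: "bump 0 c r \<in> borel_measurable borel"
  unfolding bump_def[abs_def] flat_def[abs_def] by measurable

lemma bump_integral_pos:
  assumes r: "r > 0"
  shows "integrable lborel (bump 0 c r)" "(LINT x|lborel. norm (bump 0 c r (x::real^'n::finite))) > 0"
proof -
  have le: "norm (bump 0 c r x) \<le> 2 * r ^ 4 * indicator (cball c r) x" for x :: "real^'n"
  proof (cases "x \<in> cball c r")
    case True
    then have "norm (x - c) \<le> r" by (simp add: dist_norm norm_minus_commute)
    then have n: "(norm (x - c))\<^sup>2 \<le> r\<^sup>2" by (rule power_mono) auto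
    have "norm (bump 0 c r x) \<le> 2 * (r\<^sup>2 - (norm (x - c))\<^sup>2)\<^sup>2"
      using flat_le[of 0 "r\<^sup>2 - (norm (x - c))\<^sup>2"] flat_nonneg by (simp add: bump_def fact_numeral numeral_2_eq_2)
    also have "\<dots> \<le> 2 * (r\<^sup>2)\<^sup>2" using n by (intro mult_left_mono power_mono) auto
    finally show ?thesis using True by simp
  next
    case False
    then have "bump 0 c r x = 0" using bump_nonzero_iff[of c r x] r by (auto simp: dist_norm norm_minus_commute)
    then show ?thesis by simp
  qed
  show i: "integrable lborel (bump 0 c r)"
  proof (rule Bochner_Integration.integrable_bound)
    show "integrable lborel (\<lambda>x::real^'n. 2 * r ^ 4 * indicator (cball c r) x)"
      using emeasure_bounded_finite[OF bounded_cball[of c r]]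
      by (intro integrable_mult_right integrable_real_indicator) auto
    show "AE x in lborel. norm (bump 0 c r x) \<le> norm (2 * r ^ 4 * indicator (cball c r) x :: real)"
      using le r by (intro AE_I2) (simp add: abs_mult)
  qed simp
  show "(LINT x|lborel. norm (bump 0 c r x)) > 0"
  proof (rule ccontr)
    assume "\<not> ?thesis"
    then have "(LINT x|lborel. norm (bump 0 c r x)) = 0"
      by (simp add: order.antisym)
    then have "AE x in lborel. norm (bump 0 c r x) = 0"
      using i by (subst (asm) integral_nonneg_eq_0_iff_AE) auto
    then have "{x. norm (bump 0 c r x) \<noteq> 0} \<in> null_sets lborel"
      by (subst (asm) AE_iff_null) auto
    moreover have "{x. norm (bump 0 c r x) \<noteq> 0} = ball c r"
      using r by (auto simp: bump_nonzero_iff dist_norm norm_minus_commute)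
    ultimately have "ball c r \<in> null_sets lborel" by simp
    then show False using r open_not_negligible[of "ball c r"]
      by (simp add: negligible_iff_null_sets null_sets_completionI)
  qed
qed

lemma partial_zero_outside:
  fixes f :: "real^'n::finite \<Rightarrow> complex"
  assumes "closed K" "\<And>x. x \<notin> K \<Longrightarrow> f x = 0" "x \<notin> K"
  shows "partial i f x = 0"
proof -
  have "((\<lambda>_. 0) has_derivative (\<lambda>_. 0)) (at x)" by simp
  then have "(f has_derivative (\<lambda>_. 0)) (at x)"
    by (rule has_derivative_transform_within_open[where s="- K"]) (use assms in auto)
  then show ?thesis by (rule partial_eqI)
qed

lemma schwartz_of_compact_support:
  fixes f :: "real^'n::finite \<Rightarrow> complex"
  assumes "compact K" "\<And>x. x \<notin> K \<Longrightarrow> f x = 0" "\<And>m. regular (\<lambda>_. True) m f"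
  shows "schwartz f"
proof -
  have d: "decay f" if f: "continuous_on UNIV f" "\<And>x. x \<notin> K \<Longrightarrow> f x = 0" for f :: "real^'n \<Rightarrow> complex"
    unfolding decay_def
  proof
    fix m
    have "continuous_on K (\<lambda>x. (1 + norm x) ^ m * norm (f x))"
      using f(1) by (intro continuous_intros continuous_on_subset[OF f(1)]) auto
    then have "bounded ((\<lambda>x. (1 + norm x) ^ m * norm (f x)) ` K)"
      using assms(1) compact_continuous_image compact_imp_bounded by blast
    then obtain B where B: "\<And>x. x \<in> K \<Longrightarrow> (1 + norm x) ^ m * norm (f x) \<le> B"
      unfolding bounded_iff by (auto intro: order_trans[OF abs_ge_self])
    have "(1 + norm x) ^ m * norm (f x) \<le> \<bar>B\<bar>" for x
      using B[of x] f(2)[of x] by (cases "x \<in> K") auto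
    then show "\<exists>C. \<forall>x. (1 + norm x) ^ m * norm (f x) \<le> C" by blast
  qed
  have "regular decay m f" if "regular (\<lambda>_. True) m f" "\<And>x. x \<notin> K \<Longrightarrow> f x = 0" for m f using that
  proof (induction m arbitrary: f)
    case 0
    then show ?case using d by simp
  next
    case (Suc m)
    have "regular decay m (partial i f)" for i
      by (rule Suc.IH[OF regular_SucD(2)[OF Suc.prems(1)]])
        (rule partial_zero_outside[OF compact_imp_closed[OF assms(1)] Suc.prems(2)])
    then show ?case using Suc.prems d[OF regular_continuous[OF Suc.prems(1)]] by simp
  qed
  then show ?thesis using assms unfolding schwartz_iff_regular by blast
qed

lemma test_funI:
  fixes f :: "real^'n::finite \<Rightarrow> complex"
  assumes "compact K" "\<And>x. x \<notin> K \<Longrightarrow> f x = 0" "\<And>m. regular (\<lambda>_. True) m f"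
  shows "test_fun UNIV f"
proof -
  have "{x. f x \<noteq> 0} \<subseteq> K" using assms(2) by blast
  then have "bounded {x. f x \<noteq> 0}" by (rule bounded_subset[OF compact_imp_bounded[OF assms(1)]])
  then have "compact (closure {x. f x \<noteq> 0})" unfolding compact_closure .
  then show ?thesis using assms(3) by (simp add: test_fun_def smooth_on_iff_regular)
qed

lemma test_funD:
  fixes f :: "real^'n::finite \<Rightarrow> complex"
  assumes "test_fun U f"
  shows "\<exists>K. compact K \<and> (\<forall>x. x \<notin> K \<longrightarrow> f x = 0) \<and> (\<forall>m. regular (\<lambda>_. True) m f)"
proof (intro exI conjI)
  show "compact (closure {x. f x \<noteq> 0})" using assms by (simp add: test_fun_def)
  show "\<forall>x. x \<notin> closure {x. f x \<noteq> 0} \<longrightarrow> f x = 0" using closure_subset[of "{x. f x \<noteq> 0}"] by auto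
  show "\<forall>m. regular (\<lambda>_. True) m f" using assms by (simp add: test_fun_def smooth_on_iff_regular)
qed

lemma test_fun_schwartz: 
  assumes "test_fun U f" shows "schwartz f"
proof -
  obtain K where K: "compact K" "\<And>x. x \<notin> K \<Longrightarrow> f x = 0" "\<And>m. regular (\<lambda>_. True) m f"
    using test_funD[OF assms] by blast
  then show ?thesis by (rule schwartz_of_compact_support)
qed

lemma test_fun_mult:
  assumes "test_fun UNIV f" "\<And>m. regular moderate m g"
  shows "test_fun UNIV (\<lambda>x. f x * g x)"
proof -
  obtain K where K: "compact K" "\<And>x. x \<notin> K \<Longrightarrow> f x = 0" "\<And>m. regular (\<lambda>_. True) m f" using test_funD[OF assms(1)] by blast
  show ?thesis
  proof (rule test_funI[OF K(1)])
    show "regular (\<lambda>_. True) m (\<lambda>x. f x * g x)" for m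
      by (rule regular_mult[where G="\<lambda>_. True" and ?G1.0="\<lambda>_. True" and ?G2.0=moderate]) (use K assms in auto)
  qed (use K in auto)
qed

lemma test_fun_cmult: "test_fun UNIV f \<Longrightarrow> test_fun UNIV (\<lambda>x. c * f x)"
  using test_fun_mult[OF _ regular_moderate_const, of f c] by (simp add: mult.commute)

lemma test_fun_add:
  assumes "test_fun UNIV f" "test_fun UNIV g"
  shows "test_fun UNIV (\<lambda>x. f x + g x)"
proof -
  obtain K where K: "compact K" "\<And>x. x \<notin> K \<Longrightarrow> f x = 0" "\<And>m. regular (\<lambda>_. True) m f" using test_funD[OF assms(1)] by blast
  obtain L where L: "compact L" "\<And>x. x \<notin> L \<Longrightarrow> g x = 0" "\<And>m. regular (\<lambda>_. True) m g" using test_funD[OF assms(2)] by blast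
  show ?thesis
  proof (rule test_funI[OF compact_Un[OF K(1) L(1)]])
    show "regular (\<lambda>_. True) m (\<lambda>x. f x + g x)" for m
      by (rule regular_add[where G="\<lambda>_. True"]) (use K L in auto)
  qed (use K L in auto)
qed

lemma test_fun_diff:
  assumes "test_fun UNIV f" "test_fun UNIV g"
  shows "test_fun UNIV (\<lambda>x. f x - c * g x)"
  using test_fun_add[OF assms(1) test_fun_cmult[OF assms(2), of "- c"]] by simp

section \<open>The fundamental lemma and the values of a distribution\<close>

text \<open>
  If the continuous functions differed at x0, their difference would stay within half its size of its
  value at x0 on a small ball, and a nonnegative bump supported there would detect it.\<close>

lemma fundamental_lemma:
  fixes g1 g2 :: "real^'n::finite \<Rightarrow> complex"
  assumes W: "open W" "x0 \<in> W" and g: "continuous_on W g1" "continuous_on W g2"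
    and eq: "\<And>\<phi>. test_fun W \<phi> \<Longrightarrow> (LINT x|lebesgue. g1 x * \<phi> x) = (LINT x|lebesgue. g2 x * \<phi> x)"
  shows "g1 x0 = g2 x0"
proof (rule ccontr)
  assume ne: "g1 x0 \<noteq> g2 x0"
  define d where "d x = g1 x - g2 x" for x
  have dc: "continuous_on W d" unfolding d_def using g by (intro continuous_intros)
  have d0: "d x0 \<noteq> 0" using ne by (simp add: d_def)
  obtain r1 where r1: "r1 > 0" "cball x0 r1 \<subseteq> W" using W open_contains_cball by blast
  have "continuous (at x0) d" using dc W by (simp add: continuous_on_eq_continuous_at)
  moreover have "norm (d x0) / 2 > 0" using d0 by simp
  ultimately obtain r2 where r2: "r2 > 0" "\<And>y. dist y x0 < r2 \<Longrightarrow> dist (d y) (d x0) < norm (d x0) / 2"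
    unfolding continuous_at_eps_delta by blast
  define r where "r = min r1 (r2 / 2)"
  have r: "r > 0" using r1 r2 by (simp add: r_def)
  have sub: "cball x0 r \<subseteq> W" using r1 by (auto simp: r_def)
  have close: "norm (d y - d x0) \<le> norm (d x0) / 2" if "y \<in> cball x0 r" for y
    using r2(2)[of y] that r2(1) by (auto simp: r_def dist_norm norm_minus_commute)
  let ?b = "bump 0 x0 r"
  have b0: "?b x = 0" if "x \<notin> cball x0 r" for x
    using that r bump_nonzero_iff[of x0 r x] by (auto simp: dist_norm norm_minus_commute)
  have t: "test_fun W ?b" by (rule test_fun_bump[OF r sub])
  have bc: "continuous_on UNIV ?b" using schwartz_continuous[OF test_fun_schwartz[OF t]] .
  have int: "integrable lborel (\<lambda>x. h x * ?b x)" if "continuous_on W h" for h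
  proof -
    have "continuous_on (cball x0 r) (\<lambda>x. h x * ?b x)"
      by (intro continuous_on_mult continuous_on_subset[OF that sub] continuous_on_subset[OF bc]) auto
    from borel_integrable_compact[OF compact_cball this]
    have "integrable lborel (\<lambda>x. indicator (cball x0 r) x *\<^sub>R (h x * ?b x))" .
    moreover have "(\<lambda>x. indicator (cball x0 r) x *\<^sub>R (h x * ?b x)) = (\<lambda>x. h x * ?b x)"
      using b0 by (auto simp: indicator_def fun_eq_iff)
    ultimately show ?thesis by simp
  qed
  have leb: "(LINT x|lebesgue. h x * ?b x) = (LINT x|lborel. h x * ?b x)" if "continuous_on W h" for h
    by (rule integral_completion) (use int[OF that] in auto)
  have "(LINT x|lborel. d x * ?b x) = 0"
    using eq[OF t] int[OF g(1)] int[OF g(2)] by (simp add: leb g d_def left_diff_distrib)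
  then have "(LINT x|lborel. (d x - d x0) * ?b x) = - d x0 * (LINT x|lborel. ?b x)"
    using int[OF dc] bump_integral_pos(1)[OF r, of x0] by (simp add: left_diff_distrib)
  then have "norm (d x0) * norm (LINT x|lborel. ?b x) = norm (LINT x|lborel. (d x - d x0) * ?b x)"
    by (simp add: norm_mult)
  also have "\<dots> \<le> (LINT x|lborel. norm (d x0) / 2 * norm (?b x))"
  proof (rule order_trans[OF integral_norm_bound], rule integral_mono)
    have "integrable lborel (\<lambda>x. (d x - d x0) * ?b x)" by (rule int) (intro continuous_intros dc)
    then show "integrable lborel (\<lambda>x. norm ((d x - d x0) * ?b x))" by (rule integrable_norm)
    show "integrable lborel (\<lambda>x. norm (d x0) / 2 * norm (?b x))"
      using bump_integral_pos(1)[OF r, of x0] by auto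
    show "norm ((d x - d x0) * ?b x) \<le> norm (d x0) / 2 * norm (?b x)" for x
      using mult_right_mono[OF close, of x "norm (?b x)"] b0[of x] by (cases "x \<in> cball x0 r") (simp_all add: norm_mult)
  qed
  also have "\<dots> = norm (d x0) / 2 * (LINT x|lborel. norm (?b x))" by simp
  finally have 1: "norm (d x0) * norm (LINT x|lborel. ?b x) \<le> norm (d x0) / 2 * (LINT x|lborel. norm (?b x))" .
  have "(LINT x|lborel. ?b x) = complex_of_real (LINT x|lborel. norm (?b x))"
    unfolding integral_complex_of_real[symmetric] by (rule Bochner_Integration.integral_cong) (auto simp: bump_def flat_nonneg)
  then have "norm (LINT x|lborel. ?b x) = (LINT x|lborel. norm (?b x))" by simp
  with 1 bump_integral_pos(2)[OF r, of x0] d0 show False by simp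
qed

lemma test_fun_subset: "test_fun U \<phi> \<Longrightarrow> U \<subseteq> V \<Longrightarrow> test_fun V \<phi>"
  by (auto simp: test_fun_def)

lemma smooth_on_continuous: "smooth_on U g \<Longrightarrow> continuous_on U g"
proof -
  assume "smooth_on U g"
  then have "Ck_on 0 U g" unfolding smooth_on_def by blast
  then show ?thesis by simp
qed

text \<open>
  Two local representatives near the same point agree there, so the definite description is well
  defined.\<close>

lemma distr_value_eq:
  fixes T :: "'n::finite distr"
  assumes U: "open U" "x \<in> U" "smooth_on U g" "represented_on T U g"
  shows "distr_value T x = g x"
  unfolding distr_value_def
proof (rule the_equality)
  show "\<exists>U' g'. open U' \<and> x \<in> U' \<and> smooth_on U' g' \<and> represented_on T U' g' \<and> g' x = g x" using U by blast
  fix c assume "\<exists>U g. open U \<and> x \<in> U \<and> smooth_on U g \<and> represented_on T U g \<and> g x = c"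
  then obtain U' g' where U': "open U'" "x \<in> U'" "smooth_on U' g'" "represented_on T U' g'" "g' x = c" by blast
  have c: "continuous_on U g" "continuous_on U' g'"
    using U(3) U'(3) by (auto intro: smooth_on_continuous)
  have "g' x = g x"
  proof (rule fundamental_lemma[of "U \<inter> U'"])
    fix \<phi> assume "test_fun (U \<inter> U') \<phi>"
    then have "test_fun U \<phi>" "test_fun U' \<phi>" using test_fun_subset by blast+
    then show "(LINT x|lebesgue. g' x * \<phi> x) = (LINT x|lebesgue. g x * \<phi> x)"
      using U(4) U'(4) unfolding represented_on_def by (metis (no_types))
  qed (use U U' c in \<open>auto intro: continuous_on_subset\<close>)
  then show "c = g x" using U' by simp
qed

text \<open>
  Off the origin the value is locally a smooth representative; a single exceptional point does not
  affect measurability.\<close>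

lemma distr_value_measurable:
  fixes T :: "'n::finite distr"
  assumes "sing_supp T \<subseteq> {0}"
  shows "distr_value T \<in> borel_measurable borel"
proof (rule borel_measurable_continuous_countable_exceptions[of "{0}"])
  show "continuous_on (- {0}) (distr_value T)"
  proof (rule continuous_at_imp_continuous_on, rule ballI)
    fix x :: "real^'n" assume "x \<in> - {0}"
    then have "x \<notin> sing_supp T" using assms by auto
    then obtain U g where U: "open U" "x \<in> U" "smooth_on U g" "represented_on T U g" unfolding sing_supp_def by blast
    have "continuous_on U g" using U(3) by (rule smooth_on_continuous)
    then have "continuous_on U (distr_value T)"
      by (rule continuous_on_eq) (use distr_value_eq[OF U(1) _ U(3,4)] in auto)
    then show "isCont (distr_value T) x" using U continuous_on_eq_continuous_at by blast
  qed
qed simp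

section \<open>Multi-indices and polynomials\<close>

lemma finite_msize_le: "finite {A::'n::finite \<Rightarrow> nat. msize A \<le> m}"
proof (rule finite_subset)
  show "{A::'n \<Rightarrow> nat. msize A \<le> m} \<subseteq> (\<Pi>\<^sub>E i\<in>UNIV. {..m})"
  proof
    fix A :: "'n \<Rightarrow> nat" assume "A \<in> {A. msize A \<le> m}"
    then have "A i \<le> m" for i
      using member_le_sum[of i UNIV A] by (simp add: msize_def)
    then show "A \<in> (\<Pi>\<^sub>E i\<in>UNIV. {..m})" by (simp add: PiE_UNIV_domain)
  qed
  show "finite (\<Pi>\<^sub>E i\<in>(UNIV::'n set). {..m})" by (rule finite_PiE) auto
qed

lemma finite_msize_eq: "finite {A::'n::finite \<Rightarrow> nat. msize A = m}"
  by (rule finite_subset[OF _ finite_msize_le[of m]]) auto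

lemma sum_fun_upd:
  fixes A :: "'n::finite \<Rightarrow> nat"
  shows "(\<Sum>j\<in>UNIV. (A(i := a)) j) + A i = (\<Sum>j\<in>UNIV. A j) + a"
proof -
  have "(\<Sum>j\<in>UNIV. (A(i := a)) j) = a + (\<Sum>j\<in>UNIV - {i}. A j)"
    by (subst sum.remove[of _ i]) (auto intro!: sum.cong)
  moreover have "(\<Sum>j\<in>UNIV. A j) = A i + (\<Sum>j\<in>UNIV - {i}. A j)"
    by (subst sum.remove[of _ i]) auto
  ultimately show ?thesis by simp
qed

lemma msize_Suc[simp]: "msize (A(i := Suc (A i))) = Suc (msize A)"
  using sum_fun_upd[of A i "Suc (A i)"] by (simp add: msize_def)

lemma msize_zero[simp]: "msize (\<lambda>_. 0) = 0" by (simp add: msize_def)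

lemma msize_eq_0: "msize A = 0 \<longleftrightarrow> A = (\<lambda>_. 0)"
  by (auto simp: msize_def fun_eq_iff)

lemma msize_SucE:
  assumes "msize A = Suc m"
  obtains i B where "A = B(i := Suc (B i))" "msize B = m"
proof -
  have "A \<noteq> (\<lambda>_. 0)" using assms by auto
  then obtain i where i: "A i > 0" by (auto simp: fun_eq_iff)
  define B where "B = A(i := A i - 1)"
  have "A = B(i := Suc (B i))" using i by (auto simp: B_def)
  moreover from this have "msize B = m" using assms msize_Suc[of B i] by simp
  ultimately show thesis by (rule that)
qed

lemma prod_fun_upd:
  fixes f :: "'n::finite \<Rightarrow> nat \<Rightarrow> 'b::comm_monoid_mult"
  shows "(\<Prod>j\<in>UNIV. f j ((A(i := a)) j)) = f i a * (\<Prod>j\<in>UNIV - {i}. f j (A j))"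
  by (subst prod.remove[of _ i]) (auto intro!: prod.cong)

lemma prod_remove1:
  fixes f :: "'n::finite \<Rightarrow> 'b::comm_monoid_mult"
  shows "(\<Prod>j\<in>UNIV. f j) = f i * (\<Prod>j\<in>UNIV - {i}. f j)"
  by (subst prod.remove[of _ i]) auto

text \<open>
  Induction by Euler's identity: multiplying the sum over |A| = m + 1 by m + 1 = \<Sum> A_i splits it into
  sums over i in which one factor a_i comes off each term.\<close>

lemma multinomial:
  fixes a :: "'n::finite \<Rightarrow> complex"
  shows "(\<Sum>i\<in>UNIV. a i) ^ m / fact m = (\<Sum>A | msize A = m. \<Prod>i\<in>UNIV. a i ^ A i / fact (A i))"
proof (induction m)
  case 0
  have "{A::'n \<Rightarrow> nat. msize A = 0} = {\<lambda>_. 0}" by (auto simp: msize_eq_0)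
  then show ?case by simp
next
  case (Suc m)
  define t where "t A = (\<Prod>i\<in>UNIV. a i ^ A i / fact (A i))" for A
  have t_Suc: "of_nat (Suc (B i)) * t (B(i := Suc (B i))) = a i * t B" for B i
    unfolding t_def prod_fun_upd[where f="\<lambda>j k. a j ^ k / fact k"] prod_remove1[of "\<lambda>j. a j ^ B j / fact (B j)" i]
    by (simp add: field_simps del: of_nat_Suc)
  have inner: "(\<Sum>A | msize A = Suc m. of_nat (A i) * t A) = a i * (\<Sum>B | msize B = m. t B)" for i
  proof -
    have "(\<Sum>A | msize A = Suc m. of_nat (A i) * t A) = (\<Sum>A \<in> (\<lambda>B. B(i := Suc (B i))) ` {B. msize B = m}. of_nat (A i) * t A)"
    proof (rule sum.mono_neutral_right[OF finite_msize_eq])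
      show "(\<lambda>B. B(i := Suc (B i))) ` {B. msize B = m} \<subseteq> {A. msize A = Suc m}" by auto
      show "\<forall>A\<in>{A. msize A = Suc m} - (\<lambda>B. B(i := Suc (B i))) ` {B. msize B = m}. of_nat (A i) * t A = 0"
      proof (intro ballI)
        fix A assume A: "A \<in> {A. msize A = Suc m} - (\<lambda>B. B(i := Suc (B i))) ` {B. msize B = m}"
        have "A i = 0"
        proof (rule ccontr)
          assume "A i \<noteq> 0"
          then have e: "A = (A(i := A i - 1))(i := Suc ((A(i := A i - 1)) i))" by auto
          then have "msize (A(i := A i - 1)) = m" using A msize_Suc[of "A(i := A i - 1)" i] by simp
          with e A show False by blast
        qed
        then show "of_nat (A i) * t A = 0" by simp
      qed
    qed
    also have "\<dots> = (\<Sum>B | msize B = m. of_nat (Suc (B i)) * t (B(i := Suc (B i))))"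
    proof (subst sum.reindex)
      show "inj_on (\<lambda>B. B(i := Suc (B i))) {B. msize B = m}"
      proof (rule inj_onI)
        fix B C :: "'n \<Rightarrow> nat" assume e: "B(i := Suc (B i)) = C(i := Suc (C i))"
        show "B = C"
        proof
          fix j show "B j = C j" using fun_cong[OF e, of j] by (cases "j = i") auto
        qed
      qed
    qed (simp add: o_def)
    also have "\<dots> = a i * (\<Sum>B | msize B = m. t B)" unfolding t_Suc sum_distrib_left ..
    finally show ?thesis .
  qed
  have "of_nat (Suc m) * (\<Sum>A | msize A = Suc m. t A) = (\<Sum>A | msize A = Suc m. \<Sum>i\<in>UNIV. of_nat (A i) * t A)"
    unfolding sum_distrib_left
  proof (rule sum.cong)
    fix A :: "'n \<Rightarrow> nat" assume "A \<in> {A. msize A = Suc m}"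
    then have "Suc m = (\<Sum>i\<in>UNIV. A i)" by (simp add: msize_def)
    then show "of_nat (Suc m) * t A = (\<Sum>i\<in>UNIV. of_nat (A i) * t A)"
      by (simp only: of_nat_sum sum_distrib_right)
  qed simp
  also have "\<dots> = (\<Sum>i\<in>UNIV. a i * (\<Sum>B | msize B = m. t B))"
    by (subst sum.swap) (simp only: inner)
  also have "\<dots> = (\<Sum>i\<in>UNIV. a i) * ((\<Sum>i\<in>UNIV. a i) ^ m / fact m)"
    unfolding sum_distrib_right Suc.IH t_def by (rule refl)
  finally have "(\<Sum>A | msize A = Suc m. t A) = (\<Sum>i\<in>UNIV. a i) ^ Suc m / fact (Suc m)"
    by (simp add: field_simps del: of_nat_Suc)
  then show ?case unfolding t_def ..
qed

definition mpow :: "('n::finite \<Rightarrow> complex) \<Rightarrow> ('n \<Rightarrow> nat) \<Rightarrow> complex" where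
  "mpow a A = (\<Prod>i\<in>UNIV. a i ^ A i)"

lemma mpow_Suc: "mpow a (A(i := Suc (A i))) = a i * mpow a A"
  unfolding mpow_def prod_fun_upd[where f="\<lambda>j k. a j ^ k"] prod_remove1[of "\<lambda>j. a j ^ A j" i] by (simp add: mult.assoc)

lemma mpow_zero[simp]: "mpow a (\<lambda>_. 0) = 1" by (simp add: mpow_def)

lemma mpow_mult: "mpow (\<lambda>i. a i * b i) A = mpow a A * mpow b A"
  by (simp add: mpow_def power_mult_distrib prod.distrib)

lemma multinomial_mpow:
  "(\<Sum>i\<in>UNIV. a i) ^ m / fact m = (\<Sum>A | msize A = m. mpow a A / of_nat (mfact A))"
  unfolding multinomial by (rule sum.cong) (simp_all add: mpow_def mfact_def prod_dividef)

abbreviation coord :: "real^'n::finite \<Rightarrow> 'n \<Rightarrow> complex" where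
  "coord z \<equiv> (\<lambda>i. complex_of_real (z $ i))"

inductive polyn :: "nat \<Rightarrow> (real^'n::finite \<Rightarrow> complex) \<Rightarrow> bool" where
  polyn_const: "polyn m (\<lambda>z. c)"
| polyn_add: "polyn m p \<Longrightarrow> polyn m q \<Longrightarrow> polyn m (\<lambda>z. p z + q z)"
| polyn_coord: "polyn m q \<Longrightarrow> polyn (Suc m) (\<lambda>z. complex_of_real (z $ i) * q z)"

lemma polyn_cmult: "polyn m p \<Longrightarrow> polyn m (\<lambda>z. c * p z)"
proof (induction rule: polyn.induct)
  case (polyn_const m d) then show ?case by (rule polyn.polyn_const)
next
  case (polyn_add m p q) then show ?case using polyn.polyn_add by (simp add: distrib_left)
next
  case (polyn_coord m q i) 
  from polyn.polyn_coord[OF polyn_coord.IH, of i] show ?case by (simp add: mult.left_commute)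
qed

lemma polyn_Suc: "polyn m p \<Longrightarrow> polyn (Suc m) p"
  by (induction rule: polyn.induct) (auto intro: polyn.intros)

lemma polyn_sum: "finite I \<Longrightarrow> (\<And>i. i \<in> I \<Longrightarrow> polyn m (p i)) \<Longrightarrow> polyn m (\<lambda>z. \<Sum>i\<in>I. p i z)"
  by (induction rule: finite_induct) (auto intro: polyn_const polyn_add)

lemma polyn_mpow: "msize A \<le> m \<Longrightarrow> polyn m (\<lambda>z. mpow (coord z) A)"
proof (induction m arbitrary: A)
  case 0
  then have "A = (\<lambda>_. 0)" using msize_eq_0 by auto
  then show ?case by (simp add: polyn_const)
next
  case (Suc m)
  show ?case
  proof (cases "msize A = Suc m")
    case True
    then obtain i B where A: "A = B(i := Suc (B i))" and B: "msize B = m" by (rule msize_SucE)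
    show ?thesis unfolding A mpow_Suc by (rule polyn_coord, rule Suc.IH) (simp add: B)
  next
    case False
    then show ?thesis using Suc by (intro polyn_Suc Suc.IH) simp
  qed
qed

lemma polyn_translate: "polyn m p \<Longrightarrow> polyn m (\<lambda>z. p (x + z))"
proof (induction rule: polyn.induct)
  case (polyn_coord m q i)
  have "polyn (Suc m) (\<lambda>z. complex_of_real (x $ i) * q (x + z) + complex_of_real (z $ i) * q (x + z))"
    by (intro polyn.polyn_add polyn.polyn_coord polyn_coord.IH polyn_Suc polyn_cmult)
  then show ?case by (simp add: distrib_right)
qed (auto intro: polyn.intros)

text \<open>
  The leading monomial cancels, which lowers the degree by one.\<close>

lemma polyn_translate_diff:
  "msize A = Suc m \<Longrightarrow> polyn m (\<lambda>z. mpow (coord (x + z)) A - mpow (coord z) A)"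
proof (induction m arbitrary: A)
  case 0
  then obtain i B where A: "A = B(i := Suc (B i))" and "msize B = 0" by (rule msize_SucE)
  then have B: "B = (\<lambda>_. 0)" by (simp add: msize_eq_0)
  have "(\<lambda>z. mpow (coord (x + z)) A - mpow (coord z) A) = (\<lambda>z. complex_of_real (x $ i))"
    unfolding A mpow_Suc unfolding B by (simp add: fun_eq_iff)
  then show ?case by (simp add: polyn_const)
next
  case (Suc m)
  from Suc.prems obtain i B where A: "A = B(i := Suc (B i))" and B: "msize B = Suc m" by (rule msize_SucE)
  have "polyn (Suc m) (\<lambda>z. complex_of_real (x $ i) * mpow (coord (x + z)) B
      + complex_of_real (z $ i) * (mpow (coord (x + z)) B - mpow (coord z) B))"
    by (intro polyn_add polyn_coord polyn_cmult polyn_translate[OF polyn_mpow] Suc.IH) (simp_all add: B)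
  then show ?case unfolding A mpow_Suc by (simp add: algebra_simps)
qed

lemma norm_mpow_le:
  assumes "\<And>i. norm (a i) \<le> r" shows "norm (mpow a A) \<le> r ^ msize A"
proof -
  have "norm (mpow a A) = (\<Prod>i\<in>UNIV. norm (a i) ^ A i)"
    by (simp add: mpow_def prod_norm[symmetric] norm_power)
  also have "\<dots> \<le> (\<Prod>i\<in>UNIV. r ^ A i)" by (intro prod_mono conjI power_mono assms) auto
  finally show ?thesis by (simp add: power_sum[symmetric] msize_def)
qed

lemma mpow_measurable[measurable]: 
  assumes "\<And>i. (\<lambda>x. a x i) \<in> borel_measurable M"
  shows "(\<lambda>x. mpow (a x) A) \<in> borel_measurable M"
  unfolding mpow_def using assms by measurable

lemma coord_measurable[measurable]: "(\<lambda>x::real^'n::finite. complex_of_real (x $ i)) \<in> borel_measurable borel"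
  by measurable

lemma moderate_mpow_coord: "moderate (\<lambda>p. mpow (\<lambda>i. c * complex_of_real (p $ i)) A)"
proof (rule moderateI)
  show "norm (mpow (\<lambda>i. c * complex_of_real (p $ i)) A) \<le> (norm c) ^ msize A * (1 + norm p) ^ msize A" for p
    unfolding power_mult_distrib[symmetric]
    by (rule norm_mpow_le) (auto simp: norm_mult intro!: mult_left_mono order_trans[OF component_le_norm_cart])
qed

text \<open>
  Iterated derivatives of a family indexed by multi-indices follow from single derivatives as soon as
  each of these shifts the index. All higher derivatives below are computed in this way, so that their
  order never has to be discussed.\<close>

lemma mderiv_family:
  fixes F :: "('n::finite \<Rightarrow> nat) \<Rightarrow> real^'n \<Rightarrow> 'b::real_normed_vector"
  assumes "\<And>C i. partial i (F C) = F (C(i := Suc (C i)))"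
  shows "mderiv A (F C) = F (\<lambda>i. C i + A i)"
proof -
  have pow: "(partial i ^^ k) (F C) = F (C(i := C i + k))" for i k C
  proof (induction k)
    case (Suc k)
    have e: "(C(i := C i + k))(i := Suc ((C(i := C i + k)) i)) = C(i := C i + Suc k)" by auto
    show ?case using assms[of i "C(i := C i + k)"] unfolding e funpow.simps o_apply Suc.IH .
  qed simp
  have "fold (\<lambda>i. (partial i) ^^ (A i)) is (F C) = F (\<lambda>i. if i \<in> set is then C i + A i else C i)" if "distinct is" for "is" C
    using that
  proof (induction "is" arbitrary: C)
    case (Cons j js)
    have "(\<lambda>i. if i \<in> set js then (C(j := C j + A j)) i + A i else (C(j := C j + A j)) i) =
      (\<lambda>i. if i \<in> set (j # js) then C i + A i else C i)" using Cons.prems by (auto simp: fun_eq_iff)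
    then show ?case using Cons by (simp add: pow)
  qed simp
  from this[OF coords(1)] show ?thesis by (simp add: mderiv_def coords(2))
qed

lemma mderiv_family0:
  assumes "\<And>C i. partial i (F C) = F (C(i := Suc (C i)))"
  shows "mderiv A (F (\<lambda>_. 0)) = F A"
  using mderiv_family[OF assms, of A "\<lambda>_. 0"] by simp

section \<open>A functional vanishing on a common kernel is a combination\<close>

text \<open>
  The linear algebra fact that a functional vanishing on the common kernel of finitely many functionals
  is a combination of them, by induction on their number: a vector v that is killed by all functionals
  in I but not by L fixes the coefficient of the new functional.\<close>

lemma functional_in_span:
  fixes X :: "('a \<Rightarrow> complex) set"
  assumes sub: "\<And>\<phi> \<psi> c. \<phi> \<in> X \<Longrightarrow> \<psi> \<in> X \<Longrightarrow> (\<lambda>x. \<phi> x - c * \<psi> x) \<in> X"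
    and fin: "finite I"
    and l: "\<And>i \<phi> \<psi> c. \<phi> \<in> X \<Longrightarrow> \<psi> \<in> X \<Longrightarrow> l i (\<lambda>x. \<phi> x - c * \<psi> x) = l i \<phi> - c * (l i \<psi> :: complex)"
    and L: "\<And>\<phi> \<psi> c. \<phi> \<in> X \<Longrightarrow> \<psi> \<in> X \<Longrightarrow> L (\<lambda>x. \<phi> x - c * \<psi> x) = L \<phi> - c * (L \<psi> :: complex)"
    and ker: "\<And>\<phi>. \<phi> \<in> X \<Longrightarrow> (\<And>i. i \<in> I \<Longrightarrow> l i \<phi> = 0) \<Longrightarrow> L \<phi> = 0"
  shows "\<exists>c. \<forall>\<phi>\<in>X. L \<phi> = (\<Sum>i\<in>I. c i * l i \<phi>)"
  using fin L ker
proof (induction I arbitrary: L rule: finite_induct)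
  case empty
  then show ?case by auto
next
  case (insert a I)
  show ?case
  proof (cases "\<forall>\<phi>\<in>X. (\<forall>i\<in>I. l i \<phi> = 0) \<longrightarrow> L \<phi> = 0")
    case True
    then have "\<exists>c. \<forall>\<phi>\<in>X. L \<phi> = (\<Sum>i\<in>I. c i * l i \<phi>)"
      using insert.IH[of L] insert.prems(1) by blast
    then obtain c where c: "\<forall>\<phi>\<in>X. L \<phi> = (\<Sum>i\<in>I. c i * l i \<phi>)" by blast
    have "\<forall>\<phi>\<in>X. L \<phi> = (\<Sum>i\<in>insert a I. (c(a := 0)) i * l i \<phi>)"
    proof
      fix \<phi> assume "\<phi> \<in> X"
      have "(\<Sum>i\<in>I. (c(a := 0)) i * l i \<phi>) = (\<Sum>i\<in>I. c i * l i \<phi>)"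
        by (rule sum.cong) (use insert.hyps in auto)
      then show "L \<phi> = (\<Sum>i\<in>insert a I. (c(a := 0)) i * l i \<phi>)" using c \<open>\<phi> \<in> X\<close> insert.hyps by simp
    qed
    then show ?thesis by blast
  next
    case False
    then obtain v where v: "v \<in> X" "\<And>i. i \<in> I \<Longrightarrow> l i v = 0" "L v \<noteq> 0" by blast
    have av: "l a v \<noteq> 0" using insert.prems(2)[OF v(1)] v(2,3) by auto
    define \<alpha> where "\<alpha> = L v / l a v"
    have "\<exists>c. \<forall>\<phi>\<in>X. L \<phi> - \<alpha> * l a \<phi> = (\<Sum>i\<in>I. c i * l i \<phi>)"
    proof (rule insert.IH)
      show "L (\<lambda>x. \<phi> x - c * \<psi> x) - \<alpha> * l a (\<lambda>x. \<phi> x - c * \<psi> x) = L \<phi> - \<alpha> * l a \<phi> - c * (L \<psi> - \<alpha> * l a \<psi>)"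
        if "\<phi> \<in> X" "\<psi> \<in> X" for \<phi> \<psi> c
        using that by (simp add: l insert.prems(1) algebra_simps)
      show "L \<phi> - \<alpha> * l a \<phi> = 0" if p: "\<phi> \<in> X" "\<And>i. i \<in> I \<Longrightarrow> l i \<phi> = 0" for \<phi>
      proof -
        let ?\<psi> = "\<lambda>x. \<phi> x - (l a \<phi> / l a v) * v x"
        have "L ?\<psi> = 0"
        proof (rule insert.prems(2))
          show "?\<psi> \<in> X" by (rule sub[OF p(1) v(1)])
          show "l i ?\<psi> = 0" if "i \<in> insert a I" for i
            using that p(2) v(2) av unfolding l[OF p(1) v(1)] by auto
        qed
        then show ?thesis using av unfolding insert.prems(1)[OF p(1) v(1)] by (simp add: \<alpha>_def field_simps)
      qed
    qed
    then obtain c where c: "\<forall>\<phi>\<in>X. L \<phi> - \<alpha> * l a \<phi> = (\<Sum>i\<in>I. c i * l i \<phi>)" by blast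
    have "\<forall>\<phi>\<in>X. L \<phi> = (\<Sum>i\<in>insert a I. (c(a := \<alpha>)) i * l i \<phi>)"
    proof
      fix \<phi> assume "\<phi> \<in> X"
      have "(\<Sum>i\<in>I. (c(a := \<alpha>)) i * l i \<phi>) = (\<Sum>i\<in>I. c i * l i \<phi>)"
        by (rule sum.cong) (use insert.hyps in auto)
      then show "L \<phi> = (\<Sum>i\<in>insert a I. (c(a := \<alpha>)) i * l i \<phi>)"
        using c \<open>\<phi> \<in> X\<close> insert.hyps by (simp add: algebra_simps)
    qed
    then show ?thesis by blast
  qed
qed

section \<open>Derivatives of inverse Fourier transforms\<close>

lemma decay_mpow_mult: "decay g \<Longrightarrow> decay (\<lambda>p. mpow (\<lambda>i. c * complex_of_real (p $ i)) A * g p)"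
  using decay_moderate_mult[OF _ moderate_mpow_coord] by (simp add: mult.commute)

lemma mderiv_ifourier:
  fixes g :: "real^'n::finite \<Rightarrow> complex"
  assumes g[measurable]: "g \<in> borel_measurable borel" and d: "decay g"
  shows "mderiv A (ifourier g) k = (LINT p|lborel. chi k p * (mpow (\<lambda>i. 2 * pi * \<i> * complex_of_real (p $ i)) A * g p))"
proof -
  let ?h = "\<lambda>A p. mpow (\<lambda>i. 2 * pi * \<i> * complex_of_real (p $ i)) A * g p"
  have hm[measurable]: "?h A \<in> borel_measurable borel" for A by measurable
  have hd: "decay (?h A)" for A using decay_mpow_mult[OF d, of "2 * pi * \<i>"] by simp
  have p: "partial i (ifourier (?h A)) = ifourier (?h (A(i := Suc (A i))))" for i A
  proof
    fix x
    have "(ifourier (?h A) has_derivative (\<lambda>v. LINT p|lborel. chi (- (- x)) p * (- 2 * pi * \<i> * complex_of_real (- v \<bullet> p)) * ?h A p)) (at x)"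
      unfolding ifourier_def[abs_def]
      by (rule has_derivative_compose[OF has_derivative_minus[OF has_derivative_ident] fourier_has_derivative[OF hm hd]])
    from partial_eqI[OF this] show "partial i (ifourier (?h A)) x = ifourier (?h (A(i := Suc (A i)))) x"
      by (subst ifourier_lborel[OF hm]) (auto simp: mpow_Suc inner_axis' mult_ac intro!: Bochner_Integration.integral_cong)
  qed
  have "ifourier g = ifourier (?h (\<lambda>_. 0))" by simp
  then have "mderiv A (ifourier g) k = ifourier (?h A) k"
    using mderiv_family0[where F="\<lambda>A. ifourier (?h A)", OF p] by simp
  also have "\<dots> = (LINT p|lborel. chi k p * ?h A p)" by (rule ifourier_lborel[OF hm])
  finally show ?thesis .
qed

section \<open>Removing the low-frequency Taylor polynomial\<close>

definition phase :: "real^'n::finite \<Rightarrow> real^'n \<Rightarrow> complex" where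
  "phase k p = 2 * pi * \<i> * complex_of_real (k \<bullet> p)"

lemma chi_phase: "chi k p = exp (phase k p)"
  by (simp add: chi_def phase_def)

lemma phase_add: "phase k (x + z) = phase k x + phase k z"
  by (simp add: phase_def inner_add_right distrib_left)

lemma norm_phase_le: "norm (phase k p) \<le> 2 * pi * (norm k * norm p)"
  by (simp add: phase_def norm_mult Cauchy_Schwarz_ineq2)

lemma phase_sum: "phase k p = (\<Sum>i\<in>UNIV. (2 * pi * \<i> * complex_of_real (p $ i)) * complex_of_real (k $ i))"
  by (simp add: phase_def inner_vec_def sum_distrib_left mult_ac)

lemma phase_power:
  "phase k p ^ m / fact m = (\<Sum>A | msize A = m. mpow (\<lambda>i. 2 * pi * \<i> * complex_of_real (p $ i)) A * mpow (coord k) A / of_nat (mfact A))"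
  unfolding phase_sum multinomial_mpow mpow_mult ..

lemma phase_commute: "phase k p = phase p k" by (simp add: phase_def inner_commute)

lemma phase_measurable[measurable]: "case_prod phase \<in> borel_measurable (borel \<Otimes>\<^sub>M borel)"
  unfolding phase_def[abs_def] by measurable

lemma chi_taylor:
  "norm (chi k p - (\<Sum>j\<le>m. phase k p ^ j / fact j)) \<le> (2 * pi * (norm k * norm p)) ^ Suc m"
proof -
  let ?x = "2 * pi * (k \<bullet> p)"
  have e: "phase k p = \<i> * complex_of_real ?x" by (simp add: phase_def)
  have "norm (chi k p - (\<Sum>j\<le>m. phase k p ^ j / fact j)) \<le> \<bar>?x\<bar> ^ Suc m / fact (Suc m)"
    unfolding chi_phase e by (rule iexp_approx1)
  also have "\<dots> \<le> \<bar>?x\<bar> ^ Suc m / 1"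
    by (rule divide_left_mono) (auto intro: fact_ge_1 simp del: fact_Suc)
  also have "\<dots> \<le> (2 * pi * (norm k * norm p)) ^ Suc m"
    unfolding div_by_1 by (rule power_mono) (auto simp: abs_mult Cauchy_Schwarz_ineq2)
  finally show ?thesis .
qed

lemma exp_taylor_add:
  fixes s t :: complex
  shows "(\<Sum>m\<le>K. (s + t) ^ m / fact m) = (\<Sum>j\<le>K. t ^ j / fact j * (\<Sum>i\<le>K - j. s ^ i / fact i))"
proof -
  have sR: "x ^ m /\<^sub>R fact m = x ^ m / fact m" for x :: complex and m
    by (simp add: scaleR_conv_of_real divide_inverse)
  have "(\<Sum>m\<le>K. (s + t) ^ m / fact m) = (\<Sum>m\<le>K. \<Sum>j\<le>m. t ^ j / fact j * (s ^ (m - j) / fact (m - j)))"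
    by (rule sum.cong[OF refl]) (use exp_series_add_commuting[of t s] in \<open>simp only: sR add.commute mult.commute\<close>)
  also have "\<dots> = (\<Sum>(j, i)\<in>{(j, i). j + i \<le> K}. t ^ j / fact j * (s ^ i / fact i))"
    by (rule sum.triangle_reindex_eq[symmetric])
  also have "{(j, i). j + i \<le> K} = Sigma {..K} (\<lambda>j. {..K - j})" by auto
  also have "(\<Sum>(j, i)\<in>Sigma {..K} (\<lambda>j. {..K - j}). t ^ j / fact j * (s ^ i / fact i)) =
      (\<Sum>j\<le>K. t ^ j / fact j * (\<Sum>i\<le>K - j. s ^ i / fact i))"
    by (subst sum.Sigma[symmetric]) (auto simp: sum_distrib_left)
  finally show ?thesis .
qed

text \<open>
  The oscillation with its low-frequency Taylor polynomial removed. It vanishes at k = 0 to order m + 1,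
  which compensates the singularity of the transform at the origin.\<close>

definition chi_tail :: "nat \<Rightarrow> real^'n::finite \<Rightarrow> real^'n \<Rightarrow> complex" where
  "chi_tail m k p = chi k p - (if norm k \<le> 1 then \<Sum>j\<le>m. phase k p ^ j / fact j else 0)"

lemma chi_tail_measurable[measurable]: "case_prod (chi_tail m) \<in> borel_measurable (borel \<Otimes>\<^sub>M borel)"
  unfolding chi_tail_def[abs_def] by measurable

text \<open>
  Expanding around x instead of 0 produces Taylor terms of exp (2 \<pi> i k z) whose coefficients are again
  tails; what is left over is the Taylor remainder in z and one monomial of degree N + 1 in z.\<close>

lemma chi_tail_taylor:
  "chi_tail (Suc N) k (x + z) - (\<Sum>j\<le>N. phase k z ^ j / fact j * chi_tail (Suc N - j) k x) =
     chi k x * (chi k z - (\<Sum>j\<le>N. phase k z ^ j / fact j)) -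
     (if norm k \<le> 1 then phase k z ^ Suc N / fact (Suc N) else 0)"
proof (cases "norm k \<le> 1")
  case True
  let ?t = "\<lambda>j. phase k z ^ j / fact j" and ?s = "\<lambda>m. \<Sum>i\<le>m. phase k x ^ i / fact i"
  (* the binomial theorem, sorted by powers of the phase of z; only the power N + 1 has no partner *)
  have "(\<Sum>m\<le>Suc N. phase k (x + z) ^ m / fact m) = (\<Sum>j\<le>N. ?t j * ?s (Suc N - j)) + ?t (Suc N)"
    unfolding phase_add exp_taylor_add[where K="Suc N"] by simp
  moreover have "(\<Sum>j\<le>N. ?t j * chi_tail (Suc N - j) k x) = chi k x * (\<Sum>j\<le>N. ?t j) - (\<Sum>j\<le>N. ?t j * ?s (Suc N - j))"
    using True by (simp add: chi_tail_def right_diff_distrib sum_subtractf sum_distrib_left mult.commute)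
  ultimately show ?thesis using True
    by (simp only: chi_tail_def if_True chi_add_right) (simp add: algebra_simps)
next
  case False
  then show ?thesis by (simp add: chi_tail_def chi_add_right right_diff_distrib sum_distrib_left mult.commute)
qed

lemma sum_msize_le:
  "(\<Sum>A | msize (A::'n::finite \<Rightarrow> nat) \<le> N. h A) = (\<Sum>j\<le>N. \<Sum>A | msize A = j. h A)"
proof -
  have "(\<Sum>A | msize A \<le> N. h A) = (\<Sum>j\<in>{..N}. sum h {A \<in> {A. msize A \<le> N}. msize A = j})"
    by (rule sum.group[symmetric]) (auto intro: finite_msize_le)
  also have "\<dots> = (\<Sum>j\<le>N. \<Sum>A | msize A = j. h A)"
    by (rule sum.cong[OF refl], rule sum.cong) auto
  finally show ?thesis .
qed

lemma mpow_const: "mpow (\<lambda>i. c) A = c ^ msize A"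
  by (simp add: mpow_def power_sum msize_def)

context
  fixes tv :: "real^'n::finite \<Rightarrow> complex" and N :: nat and C0 :: real
  assumes tv_meas[measurable]: "tv \<in> borel_measurable borel"
    and C0: "C0 \<ge> 0"
    and low: "\<And>k. norm (tv k) * norm k ^ Suc N \<le> C0 * weight k"
    and high: "\<And>k. norm k > 1 \<Longrightarrow> norm (tv k) \<le> C0 * weight k"
begin

definition regular_part :: "real^'n \<Rightarrow> complex" where
  "regular_part p = (LINT k|lborel. tv k * chi_tail (Suc N) k p)"

lemma chi_tail_bound:
  assumes "j \<le> N"
  shows "norm (tv k) * norm k ^ j * norm (chi_tail (Suc N - j) k p) \<le> C0 * weight k * (2 * pi * (1 + norm p)) ^ Suc (Suc N)"
proof -
  have pi1: "1 \<le> 2 * pi * (1 + norm p)"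
  proof -
    have "1 * 1 \<le> (2 * pi) * (1 + norm p)" using pi_gt3 by (intro mult_mono) auto
    then show ?thesis by simp
  qed
  have W: "0 \<le> C0 * weight k" using C0 weight_pos[of k] by simp
  show ?thesis
  proof (cases "norm k \<le> 1")
    case True
    define m where "m = Suc N - j"
    have m: "j + Suc m = Suc (Suc N)" "Suc m \<le> Suc (Suc N)" using assms by (auto simp: m_def)
    have "norm (tv k) * norm k ^ j * norm (chi_tail m k p) \<le> norm (tv k) * norm k ^ j * (2 * pi * (norm k * norm p)) ^ Suc m"
      using chi_taylor[of k p m] True by (intro mult_left_mono) (auto simp: chi_tail_def)
    also have "\<dots> = (norm (tv k) * norm k ^ Suc N) * norm k * (2 * pi * norm p) ^ Suc m"
    proof -
      have "norm k ^ j * norm k ^ Suc m = norm k ^ Suc N * norm k" unfolding power_add[symmetric] m(1) by simp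
      then have "norm (tv k) * (norm k ^ j * norm k ^ Suc m) * (2 * pi * norm p) ^ Suc m = norm (tv k) * (norm k ^ Suc N * norm k) * (2 * pi * norm p) ^ Suc m" by simp
      then show ?thesis by (simp only: power_mult_distrib mult_ac)
    qed
    also have "\<dots> \<le> (C0 * weight k) * 1 * (2 * pi * (1 + norm p)) ^ Suc m"
      using True W by (intro mult_mono low power_mono mult_left_mono) (auto simp: mult_nonneg_nonneg)
    also have "\<dots> \<le> (C0 * weight k) * 1 * (2 * pi * (1 + norm p)) ^ Suc (Suc N)"
      using pi1 m(2) W by (intro mult_left_mono power_increasing) auto
    finally show ?thesis by (simp add: m_def)
  next
    case False
    then have "norm (chi_tail (Suc N - j) k p) = 1" by (simp add: chi_tail_def)
    moreover have "norm (tv k) * norm k ^ j \<le> norm (tv k) * norm k ^ Suc N"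
      using False assms by (intro mult_left_mono power_increasing) auto
    moreover have "C0 * weight k * 1 \<le> C0 * weight k * (2 * pi * (1 + norm p)) ^ Suc (Suc N)"
      using pi1 W by (intro mult_left_mono one_le_power) auto
    ultimately show ?thesis using low[of k] by simp
  qed
qed

lemma tv_chi_tail_bound: "norm (tv k * chi_tail (Suc N) k p) \<le> C0 * weight k * (2 * pi * (1 + norm p)) ^ Suc (Suc N)"
  using chi_tail_bound[of 0 k p] by (simp add: norm_mult)

lemma tv_chi_tail_integrable: "integrable lborel (\<lambda>k. tv k * chi_tail (Suc N) k p)"
proof (rule integrable_of_weight_bound)
  show "norm (tv k * chi_tail (Suc N) k p) \<le> (C0 * (2 * pi * (1 + norm p)) ^ Suc (Suc N)) * weight k" for k
    using tv_chi_tail_bound[of k p] by (simp only: mult_ac)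
qed measurable

lemma regular_part_measurable[measurable]: "regular_part \<in> borel_measurable borel"
  unfolding regular_part_def[abs_def] by measurable

lemma regular_part_moderate: "moderate regular_part"
proof (rule moderateI)
  show "norm (regular_part p) \<le> ((LINT k|lborel. C0 * weight (k::real^'n)) * (2 * pi) ^ Suc (Suc N)) * (1 + norm p) ^ Suc (Suc N)" for p
  proof -
    have "norm (regular_part p) \<le> (LINT k|lborel. C0 * weight (k::real^'n) * (2 * pi * (1 + norm p)) ^ Suc (Suc N))"
      unfolding regular_part_def
    proof (rule order_trans[OF integral_norm_bound], rule integral_mono)
      show "integrable lborel (\<lambda>k. norm (tv k * chi_tail (Suc N) k p))" using tv_chi_tail_integrable by (rule integrable_norm)
      show "integrable lborel (\<lambda>k::real^'n. C0 * weight k * (2 * pi * (1 + norm p)) ^ Suc (Suc N))"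
        by (intro integrable_mult_left integrable_mult_right integrable_weight)
    qed (rule tv_chi_tail_bound)
    then show ?thesis unfolding integral_mult_left_zero by (simp only: power_mult_distrib mult.assoc)
  qed
qed

text \<open>
  The Taylor polynomial at x has the tails of the oscillation as coefficients, so its integrals converge
  although those of the plain oscillation need not. The bound is independent of x because the remainder
  in chi_tail_taylor depends on x only through a factor of modulus one.\<close>

lemma regular_part_taylor:
  "\<exists>C. \<forall>x. \<exists>Q. polyn N Q \<and> (\<forall>z. norm (regular_part (x + z) - Q z) \<le> C * norm z ^ Suc N)"
proof (intro exI allI conjI)
  fix x :: "real^'n"
  (* coefficient of the monomial z^A in the integrand, from the multinomial expansion of the phase *)
  define c where "c A k = tv k * (mpow (\<lambda>i. 2 * pi * \<i> * complex_of_real (k $ i)) A / of_nat (mfact A)) * chi_tail (Suc N - msize A) k x" for A k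
  define Q where "Q z = (\<Sum>A | msize A \<le> N. (LINT k|lborel. c A k) * mpow (coord z) A)" for z
  have ci: "integrable lborel (c A)" if "msize A \<le> N" for A
  proof (rule integrable_of_weight_bound)
    show "norm (c A k) \<le> ((2 * pi) ^ msize A * (C0 * (2 * pi * (1 + norm x)) ^ Suc (Suc N))) * weight k" for k
    proof -
      have "norm (mpow (\<lambda>i. 2 * pi * \<i> * complex_of_real (k $ i)) A) \<le> (2 * pi * norm k) ^ msize A"
        by (rule norm_mpow_le) (auto simp: norm_mult component_le_norm_cart)
      moreover have "mfact A \<ge> 1" by (simp add: mfact_def Suc_le_eq prod_pos)
      ultimately have "norm (mpow (\<lambda>i. 2 * pi * \<i> * complex_of_real (k $ i)) A / of_nat (mfact A)) \<le> (2 * pi * norm k) ^ msize A / 1"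
        unfolding norm_divide by (intro frac_le) auto
      then have "norm (c A k) \<le> norm (tv k) * ((2 * pi) ^ msize A * norm k ^ msize A) * norm (chi_tail (Suc N - msize A) k x)"
        unfolding c_def norm_mult by (intro mult_right_mono mult_left_mono) (auto simp: power_mult_distrib)
      also have "\<dots> = (2 * pi) ^ msize A * (norm (tv k) * norm k ^ msize A * norm (chi_tail (Suc N - msize A) k x))" by simp
      also have "\<dots> \<le> (2 * pi) ^ msize A * (C0 * weight k * (2 * pi * (1 + norm x)) ^ Suc (Suc N))"
        by (intro mult_left_mono chi_tail_bound that) simp
      finally show ?thesis by (simp only: mult_ac)
    qed
    show "c A \<in> borel_measurable borel" unfolding c_def[abs_def] by measurable
  qed
  show "polyn N Q"
    unfolding Q_def[abs_def] by (intro polyn_sum finite_msize_le polyn_cmult polyn_mpow) simp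
  fix z :: "real^'n"
  have Qz: "Q z = (LINT k|lborel. tv k * (\<Sum>j\<le>N. phase k z ^ j / fact j * chi_tail (Suc N - j) k x))"
    and Qi: "integrable lborel (\<lambda>k. tv k * (\<Sum>j\<le>N. phase k z ^ j / fact j * chi_tail (Suc N - j) k x))"
  proof -
    have e: "(\<Sum>A | msize A \<le> N. c A k * mpow (coord z) A) = tv k * (\<Sum>j\<le>N. phase k z ^ j / fact j * chi_tail (Suc N - j) k x)" for k
      unfolding sum_msize_le phase_commute[of k z] phase_power sum_distrib_left sum_distrib_right c_def
      by (intro sum.cong refl) (simp add: mult_ac)
    have i: "integrable lborel (\<lambda>k. \<Sum>A | msize A \<le> N. c A k * mpow (coord z) A)"
      by (intro Bochner_Integration.integrable_sum integrable_mult_left ci) simp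
    show "integrable lborel (\<lambda>k. tv k * (\<Sum>j\<le>N. phase k z ^ j / fact j * chi_tail (Suc N - j) k x))"
      using i unfolding e .
    have "Q z = (\<Sum>A | msize A \<le> N. LINT k|lborel. c A k * mpow (coord z) A)" unfolding Q_def by simp
    also have "\<dots> = (LINT k|lborel. (\<Sum>A | msize A \<le> N. c A k * mpow (coord z) A))"
      by (rule Bochner_Integration.integral_sum[symmetric]) (intro integrable_mult_left ci, simp)
    finally show "Q z = (LINT k|lborel. tv k * (\<Sum>j\<le>N. phase k z ^ j / fact j * chi_tail (Suc N - j) k x))"
      unfolding e .
  qed
  let ?d = "\<lambda>k. tv k * (chi_tail (Suc N) k (x + z) - (\<Sum>j\<le>N. phase k z ^ j / fact j * chi_tail (Suc N - j) k x))"
  have di: "integrable lborel ?d" unfolding right_diff_distrib by (intro Bochner_Integration.integrable_diff tv_chi_tail_integrable Qi)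
  have "regular_part (x + z) - Q z = (LINT k|lborel. ?d k)"
    unfolding right_diff_distrib Qz regular_part_def
    by (rule Bochner_Integration.integral_diff[symmetric]) (rule tv_chi_tail_integrable Qi)+
  also have "norm \<dots> \<le> (LINT k|lborel. C0 * weight (k::real^'n) * (2 * (2 * pi * norm z) ^ Suc N))"
  proof (rule order_trans[OF integral_norm_bound], rule integral_mono)
    show "integrable lborel (\<lambda>k. norm (?d k))" by (rule integrable_norm[OF di])
    show "integrable lborel (\<lambda>k::real^'n. C0 * weight k * (2 * (2 * pi * norm z) ^ Suc N))"
      by (intro integrable_mult_left integrable_mult_right integrable_weight)
    fix k :: "real^'n"
    have t: "norm (phase k z ^ Suc N / fact (Suc N)) \<le> (2 * pi * (norm k * norm z)) ^ Suc N"
    proof -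
      have "norm (phase k z ^ Suc N / fact (Suc N)) \<le> norm (phase k z) ^ Suc N / 1"
        unfolding norm_divide norm_power norm_fact by (rule divide_left_mono) (auto intro: fact_ge_1 simp del: fact_Suc)
      also have "\<dots> \<le> (2 * pi * (norm k * norm z)) ^ Suc N" unfolding div_by_1 by (rule power_mono[OF norm_phase_le]) simp
      finally show ?thesis .
    qed
    have "norm (chi_tail (Suc N) k (x + z) - (\<Sum>j\<le>N. phase k z ^ j / fact j * chi_tail (Suc N - j) k x))
      \<le> norm (chi k x * (chi k z - (\<Sum>j\<le>N. phase k z ^ j / fact j))) + norm (phase k z ^ Suc N / fact (Suc N))"
      unfolding chi_tail_taylor by (rule order_trans[OF norm_triangle_ineq4]) simp
    also have "\<dots> \<le> 2 * (2 * pi * (norm k * norm z)) ^ Suc N"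
      using chi_taylor[of k z N] t unfolding norm_mult norm_chi by linarith
    finally have "norm (?d k) \<le> norm (tv k) * (2 * (2 * pi * (norm k * norm z)) ^ Suc N)"
      unfolding norm_mult by (rule mult_left_mono) simp
    also have "\<dots> = (norm (tv k) * norm k ^ Suc N) * (2 * (2 * pi * norm z) ^ Suc N)"
      by (simp only: power_mult_distrib mult_ac)
    also have "\<dots> \<le> C0 * weight k * (2 * (2 * pi * norm z) ^ Suc N)" by (rule mult_right_mono[OF low]) simp
    finally show "norm (?d k) \<le> C0 * weight k * (2 * (2 * pi * norm z) ^ Suc N)" .
  qed
  also have "\<dots> = ((LINT k|lborel. C0 * weight (k::real^'n)) * (2 * (2 * pi) ^ Suc N)) * norm z ^ Suc N"
    unfolding integral_mult_left_zero by (simp only: power_mult_distrib mult.assoc)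
  finally show "norm (regular_part (x + z) - Q z) \<le> ((LINT k|lborel. C0 * weight (k::real^'n)) * (2 * (2 * pi) ^ Suc N)) * norm z ^ Suc N" .
qed

text \<open>
  The moment conditions say that the derivatives of \<open>\<psi>\<close> up to order N + 1 vanish at 0. They remove the
  subtracted Taylor polynomials from the pairing, and Fubini and Fourier inversion do the rest.\<close>

lemma regular_part_pairing:
  assumes s: "schwartz \<psi>"
    and mom: "\<And>A. msize A \<le> Suc N \<Longrightarrow> (LINT p|lborel. mpow (\<lambda>i. 2 * pi * \<i> * complex_of_real (p $ i)) A * fourier \<psi> p) = 0"
  shows "(LINT p|lborel. regular_part p * fourier \<psi> p) = (LINT k|lborel. tv k * \<psi> k)"
proof -
  note F = schwartz_fourier[OF s]
  note [measurable] = schwartz_measurable[OF s] schwartz_measurable[OF F]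
  obtain C where C: "\<And>p. norm (fourier \<psi> p) * (1 + norm p) ^ Suc (Suc N) \<le> C * weight p"
    using decay_weight_bound[OF schwartz_decay[OF F]] by metis
  have Fi: "integrable (lborel \<Otimes>\<^sub>M lborel) (\<lambda>(k, p). tv k * chi_tail (Suc N) k p * fourier \<psi> p)"
    proof (rule pair_integrable_bound)
      show "integrable lborel (\<lambda>k::real^'n. C0 * weight k)" by (intro integrable_mult_right integrable_weight)
      show "integrable lborel (\<lambda>p. (2 * pi) ^ Suc (Suc N) * (C * weight (p::real^'n)))"
        by (intro integrable_mult_right integrable_weight)
      fix k p :: "real^'n"
      have "norm (tv k * chi_tail (Suc N) k p * fourier \<psi> p) \<le> C0 * weight k * (2 * pi * (1 + norm p)) ^ Suc (Suc N) * norm (fourier \<psi> p)"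
        unfolding norm_mult[of "tv k * chi_tail (Suc N) k p"] by (rule mult_right_mono[OF tv_chi_tail_bound]) simp
      also have "\<dots> = C0 * weight k * ((2 * pi) ^ Suc (Suc N) * (norm (fourier \<psi> p) * (1 + norm p) ^ Suc (Suc N)))"
        by (simp only: power_mult_distrib mult_ac)
      also have "\<dots> \<le> C0 * weight k * ((2 * pi) ^ Suc (Suc N) * (C * weight p))"
        using C0 weight_pos[of k] by (intro mult_left_mono C) auto
      finally show "norm (case (k, p) of (k, p) \<Rightarrow> tv k * chi_tail (Suc N) k p * fourier \<psi> p) \<le> C0 * weight k * ((2 * pi) ^ Suc (Suc N) * (C * weight p))"
        by simp
    qed measurable
  have inner: "(LINT p|lborel. chi_tail (Suc N) k p * fourier \<psi> p) = \<psi> k" for k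
  proof -
    let ?m = "\<lambda>A p. mpow (\<lambda>i. 2 * pi * \<i> * complex_of_real (p $ i)) A * fourier \<psi> p"
    have mi: "integrable lborel (?m A)" for A
      using decay_mpow_mult[OF schwartz_decay[OF F], of "2 * pi * \<i>" A] by (intro integrable_decay) simp_all
    have t: "integrable lborel (\<lambda>p. (phase k p ^ j / fact j) * fourier \<psi> p)"
      "j \<le> Suc N \<Longrightarrow> (LINT p|lborel. (phase k p ^ j / fact j) * fourier \<psi> p) = 0" for j
    proof -
      have e: "(phase k p ^ j / fact j) * fourier \<psi> p = (\<Sum>A | msize A = j. ?m A p * (mpow (coord k) A / of_nat (mfact A)))" for p
        unfolding phase_power sum_distrib_right by (intro sum.cong refl) simp
      show "integrable lborel (\<lambda>p. (phase k p ^ j / fact j) * fourier \<psi> p)"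
        unfolding e by (intro Bochner_Integration.integrable_sum integrable_mult_left mi)
      assume j: "j \<le> Suc N"
      have "(LINT p|lborel. (phase k p ^ j / fact j) * fourier \<psi> p) = (\<Sum>A | msize A = j. (LINT p|lborel. ?m A p * (mpow (coord k) A / of_nat (mfact A))))"
        unfolding e by (rule Bochner_Integration.integral_sum) (intro integrable_mult_left mi)
      also have "\<dots> = 0"
      proof (rule sum.neutral, rule ballI)
        fix A :: "'n \<Rightarrow> nat" assume "A \<in> {A. msize A = j}"
        then have "(LINT p|lborel. ?m A p) = 0" using mom j by auto
        then show "(LINT p|lborel. ?m A p * (mpow (coord k) A / of_nat (mfact A))) = 0"
          by (simp only: integral_mult_left_zero mult_zero_left)
      qed
      finally show "(LINT p|lborel. (phase k p ^ j / fact j) * fourier \<psi> p) = 0" .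
    qed
    have ci: "integrable lborel (\<lambda>p. chi k p * fourier \<psi> p)" by (rule chi_mult_integrable[OF schwartz_integrable[OF F]])
    have c: "(LINT p|lborel. chi k p * fourier \<psi> p) = \<psi> k" by (rule fourier_inversion[OF s])
    show ?thesis
    proof (cases "norm k \<le> 1")
      case True
      have e: "chi_tail (Suc N) k p * fourier \<psi> p = chi k p * fourier \<psi> p - (\<Sum>j\<le>Suc N. (phase k p ^ j / fact j) * fourier \<psi> p)" for p
        using True by (simp only: chi_tail_def if_True left_diff_distrib sum_distrib_right)
      have "(LINT p|lborel. chi_tail (Suc N) k p * fourier \<psi> p) = (LINT p|lborel. chi k p * fourier \<psi> p) - (LINT p|lborel. (\<Sum>j\<le>Suc N. (phase k p ^ j / fact j) * fourier \<psi> p))"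
        unfolding e by (rule Bochner_Integration.integral_diff[OF ci]) (rule Bochner_Integration.integrable_sum, rule t)
      also have "(LINT p|lborel. (\<Sum>j\<le>Suc N. (phase k p ^ j / fact j) * fourier \<psi> p)) = (\<Sum>j\<le>Suc N. LINT p|lborel. (phase k p ^ j / fact j) * fourier \<psi> p)"
        by (rule Bochner_Integration.integral_sum) (rule t)
      also have "\<dots> = 0" by (rule sum.neutral) (use t(2) in auto)
      finally show ?thesis using c by simp
    next
      case False
      then show ?thesis using c by (simp add: chi_tail_def)
    qed
  qed
  from lborel_pair.Fubini_integral[OF Fi]
  have "(LINT p|lborel. LINT k|lborel. tv k * chi_tail (Suc N) k p * fourier \<psi> p) = (LINT k|lborel. LINT p|lborel. tv k * chi_tail (Suc N) k p * fourier \<psi> p)"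
    by (simp only: prod.case)
  moreover have "(LINT k|lborel. tv k * chi_tail (Suc N) k p * fourier \<psi> p) = regular_part p * fourier \<psi> p" for p
    by (simp add: regular_part_def)
  moreover have "(LINT p|lborel. tv k * chi_tail (Suc N) k p * fourier \<psi> p) = tv k * \<psi> k" for k
    using inner[of k] by (simp add: mult.assoc)
  ultimately show ?thesis by (simp only:)
qed

end

section \<open>Representation of the potential\<close>

lemma bump_shift: "bump 0 c r x = bump 0 0 r (x - c)"
  by (simp add: bump_def)

lemma fourier_bump_shift: "fourier (bump 0 c r) p = chi (- c) p * fourier (bump 0 0 r) p"
proof -
  note [measurable] = chi_measurable
  have "fourier (bump 0 c r) p = (LINT k|lborel. chi (- p) k * bump 0 c r k)" by (rule fourier_lborel) measurable
  also have "\<dots> = (LINT k|lborel. chi (- p) (k + c) * bump 0 c r (k + c))"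
    by (rule lborel_integral_translate(1)[symmetric]) measurable
  also have "\<dots> = (LINT k|lborel. chi (- c) p * (chi (- p) k * bump 0 0 r k))"
  proof (rule Bochner_Integration.integral_cong)
    have "chi (- p) c = chi (- c) p" by (simp add: chi_def inner_commute)
    then show "chi (- p) (k + c) * bump 0 c r (k + c) = chi (- c) p * (chi (- p) k * bump 0 0 r k)" for k
      by (simp add: chi_add_right bump_shift[of c])
  qed simp
  also have "\<dots> = chi (- c) p * fourier (bump 0 0 r) p"
    by (subst fourier_lborel) simp_all
  finally show ?thesis .
qed

lemma norm_chi_diff_1: "norm (chi k p - 1) \<le> 2 * pi * (norm k * norm p)"
  using chi_taylor[of k p 0] by simp

definition bump_mass :: "real \<Rightarrow> 'n::finite itself \<Rightarrow> real" where
  "bump_mass r _ = (LINT x|lborel. norm (bump 0 (0::real^'n) r x))"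

text \<open>
  The bump is nonnegative, and on its support |k| \<le> r the oscillation differs from 1 by at most
  2 \<pi> r |p|. As r tends to 0 the normalised transforms form an approximate identity for multiplication.\<close>

lemma bump_approximate_identity:
  assumes r: "r > 0"
  shows "norm (fourier (bump 0 (0::real^'n::finite) r) p / complex_of_real (bump_mass r TYPE('n))) \<le> 1"
    and "norm (fourier (bump 0 (0::real^'n::finite) r) p / complex_of_real (bump_mass r TYPE('n)) - 1) \<le> 2 * pi * (r * norm p)"
proof -
  note [measurable] = chi_measurable
  let ?b = "bump 0 (0::real^'n) r" and ?m = "bump_mass r TYPE('n)"
  have m: "?m > 0" unfolding bump_mass_def by (rule bump_integral_pos(2)[OF r])
  note bi = bump_integral_pos(1)[OF r, of "0::real^'n"]
  have F: "fourier ?b p = (LINT k|lborel. chi (- p) k * ?b k)" by (rule fourier_lborel) measurable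
  have mass: "(LINT k|lborel. ?b k) = complex_of_real ?m"
    unfolding bump_mass_def integral_complex_of_real[symmetric]
    by (rule Bochner_Integration.integral_cong) (auto simp: bump_def flat_nonneg)
  have "norm (fourier ?b p) \<le> ?m"
    unfolding bump_mass_def by (rule norm_fourier_le) measurable
  then show "norm (fourier ?b p / complex_of_real ?m) \<le> 1"
    using m by (simp add: norm_divide)
  have "norm (fourier ?b p - complex_of_real ?m) = norm (LINT k|lborel. (chi (- p) k - 1) * ?b k)"
    unfolding F mass[symmetric] left_diff_distrib mult_1
    by (subst Bochner_Integration.integral_diff) (auto intro: chi_mult_integrable bi)
  also have "\<dots> \<le> (LINT k|lborel. 2 * pi * (r * norm p) * norm (?b k))"
  proof (rule order_trans[OF integral_norm_bound], rule integral_mono)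
    have "integrable lborel (\<lambda>k. (chi (- p) k - 1) * ?b k)"
      unfolding left_diff_distrib mult_1 by (intro Bochner_Integration.integrable_diff chi_mult_integrable bi)
    then show "integrable lborel (\<lambda>k. norm ((chi (- p) k - 1) * ?b k))" by (rule integrable_norm)
    show "integrable lborel (\<lambda>k. 2 * pi * (r * norm p) * norm (?b k))"
      by (intro integrable_mult_right integrable_norm bi)
    fix k :: "real^'n"
    show "norm ((chi (- p) k - 1) * ?b k) \<le> 2 * pi * (r * norm p) * norm (?b k)"
    proof (cases "?b k = 0")
      case False
      then have "norm k \<le> r" using r by (simp add: bump_nonzero_iff)
      then have "norm p * norm k \<le> r * norm p" using mult_right_mono[of "norm k" r "norm p"] by (simp add: mult.commute)
      then have "norm (chi (- p) k - 1) \<le> 2 * pi * (r * norm p)"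
        using norm_chi_diff_1[of "- p" k] by (simp add: order_trans[OF _ mult_left_mono])
      then show ?thesis unfolding norm_mult by (rule mult_right_mono) simp
    qed simp
  qed
  also have "\<dots> = 2 * pi * (r * norm p) * ?m" by (simp add: bump_mass_def)
  finally have "norm (fourier ?b p - complex_of_real ?m) \<le> 2 * pi * (r * norm p) * ?m" .
  moreover have "fourier ?b p / complex_of_real ?m - 1 = (fourier ?b p - complex_of_real ?m) / complex_of_real ?m"
    using m by (simp add: diff_divide_distrib)
  ultimately show "norm (fourier ?b p / complex_of_real ?m - 1) \<le> 2 * pi * (r * norm p)"
    using m by (simp add: norm_divide pos_divide_le_eq)
qed

text \<open>
  Shifting a bump in frequency shows that the transform of the integrable function W F(bump) vanishes
  identically, where F(bump) is the transform of a fixed bump. By Fubini W F(bump) then annihilates every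
  Schwartz function, and letting the bump shrink removes the factor F(bump).\<close>

lemma annihilator_of_band_limited:
  fixes W :: "real^'n::finite \<Rightarrow> complex"
  assumes W[measurable]: "W \<in> borel_measurable borel"
    and int: "\<And>\<Phi>. schwartz \<Phi> \<Longrightarrow> integrable lborel (\<lambda>p. W p * \<Phi> p)"
    and zero: "\<And>\<psi>. test_fun UNIV \<psi> \<Longrightarrow> (LINT p|lborel. W p * fourier \<psi> p) = 0"
    and s: "schwartz \<Phi>"
  shows "(LINT p|lborel. W p * \<Phi> p) = 0"
proof -
  note [measurable] = schwartz_measurable[OF s]
  let ?\<psi> = "ifourier \<Phi>"
  have \<psi>: "schwartz ?\<psi>" by (rule schwartz_ifourier[OF s])
  have b: "test_fun UNIV (bump 0 c r)" if "r > 0" for c :: "real^'n" and r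
    by (rule test_fun_bump[OF that]) simp
  have bs: "schwartz (fourier (bump 0 c r))" if "r > 0" for c :: "real^'n" and r
    by (rule schwartz_fourier[OF test_fun_schwartz[OF b[OF that]]])
  define \<Theta> where "\<Theta> r p = fourier (bump 0 (0::real^'n) r) p / complex_of_real (bump_mass r TYPE('n))" for r p
  have z: "(LINT p|lborel. W p * \<Phi> p * \<Theta> r p) = 0" if r: "r > 0" for r
  proof -
    let ?h = "\<lambda>p. W p * fourier (bump 0 (0::real^'n) r) p"
    have h: "integrable lborel ?h" by (rule int[OF bs[OF r]])
    have "(LINT p|lborel. chi (- k) p * ?h p) = 0" for k
    proof -
      have "(LINT p|lborel. chi (- k) p * ?h p) = (LINT p|lborel. W p * fourier (bump 0 k r) p)"
        by (rule Bochner_Integration.integral_cong) (auto simp: fourier_bump_shift[of k])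
      then show ?thesis using zero[OF b[OF r]] by simp
    qed
    then have "(LINT p|lborel. ?h p * (LINT k|lborel. chi (- k) p * ?\<psi> k)) = 0"
      by (subst fourier_exchange[OF h schwartz_integrable[OF \<psi>]]) simp
    moreover have "(LINT k|lborel. chi (- k) p * ?\<psi> k) = \<Phi> p" for p
    proof -
      have "chi (- k) p = chi (- p) k" for k by (simp add: chi_def inner_commute)
      then have "(LINT k|lborel. chi (- k) p * ?\<psi> k) = fourier ?\<psi> p"
        using fourier_lborel[OF schwartz_measurable[OF \<psi>], of p] by simp
      then show ?thesis using fourier_ifourier[OF s] by simp
    qed
    ultimately have "(LINT p|lborel. ?h p * \<Phi> p) = 0" by simp
    then have "(LINT p|lborel. (?h p * \<Phi> p) / complex_of_real (bump_mass r TYPE('n))) = 0" by simp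
    then show ?thesis by (simp add: \<Theta>_def mult_ac)
  qed
  define d where "d n = inverse (real (Suc n))" for n
  have d0: "d \<longlonglongrightarrow> 0" unfolding d_def by (rule LIMSEQ_inverse_real_of_nat)
  have dp: "d n > 0" for n by (simp add: d_def)
  have [measurable]: "\<Theta> (d n) \<in> borel_measurable borel" for n
    unfolding \<Theta>_def[abs_def] using schwartz_measurable[OF bs[OF dp, of 0]] by measurable
  have "(\<lambda>n. LINT p|lborel. W p * \<Phi> p * \<Theta> (d n) p) \<longlonglongrightarrow> (LINT p|lborel. W p * \<Phi> p * 1)"
  proof (rule integral_dominated_convergence[where w="\<lambda>p. norm (W p * \<Phi> p)"])
    have "(\<lambda>n. \<Theta> (d n) p) \<longlonglongrightarrow> 1" for p
    proof (rule LIM_zero_cancel, rule Lim_null_comparison)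
      show "\<forall>\<^sub>F n in sequentially. norm (\<Theta> (d n) p - 1) \<le> 2 * pi * (d n * norm p)"
        unfolding \<Theta>_def by (intro always_eventually allI bump_approximate_identity(2) dp)
      show "(\<lambda>n. 2 * pi * (d n * norm p)) \<longlonglongrightarrow> 0" by (auto intro!: tendsto_eq_intros d0)
    qed
    then show "AE p in lborel. (\<lambda>n. W p * \<Phi> p * \<Theta> (d n) p) \<longlonglongrightarrow> W p * \<Phi> p * 1"
      by (intro AE_I2 tendsto_intros)
    show "AE p in lborel. norm (W p * \<Phi> p * \<Theta> (d n) p) \<le> norm (W p * \<Phi> p)" for n
    proof (rule AE_I2)
      fix p
      have "norm (\<Theta> (d n) p) \<le> 1" unfolding \<Theta>_def by (rule bump_approximate_identity(1)[OF dp])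
      then show "norm (W p * \<Phi> p * \<Theta> (d n) p) \<le> norm (W p * \<Phi> p)"
        unfolding norm_mult[of "W p * \<Phi> p"] by (rule mult_left_le) simp
    qed
  qed (use int[OF s] in auto)
  then have "(\<lambda>n. 0) \<longlonglongrightarrow> (LINT p|lborel. W p * \<Phi> p)" unfolding z[OF dp] by simp
  then show ?thesis using LIMSEQ_unique tendsto_const by blast
qed

text \<open>
  Integrability of V against one nowhere vanishing Schwartz function already makes V Lebesgue
  measurable; passing to a Borel representative makes Fubini arguments available.\<close>

lemma tempered_fun_borel:
  fixes V :: "real^'n::finite \<Rightarrow> real"
  assumes "tempered_fun V"
  obtains Vb where "Vb \<in> borel_measurable borel" "AE x in lborel. V x = Vb x"
    "\<And>\<Phi>. schwartz \<Phi> \<Longrightarrow> integrable lborel (\<lambda>x. complex_of_real (Vb x) * \<Phi> x)"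
    "\<And>\<Phi>. schwartz \<Phi> \<Longrightarrow> (LINT x|lebesgue. complex_of_real (V x) * \<Phi> x) = (LINT x|lborel. complex_of_real (Vb x) * \<Phi> x)"
proof -
  let ?g = "\<lambda>x::real^'n. exp (- 1 * (norm (x - 0))\<^sup>2)"
  have i: "integrable lebesgue (\<lambda>x. complex_of_real (V x) * \<Phi> x)" if "schwartz \<Phi>" for \<Phi>
    using assms that by (simp add: tempered_fun_def)
  have "(\<lambda>x. complex_of_real (V x) * complex_of_real (?g x)) \<in> borel_measurable lebesgue"
    using i[OF schwartz_gaussian[of 1 0]] by auto
  then have 1: "(\<lambda>x. Re (complex_of_real (V x) * complex_of_real (?g x))) \<in> borel_measurable lebesgue"
    by measurable
  have "?g \<in> borel_measurable lborel" by measurable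
  then have 2: "?g \<in> borel_measurable lebesgue" by (rule measurable_completion)
  have "(\<lambda>x. Re (complex_of_real (V x) * complex_of_real (?g x)) / ?g x) \<in> borel_measurable lebesgue"
    by (rule borel_measurable_divide[OF 1 2])
  moreover have "(\<lambda>x. Re (complex_of_real (V x) * complex_of_real (?g x)) / ?g x) = V" by (auto simp: fun_eq_iff)
  ultimately have "V \<in> borel_measurable lebesgue" by simp
  from completion_ex_borel_measurable_real[OF this]
  obtain Vb where Vb: "Vb \<in> borel_measurable borel" "AE x in lborel. V x = Vb x" by auto
  note [measurable] = Vb(1)
  have ae: "AE x in lebesgue. complex_of_real (V x) * \<Phi> x = complex_of_real (Vb x) * \<Phi> x" for \<Phi>
    using AE_completion[OF Vb(2)] by auto
  have m: "(\<lambda>x. complex_of_real (Vb x) * \<Phi> x) \<in> borel_measurable lborel" if "schwartz \<Phi>" for \<Phi>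
    using schwartz_measurable[OF that] by measurable
  have m': "(\<lambda>x. complex_of_real (V x) * \<Phi> x) \<in> borel_measurable lebesgue" if "schwartz \<Phi>" for \<Phi>
    using i[OF that] by auto
  show thesis
  proof
    show "Vb \<in> borel_measurable borel" "AE x in lborel. V x = Vb x" by fact+
    fix \<Phi> :: "real^'n \<Rightarrow> complex" assume s: "schwartz \<Phi>"
    have "integrable lebesgue (\<lambda>x. complex_of_real (Vb x) * \<Phi> x)"
      using integrable_cong_AE[OF m'[OF s] measurable_completion[OF m[OF s]] ae] i[OF s] by blast
    then show "integrable lborel (\<lambda>x. complex_of_real (Vb x) * \<Phi> x)"
      using integrable_completion[OF m[OF s]] by blast
    have "(LINT x|lebesgue. complex_of_real (V x) * \<Phi> x) = (LINT x|lebesgue. complex_of_real (Vb x) * \<Phi> x)"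
      by (rule integral_cong_AE[OF m'[OF s] measurable_completion[OF m[OF s]] ae])
    also have "\<dots> = (LINT x|lborel. complex_of_real (Vb x) * \<Phi> x)" by (rule integral_completion[OF m[OF s]])
    finally show "(LINT x|lebesgue. complex_of_real (V x) * \<Phi> x) = (LINT x|lborel. complex_of_real (Vb x) * \<Phi> x)" .
  qed
qed

lemma moderate_schwartz_integrable:
  assumes [measurable]: "U \<in> borel_measurable borel" and U: "moderate U" and s: "schwartz \<Phi>"
  shows "integrable lborel (\<lambda>p. U p * \<Phi> p)"
proof (rule integrable_decay)
  note [measurable] = schwartz_measurable[OF s]
  show "(\<lambda>p. U p * \<Phi> p) \<in> borel_measurable borel" by measurable
  show "decay (\<lambda>p. U p * \<Phi> p)"
    using decay_moderate_mult[OF schwartz_decay[OF s] U] by (simp add: mult.commute)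
qed

lemma fourier_diff:
  assumes "schwartz \<phi>" "schwartz \<psi>"
  shows "fourier (\<lambda>x. \<phi> x - c * \<psi> x) p = fourier \<phi> p - c * fourier \<psi> p"
proof -
  note [measurable] = schwartz_measurable[OF assms(1)] schwartz_measurable[OF assms(2)]
  note i = chi_mult_integrable[OF schwartz_integrable[OF assms(1)]] chi_mult_integrable[OF schwartz_integrable[OF assms(2)]]
  have "fourier (\<lambda>x. \<phi> x - c * \<psi> x) p = (LINT x|lborel. chi (- p) x * (\<phi> x - c * \<psi> x))" by (rule fourier_lborel) measurable
  also have "\<dots> = (LINT x|lborel. chi (- p) x * \<phi> x - c * (chi (- p) x * \<psi> x))"
    by (rule Bochner_Integration.integral_cong) (auto simp: algebra_simps)
  also have "\<dots> = (LINT x|lborel. chi (- p) x * \<phi> x) - (LINT x|lborel. c * (chi (- p) x * \<psi> x))"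
    by (rule Bochner_Integration.integral_diff) (intro i integrable_mult_right)+
  finally show ?thesis by (simp add: fourier_lborel)
qed

lemma pairing_fourier_diff:
  assumes [measurable]: "W \<in> borel_measurable borel" 
    and int: "\<And>\<Phi>. schwartz \<Phi> \<Longrightarrow> integrable lborel (\<lambda>p. W p * \<Phi> p)" and s: "schwartz \<phi>" "schwartz \<psi>"
  shows "(LINT p|lborel. W p * fourier (\<lambda>x. \<phi> x - c * \<psi> x) p) = (LINT p|lborel. W p * fourier \<phi> p) - c * (LINT p|lborel. W p * fourier \<psi> p)"
proof -
  note i = int[OF schwartz_fourier[OF s(1)]] int[OF schwartz_fourier[OF s(2)]]
  have "(LINT p|lborel. W p * fourier (\<lambda>x. \<phi> x - c * \<psi> x) p) = (LINT p|lborel. W p * fourier \<phi> p - c * (W p * fourier \<psi> p))"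
    by (rule Bochner_Integration.integral_cong) (auto simp: fourier_diff[OF s] algebra_simps)
  also have "\<dots> = (LINT p|lborel. W p * fourier \<phi> p) - (LINT p|lborel. c * (W p * fourier \<psi> p))"
    by (rule Bochner_Integration.integral_diff) (intro i integrable_mult_right)+
  finally show ?thesis by simp
qed

text \<open>
  This is where the two exponents are used: M1 \<le> N + 1 makes |k|^(N + 1) times the transform bounded near
  the origin, and the decay exponent leaves, after multiplication by |k|^(N + 1), the rate of the weight with
  room to spare.\<close>

lemma transform_weight_bounds:
  fixes tv :: "real^'n::finite \<Rightarrow> complex"
  assumes C1: "C1 > 0" and M1: "M1 \<le> real N + 1" and lo: "\<And>k. norm k \<le> 1 \<Longrightarrow> k \<noteq> 0 \<Longrightarrow> norm (tv k) \<le> C1 * norm k powr (- M1)"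
    and C2: "C2 > 0" and hi: "\<And>k. norm k > 1 \<Longrightarrow> norm (tv k) \<le> C2 * norm k powr (- (2 * real CARD('n) + real N + 4))"
  shows "norm (tv k) * norm k ^ Suc N \<le> ((C1 + C2) * 2 ^ (2 * CARD('n))) * weight k"
    and "norm k > 1 \<Longrightarrow> norm (tv k) \<le> ((C1 + C2) * 2 ^ (2 * CARD('n))) * weight k"
proof -
  have p: "1 + norm k > 0" by (simp add: add_pos_nonneg)
  have big: "norm (tv k) * norm k ^ Suc N \<le> ((C1 + C2) * 2 ^ (2 * CARD('n))) * weight k" if k: "norm k > 1"
  proof -
    have "norm (tv k) * norm k ^ Suc N \<le> C2 * norm k powr (- (2 * real CARD('n) + real N + 4)) * norm k powr (real (Suc N))"
      using hi[OF k] k by (subst powr_realpow) (auto intro!: mult_right_mono)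
    also have "\<dots> = C2 * norm k powr (- (2 * real CARD('n)) - 3)"
    proof -
      have "- (2 * real CARD('n) + real N + 4) + real (Suc N) = - (2 * real CARD('n)) - 3" by simp
      then show ?thesis by (simp only: mult.assoc powr_add[symmetric])
    qed
    also have "\<dots> \<le> C2 * norm k powr (- real (2 * CARD('n)))"
      using k C2 by (intro mult_left_mono powr_mono) auto
    also have "\<dots> = C2 * (1 / norm k ^ (2 * CARD('n)))"
    proof -
      have "norm k powr real (2 * CARD('n)) = norm k ^ (2 * CARD('n))" by (rule powr_realpow) (use k in auto)
      then show ?thesis by (simp only: powr_minus_divide)
    qed
    also have "1 / norm k ^ (2 * CARD('n)) \<le> 2 ^ (2 * CARD('n)) * weight k"
    proof -
      have "(1 + norm k) ^ (2 * CARD('n)) \<le> (2 * norm k) ^ (2 * CARD('n))" using k by (intro power_mono) auto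
      then have a: "(1 + norm k) ^ (2 * CARD('n)) \<le> 2 ^ (2 * CARD('n)) * norm k ^ (2 * CARD('n))" by (simp only: power_mult_distrib)
      have frac: "1 / b \<le> c * (1 / a)" if "a \<le> c * b" "0 < a" "0 < b" for a b c :: real
        using that by (simp add: field_simps)
      have "0 < norm k ^ (2 * CARD('n))" by (rule zero_less_power) (use k in linarith)
      then show ?thesis unfolding weight_def by (rule frac[OF a zero_less_power[OF p]])
    qed
    finally have "norm (tv k) * norm k ^ Suc N \<le> C2 * (2 ^ (2 * CARD('n)) * weight k)" using C2 by simp
    also have "\<dots> \<le> (C1 + C2) * (2 ^ (2 * CARD('n)) * weight k)"
      using C1 weight_pos[of k] by (intro mult_right_mono) auto
    finally show ?thesis by (simp only: mult.assoc)
  qed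
  show "norm (tv k) * norm k ^ Suc N \<le> ((C1 + C2) * 2 ^ (2 * CARD('n))) * weight k"
  proof (cases "norm k > 1 \<or> k = 0")
    case True
    then show ?thesis using big C1 C2 weight_pos[of k] by (auto simp: mult_nonneg_nonneg less_imp_le)
  next
    case False
    then have k: "norm k \<le> 1" "k \<noteq> 0" by auto
    have "norm (tv k) * norm k ^ Suc N \<le> C1 * norm k powr (- M1) * norm k powr (real (Suc N))"
      using lo[OF k] k by (subst powr_realpow) (auto intro!: mult_right_mono)
    also have "\<dots> = C1 * norm k powr (real N + 1 - M1)" by (simp add: mult.assoc powr_add[symmetric] add.commute)
    also have "\<dots> \<le> C1 * 1" using k M1 C1 by (intro mult_left_mono powr_le1) auto
    also have "\<dots> \<le> (C1 + C2) * (2 ^ (2 * CARD('n)) * weight k)"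
    proof (rule mult_mono)
      have "(1 + norm k) ^ (2 * CARD('n)) \<le> 2 ^ (2 * CARD('n))" using k by (intro power_mono) auto
      then show "1 \<le> 2 ^ (2 * CARD('n)) * weight k" using p by (simp add: weight_def pos_le_divide_eq)
    qed (use C1 C2 in auto)
    finally show ?thesis by (simp only: mult.assoc)
  qed
  show "norm (tv k) \<le> ((C1 + C2) * 2 ^ (2 * CARD('n))) * weight k" if k: "norm k > 1"
  proof -
    have "norm (tv k) * 1 \<le> norm (tv k) * norm k ^ Suc N" using k by (intro mult_left_mono one_le_power) auto
    then show ?thesis using big[OF k] by simp
  qed
qed

text \<open>
  The potential may be replaced, in pairings with Schwartz functions, by a function that is uniformly
  close to polynomials of degree N: the absolutely convergent part of its inverse Fourier integral plus
  a polynomial of degree N + 1.\<close>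

theorem potential_representation:
  fixes V :: "real^'n::finite \<Rightarrow> real"
  assumes V: "tempered_fun V" and ss: "sing_supp (distr_fourier (distr_of V)) \<subseteq> {0}"
    and C1: "C1 > 0" and M1: "M1 \<le> real N + 1" and bo: "bounded_at_origin (distr_fourier (distr_of V)) C1 M1"
    and C2: "C2 > 0" and hi: "\<And>k. norm k > 1 \<Longrightarrow>
      norm (distr_value (distr_fourier (distr_of V)) k) \<le> C2 * norm k powr (- (2 * real CARD('n) + real N + 4))"
  obtains V' C where "V' \<in> borel_measurable borel" "moderate V'"
    "\<And>\<Phi>. schwartz \<Phi> \<Longrightarrow> (LINT x|lebesgue. complex_of_real (V x) * \<Phi> x) = (LINT x|lborel. V' x * \<Phi> x)"
    "\<And>x. \<exists>Q. polyn N Q \<and> (\<forall>z. norm (V' (x + z) - Q z) \<le> C * norm z ^ Suc N)"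
proof -
  define T where "T = distr_fourier (distr_of V)"
  define tv where "tv = distr_value T"
  have tm[measurable]: "tv \<in> borel_measurable borel" unfolding tv_def T_def by (rule distr_value_measurable[OF ss])
  have lo: "norm (tv k) \<le> C1 * norm k powr (- M1)" if "norm k \<le> 1" "k \<noteq> 0" for k
    using bo that unfolding bounded_at_origin_def tv_def T_def by blast
  have rep: "T \<phi> = (LINT k|lebesgue. tv k * \<phi> k)"
    if "test_fun UNIV \<phi>" "\<And>A. msize A \<le> Suc N \<Longrightarrow> mderiv A \<phi> 0 = 0" for \<phi>
  proof -
    have "\<forall>A. real (msize A) \<le> M1 \<longrightarrow> mderiv A \<phi> 0 = 0" using that(2) M1 by force
    then show ?thesis using bo that(1) unfolding bounded_at_origin_def tv_def T_def by blast
  qed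
  define C0 where "C0 = (C1 + C2) * 2 ^ (2 * CARD('n))"
  have C0: "C0 \<ge> 0" using C1 C2 by (simp add: C0_def)
  note low = transform_weight_bounds(1)[where tv=tv, OF C1 M1 lo C2 hi[folded T_def, folded tv_def], folded C0_def]
  note high = transform_weight_bounds(2)[where tv=tv, OF C1 M1 lo C2 hi[folded T_def, folded tv_def], folded C0_def]
  obtain Vb where Vb: "Vb \<in> borel_measurable borel" "AE x in lborel. V x = Vb x"
    "\<And>\<Phi>. schwartz \<Phi> \<Longrightarrow> integrable lborel (\<lambda>x. complex_of_real (Vb x) * \<Phi> x)"
    "\<And>\<Phi>. schwartz \<Phi> \<Longrightarrow> (LINT x|lebesgue. complex_of_real (V x) * \<Phi> x) = (LINT x|lborel. complex_of_real (Vb x) * \<Phi> x)"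
    by (rule tempered_fun_borel[OF V]) (rule that)
  note [measurable] = Vb(1)
  define U where "U = regular_part tv N"
  have Um[measurable]: "U \<in> borel_measurable borel"
    unfolding U_def by (rule regular_part_measurable[OF tm C0 low high])
  have Umod: "moderate U"
    unfolding U_def by (rule regular_part_moderate[OF tm C0 low high])
  define W0 where "W0 p = complex_of_real (Vb p) - U p" for p
  have W0m[measurable]: "W0 \<in> borel_measurable borel" unfolding W0_def by measurable
  have W0i: "integrable lborel (\<lambda>p. W0 p * \<Phi> p)" if "schwartz \<Phi>" for \<Phi>
    unfolding W0_def left_diff_distrib
    by (intro Bochner_Integration.integrable_diff Vb(3) moderate_schwartz_integrable Um Umod that)
  define mon where "mon A p = mpow (\<lambda>i. 2 * pi * \<i> * complex_of_real (p $ i)) A" for A and p :: "real^'n"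
  have monm[measurable]: "mon A \<in> borel_measurable borel" for A unfolding mon_def by measurable
  have monmod: "moderate (mon A)" for A unfolding mon_def using moderate_mpow_coord[of "2 * pi * \<i>"] by simp
  have moni: "integrable lborel (\<lambda>p. mon A p * \<Phi> p)" if "schwartz \<Phi>" for \<Phi> A
    by (rule moderate_schwartz_integrable[OF monm monmod that])
  (* the monomials paired with the transform of a test function are its derivatives at 0, and where
     they vanish the hypothesis at the origin identifies the transform of V with its values *)
  have "\<exists>c. \<forall>\<phi>\<in>{\<phi>. test_fun UNIV \<phi>}. (LINT p|lborel. W0 p * fourier \<phi> p) =
      (\<Sum>A | msize A \<le> Suc N. c A * (LINT p|lborel. mon A p * fourier \<phi> p))"
  proof (rule functional_in_span[where L="\<lambda>\<phi>. LINT p|lborel. W0 p * fourier \<phi> p" and l="\<lambda>A \<phi>. LINT p|lborel. mon A p * fourier \<phi> p"])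
    show "(\<lambda>x. \<phi> x - c * \<psi> x) \<in> {\<phi>. test_fun UNIV \<phi>}"
      if "\<phi> \<in> {\<phi>. test_fun UNIV \<phi>}" "\<psi> \<in> {\<phi>. test_fun UNIV \<phi>}" for \<phi> \<psi> :: "real^'n \<Rightarrow> complex" and c
      using test_fun_diff that by simp
    show "(LINT p|lborel. mon A p * fourier (\<lambda>x. \<phi> x - c * \<psi> x) p) = (LINT p|lborel. mon A p * fourier \<phi> p) - c * (LINT p|lborel. mon A p * fourier \<psi> p)"
      if "\<phi> \<in> {\<phi>. test_fun UNIV \<phi>}" "\<psi> \<in> {\<phi>. test_fun UNIV \<phi>}" for \<phi> \<psi> c A
      using that by (intro pairing_fourier_diff moni) (auto intro: test_fun_schwartz)
    show "(LINT p|lborel. W0 p * fourier (\<lambda>x. \<phi> x - c * \<psi> x) p) = (LINT p|lborel. W0 p * fourier \<phi> p) - c * (LINT p|lborel. W0 p * fourier \<psi> p)"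
      if "\<phi> \<in> {\<phi>. test_fun UNIV \<phi>}" "\<psi> \<in> {\<phi>. test_fun UNIV \<phi>}" for \<phi> \<psi> c
      using that by (intro pairing_fourier_diff W0i) (auto intro: test_fun_schwartz)
    show "(LINT p|lborel. W0 p * fourier \<phi> p) = 0"
      if t: "\<phi> \<in> {\<phi>. test_fun UNIV \<phi>}" and m: "\<And>A. A \<in> {A. msize A \<le> Suc N} \<Longrightarrow> (LINT p|lborel. mon A p * fourier \<phi> p) = 0" for \<phi>
    proof -
      have t': "test_fun UNIV \<phi>" using t by simp
      have s: "schwartz \<phi>" by (rule test_fun_schwartz[OF t'])
      note F = schwartz_fourier[OF s]
      note [measurable] = schwartz_measurable[OF s]
      have "mderiv A \<phi> 0 = (LINT p|lborel. mon A p * fourier \<phi> p)" for A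
        using mderiv_ifourier[OF schwartz_measurable[OF F] schwartz_decay[OF F], of A 0]
        by (simp add: ifourier_fourier[OF s] mon_def)
      then have "T \<phi> = (LINT k|lebesgue. tv k * \<phi> k)" using m by (intro rep t') simp
      also have "\<dots> = (LINT k|lborel. tv k * \<phi> k)" by (rule integral_completion) measurable
      also have "\<dots> = (LINT p|lborel. U p * fourier \<phi> p)"
        unfolding U_def by (rule regular_part_pairing[OF tm C0 low high s, symmetric]) (use m in \<open>auto simp: mon_def\<close>)
      finally have "T \<phi> = (LINT p|lborel. U p * fourier \<phi> p)" .
      moreover have "T \<phi> = (LINT p|lborel. complex_of_real (Vb p) * fourier \<phi> p)"
        unfolding T_def distr_fourier_def distr_of_def by (rule Vb(4)[OF F])
      moreover have "(LINT p|lborel. W0 p * fourier \<phi> p) = (LINT p|lborel. complex_of_real (Vb p) * fourier \<phi> p) - (LINT p|lborel. U p * fourier \<phi> p)"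
        unfolding W0_def left_diff_distrib
        by (rule Bochner_Integration.integral_diff) (intro Vb(3) moderate_schwartz_integrable Um Umod F)+
      ultimately show ?thesis by simp
    qed
  qed (rule finite_msize_le)
  then obtain c where c: "\<And>\<phi>. test_fun UNIV \<phi> \<Longrightarrow> (LINT p|lborel. W0 p * fourier \<phi> p) =
      (\<Sum>A | msize A \<le> Suc N. c A * (LINT p|lborel. mon A p * fourier \<phi> p))" by blast
  define P where "P p = (\<Sum>A | msize A \<le> Suc N. c A * mon A p)" for p
  have Pm[measurable]: "P \<in> borel_measurable borel" unfolding P_def by measurable
  have Pmod: "moderate P"
  proof -
    have "moderate (\<lambda>p. \<Sum>A\<in>I. c A * mon A p)" if "finite I" for I
      using that by (induction rule: finite_induct) (auto intro!: moderate_const moderate_add moderate_mult monmod)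
    then show ?thesis unfolding P_def[abs_def] by (simp add: finite_msize_le)
  qed
  define V' where "V' p = U p + P p" for p
  have V'm[measurable]: "V' \<in> borel_measurable borel" unfolding V'_def by measurable
  have V'mod: "moderate V'" unfolding V'_def[abs_def] by (rule moderate_add[OF Umod Pmod])
  define W where "W p = complex_of_real (Vb p) - V' p" for p
  have Wi: "integrable lborel (\<lambda>p. W p * \<Phi> p)" if "schwartz \<Phi>" for \<Phi>
    unfolding W_def left_diff_distrib
    by (intro Bochner_Integration.integrable_diff Vb(3) moderate_schwartz_integrable V'm V'mod that)
  have W_zero: "(LINT p|lborel. W p * \<Phi> p) = 0" if "schwartz \<Phi>" for \<Phi>
  proof (rule annihilator_of_band_limited[OF _ Wi _ that])
    show "W \<in> borel_measurable borel" unfolding W_def by measurable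
    fix \<psi> :: "real^'n \<Rightarrow> complex" assume t: "test_fun UNIV \<psi>"
    note F = schwartz_fourier[OF test_fun_schwartz[OF t]]
    have "(LINT p|lborel. W p * fourier \<psi> p) = (LINT p|lborel. W0 p * fourier \<psi> p - P p * fourier \<psi> p)"
      by (rule Bochner_Integration.integral_cong) (auto simp: W_def W0_def V'_def algebra_simps)
    also have "\<dots> = (LINT p|lborel. W0 p * fourier \<psi> p) - (LINT p|lborel. P p * fourier \<psi> p)"
      by (rule Bochner_Integration.integral_diff) (intro W0i moderate_schwartz_integrable Pm Pmod F)+
    also have "(LINT p|lborel. P p * fourier \<psi> p) = (LINT p|lborel. (\<Sum>A | msize A \<le> Suc N. c A * (mon A p * fourier \<psi> p)))"
      by (rule Bochner_Integration.integral_cong) (auto simp: P_def sum_distrib_right mult.assoc)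
    also have "\<dots> = (\<Sum>A | msize A \<le> Suc N. LINT p|lborel. c A * (mon A p * fourier \<psi> p))"
      by (rule Bochner_Integration.integral_sum) (intro integrable_mult_right moni F)
    also have "\<dots> = (LINT p|lborel. W0 p * fourier \<psi> p)" unfolding c[OF t] by simp
    finally show "(LINT p|lborel. W p * fourier \<psi> p) = 0" by simp
  qed
  obtain CU where CU: "\<And>x. \<exists>Q. polyn N Q \<and> (\<forall>z. norm (U (x + z) - Q z) \<le> CU * norm z ^ Suc N)"
    using regular_part_taylor[OF tm C0 low high] unfolding U_def by blast
  define b where "b A = c A * (2 * pi * \<i>) ^ msize A" for A :: "'n \<Rightarrow> nat"
  have Pb: "P p = (\<Sum>A | msize A \<le> Suc N. b A * mpow (coord p) A)" for p
    unfolding P_def mon_def mpow_mult[where a="\<lambda>_. 2 * pi * \<i>"] mpow_const b_def by (simp only: mult.assoc)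
  show thesis
  proof
    show "V' \<in> borel_measurable borel" "moderate V'" by fact+
    show "(LINT x|lebesgue. complex_of_real (V x) * \<Phi> x) = (LINT x|lborel. V' x * \<Phi> x)" if s: "schwartz \<Phi>" for \<Phi>
    proof -
      have "(LINT p|lborel. W p * \<Phi> p) = (LINT x|lborel. complex_of_real (Vb x) * \<Phi> x) - (LINT x|lborel. V' x * \<Phi> x)"
        unfolding W_def left_diff_distrib
        by (rule Bochner_Integration.integral_diff) (intro Vb(3) moderate_schwartz_integrable V'm V'mod s)+
      then show ?thesis using W_zero[OF s] Vb(4)[OF s] by simp
    qed
    fix x :: "real^'n"
    obtain Q1 where Q1: "polyn N Q1" "\<And>z. norm (U (x + z) - Q1 z) \<le> CU * norm z ^ Suc N" using CU by blast
    (* the translate of P without its part of degree N + 1 in z, which is homogeneous and enters the error *)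
    define Q2 where "Q2 z = (\<Sum>A | msize A \<le> Suc N. b A * (if msize A = Suc N then mpow (coord (x + z)) A - mpow (coord z) A else mpow (coord (x + z)) A))" for z
    have "polyn N Q2" unfolding Q2_def[abs_def]
    proof (intro polyn_sum finite_msize_le polyn_cmult)
      fix A :: "'n \<Rightarrow> nat" assume "A \<in> {A. msize A \<le> Suc N}"
      then show "polyn N (\<lambda>z. if msize A = Suc N then mpow (coord (x + z)) A - mpow (coord z) A else mpow (coord (x + z)) A)"
        using polyn_translate_diff[of A N x] polyn_translate[OF polyn_mpow[of A N], of x] by (cases "msize A = Suc N") auto
    qed
    then have "polyn N (\<lambda>z. Q1 z + Q2 z)" by (rule polyn_add[OF Q1(1)])
    moreover have "norm (V' (x + z) - (Q1 z + Q2 z)) \<le> (CU + (\<Sum>A | msize A \<le> Suc N. norm (b A))) * norm z ^ Suc N" for z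
    proof -
      have "P (x + z) - Q2 z = (\<Sum>A | msize A \<le> Suc N. if msize A = Suc N then b A * mpow (coord z) A else 0)"
        unfolding Pb Q2_def sum_subtractf[symmetric] by (rule sum.cong) (auto simp: algebra_simps)
      also have "norm \<dots> \<le> (\<Sum>A | msize A \<le> Suc N. norm (b A) * norm z ^ Suc N)"
      proof (rule sum_norm_le)
        fix A :: "'n \<Rightarrow> nat"
        have "norm (mpow (coord z) A) \<le> norm z ^ msize A" by (rule norm_mpow_le) (simp add: component_le_norm_cart)
        then show "norm (if msize A = Suc N then b A * mpow (coord z) A else 0) \<le> norm (b A) * norm z ^ Suc N"
          by (auto simp: norm_mult intro: mult_left_mono)
      qed
      finally have "norm (P (x + z) - Q2 z) \<le> (\<Sum>A | msize A \<le> Suc N. norm (b A)) * norm z ^ Suc N"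
        by (simp only: sum_distrib_right)
      moreover have "V' (x + z) - (Q1 z + Q2 z) = (U (x + z) - Q1 z) + (P (x + z) - Q2 z)" by (simp add: V'_def)
      ultimately show ?thesis using Q1(2)[of z] norm_triangle_ineq[of "U (x + z) - Q1 z" "P (x + z) - Q2 z"]
        by (simp only: distrib_right)
    qed
    ultimately show "\<exists>Q. polyn N Q \<and> (\<forall>z. norm (V' (x + z) - Q z) \<le> (CU + (\<Sum>A | msize A \<le> Suc N. norm (b A))) * norm z ^ Suc N)"
      by blast
  qed
qed

section \<open>Hermite polynomials\<close>

text \<open>
  The monic Hermite polynomials of variance a, orthogonal for the centred Gaussian of that variance.\<close>

fun he :: "real \<Rightarrow> nat \<Rightarrow> real \<Rightarrow> real" where
  "he a 0 z = 1"
| "he a (Suc 0) z = z"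
| "he a (Suc (Suc n)) z = z * he a (Suc n) z - a * real (Suc n) * he a n z"

lemma he_rec: "he a (Suc n) z = z * he a n z - a * real n * he a (n - 1) z"
  by (cases n) auto

lemma he_DERIV: "DERIV (he a n) z :> real n * he a (n - 1) z"
proof (induction a n z rule: he.induct)
  case (3 a n z)
  have "DERIV (\<lambda>z. z * he a (Suc n) z - a * real (Suc n) * he a n z) z :>
     (1 * he a (Suc n) z + (real (Suc n) * he a (Suc n - 1) z) * z) - a * real (Suc n) * (real n * he a (n - 1) z)"
    by (rule DERIV_diff[OF DERIV_mult[OF DERIV_ident 3(1)] DERIV_cmult[OF 3(2)]])
  moreover have "(1 * he a (Suc n) z + (real (Suc n) * he a (Suc n - 1) z) * z) - a * real (Suc n) * (real n * he a (n - 1) z)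
     = real (Suc (Suc n)) * he a (Suc (Suc n) - 1) z"
    by (simp add: he_rec[of a n z] algebra_simps del: he.simps)
  moreover have "he a (Suc (Suc n)) = (\<lambda>z. z * he a (Suc n) z - a * real (Suc n) * he a n z)" by (rule ext) simp
  ultimately show ?case by (simp only:)
qed simp_all

text \<open>
  The bound is homogeneous in (\<open>\<surd>a\<close>, z), which is what makes the final estimate scale with \<open>\<epsilon>\<close>.\<close>

lemma abs_he_le:
  assumes "a > 0" shows "\<bar>he a n z\<bar> \<le> fact n * (sqrt a + \<bar>z\<bar>) ^ n"
  using assms
proof (induction a n z rule: he.induct)
  case (3 a n z)
  define b where "b = sqrt a + \<bar>z\<bar>"
  have b0: "b \<ge> 0" using 3 by (simp add: b_def)
  have ab: "a \<le> b\<^sup>2" using 3(3) by (simp add: b_def power2_sum)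
  have zb: "\<bar>z\<bar> \<le> b" using 3(3) by (simp add: b_def)
  have IH: "\<bar>he a (Suc n) z\<bar> \<le> fact (Suc n) * b ^ Suc n" "\<bar>he a n z\<bar> \<le> fact n * b ^ n"
    using 3 unfolding b_def by blast+
  have "\<bar>he a (Suc (Suc n)) z\<bar> \<le> \<bar>z\<bar> * \<bar>he a (Suc n) z\<bar> + a * real (Suc n) * \<bar>he a n z\<bar>"
    using 3(3) abs_triangle_ineq4[of "z * he a (Suc n) z" "a * real (Suc n) * he a n z"]
    by (simp add: abs_mult del: of_nat_Suc)
  also have "\<dots> \<le> b * (fact (Suc n) * b ^ Suc n) + b\<^sup>2 * real (Suc n) * (fact n * b ^ n)"
    using 3(3) zb ab b0 by (intro add_mono mult_mono IH mult_nonneg_nonneg) auto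
  also have "\<dots> = 2 * (fact (Suc n) * b ^ Suc (Suc n))"
    by (simp add: power2_eq_square algebra_simps)
  also have "\<dots> \<le> real (Suc (Suc n)) * (fact (Suc n) * b ^ Suc (Suc n))"
    using b0 by (intro mult_right_mono) auto
  also have "\<dots> = real (Suc (Suc n)) * (fact (Suc n) * (sqrt a + \<bar>z\<bar>) ^ Suc (Suc n))" by (simp only: b_def)
  finally show ?case by (simp only: fact_Suc[of "Suc n"] mult.assoc)
qed (auto simp: add_nonneg_nonneg)

text \<open>
  Hermite polynomials form an Appell sequence: both sides have the same derivative in h, by induction, and
  the same value at h = 0.\<close>

lemma he_add: "he a n (z + h) / fact n = (\<Sum>j\<le>n. he a j z / fact j * (h ^ (n - j) / fact (n - j)))"
proof (induction n arbitrary: h)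
  case (Suc n)
  let ?f = "\<lambda>h. he a (Suc n) (z + h) / fact (Suc n)"
  let ?g = "\<lambda>h. \<Sum>j\<le>Suc n. he a j z / fact j * (h ^ (Suc n - j) / fact (Suc n - j))"
  have f: "DERIV ?f h :> he a n (z + h) / fact n" for h
  proof -
    have "DERIV (\<lambda>h. he a (Suc n) (z + h)) h :> real (Suc n) * he a n (z + h)"
      using he_DERIV[of a "Suc n" "h + z"] unfolding DERIV_shift by (simp add: add.commute del: he.simps)
    from DERIV_cdivide[OF this, of "fact (Suc n)"] show ?thesis by (simp del: he.simps of_nat_Suc)
  qed
  have g: "DERIV ?g h :> (\<Sum>j\<le>n. he a j z / fact j * (h ^ (n - j) / fact (n - j)))" for h
  proof -
    have t: "DERIV (\<lambda>h. he a j z / fact j * (h ^ (Suc n - j) / fact (Suc n - j))) h :> he a j z / fact j * (h ^ (n - j) / fact (n - j))" if "j \<le> n" for j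
    proof -
      have "DERIV (\<lambda>h. h ^ Suc (n - j) / fact (Suc (n - j))) h :> (1 + real (n - j)) * (1 * h ^ (n - j)) / fact (Suc (n - j))"
        by (intro DERIV_cdivide DERIV_power_Suc DERIV_ident)
      moreover have "(1 + real (n - j)) * (1 * h ^ (n - j)) / fact (Suc (n - j)) = h ^ (n - j) / fact (n - j)"
        by (simp add: add_nonneg_eq_0_iff)
      ultimately show ?thesis using that by (intro DERIV_cmult) (simp only: Suc_diff_le)
    qed
    have "DERIV (\<lambda>h. (\<Sum>j\<le>n. he a j z / fact j * (h ^ (Suc n - j) / fact (Suc n - j))) + he a (Suc n) z / fact (Suc n)) h :>
      (\<Sum>j\<le>n. he a j z / fact j * (h ^ (n - j) / fact (n - j))) + 0"
      by (intro DERIV_add DERIV_sum t DERIV_const) simp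
    then show ?thesis by simp
  qed
  have d: "DERIV (\<lambda>h. ?f h - ?g h) h :> 0" for h
    using DERIV_diff[OF f g, of h] by (simp only: Suc.IH diff_self)
  have "\<forall>h. DERIV (\<lambda>h. ?f h - ?g h) h :> 0" using d by blast
  then have "?f h - ?g h = ?f 0 - ?g 0" by (rule DERIV_isconst_all)
  moreover have "?g 0 = he a (Suc n) z / fact (Suc n)"
  proof -
    have "(\<Sum>j\<le>n. he a j z / fact j * (0 ^ (Suc n - j) / fact (Suc n - j))) = 0"
      by (rule sum.neutral) (auto simp: power_0_left)
    then show ?thesis by simp
  qed
  ultimately show ?case by simp
qed simp

definition hem :: "real \<Rightarrow> ('n::finite \<Rightarrow> nat) \<Rightarrow> real^'n \<Rightarrow> real" where
  "hem a A z = (\<Prod>i\<in>UNIV. he a (A i) (z $ i))"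

lemma hem_zero[simp]: "hem a (\<lambda>_. 0) z = 1" by (simp add: hem_def)

lemma hem_Suc: "hem a (A(i := Suc (A i))) z = z $ i * hem a A z - a * real (A i) * hem a (A(i := A i - 1)) z"
  unfolding hem_def prod_fun_upd[where f="\<lambda>j k. he a k (z $ j)"] prod_remove1[of "\<lambda>j. he a (A j) (z $ j)" i] he_rec
  by (simp add: algebra_simps)

lemma abs_hem_le:
  assumes "a > 0" shows "\<bar>hem a A z\<bar> \<le> real (mfact A) * (sqrt a + norm z) ^ msize A"
proof -
  have "\<bar>hem a A z\<bar> = (\<Prod>i\<in>UNIV. \<bar>he a (A i) (z $ i)\<bar>)" by (simp add: hem_def abs_prod)
  also have "\<dots> \<le> (\<Prod>i\<in>UNIV. fact (A i) * (sqrt a + norm z) ^ A i)"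
  proof (rule prod_mono, intro conjI)
    fix i
    have "\<bar>he a (A i) (z $ i)\<bar> \<le> fact (A i) * (sqrt a + \<bar>z $ i\<bar>) ^ A i" by (rule abs_he_le[OF assms])
    also have "\<dots> \<le> fact (A i) * (sqrt a + norm z) ^ A i"
      using assms component_le_norm_cart[of z i] by (intro mult_left_mono power_mono) auto
    finally show "\<bar>he a (A i) (z $ i)\<bar> \<le> fact (A i) * (sqrt a + norm z) ^ A i" .
  qed simp
  finally show ?thesis by (simp add: prod.distrib mfact_def msize_def power_sum)
qed

lemma mfact_pos: "mfact A > 0" by (simp add: mfact_def prod_pos)

lemma mfact_Suc: "mfact (A(i := Suc (A i))) = Suc (A i) * mfact A"
  unfolding mfact_def prod_fun_upd[where f="\<lambda>j k. fact k"] prod_remove1[of "\<lambda>j. fact (A j)" i] by (simp add: algebra_simps)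

lemma he_measurable[measurable]: "he a n \<in> borel_measurable borel"
proof -
  have "continuous_on UNIV (he a n)"
    by (rule continuous_at_imp_continuous_on) (use he_DERIV DERIV_isCont in blast)
  then show ?thesis by (rule borel_measurable_continuous_onI)
qed

lemma hem_measurable[measurable]: "hem a A \<in> borel_measurable borel"
  unfolding hem_def[abs_def] by measurable

lemma hem_add:
  "hem a C (z + h) / real (mfact C) = (\<Sum>A\<in>(\<Pi>\<^sub>E i\<in>UNIV. {..C i}).
     hem a A z / real (mfact A) * ((\<Prod>i\<in>UNIV. (h $ i) ^ (C i - A i)) / real (mfact (\<lambda>i. C i - A i))))"
proof -
  have "hem a C (z + h) / real (mfact C) = (\<Prod>i\<in>UNIV. he a (C i) (z $ i + h $ i) / fact (C i))"
    by (simp add: hem_def mfact_def prod_dividef)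
  also have "\<dots> = (\<Prod>i\<in>UNIV. \<Sum>j\<in>{..C i}. he a j (z $ i) / fact j * ((h $ i) ^ (C i - j) / fact (C i - j)))"
    by (simp only: he_add)
  also have "\<dots> = (\<Sum>A\<in>(\<Pi>\<^sub>E i\<in>UNIV. {..C i}). \<Prod>i\<in>UNIV. he a (A i) (z $ i) / fact (A i) * ((h $ i) ^ (C i - A i) / fact (C i - A i)))"
    by (rule prod_sum_PiE) auto
  finally show ?thesis by (simp add: hem_def mfact_def prod_dividef prod.distrib)
qed

section \<open>Orthogonality of the Hermite polynomials\<close>

abbreviation hemc :: "real \<Rightarrow> ('n::finite \<Rightarrow> nat) \<Rightarrow> real^'n \<Rightarrow> complex" where
  "hemc a A \<equiv> (\<lambda>z. complex_of_real (hem a A z))"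

lemma polyn_regular: "polyn m p \<Longrightarrow> regular moderate k p"
  by (induction rule: polyn.induct)
    (auto intro: regular_moderate_const regular_moderate_add regular_moderate_mult regular_moderate_coord)

lemma polyn_hem: "msize A \<le> m \<Longrightarrow> polyn m (hemc a A)"
proof (induction m arbitrary: A rule: less_induct)
  case (less m)
  show ?case
  proof (cases "msize A")
    case 0
    then have "A = (\<lambda>_. 0)" by (simp add: msize_eq_0)
    then show ?thesis by (simp add: polyn_const)
  next
    case (Suc k)
    then obtain i B where A: "A = B(i := Suc (B i))" and B: "msize B = k" by (rule msize_SucE)
    obtain m' where m: "m = Suc m'" "k \<le> m'" using less.prems Suc by (cases m) auto
    have "polyn (Suc m') (\<lambda>z. complex_of_real (z $ i) * hemc a B z + (- (a * real (B i))) * hemc a (B(i := B i - 1)) z)"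
    proof (intro polyn_add polyn_coord polyn_cmult)
      show "polyn m' (hemc a B)" using less.IH[of m' B] m B by simp
      have "msize (B(i := B i - 1)) \<le> msize B"
        unfolding msize_def by (rule sum_mono) auto
      then have le: "msize (B(i := B i - 1)) \<le> m'" using m B by linarith
      show "polyn (Suc m') (hemc a (B(i := B i - 1)))" by (rule polyn_Suc[OF less.IH[OF _ le]]) (simp add: m)
    qed
    then show ?thesis unfolding A m hem_Suc by simp
  qed
qed

lemma regular_hem: "regular moderate k (hemc a A)"
  by (rule polyn_regular[OF polyn_hem[OF order_refl]])

lemma partial_prod:
  fixes f :: "'n::finite \<Rightarrow> real \<Rightarrow> real"
  assumes "DERIV (f i) (z $ i) :> d"
  shows "partial i (\<lambda>z::real^'n. complex_of_real (\<Prod>j\<in>UNIV. f j (z $ j))) z = complex_of_real (d * (\<Prod>j\<in>UNIV - {i}. f j (z $ j)))"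
proof -
  have e: "(\<Prod>j\<in>UNIV. f j ((z + t *\<^sub>R axis i 1) $ j)) = f i (z $ i + t) * (\<Prod>j\<in>UNIV - {i}. f j (z $ j))" for t
    unfolding prod_remove1[of _ i]
    by (intro arg_cong2[where f="(*)"] prod.cong) (auto simp: axis_def)
  have "DERIV (\<lambda>t. f i (z $ i + t)) 0 :> d"
    using assms DERIV_shift[of "f i" d 0 "z $ i"] by (simp add: add.commute)
  from DERIV_cmult_right[OF this, of "\<Prod>j\<in>UNIV - {i}. f j (z $ j)"]
  have "((\<lambda>t. complex_of_real (f i (z $ i + t) * (\<Prod>j\<in>UNIV - {i}. f j (z $ j)))) has_vector_derivative complex_of_real (d * (\<Prod>j\<in>UNIV - {i}. f j (z $ j)))) (at 0)"
    by (intro has_vector_derivative_of_real) (simp add: has_real_derivative_iff_has_vector_derivative)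
  then show ?thesis unfolding partial_def e by (rule vector_derivative_at)
qed

lemma partial_hem: "partial i (hemc a A) = (\<lambda>z. of_nat (A i) * hemc a (A(i := A i - 1)) z)"
proof
  fix z
  show "partial i (hemc a A) z = of_nat (A i) * hemc a (A(i := A i - 1)) z"
    unfolding hem_def prod_fun_upd[where f="\<lambda>j k. he a k (z $ j)"]
    by (subst partial_prod[OF he_DERIV]) simp
qed

text \<open>
  The centred Gaussian density with variance a in each coordinate.\<close>

definition gam :: "real \<Rightarrow> real^'n::finite \<Rightarrow> real" where
  "gam a z = (1 / sqrt (2 * pi * a)) ^ CARD('n) * exp (- (1 / (2 * a)) * (norm z)\<^sup>2)"

abbreviation gamc :: "real \<Rightarrow> real^'n::finite \<Rightarrow> complex" where
  "gamc a \<equiv> (\<lambda>z. complex_of_real (gam a z))"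

lemma gam_measurable[measurable]: "gam a \<in> borel_measurable borel"
  unfolding gam_def[abs_def] by measurable

lemma gam_nonneg: "a > 0 \<Longrightarrow> gam a z \<ge> 0" by (simp add: gam_def)

lemma schwartz_gam: "a > 0 \<Longrightarrow> schwartz (gamc a :: real^'n::finite \<Rightarrow> complex)"
  using schwartz_cmult[OF schwartz_gaussian[of "1 / (2 * a)" "0::real^'n"], of "complex_of_real ((1 / sqrt (2 * pi * a)) ^ CARD('n))"]
  by (simp add: gam_def[abs_def])

lemma gam_integral: 
  assumes a: "a > 0" shows "(LINT z|lborel. gam a (z::real^'n::finite)) = 1"
proof -
  have e: "gam a z = (1 / sqrt a) ^ CARD('n) * std_gauss ((1 / sqrt a) *\<^sub>R z)" for z :: "real^'n"
    using a by (simp add: gam_def std_gauss_eq real_sqrt_mult power_mult_distrib power_one_over power_divide mult_ac)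
  have "(LINT x|lborel. std_gauss (x::real^'n)) = (1 / sqrt a) ^ CARD('n) * (LINT z|lborel. std_gauss ((1 / sqrt a) *\<^sub>R (z::real^'n)))"
    using lborel_integral_affine(1)[of "1 / sqrt a" "std_gauss :: real^'n \<Rightarrow> real" 0] a by simp
  then show ?thesis unfolding e std_gauss_integral(2) by simp
qed

lemma partial_gam:
  fixes z :: "real^'n::finite"
  assumes a: "a > 0" shows "partial i (gamc a) z = - complex_of_real (z $ i / a) * gamc a z"
proof -
  have "((\<lambda>x. complex_of_real ((1 / sqrt (2 * pi * a)) ^ CARD('n)) * complex_of_real (exp (- (1 / (2 * a)) * (norm (x - 0))\<^sup>2))) has_derivative
     (\<lambda>v. complex_of_real ((1 / sqrt (2 * pi * a)) ^ CARD('n)) * complex_of_real (- 2 * (1 / (2 * a)) * ((z - 0) \<bullet> v) * exp (- (1 / (2 * a)) * (norm (z - 0))\<^sup>2)))) (at z)"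
    by (rule has_derivative_mult_right[OF has_derivative_gaussian])
  from partial_eqI[OF this] show ?thesis
    using a by (simp add: gam_def[abs_def] inner_axis mult_ac)
qed

text \<open>
  The raising operator: differentiating a Hermite function raises the degree.\<close>

lemma partial_hem_gam:
  assumes a: "a > 0"
  shows "partial i (\<lambda>z. hemc a D z * gamc a z) = (\<lambda>z. - complex_of_real (1 / a) * (hemc a (D(i := Suc (D i))) z * gamc a z))"
  unfolding partial_mult[OF regular_SucD(1)[OF regular_hem] schwartz_differentiable[OF schwartz_gam[OF a]]] partial_hem partial_gam[OF a] hem_Suc
  using a by (auto simp: fun_eq_iff field_simps)

lemma schwartz_moderate_gam:
  assumes "a > 0" "\<And>m. regular moderate m p" shows "schwartz (\<lambda>z. p z * gamc a z)"
  using schwartz_mult[OF schwartz_gam[OF assms(1)] assms(2)] by (simp add: mult.commute)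

lemma integral_by_parts:
  fixes f g :: "real^'n::finite \<Rightarrow> complex"
  assumes f: "\<And>m. regular moderate m f" and g: "schwartz g"
  shows "(LINT z|lborel. f z * partial i g z) = - (LINT z|lborel. partial i f z * g z)"
proof -
  have s: "schwartz (\<lambda>z. h z * k z)" if "\<And>m. regular moderate m h" "schwartz k" for h k :: "real^'n \<Rightarrow> complex"
    using schwartz_mult[OF that(2,1)] by (simp add: mult.commute)
  have "0 = (LINT z|lborel. partial i (\<lambda>z. f z * g z) z)"
    by (rule integral_partial_schwartz[OF s[OF f g], symmetric])
  also have "\<dots> = (LINT z|lborel. f z * partial i g z + partial i f z * g z)"
    unfolding partial_mult[OF regular_SucD(1)[OF f] schwartz_differentiable[OF g]] ..
  also have "\<dots> = (LINT z|lborel. f z * partial i g z) + (LINT z|lborel. partial i f z * g z)"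
    by (rule Bochner_Integration.integral_add)
      (intro schwartz_integrable s f schwartz_partial g regular_partial)+
  finally show ?thesis by (simp add: add_eq_0_iff)
qed

text \<open>
  Normalised so that the coefficient is the derivative of order D, at 0, of the convolution of Q with the
  Gaussian density.\<close>

definition hcoef :: "real \<Rightarrow> (real^'n::finite \<Rightarrow> complex) \<Rightarrow> ('n \<Rightarrow> nat) \<Rightarrow> complex" where
  "hcoef a Q D = complex_of_real (1 / a ^ msize D) * (LINT z|lborel. Q z * (hemc a D z * gamc a z))"

text \<open>
  Integration by parts moves the derivative hidden in a Hermite function of higher degree onto Q.\<close>

lemma hem_raise:
  assumes a: "a > 0" and Q: "\<And>m. regular moderate m Q"
  shows "hcoef a Q (D(i := Suc (D i))) = hcoef a (partial i Q) D"
proof -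
  have "(LINT z|lborel. Q z * partial i (\<lambda>z. hemc a D z * gamc a z) z) = - (LINT z|lborel. partial i Q z * (hemc a D z * gamc a z))"
    by (rule integral_by_parts[OF Q schwartz_moderate_gam[OF a regular_hem]])
  then have "(LINT z|lborel. Q z * (- complex_of_real (1 / a) * (hemc a (D(i := Suc (D i))) z * gamc a z))) = - (LINT z|lborel. partial i Q z * (hemc a D z * gamc a z))"
    unfolding partial_hem_gam[OF a] .
  moreover have "(LINT z|lborel. Q z * (- complex_of_real (1 / a) * (hemc a (D(i := Suc (D i))) z * gamc a z))) =
     - complex_of_real (1 / a) * (LINT z|lborel. Q z * (hemc a (D(i := Suc (D i))) z * gamc a z))"
    by (subst integral_mult_right_zero[symmetric], rule Bochner_Integration.integral_cong) (auto simp: mult_ac)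
  ultimately have "complex_of_real (1 / a) * (LINT z|lborel. Q z * (hemc a (D(i := Suc (D i))) z * gamc a z)) = (LINT z|lborel. partial i Q z * (hemc a D z * gamc a z))"
    by (simp only: mult_minus_left neg_equal_iff_equal)
  then show ?thesis
    unfolding hcoef_def msize_Suc by (simp add: mult.assoc power_Suc2 flip: divide_divide_eq_left)
qed

lemma hcoef_cmult: "hcoef a (\<lambda>z. c * Q z) D = c * hcoef a Q D"
  by (simp add: hcoef_def mult.assoc)

text \<open>
  Repeated raising differentiates one Hermite polynomial as often as the degree of the other one
  demands, and nothing or a constant survives.\<close>

lemma hem_orthogonal:
  assumes a: "a > 0"
  shows "hcoef a (hemc a C) D = (if C = D then of_nat (mfact D) else 0)"
proof (induction "msize D" arbitrary: C D)
  case 0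
  then have D: "D = (\<lambda>_. 0)" by (simp add: msize_eq_0)
  show ?case
  proof (cases "msize C")
    case 0
    then have C: "C = (\<lambda>_. 0)" by (simp add: msize_eq_0)
    show ?thesis unfolding C D by (simp add: hcoef_def integral_complex_of_real gam_integral[OF a] mfact_def)
  next
    case (Suc k)
    then obtain i B where C: "C = B(i := Suc (B i))" "msize B = k" by (rule msize_SucE)
    have "hcoef a (hemc a C) D = complex_of_real (a ^ msize C) * hcoef a (\<lambda>_. 1) C"
      unfolding D hcoef_def using a by simp
    also have "hcoef a (\<lambda>_. 1) C = hcoef a (partial i (\<lambda>_. 1)) B"
      unfolding C(1) by (rule hem_raise[OF a regular_moderate_const])
    also have "\<dots> = 0" by (simp add: partial_const hcoef_def)
    finally show ?thesis using Suc D by auto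
  qed
next
  case (Suc k)
  obtain i B where D: "D = B(i := Suc (B i))" and B: "msize B = k" using msize_SucE[OF Suc.hyps(2)[symmetric]] .
  have "hcoef a (hemc a C) D = hcoef a (partial i (hemc a C)) B"
    unfolding D by (rule hem_raise[OF a regular_hem])
  also have "\<dots> = of_nat (C i) * hcoef a (hemc a (C(i := C i - 1))) B"
    unfolding partial_hem hcoef_cmult ..
  also have "hcoef a (hemc a (C(i := C i - 1))) B = (if C(i := C i - 1) = B then of_nat (mfact B) else 0)"
    by (rule Suc.hyps(1)) (simp add: B)
  finally have e: "hcoef a (hemc a C) D = of_nat (C i) * (if C(i := C i - 1) = B then of_nat (mfact B) else 0)" .
  show ?case
  proof (cases "C = D")
    case True
    then have "C(i := C i - 1) = B" "C i = Suc (B i)" unfolding D by auto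
    then show ?thesis unfolding e using True D mfact_Suc[of B i] by (simp add: algebra_simps)
  next
    case False
    have "C i = 0 \<or> C(i := C i - 1) \<noteq> B"
    proof (rule ccontr)
      assume "\<not> ?thesis"
      then have 1: "C i \<noteq> 0" "C(i := C i - 1) = B" by auto
      have "C = (C(i := C i - 1))(i := Suc ((C(i := C i - 1)) i))" using 1(1) by auto
      then have "C = D" unfolding 1(2) D .
      with False show False by simp
    qed
    then show ?thesis unfolding e using False by auto
  qed
qed

section \<open>The Hermite expansion reproduces polynomials\<close>

inductive hspan :: "real \<Rightarrow> nat \<Rightarrow> (real^'n::finite \<Rightarrow> complex) \<Rightarrow> bool" for a where
  hspan_base: "msize C \<le> m \<Longrightarrow> hspan a m (hemc a C)"
| hspan_add: "hspan a m p \<Longrightarrow> hspan a m q \<Longrightarrow> hspan a m (\<lambda>z. p z + q z)"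
| hspan_cmult: "hspan a m p \<Longrightarrow> hspan a m (\<lambda>z. c * p z)"

lemma hspan_coord: "hspan a m q \<Longrightarrow> hspan a (Suc m) (\<lambda>z. complex_of_real (z $ i) * q z)"
proof (induction rule: hspan.induct)
  case (hspan_base C m)
  have "msize (C(i := C i - 1)) \<le> msize C" unfolding msize_def by (rule sum_mono) auto
  then have "hspan a (Suc m) (\<lambda>z. hemc a (C(i := Suc (C i))) z + complex_of_real (a * real (C i)) * hemc a (C(i := C i - 1)) z)"
    using hspan_base by (intro hspan.intros) auto
  then show ?case by (simp add: hem_Suc)
next
  case (hspan_add m p q)
  then show ?case using hspan.hspan_add by (simp add: distrib_left)
next
  case (hspan_cmult m p c)
  from hspan.hspan_cmult[OF hspan_cmult.IH, of c] show ?case by (simp add: mult.left_commute)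
qed

lemma polyn_hspan: "polyn m p \<Longrightarrow> hspan a m p"
proof (induction rule: polyn.induct)
  case (polyn_const m c)
  from hspan_cmult[OF hspan_base[of "\<lambda>_. 0" m a], of c] show ?case by simp
qed (auto intro: hspan.hspan_add hspan_coord)

definition index_pairs :: "nat \<Rightarrow> (('n::finite \<Rightarrow> nat) \<times> ('n \<Rightarrow> nat)) set" where
  "index_pairs N = {(A, B). msize A + msize B \<le> N}"

lemma finite_index_pairs: "finite (index_pairs N)"
  by (rule finite_subset[of _ "{A. msize A \<le> N} \<times> {B. msize B \<le> N}"])
    (auto simp: index_pairs_def finite_msize_le)

lemma sum_index_pairs:
  "(\<Sum>m\<le>N. \<Sum>l\<le>m. \<Sum>A | msize A = l. \<Sum>B | msize B = m - l. F A B) = (\<Sum>(A, B)\<in>index_pairs N. F A B)"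
proof -
  have "(\<Sum>m\<le>N. \<Sum>l\<le>m. \<Sum>A | msize A = l. \<Sum>B | msize B = m - l. F A B) =
    (\<Sum>(l, j)\<in>{(l, j). l + j \<le> N}. \<Sum>A | msize A = l. \<Sum>B | msize B = j. F A B)"
    by (rule sum.triangle_reindex_eq[symmetric])
  also have "\<dots> = (\<Sum>y\<in>{(l, j). l + j \<le> N}. \<Sum>(A, B)\<in>{x. x \<in> index_pairs N \<and> (case x of (A, B) \<Rightarrow> (msize A, msize B)) = y}. F A B)"
  proof (rule sum.cong[OF refl], clarify)
    fix l j assume "l + j \<le> N"
    then have eq: "{x. x \<in> index_pairs N \<and> (case x of (A, B) \<Rightarrow> (msize A, msize B)) = (l, j)} = {A. msize A = l} \<times> {B. msize B = j}"
      by (auto simp: index_pairs_def)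
    show "(\<Sum>A | msize A = l. \<Sum>B | msize B = j. F A B) = (\<Sum>(A, B)\<in>{x. x \<in> index_pairs N \<and> (case x of (A, B) \<Rightarrow> (msize A, msize B)) = (l, j)}. F A B)"
      unfolding eq by (rule sum.cartesian_product)
  qed
  also have "\<dots> = (\<Sum>(A, B)\<in>index_pairs N. F A B)"
  proof (rule sum.group)
    show "finite {(l, j). l + j \<le> N}" by (rule finite_subset[of _ "{..N} \<times> {..N}"]) auto
    show "(\<lambda>(A, B). (msize A, msize B)) ` index_pairs N \<subseteq> {(l, j). l + j \<le> N}" by (auto simp: index_pairs_def)
  qed (rule finite_index_pairs)
  finally show ?thesis .
qed

lemma hcoef_add:
  assumes "a > 0" "\<And>m. regular moderate m p" "\<And>m. regular moderate m q"
  shows "hcoef a (\<lambda>z. p z + q z) D = hcoef a p D + hcoef a q D"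
proof -
  have i: "integrable lborel (\<lambda>z. p z * (hemc a D z * gamc a z))" if "\<And>m. regular moderate m p" for p
    using schwartz_integrable[OF schwartz_moderate_gam[OF assms(1), of "\<lambda>z. p z * hemc a D z", OF regular_moderate_mult[OF that regular_hem]]]
    by (simp add: mult.assoc)
  show ?thesis unfolding hcoef_def distrib_right Bochner_Integration.integral_add[OF i[OF assms(2)] i[OF assms(3)]] distrib_left ..
qed

lemma regular_hspan: "hspan a m p \<Longrightarrow> regular moderate k p"
  by (induction rule: hspan.induct) (auto intro: regular_hem regular_moderate_add regular_moderate_mult regular_moderate_const)

text \<open>
  For a Hermite polynomial all coefficients with A + B \<noteq> C vanish by orthogonality, and what remains is
  the addition formula for Hermite polynomials.\<close>

lemma hermite_expansion_hspan:
  assumes a: "a > 0"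
  shows "hspan a N Q \<Longrightarrow> Q (z + h) = (\<Sum>(A, B)\<in>index_pairs N. hcoef a Q (\<lambda>i. A i + B i) * hemc a A z * mpow (coord h) B / of_nat (mfact A * mfact B))"
proof (induction rule: hspan.induct)
  case (hspan_base C N)
  let ?t = "\<lambda>A B. hemc a A z * mpow (coord h) B / of_nat (mfact A * mfact B)"
  let ?S = "\<Pi>\<^sub>E i\<in>(UNIV::'a set). {..C i}"
  (* the pairs (A, B) with A + B = C *)
  let ?f = "\<lambda>A. (A, \<lambda>i. C i - A i)"
  have "(\<Sum>(A, B)\<in>index_pairs N. hcoef a (hemc a C) (\<lambda>i. A i + B i) * hemc a A z * mpow (coord h) B / of_nat (mfact A * mfact B))
      = (\<Sum>x\<in>?f ` ?S. of_nat (mfact C) * (case x of (A, B) \<Rightarrow> ?t A B))"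
  proof (rule sum.mono_neutral_cong_right[OF finite_index_pairs])
    show "?f ` ?S \<subseteq> index_pairs N"
    proof
      fix x assume "x \<in> ?f ` ?S"
      then obtain A where A: "A \<in> ?S" "x = ?f A" by blast
      then have le: "A i \<le> C i" for i by (auto simp: PiE_UNIV_domain)
      have "msize A + msize (\<lambda>i. C i - A i) = msize C"
        unfolding msize_def sum.distrib[symmetric] by (rule sum.cong) (auto simp: le)
      then show "x \<in> index_pairs N" using A hspan_base by (simp add: index_pairs_def)
    qed
    show "\<forall>x\<in>index_pairs N - ?f ` ?S. (case x of (A, B) \<Rightarrow> hcoef a (hemc a C) (\<lambda>i. A i + B i) * hemc a A z * mpow (coord h) B / of_nat (mfact A * mfact B)) = 0"
    proof (rule ballI, clarify)
      fix A B assume x: "(A, B) \<in> index_pairs N" "(A, B) \<notin> ?f ` ?S"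
      have "C \<noteq> (\<lambda>i. A i + B i)"
      proof
        assume C: "C = (\<lambda>i. A i + B i)"
        then have "A \<in> ?S" "(A, B) = ?f A" by (auto simp: PiE_UNIV_domain)
        with x(2) show False by blast
      qed
      then show "hcoef a (hemc a C) (\<lambda>i. A i + B i) * hemc a A z * mpow (coord h) B / of_nat (mfact A * mfact B) = 0"
        by (simp add: hem_orthogonal[OF a])
    qed
    fix x assume "x \<in> ?f ` ?S"
    then obtain A where A: "A \<in> ?S" "x = ?f A" by blast
    then have le: "A i \<le> C i" for i by (auto simp: PiE_UNIV_domain)
    then have "(\<lambda>i. A i + (C i - A i)) = C" by (auto simp: fun_eq_iff)
    then show "(case x of (A, B) \<Rightarrow> hcoef a (hemc a C) (\<lambda>i. A i + B i) * hemc a A z * mpow (coord h) B / of_nat (mfact A * mfact B))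
        = of_nat (mfact C) * (case x of (A, B) \<Rightarrow> ?t A B)"
      using A by (simp add: hem_orthogonal[OF a])
  qed
  also have "\<dots> = of_nat (mfact C) * (\<Sum>A\<in>?S. ?t A (\<lambda>i. C i - A i))"
    unfolding sum_distrib_left by (subst sum.reindex) (auto simp: inj_on_def)
  also have "(\<Sum>A\<in>?S. ?t A (\<lambda>i. C i - A i)) = complex_of_real (hem a C (z + h) / real (mfact C))"
    unfolding hem_add of_real_sum by (intro sum.cong refl) (simp add: mpow_def)
  also have "of_nat (mfact C) * \<dots> = hemc a C (z + h)" using mfact_pos[of C] by simp
  finally show ?case by simp
next
  case (hspan_add N p q)
  have "hcoef a (\<lambda>z. p z + q z) D = hcoef a p D + hcoef a q D" for D
    by (rule hcoef_add[OF a]) (rule regular_hspan, fact)+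
  then show ?case unfolding hspan_add.IH
    by (simp add: sum.distrib[symmetric] split_beta distrib_right add_divide_distrib)
next
  case (hspan_cmult N p c)
  then show ?case unfolding hspan_cmult.IH hcoef_cmult
    by (simp add: sum_distrib_left split_beta mult.assoc)
qed

lemma hermite_expansion_polyn:
  assumes "a > 0" "polyn N Q"
  shows "Q (z + h) = (\<Sum>(A, B)\<in>index_pairs N. hcoef a Q (\<lambda>i. A i + B i) * hemc a A z * mpow (coord h) B / of_nat (mfact A * mfact B))"
  by (rule hermite_expansion_hspan[OF assms(1) polyn_hspan[OF assms(2)]])

section \<open>Shearing phase space\<close>

text \<open>
  For fixed y the shear is a translation in u, so it preserves measure by Fubini.\<close>

lemma distr_shear:
  "distr lborel borel (\<lambda>(u, y). (u + h *\<^sub>R y, y)) = (lborel :: ('a::euclidean_space \<times> 'a) measure)"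
proof -
  let ?T = "\<lambda>(u::'a, y). (u + h *\<^sub>R y, y)"
  have T[measurable]: "?T \<in> borel \<rightarrow>\<^sub>M borel"
    by (rule borel_measurable_continuous_onI) (auto simp: split_beta intro!: continuous_intros)
  have "distr lborel borel ?T = lborel"
  proof (rule measure_eqI)
    fix A :: "('a \<times> 'a) set" assume "A \<in> sets (distr lborel borel ?T)"
    then have A[measurable]: "A \<in> sets borel" by simp
    have TA: "?T -` A \<inter> space borel \<in> sets borel" using measurable_sets[OF T A] .
    have A2: "A \<in> sets (lborel \<Otimes>\<^sub>M lborel)" and TA2: "?T -` A \<in> sets (lborel \<Otimes>\<^sub>M lborel)"
      unfolding lborel_prod using A TA by simp_all
    have "emeasure (distr lborel borel ?T) A = emeasure (lborel \<Otimes>\<^sub>M lborel) (?T -` A)"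
      by (simp add: emeasure_distr lborel_prod)
    also have "\<dots> = (\<integral>\<^sup>+y. emeasure lborel ((\<lambda>u. (u, y)) -` (?T -` A)) \<partial>lborel)"
      by (rule lborel_pair.emeasure_pair_measure_alt2[OF TA2])
    also have "\<dots> = (\<integral>\<^sup>+y. emeasure lborel ((\<lambda>u. (u, y)) -` A) \<partial>lborel)"
    proof (rule nn_integral_cong)
      fix y :: 'a
      have B: "(\<lambda>u. (u, y)) -` A \<in> sets borel" using sets_Pair2[OF A2] by simp
      have "emeasure lborel ((\<lambda>u. (u, y)) -` A) = emeasure (distr lborel borel ((+) (h *\<^sub>R y))) ((\<lambda>u. (u, y)) -` A)"
        by (simp add: lborel_distr_plus)
      also have "\<dots> = emeasure lborel ((+) (h *\<^sub>R y) -` ((\<lambda>u. (u, y)) -` A))"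
        using B by (simp add: emeasure_distr)
      also have "(+) (h *\<^sub>R y) -` ((\<lambda>u. (u, y)) -` A) = (\<lambda>u. (u, y)) -` (?T -` A)" by (auto simp: add.commute)
      finally show "emeasure lborel ((\<lambda>u. (u, y)) -` (?T -` A)) = emeasure lborel ((\<lambda>u. (u, y)) -` A)" ..
    qed
    also have "\<dots> = emeasure (lborel \<Otimes>\<^sub>M lborel) A"
      by (rule lborel_pair.emeasure_pair_measure_alt2[OF A2, symmetric])
    finally show "emeasure (distr lborel borel ?T) A = emeasure lborel A" by (simp add: lborel_prod)
  qed simp
  then show ?thesis .
qed

lemma shear_measurable[measurable]:
  "(\<lambda>(u::'a::euclidean_space, y). (u + h *\<^sub>R y, y)) \<in> borel \<rightarrow>\<^sub>M borel"
  by (rule borel_measurable_continuous_onI) (auto simp: split_beta intro!: continuous_intros)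

lemma integral_shear:
  fixes F :: "'a::euclidean_space \<times> 'a \<Rightarrow> 'b::{banach, second_countable_topology}"
  assumes [measurable]: "F \<in> borel_measurable borel"
  shows "(LINT p|lborel. F (fst p + h *\<^sub>R snd p, snd p)) = (LINT p|lborel. F p)"
    and "integrable lborel (\<lambda>p. F (fst p + h *\<^sub>R snd p, snd p)) \<longleftrightarrow> integrable lborel F"
proof -
  have T: "(\<lambda>(u::'a, y). (u + h *\<^sub>R y, y)) \<in> lborel \<rightarrow>\<^sub>M borel" by measurable
  show "(LINT p|lborel. F (fst p + h *\<^sub>R snd p, snd p)) = (LINT p|lborel. F p)"
    using integral_distr[OF T assms] unfolding distr_shear by (simp add: split_beta)
  show "integrable lborel (\<lambda>p. F (fst p + h *\<^sub>R snd p, snd p)) \<longleftrightarrow> integrable lborel F"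
    using integrable_distr_eq[OF T assms] unfolding distr_shear by (simp add: split_beta)
qed

text \<open>
  This allows V to be changed on a null set inside integrals over (u, y), where it is evaluated at
  u + h y.\<close>

lemma AE_shear:
  assumes "AE x in (lborel :: 'a::euclidean_space measure). P x"
  shows "AE p in (lborel :: ('a \<times> 'a) measure). P (fst p + h *\<^sub>R snd p)"
proof -
  obtain N where N: "N \<in> null_sets (lborel :: 'a measure)" "{x. \<not> P x} \<subseteq> N"
    using assms by (auto simp: eventually_ae_filter)
  have Nm[measurable]: "N \<in> sets borel" using N by auto
  have z: "N \<times> (UNIV :: 'a set) \<in> null_sets lborel"
    using lborel.times_in_null_sets1[OF N(1), of "UNIV :: 'a set"] by (simp add: lborel_prod)
  have T: "(\<lambda>(u::'a, y). (u + h *\<^sub>R y, y)) \<in> lborel \<rightarrow>\<^sub>M borel" by measurable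
  have "AE p in (lborel :: ('a \<times> 'a) measure). p \<notin> N \<times> UNIV"
    by (rule AE_not_in[OF z])
  then have "AE p in distr lborel borel (\<lambda>(u::'a, y). (u + h *\<^sub>R y, y)). p \<notin> N \<times> UNIV"
    unfolding distr_shear .
  then have "AE p in (lborel :: ('a \<times> 'a) measure). (case p of (u, y) \<Rightarrow> (u + h *\<^sub>R y, y)) \<notin> N \<times> UNIV"
    by (rule AE_distrD[OF T])
  then show ?thesis by eventually_elim (use N(2) in auto)
qed

lemma lebesgue_measurable_AE:
  fixes f g :: "'a::euclidean_space \<Rightarrow> 'b::topological_space"
  assumes g: "g \<in> borel_measurable lborel" and ae: "AE x in lborel. f x = g x"
  shows "f \<in> borel_measurable lebesgue"
proof (rule measurableI)
  fix S :: "'b set" assume S: "S \<in> sets borel"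
  obtain N where N: "N \<in> null_sets (lborel :: 'a measure)" "{x. f x \<noteq> g x} \<subseteq> N"
    using ae by (auto simp: eventually_ae_filter)
  have gS: "g -` S \<in> sets lebesgue" using measurable_sets[OF g S] by auto
  have Nl: "N \<in> sets lebesgue" using N(1) by auto
  have "f -` S \<inter> N \<in> null_sets lebesgue"
    by (rule null_sets_completion_subset[OF _ null_sets_completionI[OF N(1)]]) auto
  then have "(g -` S - N) \<union> (f -` S \<inter> N) \<in> sets lebesgue" using gS Nl by blast
  moreover have "f -` S = (g -` S - N) \<union> (f -` S \<inter> N)" using N(2) by auto
  ultimately show "f -` S \<inter> space lebesgue \<in> sets lebesgue" by simp
qed simp

lemma lebesgue_integral_AE:
  fixes f g :: "'a::euclidean_space \<Rightarrow> 'b::{banach, second_countable_topology}"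
  assumes g: "g \<in> borel_measurable lborel" and ae: "AE x in lborel. f x = g x"
  shows "(LINT x|lebesgue. f x) = (LINT x|lborel. g x)"
proof -
  have "(LINT x|lebesgue. f x) = (LINT x|lebesgue. g x)"
    by (rule integral_cong_AE[OF lebesgue_measurable_AE[OF g ae] measurable_completion[OF g] AE_completion[OF ae]])
  also have "\<dots> = (LINT x|lborel. g x)" by (rule integral_completion[OF g])
  finally show ?thesis .
qed

section \<open>Gaussian averages of a rapidly decreasing function\<close>

lemma has_derivative_gaussian_affine:
  fixes f :: "real^'n::finite \<Rightarrow> real^'n"
  assumes "(f has_derivative f') (at x)"
  shows "((\<lambda>x. complex_of_real (exp (- c * (norm (f x))\<^sup>2))) has_derivative
     (\<lambda>v. complex_of_real (- 2 * c * (f x \<bullet> f' v) * exp (- c * (norm (f x))\<^sup>2)))) (at x)"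
proof -
  have "((\<lambda>x. f x \<bullet> f x) has_derivative (\<lambda>v. f x \<bullet> f' v + f' v \<bullet> f x)) (at x)"
    by (rule has_derivative_inner[OF assms assms])
  from has_derivative_mult_right[OF this, of "- c"]
  have "((\<lambda>x. - c * (f x \<bullet> f x)) has_derivative (\<lambda>v. - 2 * c * (f x \<bullet> f' v))) (at x)"
    by (simp add: inner_commute algebra_simps)
  from DERIV_compose_FDERIV[OF DERIV_exp this]
  show ?thesis unfolding power2_norm_eq_inner by (intro has_derivative_of_real) 
qed

context
  fixes \<alpha> \<gamma> :: real and x2 \<kappa> :: "real^'n::finite"
  assumes pos: "\<alpha> \<ge> 0" "\<gamma> \<ge> 0"
begin

text \<open>
  The kernel that appears when the y-integral of the Wigner kernel is rewritten in the two points
  p = u + \<open>\<epsilon>\<close> y / 2 and q = u - \<open>\<epsilon>\<close> y / 2.\<close>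

definition gker :: "real^'n \<Rightarrow> real^'n \<Rightarrow> complex" where
  "gker p q = complex_of_real (exp (- \<alpha> * (norm (p + q - x2))\<^sup>2)) * complex_of_real (exp (- \<gamma> * (norm (p - q))\<^sup>2)) * chi \<kappa> (p - q)"

definition gavg :: "(real^'n \<Rightarrow> complex) \<Rightarrow> real^'n \<Rightarrow> complex" where
  "gavg m p = (LINT q|lborel. gker p q * m q)"

lemma gker_measurable[measurable]: "case_prod gker \<in> borel_measurable (borel \<Otimes>\<^sub>M borel)"
  unfolding gker_def[abs_def] by measurable

lemma norm_gker: "norm (gker p q) \<le> 1"
proof -
  have "exp (- \<alpha> * (norm (p + q - x2))\<^sup>2) * exp (- \<gamma> * (norm (p - q))\<^sup>2) \<le> 1 * 1"
    by (rule mult_mono) (use pos in auto)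
  then show ?thesis by (simp add: gker_def norm_mult)
qed

lemma gker_has_derivative:
  "((\<lambda>p. gker p q) has_derivative (\<lambda>v. gker p q * (complex_of_real (- 2 * \<alpha> * ((p + q - x2) \<bullet> v) - 2 * \<gamma> * ((p - q) \<bullet> v)) + 2 * pi * \<i> * complex_of_real (\<kappa> \<bullet> v)))) (at p)"
proof -
  have 1: "((\<lambda>p. p + q - x2) has_derivative (\<lambda>v. v)) (at p)" "((\<lambda>p. p - q) has_derivative (\<lambda>v. v)) (at p)"
    by (auto intro!: derivative_eq_intros)
  have 2: "((\<lambda>p. chi \<kappa> (p - q)) has_derivative (\<lambda>v. 2 * pi * \<i> * complex_of_real (\<kappa> \<bullet> v) * chi \<kappa> (p - q))) (at p)"
    by (rule has_derivative_compose[where f="\<lambda>p. p - q" and g="chi \<kappa>", OF 1(2) chi_has_derivative])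
  from has_derivative_mult[OF has_derivative_mult[OF has_derivative_gaussian_affine[OF 1(1), of \<alpha>] has_derivative_gaussian_affine[OF 1(2), of \<gamma>]] 2]
  show ?thesis unfolding gker_def by (rule has_derivative_eq_rhs) (simp add: fun_eq_iff algebra_simps)
qed

lemma gker_mult_integrable:
  assumes [measurable]: "m \<in> borel_measurable borel" and "decay m"
  shows "integrable lborel (\<lambda>q. gker p q * m q)"
proof (rule Bochner_Integration.integrable_bound[OF integrable_decay[OF assms]])
  show "AE q in lborel. norm (gker p q * m q) \<le> norm (m q)"
    by (rule AE_I2) (simp add: norm_mult mult_left_le_one_le norm_gker)
qed measurable

lemma gavg_has_derivative:
  assumes m[measurable]: "m \<in> borel_measurable borel" and d: "decay m"
  shows "(gavg m has_derivative (\<lambda>v. LINT q|lborel. gker p q * (complex_of_real (- 2 * \<alpha> * ((p + q - x2) \<bullet> v) - 2 * \<gamma> * ((p - q) \<bullet> v)) + 2 * pi * \<i> * complex_of_real (\<kappa> \<bullet> v)) * m q)) (at p)"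
proof -
  define L where "L = 2 * \<alpha> * (norm p + 1 + norm x2) + 2 * \<gamma> * (norm p + 1) + 2 * pi * norm \<kappa>"
  obtain C where C: "C \<ge> 0" "\<And>q. norm (m q) * (1 + norm q) ^ 1 \<le> C * weight q" using decay_weight_bound[OF d] by metis
  show ?thesis unfolding gavg_def[abs_def]
  proof (rule has_derivative_integral[where r=1 and g="\<lambda>q. L * (C * weight q)"])
    show "integrable lborel (\<lambda>q. gker p q * m q)" for p by (rule gker_mult_integrable[OF m d])
    show "((\<lambda>p. gker p q * m q) has_derivative (\<lambda>v. gker p q * (complex_of_real (- 2 * \<alpha> * ((p + q - x2) \<bullet> v) - 2 * \<gamma> * ((p - q) \<bullet> v)) + 2 * pi * \<i> * complex_of_real (\<kappa> \<bullet> v)) * m q)) (at p)" for p q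
      by (rule has_derivative_mult_left[OF gker_has_derivative])
    show "integrable lborel (\<lambda>q::real^'n. L * (C * weight q))" by (intro integrable_mult_right integrable_weight)
    fix p' q v :: "real^'n" assume "p' \<in> ball p 1"
    then have p': "norm p' \<le> norm p + 1" using norm_triangle_ineq2[of p' p] by (simp add: dist_norm norm_minus_commute)
    have n1: "norm (p' + q - x2) \<le> (norm p + 1 + norm x2) * (1 + norm q)"
    proof -
      have "norm (p' + q - x2) \<le> norm p' + norm q + norm x2"
        using norm_triangle_ineq4[of "p' + q" x2] norm_triangle_ineq[of p' q] by linarith
      also have "\<dots> \<le> (norm p + 1 + norm x2) + 1 * norm q" using p' by simp
      also have "\<dots> \<le> (norm p + 1 + norm x2) + (norm p + 1 + norm x2) * norm q"
        by (intro add_left_mono mult_right_mono) auto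
      finally show ?thesis by (simp add: algebra_simps)
    qed
    have n2: "norm (p' - q) \<le> (norm p + 1) * (1 + norm q)"
    proof -
      have "norm (p' - q) \<le> norm p' + norm q" by (rule norm_triangle_ineq4)
      also have "\<dots> \<le> (norm p + 1) + 1 * norm q" using p' by simp
      also have "\<dots> \<le> (norm p + 1) + (norm p + 1) * norm q" by (intro add_left_mono mult_right_mono) auto
      finally show ?thesis by (simp add: algebra_simps)
    qed
    let ?X = "complex_of_real (- 2 * \<alpha> * ((p' + q - x2) \<bullet> v) - 2 * \<gamma> * ((p' - q) \<bullet> v)) + 2 * pi * \<i> * complex_of_real (\<kappa> \<bullet> v)"
    have c1: "\<bar>(p' + q - x2) \<bullet> v\<bar> \<le> (norm p + 1 + norm x2) * (1 + norm q) * norm v"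
      by (rule order_trans[OF Cauchy_Schwarz_ineq2 mult_right_mono[OF n1]]) simp
    have c2: "\<bar>(p' - q) \<bullet> v\<bar> \<le> (norm p + 1) * (1 + norm q) * norm v"
      by (rule order_trans[OF Cauchy_Schwarz_ineq2 mult_right_mono[OF n2]]) simp
    have c3: "\<bar>\<kappa> \<bullet> v\<bar> \<le> norm \<kappa> * (1 + norm q) * norm v"
    proof -
      have "norm \<kappa> * 1 * norm v \<le> norm \<kappa> * (1 + norm q) * norm v" by (intro mult_right_mono mult_left_mono) auto
      then show ?thesis using Cauchy_Schwarz_ineq2[of \<kappa> v] by simp
    qed
    have "norm ?X \<le> 2 * \<alpha> * \<bar>(p' + q - x2) \<bullet> v\<bar> + 2 * \<gamma> * \<bar>(p' - q) \<bullet> v\<bar> + 2 * pi * \<bar>\<kappa> \<bullet> v\<bar>"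
    proof -
      have "norm ?X \<le> norm (complex_of_real (- 2 * \<alpha> * ((p' + q - x2) \<bullet> v) - 2 * \<gamma> * ((p' - q) \<bullet> v))) + norm (2 * pi * \<i> * complex_of_real (\<kappa> \<bullet> v))"
        by (rule norm_triangle_ineq)
      moreover have "norm (complex_of_real (- 2 * \<alpha> * ((p' + q - x2) \<bullet> v) - 2 * \<gamma> * ((p' - q) \<bullet> v))) \<le> \<bar>2 * \<alpha> * ((p' + q - x2) \<bullet> v)\<bar> + \<bar>2 * \<gamma> * ((p' - q) \<bullet> v)\<bar>"
        unfolding norm_of_real by linarith
      ultimately show ?thesis using pos by (simp add: norm_mult abs_mult)
    qed
    also have "\<dots> \<le> 2 * \<alpha> * ((norm p + 1 + norm x2) * (1 + norm q) * norm v) + 2 * \<gamma> * ((norm p + 1) * (1 + norm q) * norm v) + 2 * pi * (norm \<kappa> * (1 + norm q) * norm v)"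
      using pos by (intro add_mono mult_left_mono c1 c2 c3) auto
    also have "\<dots> = L * ((1 + norm q) * norm v)" by (simp add: L_def algebra_simps)
    finally have X: "norm ?X \<le> L * ((1 + norm q) * norm v)" .
    have L0: "L \<ge> 0" unfolding L_def using pos by (intro add_nonneg_nonneg mult_nonneg_nonneg) auto
    have "norm (gker p' q * ?X * m q) \<le> 1 * (L * ((1 + norm q) * norm v)) * norm (m q)"
      unfolding norm_mult by (intro mult_right_mono mult_mono X norm_gker) auto
    also have "\<dots> = L * (norm (m q) * (1 + norm q) ^ 1) * norm v" by simp
    also have "\<dots> \<le> L * (C * weight q) * norm v" by (intro mult_right_mono mult_left_mono C L0) auto
    finally show "norm (gker p' q * ?X * m q) \<le> L * (C * weight q) * norm v" .
  qed (simp, measurable)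
qed

text \<open>
  A derivative of the kernel produces affine factors in p and q; the ones in p leave the integral, the
  ones in q are moved into m, where decay is preserved.\<close>

lemma partial_gavg:
  assumes m[measurable]: "m \<in> borel_measurable borel" and d: "decay m"
  shows "partial i (gavg m) p = (complex_of_real (- 2 * (\<alpha> + \<gamma>)) * complex_of_real (p $ i) + (complex_of_real (2 * \<alpha> * x2 $ i) + 2 * pi * \<i> * complex_of_real (\<kappa> $ i))) * gavg m p
     + complex_of_real (2 * (\<gamma> - \<alpha>)) * gavg (\<lambda>q. complex_of_real (q $ i) * m q) p"
proof -
  let ?c = "complex_of_real (- 2 * (\<alpha> + \<gamma>)) * complex_of_real (p $ i) + (complex_of_real (2 * \<alpha> * x2 $ i) + 2 * pi * \<i> * complex_of_real (\<kappa> $ i))"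
  have i1: "integrable lborel (\<lambda>q. ?c * (gker p q * m q))" by (intro integrable_mult_right gker_mult_integrable m d)
  have i2: "integrable lborel (\<lambda>q. complex_of_real (2 * (\<gamma> - \<alpha>)) * (gker p q * (complex_of_real (q $ i) * m q)))"
    by (intro integrable_mult_right gker_mult_integrable decay_coord_mult d) measurable
  have "partial i (gavg m) p = (LINT q|lborel. ?c * (gker p q * m q) + complex_of_real (2 * (\<gamma> - \<alpha>)) * (gker p q * (complex_of_real (q $ i) * m q)))"
    unfolding partial_eqI[OF gavg_has_derivative[OF m d]]
    by (rule Bochner_Integration.integral_cong) (simp_all add: inner_axis algebra_simps)
  also have "\<dots> = ?c * gavg m p + complex_of_real (2 * (\<gamma> - \<alpha>)) * gavg (\<lambda>q. complex_of_real (q $ i) * m q) p"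
    unfolding Bochner_Integration.integral_add[OF i1 i2] by (simp add: gavg_def)
  finally show ?thesis .
qed

lemma regular_gavg: "m \<in> borel_measurable borel \<Longrightarrow> decay m \<Longrightarrow> regular moderate n (gavg m)"
proof (induction n arbitrary: m)
  case 0
  have "gavg m differentiable_on UNIV"
    using gavg_has_derivative[OF 0] unfolding differentiable_on_def differentiable_def by blast
  moreover have "moderate (gavg m)"
  proof (rule moderate_bounded)
    show "norm (gavg m p) \<le> (LINT q|lborel. norm (m q))" for p
      unfolding gavg_def
    proof (rule order_trans[OF integral_norm_bound], rule integral_mono)
      show "integrable lborel (\<lambda>q. norm (gker p q * m q))" by (rule integrable_norm[OF gker_mult_integrable[OF 0]])
      show "integrable lborel (\<lambda>q. norm (m q))" by (rule integrable_norm[OF integrable_decay[OF 0]])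
    qed (simp add: norm_mult mult_left_le_one_le norm_gker)
  qed
  ultimately show ?case using differentiable_imp_continuous_on by auto
next
  case (Suc n)
  note [measurable] = Suc.prems(1)
  show ?case
  proof (rule regular_SucI)
    show "gavg m differentiable_on UNIV"
      using gavg_has_derivative[OF Suc.prems] unfolding differentiable_on_def differentiable_def by blast
    show "moderate (gavg m)" using regular_class[OF Suc.IH[OF Suc.prems]] .
    show "regular moderate n (partial i (gavg m))" for i
      unfolding partial_gavg[OF Suc.prems, abs_def]
      by (intro regular_moderate_add regular_moderate_mult regular_moderate_const regular_moderate_coord Suc.IH decay_coord_mult Suc.prems)
        measurable
  qed
qed

end

section \<open>Uniqueness of entire extensions\<close>

lemma entire_ray_holomorphic:
  fixes F :: "(complex^'n::finite) \<times> (complex^'n) \<Rightarrow> complex"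
  assumes "entire F"
  shows "(\<lambda>\<zeta>. F (X + \<zeta> *s X', K + \<zeta> *s K')) holomorphic_on UNIV"
  unfolding holomorphic_on_def field_differentiable_def
proof (intro ballI)
  fix \<zeta> :: complex
  let ?z = "(X + \<zeta> *s X', K + \<zeta> *s K')"
  obtain D where D: "(F has_derivative D) (at ?z)" "\<And>c v. D (c *s fst v, c *s snd v) = c * D v"
    using assms unfolding entire_def by metis
  have b: "bounded_linear (\<lambda>\<zeta>. \<zeta> *s Y)" for Y :: "complex^'n"
  proof (rule bounded_linear_intro[where K="norm Y"])
    show "(x + y) *s Y = x *s Y + y *s Y" for x y :: complex by (rule vector_sadd_rdistrib)
    show "(r *\<^sub>R x) *s Y = r *\<^sub>R (x *s Y)" for r and x :: complex
      by (simp add: vec_eq_iff)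
    show "norm (x *s Y) \<le> norm x * norm Y" for x :: complex
      by (simp add: norm_vec_def norm_mult L2_set_right_distrib)
  qed
  have "((\<lambda>\<zeta>. (X + \<zeta> *s X', K + \<zeta> *s K')) has_derivative (\<lambda>h. (h *s X', h *s K'))) (at \<zeta>)"
    by (intro has_derivative_Pair has_derivative_add_const[THEN has_derivative_eq_rhs]
        has_derivative_eq_rhs[OF has_derivative_add[OF has_derivative_const bounded_linear_imp_has_derivative[OF b]]]) auto
  from has_derivative_compose[OF this, of F D] D(1)
  have "((\<lambda>\<zeta>. F (X + \<zeta> *s X', K + \<zeta> *s K')) has_derivative (\<lambda>h. D (h *s X', h *s K'))) (at \<zeta>)" by simp
  moreover have "(\<lambda>h. D (h *s X', h *s K')) = (*) (D (X', K'))"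
    using D(2)[of _ "(X', K')"] by (auto simp: fun_eq_iff mult.commute)
  ultimately show "\<exists>f'. ((\<lambda>\<zeta>. F (X + \<zeta> *s X', K + \<zeta> *s K')) has_field_derivative f') (at \<zeta> within UNIV)"
    unfolding has_field_derivative_def by auto
qed

text \<open>
  Each complex point lies on the complex line through a real point in a real direction, parametrised by
  \<open>\<zeta> \<mapsto> X + \<zeta> Y\<close>. On such a line both functions are holomorphic in one variable and agree for real \<open>\<zeta>\<close>,
  hence also at \<open>\<zeta> = i\<close>.\<close>

lemma entire_unique:
  fixes F G :: "(complex^'n::finite) \<times> (complex^'n) \<Rightarrow> complex"
  assumes F: "entire F" and G: "entire G" and eq: "\<And>x k. F (cvec x, cvec k) = G (cvec x, cvec k)"
  shows "F = G"
proof
  fix z :: "(complex^'n) \<times> (complex^'n)"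
  define re where "re Y = (\<chi> i. Re (Y $ i))" for Y :: "complex^'n"
  define im where "im Y = (\<chi> i. Im (Y $ i))" for Y :: "complex^'n"
  have dec: "Y = cvec (re Y) + \<i> *s cvec (im Y)" for Y
    by (simp add: vec_eq_iff cvec_def re_def im_def complex_eq_iff)
  obtain X K where z: "z = (X, K)" by (cases z)
  let ?g = "\<lambda>\<zeta>. F (cvec (re X) + \<zeta> *s cvec (im X), cvec (re K) + \<zeta> *s cvec (im K)) - G (cvec (re X) + \<zeta> *s cvec (im X), cvec (re K) + \<zeta> *s cvec (im K))"
  have "?g holomorphic_on UNIV"
    by (intro holomorphic_on_diff entire_ray_holomorphic F G)
  moreover have "?g \<zeta> = 0" if "\<zeta> \<in> \<real>" for \<zeta>
  proof -
    from that obtain t where t: "\<zeta> = complex_of_real t" by (auto elim: Reals_cases)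
    have "cvec x + \<zeta> *s cvec x' = cvec (x + t *\<^sub>R x')" for x x' :: "real^'n"
      by (simp add: vec_eq_iff cvec_def t)
    then show ?thesis using eq by simp
  qed
  moreover have "(0::complex) islimpt \<real>"
  proof (rule islimpt_approachable[THEN iffD2], intro allI impI)
    fix e :: real assume "e > 0"
    then show "\<exists>x'\<in>\<real>. x' \<noteq> 0 \<and> dist x' (0::complex) < e"
      by (intro bexI[of _ "complex_of_real (e / 2)"]) auto
  qed
  ultimately have "?g \<i> = 0"
    by (intro analytic_continuation[of ?g UNIV "\<real>" 0 "\<i>"]) auto
  then show "F z = G z" using dec[of X] dec[of K] z by simp
qed

lemma entire_ext_eq:
  assumes "entire F" "\<And>x k. F (cvec x, cvec k) = w x k"
  shows "entire_ext w = F"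
  unfolding entire_ext_def
  by (rule the_equality) (use assms in \<open>auto intro: entire_unique\<close>)

section \<open>The smoothed Wigner transform as an oscillating Gaussian average\<close>

lemma fst_borel_measurable[measurable]: "(fst :: 'a::euclidean_space \<times> 'b::euclidean_space \<Rightarrow> 'a) \<in> borel \<rightarrow>\<^sub>M borel"
  by (rule borel_measurable_continuous_onI) (intro continuous_intros)

lemma snd_borel_measurable[measurable]: "(snd :: 'a::euclidean_space \<times> 'b::euclidean_space \<Rightarrow> 'b) \<in> borel \<rightarrow>\<^sub>M borel"
  by (rule borel_measurable_continuous_onI) (intro continuous_intros)

lemma pair_integrable_lborel:
  fixes F :: "'a::euclidean_space \<times> 'b::euclidean_space \<Rightarrow> 'c::{banach, second_countable_topology}"
  assumes "integrable lborel f" "integrable lborel g" "F \<in> borel_measurable borel"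
    and "\<And>x y. norm (F (x, y)) \<le> f x * (g y :: real)"
  shows "integrable lborel F"
  using pair_integrable_bound[of f g F] assms by (simp add: lborel_prod borel_prod)

lemma iterated_integral_lborel:
  fixes F :: "'a::euclidean_space \<times> 'b::euclidean_space \<Rightarrow> 'c::{banach, second_countable_topology}"
  assumes "integrable lborel F"
  shows "(LINT p|lborel. F p) = (LINT x|lborel. LINT y|lborel. F (x, y))"
  using lborel_pair.integral_fst'[of F] assms by (simp add: lborel_prod)

lemma schwartz_bounded: 
  assumes "schwartz f" shows "\<exists>B\<ge>0. \<forall>x. norm (f x) \<le> B"
proof -
  obtain B where B: "\<And>x. (1 + norm x) ^ 0 * norm (f x) \<le> B"
    using schwartz_decay[OF assms] unfolding decay_def by metis
  then show ?thesis using order_trans[OF norm_ge_zero B[of 0, simplified]] by (intro exI[of _ B]) simp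
qed

lemma cnj_borel_measurable[measurable]: "cnj \<in> borel \<rightarrow>\<^sub>M borel"
  by (rule borel_measurable_continuous_onI) (intro continuous_intros)

lemma gaussian_integrable: "c > 0 \<Longrightarrow> integrable lborel (\<lambda>y::real^'n::finite. exp (- c * (norm y)\<^sup>2))"
proof -
  assume "c > 0"
  from schwartz_integrable[OF schwartz_gaussian[OF this, of 0]]
  have "integrable lborel (\<lambda>y::real^'n. complex_of_real (exp (- c * (norm y)\<^sup>2)))" by simp
  from integrable_norm[OF this] show ?thesis by simp
qed

lemma decay_cnj: "decay f \<Longrightarrow> decay (\<lambda>x. cnj (f x))"
  by (simp add: decay_def)

locale wigner =
  fixes \<sigma>x \<sigma>k \<epsilon> :: real and f :: "real^'n::finite \<Rightarrow> complex"
  assumes pos: "\<sigma>x > 0" "\<sigma>k > 0" "\<epsilon> > 0" and f: "schwartz f"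

context wigner
begin

text \<open>
  The variance of the Gaussian in u in the definition of the transform.\<close>

definition var :: real where "var = \<epsilon> * \<sigma>x\<^sup>2 / (4 * pi)"

definition damp :: "real^'n \<Rightarrow> real" where
  "damp y = exp (- (pi * \<epsilon> * \<sigma>k\<^sup>2 / 2) * (norm y)\<^sup>2)"

definition wker :: "real^'n \<Rightarrow> real^'n \<Rightarrow> (real^'n) \<times> (real^'n) \<Rightarrow> complex" where
  "wker x k p = gamc var (fst p - x) * (chi (- k) (snd p) * complex_of_real (damp (snd p)))"

definition amp :: "(real^'n) \<times> (real^'n) \<Rightarrow> complex" where
  "amp p = f (fst p + (\<epsilon> / 2) *\<^sub>R snd p) * cnj (f (fst p - (\<epsilon> / 2) *\<^sub>R snd p))"

lemma var_pos: "var > 0" using pos by (simp add: var_def)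

lemma f_meas[measurable]: "f \<in> borel_measurable borel" by (rule schwartz_measurable[OF f])

lemma damp_measurable[measurable]: "damp \<in> borel_measurable borel"
  unfolding damp_def[abs_def] by measurable

lemma damp_integrable: "integrable lborel damp"
  unfolding damp_def[abs_def] by (rule gaussian_integrable) (use pos in simp)

lemma damp_bounds: "0 \<le> damp y" "damp y \<le> 1" using pos by (simp_all add: damp_def)

lemma wker_measurable[measurable]: "wker x k \<in> borel_measurable borel"
proof -
  note [measurable] = chi_measurable
  show ?thesis unfolding wker_def[abs_def] by measurable
qed

lemma amp_measurable[measurable]: "amp \<in> borel_measurable borel"
  unfolding amp_def[abs_def] by measurable

lemma gam_le: "gam a (z::real^'n) \<le> gam a (0::real^'n)" if "a > 0"
  using that by (simp add: gam_def mult_left_le)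

lemma norm_wker_le: "norm (wker x k p) \<le> gam var (0::real^'n) * damp (snd p)"
  using gam_le[OF var_pos, of "fst p - x"] gam_nonneg[OF var_pos, of "fst p - x"] damp_bounds[of "snd p"]
  by (simp add: wker_def norm_mult mult_right_mono)

lemma wigner_prefactor: "(sqrt 2 / (\<sigma>x * sqrt \<epsilon>)) ^ CARD('n) * exp (- (2 * pi * (norm z)\<^sup>2 / (\<epsilon> * \<sigma>x\<^sup>2))) = gam var (z::real^'n)"
proof -
  have "sqrt (2 * pi * var) = \<sigma>x * sqrt \<epsilon> / sqrt 2"
    using pos by (simp add: var_def real_sqrt_divide real_sqrt_mult)
  then have "1 / sqrt (2 * pi * var) = sqrt 2 / (\<sigma>x * sqrt \<epsilon>)" by simp
  moreover have "- (1 / (2 * var)) * (norm z)\<^sup>2 = - (2 * pi * (norm z)\<^sup>2 / (\<epsilon> * \<sigma>x\<^sup>2))"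
    using pos by (simp add: var_def field_simps)
  ultimately show ?thesis unfolding gam_def by simp
qed

lemma smoothed_wigner_wker:
  "smoothed_wigner \<sigma>x \<sigma>k \<epsilon> F g x k =
     (LINT p|lebesgue. wker x k p * (F (fst p + (\<epsilon> / 2) *\<^sub>R snd p) * cnj (g (fst p - (\<epsilon> / 2) *\<^sub>R snd p))))"
proof -
  let ?c = "complex_of_real ((sqrt 2 / (\<sigma>x * sqrt \<epsilon>)) ^ CARD('n))"
  have e: "?c * exp (- 2 * pi * \<i> * complex_of_real (k \<bullet> y) - complex_of_real (pi * \<epsilon> * \<sigma>k\<^sup>2 * (norm y)\<^sup>2 / 2)
             - complex_of_real (2 * pi * (norm (u - x))\<^sup>2 / (\<epsilon> * \<sigma>x\<^sup>2))) = wker x k (u, y)" for u y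
  proof -
    have "exp (- 2 * pi * \<i> * complex_of_real (k \<bullet> y) - complex_of_real (pi * \<epsilon> * \<sigma>k\<^sup>2 * (norm y)\<^sup>2 / 2)
             - complex_of_real (2 * pi * (norm (u - x))\<^sup>2 / (\<epsilon> * \<sigma>x\<^sup>2)))
       = exp (2 * pi * \<i> * complex_of_real (- k \<bullet> y) + complex_of_real (- (pi * \<epsilon> * \<sigma>k\<^sup>2 / 2) * (norm y)\<^sup>2)
             + complex_of_real (- (2 * pi * (norm (u - x))\<^sup>2 / (\<epsilon> * \<sigma>x\<^sup>2))))"
      by (rule arg_cong[where f=exp]) simp
    also have "\<dots> = chi (- k) y * complex_of_real (damp y) * complex_of_real (exp (- (2 * pi * (norm (u - x))\<^sup>2 / (\<epsilon> * \<sigma>x\<^sup>2))))"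
      by (simp only: exp_add chi_def damp_def exp_of_real)
    finally show ?thesis
      unfolding wker_def fst_conv snd_conv wigner_prefactor[symmetric, of "u - x"] of_real_mult by (simp only: mult_ac)
  qed
  have "smoothed_wigner \<sigma>x \<sigma>k \<epsilon> F g x k = (LINT p|lebesgue. ?c * (case p of (u, y) \<Rightarrow>
        exp (- 2 * pi * \<i> * complex_of_real (k \<bullet> y)
             - complex_of_real (pi * \<epsilon> * \<sigma>k\<^sup>2 * (norm y)\<^sup>2 / 2)
             - complex_of_real (2 * pi * (norm (u - x))\<^sup>2 / (\<epsilon> * \<sigma>x\<^sup>2))) *
        F (u + (\<epsilon> / 2) *\<^sub>R y) * cnj (g (u - (\<epsilon> / 2) *\<^sub>R y))))"
    unfolding smoothed_wigner_def by (rule integral_mult_right_zero[symmetric])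
  also have "\<dots> = (LINT p|lebesgue. wker x k p * (F (fst p + (\<epsilon> / 2) *\<^sub>R snd p) * cnj (g (fst p - (\<epsilon> / 2) *\<^sub>R snd p))))"
  proof (rule Bochner_Integration.integral_cong[OF refl])
    fix p :: "(real^'n) \<times> (real^'n)"
    obtain u y where p: "p = (u, y)" by (cases p)
    show "?c * (case p of (u, y) \<Rightarrow>
        exp (- 2 * pi * \<i> * complex_of_real (k \<bullet> y)
             - complex_of_real (pi * \<epsilon> * \<sigma>k\<^sup>2 * (norm y)\<^sup>2 / 2)
             - complex_of_real (2 * pi * (norm (u - x))\<^sup>2 / (\<epsilon> * \<sigma>x\<^sup>2))) *
        F (u + (\<epsilon> / 2) *\<^sub>R y) * cnj (g (u - (\<epsilon> / 2) *\<^sub>R y))) = wker x k p * (F (fst p + (\<epsilon> / 2) *\<^sub>R snd p) * cnj (g (fst p - (\<epsilon> / 2) *\<^sub>R snd p)))"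
      unfolding p prod.case fst_conv snd_conv e[symmetric] by (simp only: mult.assoc)
  qed
  finally show ?thesis .
qed

text \<open>
  The density against which a factor inserted in the first slot of the transform is integrated.\<close>

definition Phi :: "real^'n \<Rightarrow> real^'n \<Rightarrow> real^'n \<Rightarrow> complex" where
  "Phi x k q = f q * (LINT y|lborel. wker x k (q - (\<epsilon> / 2) *\<^sub>R y, y) * cnj (f (q - \<epsilon> *\<^sub>R y)))"

lemma wigner_pairing:
  assumes B[measurable]: "B \<in> borel_measurable borel" and Bi: "integrable lborel (\<lambda>q. B q * f q)"
  shows "integrable lborel (\<lambda>p. wker x k p * (B (fst p + (\<epsilon> / 2) *\<^sub>R snd p) * amp p))"
    and "(LINT p|lborel. wker x k p * (B (fst p + (\<epsilon> / 2) *\<^sub>R snd p) * amp p)) = (LINT q|lborel. B q * Phi x k q)"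
proof -
  obtain M where M: "M \<ge> 0" "\<And>x. norm (f x) \<le> M" using schwartz_bounded[OF f] by blast
  define F where "F p = (B (fst p) * f (fst p)) * (wker x k (fst p - (\<epsilon> / 2) *\<^sub>R snd p, snd p) * cnj (f (fst p - \<epsilon> *\<^sub>R snd p)))" for p
  have Fm[measurable]: "F \<in> borel_measurable borel"
  proof -
    note [measurable] = chi_measurable
    show ?thesis unfolding F_def[abs_def] wker_def fst_conv snd_conv by measurable
  qed
  have Fi: "integrable lborel F"
  proof (rule pair_integrable_lborel[OF integrable_norm[OF Bi] _ Fm])
    show "integrable lborel (\<lambda>y. gam var (0::real^'n) * M * damp y)" by (intro integrable_mult_right damp_integrable)
    show "norm (F (q, y)) \<le> norm (B q * f q) * (gam var (0::real^'n) * M * damp y)" for q y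
    proof -
      have "norm (wker x k (q - (\<epsilon> / 2) *\<^sub>R y, y) * cnj (f (q - \<epsilon> *\<^sub>R y))) \<le> (gam var (0::real^'n) * damp y) * M"
        unfolding norm_mult complex_mod_cnj using norm_wker_le[of x k "(q - (\<epsilon> / 2) *\<^sub>R y, y)"] M gam_nonneg[OF var_pos, of "0::real^'n"] damp_bounds[of y]
        by (intro mult_mono) auto
      then have "norm (B q * f q) * norm (wker x k (q - (\<epsilon> / 2) *\<^sub>R y, y) * cnj (f (q - \<epsilon> *\<^sub>R y))) \<le> norm (B q * f q) * ((gam var (0::real^'n) * damp y) * M)"
        by (rule mult_left_mono) simp
      then show ?thesis unfolding F_def fst_conv snd_conv norm_mult[of "B q * f q"] by (simp only: mult_ac)
    qed
  qed
  have e: "F (fst p + (\<epsilon> / 2) *\<^sub>R snd p, snd p) = wker x k p * (B (fst p + (\<epsilon> / 2) *\<^sub>R snd p) * amp p)" for p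
  proof -
    have "fst p + (\<epsilon> / 2) *\<^sub>R snd p - \<epsilon> *\<^sub>R snd p = fst p - (\<epsilon> / 2) *\<^sub>R snd p"
    proof -
      have "\<epsilon> *\<^sub>R snd p = (\<epsilon> / 2) *\<^sub>R snd p + (\<epsilon> / 2) *\<^sub>R snd p" by (simp flip: scaleR_add_left)
      then show ?thesis by simp
    qed
    then show ?thesis
      unfolding F_def amp_def fst_conv snd_conv by (simp only: add_diff_cancel_right' prod.collapse mult_ac)
  qed
  show "integrable lborel (\<lambda>p. wker x k p * (B (fst p + (\<epsilon> / 2) *\<^sub>R snd p) * amp p))"
    using integral_shear(2)[OF Fm, of "\<epsilon> / 2"] Fi unfolding e by blast
  have "(LINT p|lborel. wker x k p * (B (fst p + (\<epsilon> / 2) *\<^sub>R snd p) * amp p)) = (LINT p|lborel. F p)"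
    using integral_shear(1)[OF Fm, of "\<epsilon> / 2"] unfolding e .
  also have "\<dots> = (LINT q|lborel. LINT y|lborel. F (q, y))" by (rule iterated_integral_lborel[OF Fi])
  also have "\<dots> = (LINT q|lborel. B q * Phi x k q)"
    unfolding F_def fst_conv snd_conv integral_mult_right_zero Phi_def by (simp only: mult.assoc)
  finally show "(LINT p|lborel. wker x k p * (B (fst p + (\<epsilon> / 2) *\<^sub>R snd p) * amp p)) = (LINT q|lborel. B q * Phi x k q)" .
qed

text \<open>
  The substitution q' = q - \<open>\<epsilon>\<close> y turns the inner integral into a Gaussian average of the conjugate of f,
  which is smooth with polynomially bounded derivatives; the factor f provides the decay.\<close>

lemma schwartz_Phi: "schwartz (Phi x k)"
proof -
  let ?a = "1 / (8 * var)" and ?g = "pi * \<sigma>k\<^sup>2 / (2 * \<epsilon>)" and ?x2 = "2 *\<^sub>R x" and ?\<kappa> = "- (1 / \<epsilon>) *\<^sub>R k"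
  have nn: "?a \<ge> 0" "?g \<ge> 0" using var_pos pos by auto
  define m where "m q = cnj (f q)" for q
  have m[measurable]: "m \<in> borel_measurable borel" unfolding m_def by measurable
  have md: "decay m" unfolding m_def[abs_def] by (rule decay_cnj[OF schwartz_decay[OF f]])
  define C where "C = complex_of_real (\<bar>- (1 / \<epsilon>)\<bar> ^ CARD('n) * (1 / sqrt (2 * pi * var)) ^ CARD('n))"
  have inner: "(LINT y|lborel. wker x k (q - (\<epsilon> / 2) *\<^sub>R y, y) * cnj (f (q - \<epsilon> *\<^sub>R y))) = C * gavg ?a ?g ?x2 ?\<kappa> m q" for q
  proof -
    let ?G = "\<lambda>y. wker x k (q - (\<epsilon> / 2) *\<^sub>R y, y) * cnj (f (q - \<epsilon> *\<^sub>R y))"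
    have Gm: "?G \<in> borel_measurable borel"
    proof -
      note [measurable] = chi_measurable
      show ?thesis unfolding wker_def fst_conv snd_conv by measurable
    qed
    have e: "?G ((1 / \<epsilon>) *\<^sub>R q + (- (1 / \<epsilon>)) *\<^sub>R q') = complex_of_real ((1 / sqrt (2 * pi * var)) ^ CARD('n)) * (gker ?a ?g ?x2 ?\<kappa> q q' * m q')" for q'
    proof -
      let ?y = "(1 / \<epsilon>) *\<^sub>R q + (- (1 / \<epsilon>)) *\<^sub>R q'"
      have y: "?y = (1 / \<epsilon>) *\<^sub>R (q - q')" by (simp add: scaleR_diff_right)
      have 1: "q - (\<epsilon> / 2) *\<^sub>R ?y - x = (1 / 2) *\<^sub>R (q + q' - ?x2)"
      proof -
        have "q - (\<epsilon> / 2) *\<^sub>R ?y = q - (1 / 2) *\<^sub>R (q - q')" unfolding y using pos by simp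
        also have "\<dots> = (1 / 2) *\<^sub>R (q + q')"
          by (simp add: vec_eq_iff field_simps)
        finally show ?thesis by (simp add: scaleR_diff_right)
      qed
      have 2: "q - \<epsilon> *\<^sub>R ?y = q'" unfolding y using pos by simp
      have 3: "chi (- k) ?y = chi ?\<kappa> (q - q')" unfolding y by (simp add: chi_def)
      have 4: "damp ?y = exp (- ?g * (norm (q - q'))\<^sup>2)"
      proof -
        have "norm ((1 / \<epsilon>) *\<^sub>R (q - q')) = (1 / \<epsilon>) * norm (q - q')" using pos by simp
        then show ?thesis unfolding damp_def y using pos by (simp only: power_mult_distrib) (simp add: field_simps power2_eq_square)
      qed
      have 5: "gam var (q - (\<epsilon> / 2) *\<^sub>R ?y - x) = (1 / sqrt (2 * pi * var)) ^ CARD('n) * exp (- ?a * (norm (q + q' - ?x2))\<^sup>2)"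
        unfolding 1 gam_def by (simp add: power_mult_distrib power_divide)
      show ?thesis unfolding wker_def fst_conv snd_conv 2 3 4 5 gker_def[OF nn] m_def by (simp only: of_real_mult mult_ac)
    qed
    have "(LINT y|lborel. ?G y) = \<bar>- (1 / \<epsilon>)\<bar> ^ DIM(real^'n) *\<^sub>R (LINT q'|lborel. ?G ((1 / \<epsilon>) *\<^sub>R q + (- (1 / \<epsilon>)) *\<^sub>R q'))"
      by (rule lborel_integral_affine(1)[OF _ Gm]) (use pos in simp)
    also have "\<dots> = C * gavg ?a ?g ?x2 ?\<kappa> m q"
      unfolding e integral_mult_right_zero gavg_def[OF nn] C_def by (simp add: scaleR_conv_of_real)
    finally show ?thesis .
  qed
  show ?thesis
    unfolding Phi_def[abs_def] inner
    by (intro schwartz_mult[OF f] regular_moderate_mult regular_moderate_const regular_gavg[OF nn m md])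
qed

end

section \<open>Differentiating averages\<close>

lemma gaussian_poly_integrable:
  assumes "c > 0" shows "integrable lborel (\<lambda>y::real^'n::finite. (1 + norm y) ^ k * exp (- c * (norm y)\<^sup>2))"
proof -
  let ?g = "\<lambda>y::real^'n. complex_of_real ((1 + norm y) ^ k * exp (- c * (norm y)\<^sup>2))"
  have "decay ?g"
  proof (rule decay_gaussian_bound[OF assms])
    show "norm (?g y) \<le> 1 * (1 + norm y) ^ k * exp (- c * (norm y)\<^sup>2)" for y
      unfolding norm_of_real by (simp add: abs_mult)
  qed
  then have "integrable lborel ?g" by (intro integrable_decay) measurable
  from integrable_norm[OF this] show ?thesis unfolding norm_of_real by (simp add: abs_mult)
qed

lemma one_plus_norm_shift: 
  fixes z v :: "'a::real_normed_vector"
  assumes "norm v \<le> 1" shows "1 + norm z \<le> 2 * (1 + norm (z + v))"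
proof -
  have "norm z \<le> norm (z + v) + norm v" using norm_triangle_ineq4[of "z + v" v] by simp
  then show ?thesis using assms norm_ge_zero[of "z + v"] unfolding distrib_left by linarith
qed

text \<open>
  Translating the argument of a Schwartz function inside an average. The weight 1 / (1 + |u - x|)^m
  in the hypothesis lets c grow polynomially in u, as the potential does, or have no decay in u, as the
  bounds for the Wigner density do.\<close>

lemma average_has_vector_derivative:
  fixes \<psi> :: "real^'n::finite \<Rightarrow> complex" and u :: "'w \<Rightarrow> real^'n" and c :: "'w \<Rightarrow> complex"
  assumes u[measurable]: "u \<in> M \<rightarrow>\<^sub>M borel" and c[measurable]: "c \<in> borel_measurable M" and s: "schwartz \<psi>"
    and int: "\<And>x. integrable M (\<lambda>w. norm (c w) / (1 + norm (u w - x)) ^ m)"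
  shows "integrable M (\<lambda>w. \<psi> (u w - x) * c w)"
    and "((\<lambda>t. LINT w|M. \<psi> (u w - (x + t *\<^sub>R axis i 1)) * c w) has_vector_derivative (LINT w|M. - partial i \<psi> (u w - x) * c w)) (at 0)"
proof -
  note [measurable] = schwartz_measurable[OF s] schwartz_measurable[OF schwartz_partial[OF s]]
  have p1: "1 + norm z > 0" for z :: "real^'n" by (simp add: add_pos_nonneg)
  have bound: "\<exists>C\<ge>0. \<forall>z. norm (\<phi> z) \<le> C / (1 + norm z) ^ m" if s': "schwartz \<phi>" for \<phi> :: "real^'n \<Rightarrow> complex"
  proof -
    obtain C where C: "\<And>z. (1 + norm z) ^ m * norm (\<phi> z) \<le> C" using schwartz_decay[OF s'] unfolding decay_def by blast
    have "C \<ge> 0" using order_trans[OF norm_ge_zero C[of 0, simplified]] .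
    moreover have "norm (\<phi> z) \<le> C / (1 + norm z) ^ m" for z
      using C[of z] zero_less_power[OF p1[of z], of m] by (simp add: pos_le_divide_eq mult.commute)
    ultimately show ?thesis by blast
  qed
  show ii: "integrable M (\<lambda>w. \<psi> (u w - x) * c w)" for x
  proof -
    obtain C where C: "C \<ge> 0" "\<And>z. norm (\<psi> z) \<le> C / (1 + norm z) ^ m" using bound[OF s] by blast
    show ?thesis
    proof (rule Bochner_Integration.integrable_bound)
      show "integrable M (\<lambda>w. C * (norm (c w) / (1 + norm (u w - x)) ^ m))" by (intro integrable_mult_right int)
      show "AE w in M. norm (\<psi> (u w - x) * c w) \<le> norm (C * (norm (c w) / (1 + norm (u w - x)) ^ m))"
      proof (rule AE_I2)
        fix w
        have "norm (\<psi> (u w - x)) * norm (c w) \<le> C / (1 + norm (u w - x)) ^ m * norm (c w)" by (intro mult_right_mono C) simp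
        then show "norm (\<psi> (u w - x) * c w) \<le> norm (C * (norm (c w) / (1 + norm (u w - x)) ^ m))"
          unfolding norm_mult using C(1) by simp
      qed
    qed measurable
  qed
  obtain C where C: "C \<ge> 0" "\<And>z. norm (partial i \<psi> z) \<le> C / (1 + norm z) ^ m" using bound[OF schwartz_partial[OF s]] by blast
  let ?a = "axis i 1 :: real^'n"
  have "((\<lambda>t. LINT w|M. \<psi> (u w - (x + t *\<^sub>R ?a)) * c w) has_derivative (\<lambda>v. LINT w|M. (v *\<^sub>R (- partial i \<psi> (u w - (x + 0 *\<^sub>R ?a)))) * c w)) (at 0)"
  proof (rule has_derivative_integral[where r=1 and g="\<lambda>w. C * 2 ^ m * (norm (c w) / (1 + norm (u w - x)) ^ m)"])
    show "integrable M (\<lambda>w. \<psi> (u w - (x + t *\<^sub>R ?a)) * c w)" for t by (rule ii)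
    show "integrable M (\<lambda>w. C * 2 ^ m * (norm (c w) / (1 + norm (u w - x)) ^ m))" by (intro integrable_mult_right int)
    show "((\<lambda>t. \<psi> (u w - (x + t *\<^sub>R ?a)) * c w) has_derivative (\<lambda>v. (v *\<^sub>R (- partial i \<psi> (u w - (x + t *\<^sub>R ?a)))) * c w)) (at t)" for t w
    proof -
      have 1: "((\<lambda>s. \<psi> ((u w - x) + s *\<^sub>R ?a)) has_derivative (\<lambda>v. v *\<^sub>R partial i \<psi> ((u w - x) + (- t) *\<^sub>R ?a))) (at (- t))"
        using has_vector_derivative_partial[OF schwartz_differentiable[OF s], of "u w - x" i "- t"] by (simp add: has_vector_derivative_def)
      have 2: "((\<lambda>t::real. - t) has_derivative (\<lambda>v. - v)) (at t)" by (auto intro!: derivative_eq_intros)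
      have "((\<lambda>t. \<psi> ((u w - x) + (- t) *\<^sub>R ?a)) has_derivative (\<lambda>v. (- v) *\<^sub>R partial i \<psi> ((u w - x) + (- t) *\<^sub>R ?a))) (at t)"
        by (rule has_derivative_compose[where f=uminus, OF 2 1])
      then have "((\<lambda>t. \<psi> (u w - (x + t *\<^sub>R ?a))) has_derivative (\<lambda>v. v *\<^sub>R (- partial i \<psi> (u w - (x + t *\<^sub>R ?a))))) (at t)"
        by (simp add: algebra_simps)
      then show ?thesis by (rule has_derivative_mult_left)
    qed
    fix t v :: real and w assume t: "t \<in> ball 0 1"
    let ?z = "u w - x"
    have "norm (- (t *\<^sub>R ?a)) \<le> 1" using t by (simp add: norm_axis_1)
    then have "1 + norm ?z \<le> 2 * (1 + norm (?z + - (t *\<^sub>R ?a)))" by (rule one_plus_norm_shift)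
    then have "(1 + norm ?z) ^ m \<le> (2 * (1 + norm (?z + - (t *\<^sub>R ?a)))) ^ m" using p1[of ?z] by (intro power_mono) auto
    then have le: "(1 + norm ?z) ^ m \<le> 2 ^ m * (1 + norm (u w - (x + t *\<^sub>R ?a))) ^ m"
      unfolding power_mult_distrib by (simp add: algebra_simps)
    have frac: "d / b \<le> d * e / a" if "a \<le> e * b" "0 < a" "0 < b" "0 \<le> d" for a b d e :: real
    proof -
      have "1 / b \<le> e / a" using that by (simp add: field_simps)
      from mult_left_mono[OF this that(4)] show ?thesis by simp
    qed
    have "norm (partial i \<psi> (u w - (x + t *\<^sub>R ?a))) \<le> C / (1 + norm (u w - (x + t *\<^sub>R ?a))) ^ m" by (rule C)
    also have "\<dots> \<le> C * 2 ^ m / (1 + norm ?z) ^ m"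
      by (rule frac[OF le]) (use C p1 in \<open>auto intro: zero_less_power\<close>)
    finally have "norm (partial i \<psi> (u w - (x + t *\<^sub>R ?a))) * norm (c w) \<le> C * 2 ^ m / (1 + norm ?z) ^ m * norm (c w)"
      by (rule mult_right_mono) simp
    then have "\<bar>v\<bar> * (norm (partial i \<psi> (u w - (x + t *\<^sub>R ?a))) * norm (c w)) \<le> \<bar>v\<bar> * (C * 2 ^ m / (1 + norm ?z) ^ m * norm (c w))"
      by (rule mult_left_mono) simp
    then show "norm ((v *\<^sub>R (- partial i \<psi> (u w - (x + t *\<^sub>R ?a)))) * c w) \<le> C * 2 ^ m * (norm (c w) / (1 + norm ?z) ^ m) * norm v"
      by (simp add: norm_mult mult_ac)
  qed (simp, measurable)
  moreover have "(LINT w|M. (v *\<^sub>R (- partial i \<psi> (u w - (x + 0 *\<^sub>R ?a)))) * c w) = v *\<^sub>R (LINT w|M. - partial i \<psi> (u w - x) * c w)" for v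
    by (subst integral_scaleR_right[symmetric]) (rule Bochner_Integration.integral_cong, auto)
  ultimately show "((\<lambda>t. LINT w|M. \<psi> (u w - (x + t *\<^sub>R axis i 1)) * c w) has_vector_derivative (LINT w|M. - partial i \<psi> (u w - x) * c w)) (at 0)"
    unfolding has_vector_derivative_def by simp
qed

lemma partial_oscillation:
  fixes c :: "'w \<Rightarrow> complex" and y :: "'w \<Rightarrow> real^'n::finite"
  assumes y[measurable]: "y \<in> M \<rightarrow>\<^sub>M borel" and c: "integrable M c" and yc: "integrable M (\<lambda>w. norm (y w) * norm (c w))"
  shows "partial i (\<lambda>k. LINT w|M. chi (- k) (y w) * c w) k = (LINT w|M. chi (- k) (y w) * ((- 2 * pi * \<i> * complex_of_real (y w $ i)) * c w))"
proof -
  have [measurable]: "c \<in> borel_measurable M" using c by auto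
  note [measurable] = chi_measurable
  have "((\<lambda>k. LINT w|M. chi (- k) (y w) * c w) has_derivative (\<lambda>v. LINT w|M. chi (- k) (y w) * (- 2 * pi * \<i> * complex_of_real (v \<bullet> y w)) * c w)) (at k)"
  proof (rule has_derivative_integral[where r=1 and g="\<lambda>w. 2 * pi * (norm (y w) * norm (c w))"])
    show "integrable M (\<lambda>w. chi (- k) (y w) * c w)" for k
      by (rule Bochner_Integration.integrable_bound[OF c]) (measurable, simp add: norm_mult)
    show "integrable M (\<lambda>w. 2 * pi * (norm (y w) * norm (c w)))" by (intro integrable_mult_right yc)
    show "((\<lambda>k. chi (- k) (y w) * c w) has_derivative (\<lambda>v. chi (- k) (y w) * (- 2 * pi * \<i> * complex_of_real (v \<bullet> y w)) * c w)) (at k)" for k w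
    proof -
      have "((\<lambda>k. exp (2 * pi * \<i> * complex_of_real (- k \<bullet> y w)) * c w) has_derivative
        (\<lambda>v. 2 * pi * \<i> * complex_of_real (- v \<bullet> y w) * exp (2 * pi * \<i> * complex_of_real (- k \<bullet> y w)) * c w)) (at k)"
        by (intro has_derivative_mult_left has_derivative_exp_complex has_derivative_mult_right has_derivative_of_real
          has_derivative_inner_left has_derivative_minus has_derivative_ident)
      then show ?thesis unfolding chi_def by (simp add: mult_ac)
    qed
    show "norm (chi (- k) (y w) * (- 2 * pi * \<i> * complex_of_real (v \<bullet> y w)) * c w) \<le> 2 * pi * (norm (y w) * norm (c w)) * norm v" for k v w
    proof -
      have "norm (chi (- k) (y w) * (- 2 * pi * \<i> * complex_of_real (v \<bullet> y w)) * c w) = 2 * pi * (\<bar>v \<bullet> y w\<bar> * norm (c w))"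
        by (simp add: norm_mult)
      also have "\<dots> \<le> 2 * pi * (norm v * norm (y w) * norm (c w))"
        by (intro mult_left_mono mult_right_mono Cauchy_Schwarz_ineq2) auto
      finally show ?thesis by (simp add: mult_ac)
    qed
  qed (simp, measurable)
  from partial_eqI[OF this] show ?thesis by (simp add: inner_axis' mult_ac)
qed

text \<open>
  The derivative of order A in x of gam a (u - x), as a function of u - x; the sign of the reflected
  argument cancels the sign of the raising operator.\<close>

definition gder :: "real \<Rightarrow> ('n::finite \<Rightarrow> nat) \<Rightarrow> real^'n \<Rightarrow> complex" where
  "gder a A z = complex_of_real (1 / a ^ msize A) * (hemc a A z * gamc a z)"

lemma gder_zero: "gder a (\<lambda>_. 0) = gamc a" by (simp add: gder_def fun_eq_iff)

lemma schwartz_gder: "a > 0 \<Longrightarrow> schwartz (gder a A)"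
  unfolding gder_def[abs_def] by (intro schwartz_cmult schwartz_moderate_gam regular_hem)

lemma partial_gder: "a > 0 \<Longrightarrow> - partial i (gder a A) z = gder a (A(i := Suc (A i))) z"
proof -
  assume a: "a > 0"
  have "partial i (gder a A) = (\<lambda>z. complex_of_real (1 / a ^ msize A) * partial i (\<lambda>z. hemc a A z * gamc a z) z)"
    unfolding gder_def[abs_def]
    by (rule partial_linear[OF schwartz_differentiable[OF schwartz_moderate_gam[OF a regular_hem]] bounded_linear_mult_right])
  then show ?thesis unfolding partial_hem_gam[OF a] unfolding gder_def msize_Suc using a by simp
qed

text \<open>
  The linear map L is the identity for the transform, and the real and the imaginary part for the
  potential, which is real while its replacement is complex.\<close>

lemma mderiv_average:
  fixes u :: "'w \<Rightarrow> real^'n::finite" and c :: "'w \<Rightarrow> complex" and L :: "complex \<Rightarrow> 'b::real_normed_vector"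
  assumes a: "a > 0" and u: "u \<in> M \<rightarrow>\<^sub>M borel" and c: "c \<in> borel_measurable M"
    and int: "\<And>x. integrable M (\<lambda>w. norm (c w) / (1 + norm (u w - x)) ^ m)" and L: "bounded_linear L"
  shows "mderiv A (\<lambda>x. L (LINT w|M. gamc a (u w - x) * c w)) x = L (LINT w|M. gder a A (u w - x) * c w)"
proof -
  let ?F = "\<lambda>A x. L (LINT w|M. gder a A (u w - x) * c w)"
  have "partial i (?F C) = ?F (C(i := Suc (C i)))" for i C
  proof
    fix x
    have "((\<lambda>t. LINT w|M. gder a C (u w - (x + t *\<^sub>R axis i 1)) * c w) has_vector_derivative (LINT w|M. - partial i (gder a C) (u w - x) * c w)) (at 0)"
      by (rule average_has_vector_derivative(2)[OF u c schwartz_gder[OF a] int])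
    from bounded_linear.has_vector_derivative[OF L this[unfolded partial_gder[OF a]]]
    show "partial i (?F C) x = ?F (C(i := Suc (C i))) x"
      by (subst partial_def) (rule vector_derivative_at)
  qed
  from mderiv_family0[where F="?F", OF this, of A] show ?thesis by (simp add: gder_zero fun_eq_iff)
qed

section \<open>The entire extension of the transform\<close>

context wigner
begin

lemma wigner_lborel:
  "smoothed_wigner \<sigma>x \<sigma>k \<epsilon> f f x k = (LINT p|lborel. wker x k p * amp p)"
  unfolding smoothed_wigner_wker amp_def[symmetric] by (rule integral_completion) measurable

text \<open>
  The exponent of the kernel with complex position and momentum, and below it the factor that does
  not depend on them; the integrand of the entire extension is the exponential times this factor.\<close>

definition cexpo :: "(complex^'n) \<times> (complex^'n) \<Rightarrow> (real^'n) \<times> (real^'n) \<Rightarrow> complex" where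
  "cexpo z p = - (\<Sum>i\<in>UNIV. (complex_of_real (fst p $ i) - fst z $ i)\<^sup>2) / complex_of_real (2 * var)
     - 2 * pi * \<i> * (\<Sum>i\<in>UNIV. snd z $ i * complex_of_real (snd p $ i))"

definition camp :: "(real^'n) \<times> (real^'n) \<Rightarrow> complex" where
  "camp p = complex_of_real ((1 / sqrt (2 * pi * var)) ^ CARD('n) * damp (snd p)) * amp p"

definition cwig :: "(complex^'n) \<times> (complex^'n) \<Rightarrow> complex" where
  "cwig z = (LINT p|lborel. exp (cexpo z p) * camp p)"

lemma camp_measurable[measurable]: "camp \<in> borel_measurable borel"
  unfolding camp_def[abs_def] by measurable

lemma cexpo_measurable[measurable]: "cexpo z \<in> borel_measurable borel"
  unfolding cexpo_def[abs_def] by measurable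

definition dcexpo :: "(complex^'n) \<times> (complex^'n) \<Rightarrow> (real^'n) \<times> (real^'n) \<Rightarrow> (complex^'n) \<times> (complex^'n) \<Rightarrow> complex" where
  "dcexpo z p v = (\<Sum>i\<in>UNIV. (complex_of_real (fst p $ i) - fst z $ i) * fst v $ i) / complex_of_real var
     - 2 * pi * \<i> * (\<Sum>i\<in>UNIV. snd v $ i * complex_of_real (snd p $ i))"

lemma cexpo_has_derivative: "((\<lambda>z. cexpo z p) has_derivative dcexpo z p) (at z)"
proof -
  have n1: "((\<lambda>z::(complex^'n) \<times> (complex^'n). fst z $ i) has_derivative (\<lambda>v. fst v $ i)) (at z)" for i
    by (intro bounded_linear.has_derivative[OF bounded_linear_vec_nth] has_derivative_fst has_derivative_ident)
  have n2: "((\<lambda>z::(complex^'n) \<times> (complex^'n). snd z $ i) has_derivative (\<lambda>v. snd v $ i)) (at z)" for i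
    by (intro bounded_linear.has_derivative[OF bounded_linear_vec_nth] has_derivative_snd has_derivative_ident)
  have s: "((\<lambda>z. (complex_of_real (fst p $ i) - fst z $ i)\<^sup>2) has_derivative (\<lambda>v. - 2 * ((complex_of_real (fst p $ i) - fst z $ i) * fst v $ i))) (at z)" for i
    using has_derivative_mult[OF has_derivative_diff[OF has_derivative_const n1[of i]] has_derivative_diff[OF has_derivative_const n1[of i]], of "complex_of_real (fst p $ i)" "complex_of_real (fst p $ i)"]
    unfolding power2_eq_square by (rule has_derivative_eq_rhs) (simp add: fun_eq_iff algebra_simps)
  have d1: "((\<lambda>z. - (\<Sum>i\<in>UNIV. (complex_of_real (fst p $ i) - fst z $ i)\<^sup>2) / complex_of_real (2 * var)) has_derivative
     (\<lambda>v. - (\<Sum>i\<in>UNIV. - 2 * ((complex_of_real (fst p $ i) - fst z $ i) * fst v $ i)) / complex_of_real (2 * var))) (at z)"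
    by (intro bounded_linear.has_derivative[OF bounded_linear_divide] has_derivative_minus has_derivative_sum s)
  have d2: "((\<lambda>z::(complex^'n) \<times> (complex^'n). 2 * pi * \<i> * (\<Sum>i\<in>UNIV. snd z $ i * complex_of_real (snd p $ i))) has_derivative
     (\<lambda>v. 2 * pi * \<i> * (\<Sum>i\<in>UNIV. snd v $ i * complex_of_real (snd p $ i)))) (at z)"
    by (intro has_derivative_mult_right has_derivative_sum has_derivative_mult_left n2)
  have eq: "- (\<Sum>i\<in>UNIV. - 2 * ((complex_of_real (fst p $ i) - fst z $ i) * fst v $ i)) / complex_of_real (2 * var)
      = (\<Sum>i\<in>UNIV. (complex_of_real (fst p $ i) - fst z $ i) * fst v $ i) / complex_of_real var" for v
    by (simp add: sum_distrib_left[symmetric] sum_negf)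
  show ?thesis
    unfolding cexpo_def by (rule has_derivative_eq_rhs[OF has_derivative_diff[OF d1 d2]]) (rule ext, unfold dcexpo_def eq, rule refl)
qed

lemma dcexpo_measurable[measurable]: "(\<lambda>p. dcexpo z p v) \<in> borel_measurable borel"
  unfolding dcexpo_def[abs_def] by measurable

lemma dcexpo_complex_linear: "dcexpo z p (c *s fst v, c *s snd v) = c * dcexpo z p v"
  by (simp add: dcexpo_def sum_distrib_left right_diff_distrib mult_ac)

lemma norm_components:
  fixes z :: "(complex^'n) \<times> (complex^'n)"
  assumes "norm z \<le> R" shows "norm (fst z $ i) \<le> R" "norm (snd z $ i) \<le> R"
proof -
  obtain X K where z: "z = (X, K)" by (cases z)
  show "norm (fst z $ i) \<le> R" "norm (snd z $ i) \<le> R"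
    using assms norm_fst_le[of X K] norm_snd_le[of K X] Finite_Cartesian_Product.norm_nth_le[of X i] Finite_Cartesian_Product.norm_nth_le[of K i]
    unfolding z by (auto intro: order_trans)
qed

text \<open>
  Complex shifts of the position cost at most half of the Gaussian decay in u, and complex momenta cost an
  exponential factor in y, which the Gaussian damping absorbs.\<close>

lemma Re_cexpo_le:
  assumes z: "norm z \<le> R"
  shows "Re (cexpo z p) \<le> real CARD('n) * R\<^sup>2 / (2 * var) - (norm (fst p))\<^sup>2 / (4 * var) + 2 * pi * real CARD('n) * R * norm (snd p)"
proof -
  note c = norm_components[OF z]
  have R: "R \<ge> 0" using z norm_ge_zero order_trans by blast
  have sq: "(fst p $ i)\<^sup>2 / 2 - R\<^sup>2 \<le> Re ((complex_of_real (fst p $ i) - fst z $ i)\<^sup>2)" for i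
  proof -
    let ?u = "fst p $ i" and ?X = "fst z $ i"
    have "(norm ?X)\<^sup>2 \<le> R\<^sup>2" using c(1) by (intro power_mono) auto
    then have "(Re ?X)\<^sup>2 + (Im ?X)\<^sup>2 \<le> R\<^sup>2" by (simp add: cmod_power2)
    moreover have "Re ((complex_of_real ?u - ?X)\<^sup>2) = (?u - Re ?X)\<^sup>2 - (Im ?X)\<^sup>2" by (simp add: power2_eq_square)
    moreover have "0 \<le> (?u - 2 * Re ?X)\<^sup>2 / 2" by simp
    moreover have "(?u - 2 * Re ?X)\<^sup>2 / 2 = (?u - Re ?X)\<^sup>2 - ?u\<^sup>2 / 2 + (Re ?X)\<^sup>2" by (simp add: power2_eq_square field_simps)
    ultimately show ?thesis by linarith
  qed
  have n2: "(\<Sum>i\<in>UNIV. (fst p $ i)\<^sup>2) = (norm (fst p))\<^sup>2"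
    by (simp add: norm_vec_def L2_set_def sum_nonneg)
  have "(\<Sum>i\<in>UNIV. (fst p $ i)\<^sup>2 / 2 - R\<^sup>2) \<le> (\<Sum>i\<in>UNIV. Re ((complex_of_real (fst p $ i) - fst z $ i)\<^sup>2))"
    by (rule sum_mono) (rule sq)
  then have 1: "(norm (fst p))\<^sup>2 / 2 - real CARD('n) * R\<^sup>2 \<le> Re (\<Sum>i\<in>UNIV. (complex_of_real (fst p $ i) - fst z $ i)\<^sup>2)"
    by (simp add: sum_subtractf n2 flip: sum_divide_distrib)
  then have 2: "((norm (fst p))\<^sup>2 / 2 - real CARD('n) * R\<^sup>2) / (2 * var) \<le> Re (\<Sum>i\<in>UNIV. (complex_of_real (fst p $ i) - fst z $ i)\<^sup>2) / (2 * var)"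
    by (rule divide_right_mono) (use var_pos in simp)
  have 3: "norm (\<Sum>i\<in>UNIV. snd z $ i * complex_of_real (snd p $ i)) \<le> real CARD('n) * (R * norm (snd p))"
  proof -
    have "norm (\<Sum>i\<in>UNIV. snd z $ i * complex_of_real (snd p $ i)) \<le> (\<Sum>i\<in>(UNIV::'n set). R * norm (snd p))"
      by (rule sum_norm_le) (auto simp: norm_mult intro!: mult_mono c component_le_norm_cart R)
    then show ?thesis by simp
  qed
  let ?S = "\<Sum>i\<in>UNIV. snd z $ i * complex_of_real (snd p $ i)"
  have "Re (- (2 * pi * \<i> * ?S)) \<le> norm (2 * pi * \<i> * ?S)" using complex_Re_le_cmod[of "- (2 * pi * \<i> * ?S)"] by simp
  also have "\<dots> = 2 * pi * norm ?S" by (simp add: norm_mult)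
  also have "\<dots> \<le> 2 * pi * (real CARD('n) * (R * norm (snd p)))" by (intro mult_left_mono 3) auto
  finally have 4: "Re (- (2 * pi * \<i> * ?S)) \<le> 2 * pi * real CARD('n) * R * norm (snd p)" by (simp add: mult_ac)
  have "Re (cexpo z p) = - (Re (\<Sum>i\<in>UNIV. (complex_of_real (fst p $ i) - fst z $ i)\<^sup>2) / (2 * var)) + Re (- (2 * pi * \<i> * ?S))"
  proof -
    have "cexpo z p = - ((\<Sum>i\<in>UNIV. (complex_of_real (fst p $ i) - fst z $ i)\<^sup>2) / complex_of_real (2 * var)) + - (2 * pi * \<i> * ?S)"
      by (simp add: cexpo_def)
    then show ?thesis by (simp only: plus_complex.sel uminus_complex.sel Re_divide_of_real)
  qed
  moreover have "((norm (fst p))\<^sup>2 / 2 - real CARD('n) * R\<^sup>2) / (2 * var) = (norm (fst p))\<^sup>2 / (4 * var) - real CARD('n) * R\<^sup>2 / (2 * var)"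
    by (simp add: diff_divide_distrib)
  ultimately show ?thesis using 2 4 by linarith
qed

lemma norm_dcexpo_le:
  assumes z: "norm z \<le> R"
  shows "norm (dcexpo z p v) \<le> (real CARD('n) * (1 + R) / var + 2 * pi * real CARD('n)) * ((1 + norm (fst p)) * (1 + norm (snd p))) * norm v"
proof -
  note c = norm_components[OF z] and cv = norm_components[OF order_refl, of v]
  have R: "R \<ge> 0" using z norm_ge_zero order_trans by blast
  let ?q = "(1 + norm (fst p)) * (1 + norm (snd p))"
  have q1: "norm (fst p) + R \<le> (1 + R) * ?q"
  proof -
    have "norm (fst p) + R \<le> (1 + R) * (1 + norm (fst p))" using R by (simp add: algebra_simps)
    also have "\<dots> \<le> (1 + R) * ((1 + norm (fst p)) * (1 + norm (snd p)))"
      using R by (intro mult_left_mono) (auto simp: algebra_simps)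
    finally show ?thesis .
  qed
  have q2: "norm (snd p) \<le> ?q" by (simp add: algebra_simps)
  have 1: "norm (\<Sum>i\<in>UNIV. (complex_of_real (fst p $ i) - fst z $ i) * fst v $ i) \<le> real CARD('n) * ((1 + R) * ?q * norm v)"
  proof -
    have "norm (\<Sum>i\<in>UNIV. (complex_of_real (fst p $ i) - fst z $ i) * fst v $ i) \<le> (\<Sum>i\<in>(UNIV::'n set). (1 + R) * ?q * norm v)"
    proof (rule sum_norm_le)
      fix i
      have "norm (complex_of_real (fst p $ i) - fst z $ i) \<le> norm (fst p) + R"
        using norm_triangle_ineq4[of "complex_of_real (fst p $ i)" "fst z $ i"] component_le_norm_cart[of "fst p" i] c(1)[of i] by simp
      then show "norm ((complex_of_real (fst p $ i) - fst z $ i) * fst v $ i) \<le> (1 + R) * ?q * norm v"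
        unfolding norm_mult using q1 cv(1)[of i] R by (intro mult_mono) (auto intro: order_trans)
    qed
    then show ?thesis by simp
  qed
  have 2: "norm (\<Sum>i\<in>UNIV. snd v $ i * complex_of_real (snd p $ i)) \<le> real CARD('n) * (norm v * ?q)"
  proof -
    have "norm (\<Sum>i\<in>UNIV. snd v $ i * complex_of_real (snd p $ i)) \<le> (\<Sum>i\<in>(UNIV::'n set). norm v * ?q)"
    proof (rule sum_norm_le)
      fix i
      show "norm (snd v $ i * complex_of_real (snd p $ i)) \<le> norm v * ?q"
        unfolding norm_mult using cv(2)[of i] component_le_norm_cart[of "snd p" i] q2
        by (intro mult_mono) (auto intro: order_trans)
    qed
    then show ?thesis by simp
  qed
  have "norm (dcexpo z p v) \<le> norm (\<Sum>i\<in>UNIV. (complex_of_real (fst p $ i) - fst z $ i) * fst v $ i) / var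
     + 2 * pi * norm (\<Sum>i\<in>UNIV. snd v $ i * complex_of_real (snd p $ i))"
    unfolding dcexpo_def using var_pos by (intro order_trans[OF norm_triangle_ineq4]) (simp add: norm_divide norm_mult)
  also have "\<dots> \<le> real CARD('n) * ((1 + R) * ?q * norm v) / var + 2 * pi * (real CARD('n) * (norm v * ?q))"
    using var_pos by (intro add_mono divide_right_mono mult_left_mono 1 2) auto
  also have "\<dots> = (real CARD('n) * (1 + R) / var + 2 * pi * real CARD('n)) * ?q * norm v"
  proof -
    have "n * (s * q * w) / a + 2 * pi * (n * (w * q)) = (n * s / a + 2 * pi * n) * q * w" for n s q w a :: real
      by (simp add: distrib_left distrib_right mult_ac)
    then show ?thesis .
  qed
  finally show ?thesis .
qed

definition dommaj :: "real \<Rightarrow> (real^'n) \<times> (real^'n) \<Rightarrow> real" where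
  "dommaj R p = ((1 + norm (fst p)) * exp (- (1 / (4 * var)) * (norm (fst p))\<^sup>2)) * ((1 + norm (snd p)) * (exp (2 * pi * real CARD('n) * R * norm (snd p)) * damp (snd p)))"

lemma dommaj_integrable: "integrable lborel (dommaj R)"
proof -
  let ?b = "pi * \<epsilon> * \<sigma>k\<^sup>2 / 2" and ?c = "2 * pi * real CARD('n) * R"
  have b: "?b > 0" using pos by simp
  let ?E = "exp (?c\<^sup>2 / (2 * ?b))"
  show ?thesis
  proof (rule pair_integrable_lborel)
    show "integrable lborel (\<lambda>u::real^'n. (1 + norm u) ^ 1 * exp (- (1 / (4 * var)) * (norm u)\<^sup>2))"
      by (rule gaussian_poly_integrable) (use var_pos in simp)
    show "integrable lborel (\<lambda>y::real^'n. ?E * ((1 + norm y) ^ 1 * exp (- (?b / 2) * (norm y)\<^sup>2)))"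
      by (intro integrable_mult_right gaussian_poly_integrable) (use b in simp)
    show "dommaj R \<in> borel_measurable borel" unfolding dommaj_def[abs_def] by measurable
    fix u y :: "real^'n"
    have "exp (?c * norm y) * damp y \<le> ?E * exp (- (?b / 2) * (norm y)\<^sup>2)"
    proof -
      have "0 \<le> (?b / 2) * (norm y - ?c / ?b)\<^sup>2" using b by simp
      also have "\<dots> = (?b / 2) * (norm y)\<^sup>2 - ?c * norm y + ?c\<^sup>2 / (2 * ?b)"
      proof -
        have "(b / 2) * (t - c / b)\<^sup>2 = (b / 2) * t\<^sup>2 - c * t + c\<^sup>2 / (2 * b)" if "b > 0" for b c t :: real
          using that by (simp add: power2_eq_square field_simps)
        from this[OF b] show ?thesis .
      qed
      finally have le: "0 \<le> (?b / 2) * (norm y)\<^sup>2 - ?c * norm y + ?c\<^sup>2 / (2 * ?b)" .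
      have "t + (- b * s) \<le> d + - (b / 2) * s" if "0 \<le> (b / 2) * s - t + d" for b s t d :: real
        using that by simp
      from this[OF le] have "?c * norm y + (- ?b * (norm y)\<^sup>2) \<le> ?c\<^sup>2 / (2 * ?b) + - (?b / 2) * (norm y)\<^sup>2" .
      then show ?thesis unfolding damp_def exp_add[symmetric] by simp
    qed
    then have "(1 + norm y) * (exp (?c * norm y) * damp y) \<le> (1 + norm y) * (?E * exp (- (?b / 2) * (norm y)\<^sup>2))" by (rule mult_left_mono) simp
    then have "dommaj R (u, y) \<le> ((1 + norm u) * exp (- (1 / (4 * var)) * (norm u)\<^sup>2)) * ((1 + norm y) * (?E * exp (- (?b / 2) * (norm y)\<^sup>2)))"
      unfolding dommaj_def fst_conv snd_conv by (rule mult_left_mono) simp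
    moreover have "dommaj R (u, y) \<ge> 0" unfolding dommaj_def using damp_bounds by simp
    ultimately show "norm (dommaj R (u, y)) \<le> ((1 + norm u) ^ 1 * exp (- (1 / (4 * var)) * (norm u)\<^sup>2)) * (?E * ((1 + norm y) ^ 1 * exp (- (?b / 2) * (norm y)\<^sup>2)))"
      by (simp add: mult_ac)
  qed
qed

lemma cwig_bound: "\<exists>C\<ge>0. \<forall>z p. norm z \<le> R \<longrightarrow> norm (exp (cexpo z p) * camp p) * ((1 + norm (fst p)) * (1 + norm (snd p))) \<le> C * dommaj R p"
proof -
  obtain M where M: "M \<ge> 0" "\<And>x. norm (f x) \<le> M" using schwartz_bounded[OF f] by blast
  define g where "g = (1 / sqrt (2 * pi * var)) ^ CARD('n)"
  have g: "g \<ge> 0" using var_pos by (simp add: g_def)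
  define E where "E = exp (real CARD('n) * R\<^sup>2 / (2 * var))"
  have "norm (exp (cexpo z p) * camp p) * ((1 + norm (fst p)) * (1 + norm (snd p))) \<le> E * (g * (M * M)) * dommaj R p" if z: "norm z \<le> R" for z p
  proof -
    have "norm (exp (cexpo z p)) \<le> exp (real CARD('n) * R\<^sup>2 / (2 * var) + - (1 / (4 * var)) * (norm (fst p))\<^sup>2 + 2 * pi * real CARD('n) * R * norm (snd p))"
      using Re_cexpo_le[OF z, of p] by (simp add: norm_exp_eq_Re)
    also have "\<dots> = E * exp (- (1 / (4 * var)) * (norm (fst p))\<^sup>2) * exp (2 * pi * real CARD('n) * R * norm (snd p))"
      by (simp only: exp_add E_def)
    finally have e: "norm (exp (cexpo z p)) \<le> E * exp (- (1 / (4 * var)) * (norm (fst p))\<^sup>2) * exp (2 * pi * real CARD('n) * R * norm (snd p))" .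
    have a: "norm (amp p) \<le> M * M" unfolding amp_def norm_mult complex_mod_cnj by (intro mult_mono M) (use M in auto)
    have c: "norm (camp p) \<le> g * damp (snd p) * (M * M)"
    proof -
      have "norm (complex_of_real (g * damp (snd p))) = g * damp (snd p)" unfolding norm_of_real using g damp_bounds[of "snd p"] by simp
      then show ?thesis unfolding camp_def norm_mult[of _ "amp p"] g_def[symmetric] using g damp_bounds[of "snd p"] a by (simp add: mult_left_mono)
    qed
    have "norm (exp (cexpo z p) * camp p) \<le> (E * exp (- (1 / (4 * var)) * (norm (fst p))\<^sup>2) * exp (2 * pi * real CARD('n) * R * norm (snd p))) * (g * damp (snd p) * (M * M))"
      unfolding norm_mult by (rule mult_mono[OF e c]) (auto simp: E_def)
    then have "norm (exp (cexpo z p) * camp p) * ((1 + norm (fst p)) * (1 + norm (snd p))) \<le> (E * exp (- (1 / (4 * var)) * (norm (fst p))\<^sup>2) * exp (2 * pi * real CARD('n) * R * norm (snd p))) * (g * damp (snd p) * (M * M)) * ((1 + norm (fst p)) * (1 + norm (snd p)))"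
      by (rule mult_right_mono) simp
    then show ?thesis unfolding dommaj_def by (simp only: mult_ac)
  qed
  moreover have "E * (g * (M * M)) \<ge> 0" using g M by (simp add: E_def)
  ultimately show ?thesis by blast
qed

lemma cwig_has_derivative:
  "(cwig has_derivative (\<lambda>v. LINT p|lborel. dcexpo z p v * exp (cexpo z p) * camp p)) (at z)"
proof -
  define R where "R = norm z + 1"
  obtain C where C: "C \<ge> 0" "\<And>z p. norm z \<le> R \<Longrightarrow> norm (exp (cexpo z p) * camp p) * ((1 + norm (fst p)) * (1 + norm (snd p))) \<le> C * dommaj R p"
    using cwig_bound[of R] by blast
  define K where "K = real CARD('n) * (1 + R) / var + 2 * pi * real CARD('n)"
  have K: "K \<ge> 0" using var_pos by (simp add: K_def R_def)
  show ?thesis unfolding cwig_def[abs_def]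
  proof (rule has_derivative_integral[where r=1 and g="\<lambda>p. K * (C * dommaj R p)"])
    show "integrable lborel (\<lambda>p. K * (C * dommaj R p))" by (intro integrable_mult_right dommaj_integrable)
    show "((\<lambda>z. exp (cexpo z p) * camp p) has_derivative (\<lambda>v. dcexpo z p v * exp (cexpo z p) * camp p)) (at z)" for z p
      by (intro has_derivative_mult_left has_derivative_exp_complex cexpo_has_derivative)
    show "integrable lborel (\<lambda>p. exp (cexpo z p) * camp p)" for z
    proof -
      obtain C' where C': "\<And>p. norm (exp (cexpo z p) * camp p) * ((1 + norm (fst p)) * (1 + norm (snd p))) \<le> C' * dommaj (norm z) p"
        using cwig_bound[of "norm z"] by blast
      show ?thesis
      proof (rule Bochner_Integration.integrable_bound)
        show "integrable lborel (\<lambda>p. C' * dommaj (norm z) p)" by (intro integrable_mult_right dommaj_integrable)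
        show "AE p in lborel. norm (exp (cexpo z p) * camp p) \<le> norm (C' * dommaj (norm z) p)"
        proof (rule AE_I2)
          fix p :: "(real^'n) \<times> (real^'n)"
          have "1 * 1 \<le> (1 + norm (fst p)) * (1 + norm (snd p))" by (intro mult_mono) auto
          then have "norm (exp (cexpo z p) * camp p) * 1 \<le> norm (exp (cexpo z p) * camp p) * ((1 + norm (fst p)) * (1 + norm (snd p)))"
            by (intro mult_left_mono) auto
          then show "norm (exp (cexpo z p) * camp p) \<le> norm (C' * dommaj (norm z) p)" using C'[of p] by simp
        qed
      qed measurable
    qed
    fix z' v :: "(complex^'n) \<times> (complex^'n)" and p :: "(real^'n) \<times> (real^'n)" assume "z' \<in> ball z 1"
    then have z': "norm z' \<le> R" using norm_triangle_ineq2[of z' z] by (simp add: R_def dist_norm norm_minus_commute)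
    let ?q = "(1 + norm (fst p)) * (1 + norm (snd p))"
    have "norm (dcexpo z' p v * exp (cexpo z' p) * camp p) = norm (dcexpo z' p v) * norm (exp (cexpo z' p) * camp p)"
      by (simp only: norm_mult mult.assoc)
    also have "\<dots> \<le> (K * ?q * norm v) * norm (exp (cexpo z' p) * camp p)"
      unfolding K_def by (rule mult_right_mono[OF norm_dcexpo_le[OF z']]) simp
    also have "\<dots> = K * (norm (exp (cexpo z' p) * camp p) * ?q) * norm v" by (simp only: mult_ac)
    also have "\<dots> \<le> K * (C * dommaj R p) * norm v" by (intro mult_right_mono mult_left_mono C z' K) simp
    finally show "norm (dcexpo z' p v * exp (cexpo z' p) * camp p) \<le> K * (C * dommaj R p) * norm v" .
  qed (simp, measurable)
qed

lemma entire_cwig: "entire cwig"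
  unfolding entire_def
proof (intro allI exI conjI)
  fix z show "(cwig has_derivative (\<lambda>v. LINT p|lborel. dcexpo z p v * exp (cexpo z p) * camp p)) (at z)" by (rule cwig_has_derivative)
  fix c v
  show "(LINT p|lborel. dcexpo z p (c *s fst v, c *s snd v) * exp (cexpo z p) * camp p) = c * (LINT p|lborel. dcexpo z p v * exp (cexpo z p) * camp p)"
    unfolding dcexpo_complex_linear by (simp add: mult.assoc)
qed

text \<open>
  Completing the square: the complex shift of the position in the symbol, together with the prefactor,
  turns the Gaussian around the complex point back into the Gaussian around x times an oscillation
  with frequency S in u, and the shift of the momentum contributes the same oscillation in
  \<open>\<epsilon>\<close> y / 2.\<close>

lemma cexpo_symbol:
  "2 * pi * \<i> * complex_of_real (S \<bullet> x) - complex_of_real (\<epsilon> * pi / 2 * \<sigma>x\<^sup>2 * (norm S)\<^sup>2)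
     + cexpo (cvec x + (\<i> * complex_of_real (\<epsilon> * \<sigma>x\<^sup>2 / 2)) *s cvec S, cvec (k - (\<epsilon> / 2) *\<^sub>R S)) p
   = complex_of_real (- (1 / (2 * var)) * (norm (fst p - x))\<^sup>2) + 2 * pi * \<i> * complex_of_real (- k \<bullet> snd p)
     + 2 * pi * \<i> * complex_of_real (S \<bullet> (fst p + (\<epsilon> / 2) *\<^sub>R snd p))"
proof -
  (* the imaginary shift of the position is theta S *)
  define \<theta> where "\<theta> = \<epsilon> * \<sigma>x\<^sup>2 / 2"
  have \<theta>: "\<theta> = 2 * pi * var" by (simp add: \<theta>_def var_def)
  have v0: "complex_of_real var \<noteq> 0" using var_pos by simp
  have sq: "(\<Sum>i\<in>UNIV. (complex_of_real (fst p $ i) - (cvec x + (\<i> * complex_of_real \<theta>) *s cvec S) $ i)\<^sup>2)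
     = complex_of_real ((norm (fst p - x))\<^sup>2) - 2 * \<i> * complex_of_real (\<theta> * (S \<bullet> (fst p - x))) - complex_of_real (\<theta>\<^sup>2 * (norm S)\<^sup>2)"
  proof -
    have "(\<Sum>i\<in>UNIV. (complex_of_real (fst p $ i) - (cvec x + (\<i> * complex_of_real \<theta>) *s cvec S) $ i)\<^sup>2)
      = (\<Sum>i\<in>UNIV. complex_of_real (((fst p - x) $ i) * ((fst p - x) $ i)) - 2 * \<i> * complex_of_real (\<theta> * (S $ i * (fst p - x) $ i)) - complex_of_real (\<theta>\<^sup>2 * (S $ i * S $ i)))"
    proof (rule sum.cong[OF refl])
      fix i
      have "(a - (b + \<i> * t * s))\<^sup>2 = (a - b) * (a - b) - 2 * \<i> * (t * (s * (a - b))) - t\<^sup>2 * (s * s)" for a b t s :: complex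
        by (simp add: power2_eq_square algebra_simps)
      from this[of "complex_of_real (fst p $ i)" "complex_of_real (x $ i)" "complex_of_real \<theta>" "complex_of_real (S $ i)"]
      show "(complex_of_real (fst p $ i) - (cvec x + (\<i> * complex_of_real \<theta>) *s cvec S) $ i)\<^sup>2
        = complex_of_real (((fst p - x) $ i) * ((fst p - x) $ i)) - 2 * \<i> * complex_of_real (\<theta> * (S $ i * (fst p - x) $ i)) - complex_of_real (\<theta>\<^sup>2 * (S $ i * S $ i))"
        by (simp add: cvec_def)
    qed
    also have "\<dots> = complex_of_real ((fst p - x) \<bullet> (fst p - x)) - 2 * \<i> * complex_of_real (\<theta> * (S \<bullet> (fst p - x))) - complex_of_real (\<theta>\<^sup>2 * (S \<bullet> S))"
      unfolding inner_vec_def sum_subtractf inner_real_def of_real_sum sum_distrib_left by simp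
    finally show ?thesis by (simp only: power2_norm_eq_inner)
  qed
  have lin: "(\<Sum>i\<in>UNIV. cvec (k - (\<epsilon> / 2) *\<^sub>R S) $ i * complex_of_real (snd p $ i)) = complex_of_real (k \<bullet> snd p) - complex_of_real ((\<epsilon> / 2) * (S \<bullet> snd p))"
  proof -
    have "(\<Sum>i\<in>UNIV. cvec (k - (\<epsilon> / 2) *\<^sub>R S) $ i * complex_of_real (snd p $ i)) = complex_of_real ((k - (\<epsilon> / 2) *\<^sub>R S) \<bullet> snd p)"
      by (simp add: cvec_def inner_vec_def)
    then show ?thesis by (simp add: inner_diff_left)
  qed
  have g: "\<epsilon> * pi / 2 * \<sigma>x\<^sup>2 * (norm S)\<^sup>2 = pi * \<theta> * (norm S)\<^sup>2" by (simp add: \<theta>_def)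
  have "cexpo (cvec x + (\<i> * complex_of_real \<theta>) *s cvec S, cvec (k - (\<epsilon> / 2) *\<^sub>R S)) p
    = - (complex_of_real ((norm (fst p - x))\<^sup>2) - 2 * \<i> * complex_of_real (\<theta> * (S \<bullet> (fst p - x))) - complex_of_real (\<theta>\<^sup>2 * (norm S)\<^sup>2)) / complex_of_real (2 * var)
      - 2 * pi * \<i> * (complex_of_real (k \<bullet> snd p) - complex_of_real ((\<epsilon> / 2) * (S \<bullet> snd p)))"
    unfolding cexpo_def fst_conv snd_conv sq lin ..
  also have "\<dots> = complex_of_real (- (1 / (2 * var)) * (norm (fst p - x))\<^sup>2) + 2 * pi * \<i> * complex_of_real (S \<bullet> (fst p - x)) + complex_of_real (pi * \<theta> * (norm S)\<^sup>2)
      - 2 * pi * \<i> * (complex_of_real (k \<bullet> snd p) - complex_of_real ((\<epsilon> / 2) * (S \<bullet> snd p)))"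
    unfolding \<theta> using v0 by (simp add: field_simps power2_eq_square)
  finally have e: "cexpo (cvec x + (\<i> * complex_of_real \<theta>) *s cvec S, cvec (k - (\<epsilon> / 2) *\<^sub>R S)) p = \<dots>" .
  show ?thesis unfolding \<theta>_def[symmetric] g e
    by (simp add: inner_diff_right inner_add_right algebra_simps)
qed

lemma cwig_symbol:
  "exp (2 * pi * \<i> * complex_of_real (S \<bullet> x) - complex_of_real (\<epsilon> * pi / 2 * \<sigma>x\<^sup>2 * (norm S)\<^sup>2)) *
     cwig (cvec x + (\<i> * complex_of_real (\<epsilon> * \<sigma>x\<^sup>2 / 2)) *s cvec S, cvec (k - (\<epsilon> / 2) *\<^sub>R S))
   = (LINT p|lborel. wker x k p * (chi S (fst p + (\<epsilon> / 2) *\<^sub>R snd p) * amp p))"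
  unfolding cwig_def integral_mult_right_zero[symmetric]
proof (rule Bochner_Integration.integral_cong[OF refl])
  fix p :: "(real^'n) \<times> (real^'n)"
  let ?A = "2 * pi * \<i> * complex_of_real (S \<bullet> x) - complex_of_real (\<epsilon> * pi / 2 * \<sigma>x\<^sup>2 * (norm S)\<^sup>2)"
  let ?z = "(cvec x + (\<i> * complex_of_real (\<epsilon> * \<sigma>x\<^sup>2 / 2)) *s cvec S, cvec (k - (\<epsilon> / 2) *\<^sub>R S))"
  have "exp ?A * (exp (cexpo ?z p) * camp p) = exp (?A + cexpo ?z p) * camp p" by (simp only: exp_add mult.assoc)
  also have "\<dots> = wker x k p * (chi S (fst p + (\<epsilon> / 2) *\<^sub>R snd p) * amp p)"
    unfolding cexpo_symbol unfolding exp_add exp_of_real unfolding wker_def gam_def chi_def camp_def of_real_mult by (simp only: mult_ac)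
  finally show "exp ?A * (exp (cexpo ?z p) * camp p) = wker x k p * (chi S (fst p + (\<epsilon> / 2) *\<^sub>R snd p) * amp p)" .
qed

lemma entire_ext_wigner: "entire_ext (smoothed_wigner \<sigma>x \<sigma>k \<epsilon> f f) = cwig"
proof (rule entire_ext_eq[OF entire_cwig])
  fix x k :: "real^'n"
  have "cwig (cvec x, cvec k) = (LINT p|lborel. wker x k p * (chi 0 (fst p + (\<epsilon> / 2) *\<^sub>R snd p) * amp p))"
    using cwig_symbol[of 0 x k] by (simp add: cvec_def vec_eq_iff zero_vec_def[symmetric])
  then show "cwig (cvec x, cvec k) = smoothed_wigner \<sigma>x \<sigma>k \<epsilon> f f x k" by (simp add: wigner_lborel)
qed

lemma wigner_symbol_ifourier:
  "wigner_symbol \<sigma>x \<epsilon> (smoothed_wigner \<sigma>x \<sigma>k \<epsilon> f f) x k = ifourier (Phi x k)"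
proof
  fix S
  have i: "integrable lborel (\<lambda>q. chi S q * f q)" by (rule chi_mult_integrable[OF schwartz_integrable[OF f]])
  show "wigner_symbol \<sigma>x \<epsilon> (smoothed_wigner \<sigma>x \<sigma>k \<epsilon> f f) x k S = ifourier (Phi x k) S"
    unfolding wigner_symbol_def entire_ext_wigner cwig_symbol wigner_pairing(2)[OF chi_measurable i]
    by (rule ifourier_lborel[OF schwartz_measurable[OF schwartz_Phi], symmetric])
qed

lemma schwartz_wigner_symbol:
  "schwartz (wigner_symbol \<sigma>x \<epsilon> (smoothed_wigner \<sigma>x \<sigma>k \<epsilon> f f) x k)"
  unfolding wigner_symbol_ifourier by (rule schwartz_ifourier[OF schwartz_Phi])

text \<open>
  Since the symbol is the inverse transform of \<open>\<Phi>\<close>, pairing the transform of V with it is pairing V with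
  \<open>\<Phi>\<close>, which is the shear substitution q = u + \<open>\<epsilon>\<close> y / 2 in the definition of the transform.\<close>

theorem wigner_potential_pairing:
  assumes V: "tempered_fun V"
  shows "smoothed_wigner \<sigma>x \<sigma>k \<epsilon> (\<lambda>x. complex_of_real (V x) * f x) f x k =
      distr_fourier (distr_of V) (wigner_symbol \<sigma>x \<epsilon> (smoothed_wigner \<sigma>x \<sigma>k \<epsilon> f f) x k)"
    and "smoothed_wigner \<sigma>x \<sigma>k \<epsilon> (\<lambda>x. complex_of_real (V x) * f x) f x k = (LINT q|lebesgue. complex_of_real (V q) * Phi x k q)"
proof -
  obtain Vb where Vb: "Vb \<in> borel_measurable borel" "AE x in lborel. V x = Vb x"
    "\<And>\<Phi>. schwartz \<Phi> \<Longrightarrow> integrable lborel (\<lambda>x. complex_of_real (Vb x) * \<Phi> x)"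
    "\<And>\<Phi>. schwartz \<Phi> \<Longrightarrow> (LINT x|lebesgue. complex_of_real (V x) * \<Phi> x) = (LINT x|lborel. complex_of_real (Vb x) * \<Phi> x)"
    by (rule tempered_fun_borel[OF V]) (rule that)
  note [measurable] = Vb(1)
  have "smoothed_wigner \<sigma>x \<sigma>k \<epsilon> (\<lambda>x. complex_of_real (V x) * f x) f x k =
    (LINT p|lebesgue. wker x k p * (complex_of_real (V (fst p + (\<epsilon> / 2) *\<^sub>R snd p)) * amp p))"
    unfolding smoothed_wigner_wker amp_def by (simp only: mult.assoc)
  also have "\<dots> = (LINT p|lborel. wker x k p * (complex_of_real (Vb (fst p + (\<epsilon> / 2) *\<^sub>R snd p)) * amp p))"
  proof (rule lebesgue_integral_AE)
    have "AE p in lborel. V (fst p + (\<epsilon> / 2) *\<^sub>R snd p) = Vb (fst p + (\<epsilon> / 2) *\<^sub>R snd p)"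
      by (rule AE_shear[OF Vb(2)])
    then show "AE p in lborel. wker x k p * (complex_of_real (V (fst p + (\<epsilon> / 2) *\<^sub>R snd p)) * amp p) = wker x k p * (complex_of_real (Vb (fst p + (\<epsilon> / 2) *\<^sub>R snd p)) * amp p)"
      by eventually_elim simp
  qed measurable
  also have "\<dots> = (LINT q|lborel. complex_of_real (Vb q) * Phi x k q)"
    by (rule wigner_pairing(2)[OF _ Vb(3)[OF f]]) measurable
  also have "\<dots> = (LINT q|lebesgue. complex_of_real (V q) * Phi x k q)" by (rule Vb(4)[OF schwartz_Phi, symmetric])
  finally show 1: "smoothed_wigner \<sigma>x \<sigma>k \<epsilon> (\<lambda>x. complex_of_real (V x) * f x) f x k = (LINT q|lebesgue. complex_of_real (V q) * Phi x k q)" .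
  show "smoothed_wigner \<sigma>x \<sigma>k \<epsilon> (\<lambda>x. complex_of_real (V x) * f x) f x k =
      distr_fourier (distr_of V) (wigner_symbol \<sigma>x \<epsilon> (smoothed_wigner \<sigma>x \<sigma>k \<epsilon> f f) x k)"
    unfolding 1 wigner_symbol_ifourier distr_fourier_def distr_of_def fourier_ifourier[OF schwartz_Phi] ..
qed

end

section \<open>The remainder of the Hermite expansion\<close>

lemma gam_moment:
  assumes a: "a > 0"
  shows "integrable lborel (\<lambda>z::real^'n::finite. (sqrt a + norm z) ^ k * gam a z)"
    and "(LINT z|lborel. (sqrt a + norm (z::real^'n)) ^ k * gam a z) = sqrt a ^ k * (LINT w|lborel. (1 + norm (w::real^'n)) ^ k * gam 1 w)"
proof -
  let ?f = "\<lambda>z::real^'n. (sqrt a + norm z) ^ k * gam a z"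
  have s: "sqrt a > 0" using a by simp
  have g: "gam a (0 + sqrt a *\<^sub>R w) = (1 / sqrt a) ^ CARD('n) * gam 1 w" for w :: "real^'n"
    using a by (simp add: gam_def real_sqrt_mult power_mult_distrib power_divide mult_ac)
  have sc: "?f (0 + sqrt a *\<^sub>R w) = (sqrt a ^ k * (1 / sqrt a) ^ CARD('n)) * ((1 + norm w) ^ k * gam 1 w)" for w :: "real^'n"
  proof -
    have "sqrt a + norm (0 + sqrt a *\<^sub>R w) = sqrt a * (1 + norm w)" using s by (simp add: distrib_left)
    then show ?thesis unfolding g by (simp only: power_mult_distrib mult_ac)
  qed
  have 1: "integrable lborel (\<lambda>w::real^'n. (1 + norm w) ^ k * gam 1 w)"
    using integrable_mult_right[OF gaussian_poly_integrable[where 'n='n, of "1/2" k], of "(1 / sqrt (2 * pi * 1)) ^ CARD('n)"]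
    by (simp add: gam_def mult_ac)
  have fm: "?f \<in> borel_measurable borel" by measurable
  show "integrable lborel ?f"
    using lborel_integral_affine(2)[of "sqrt a" ?f 0, OF _ fm] s 1 unfolding sc by (simp add: integrable_mult_right)
  have "(LINT z|lborel. ?f z) = \<bar>sqrt a\<bar> ^ DIM(real^'n) *\<^sub>R (LINT w|lborel. ?f (0 + sqrt a *\<^sub>R w))"
    by (rule lborel_integral_affine(1)[OF _ fm]) (use s in simp)
  also have "\<dots> = sqrt a ^ k * (LINT w|lborel. (1 + norm (w::real^'n)) ^ k * gam 1 w)"
    unfolding sc integral_mult_right_zero using s by (simp add: power_divide)
  finally show "(LINT z|lborel. ?f z) = sqrt a ^ k * (LINT w|lborel. (1 + norm (w::real^'n)) ^ k * gam 1 w)" .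
qed

text \<open>
  Scaling z by \<open>\<surd>a\<close> reduces the Gaussian moments to variance 1; a function of order |z|^K then has a
  coefficient of order D of size \<open>\<surd>a\<close> to the power K - |D|.\<close>

lemma hcoef_bound:
  fixes \<rho> :: "real^'n::finite \<Rightarrow> complex"
  assumes a: "a > 0" and \<rho>[measurable]: "\<rho> \<in> borel_measurable borel" and C: "C \<ge> 0" "\<And>z. norm (\<rho> z) \<le> C * norm z ^ K"
  shows "integrable lborel (\<lambda>z. \<rho> z * (hemc a D z * gamc a z))"
    and "norm (hcoef a \<rho> D) * sqrt a ^ msize D \<le> C * real (mfact D) * sqrt a ^ K * (LINT w|lborel. (1 + norm (w::real^'n)) ^ (K + msize D) * gam 1 w)"
proof -
  let ?d = "msize D"
  have s: "sqrt a > 0" using a by simp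
  let ?g = "\<lambda>z::real^'n. (C * real (mfact D)) * ((sqrt a + norm z) ^ (K + ?d) * gam a z)"
  have le: "norm (\<rho> z * (hemc a D z * gamc a z)) \<le> ?g z" for z
  proof -
    have "norm (\<rho> z) \<le> C * (sqrt a + norm z) ^ K"
      using C(2)[of z] by (rule order_trans) (intro mult_left_mono power_mono C, use s in auto)
    then have "norm (\<rho> z) * (\<bar>hem a D z\<bar> * gam a z) \<le> (C * (sqrt a + norm z) ^ K) * ((real (mfact D) * (sqrt a + norm z) ^ ?d) * gam a z)"
      using s by (intro mult_mono mult_right_mono abs_hem_le[OF a] gam_nonneg[OF a] mult_nonneg_nonneg C) auto
    then show ?thesis using gam_nonneg[OF a, of z] by (simp add: norm_mult power_add mult_ac)
  qed
  have gi: "integrable lborel ?g" by (intro integrable_mult_right gam_moment(1)[OF a])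
  show i: "integrable lborel (\<lambda>z. \<rho> z * (hemc a D z * gamc a z))"
    by (rule Bochner_Integration.integrable_bound[OF gi]) (measurable, use le order_trans[OF _ abs_ge_self] in \<open>auto intro!: AE_I2\<close>)
  have "norm (LINT z|lborel. \<rho> z * (hemc a D z * gamc a z)) \<le> (LINT z|lborel. norm (\<rho> z * (hemc a D z * gamc a z)))"
    by (rule integral_norm_bound)
  also have "\<dots> \<le> (LINT z|lborel. ?g z)" by (rule integral_mono[OF integrable_norm[OF i] gi le])
  also have "\<dots> = C * real (mfact D) * (sqrt a ^ (K + ?d) * (LINT w|lborel. (1 + norm (w::real^'n)) ^ (K + ?d) * gam 1 w))"
    unfolding integral_mult_right_zero gam_moment(2)[OF a] ..
  finally have b: "norm (LINT z|lborel. \<rho> z * (hemc a D z * gamc a z)) \<le> \<dots>" .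
  have e: "1 / a ^ ?d * X * sqrt a ^ ?d \<le> P * sqrt a ^ K * M" if "X \<le> P * (sqrt a ^ (K + ?d) * M)" for X P M
  proof -
    have aa: "a ^ ?d = sqrt a ^ ?d * sqrt a ^ ?d" using a by (simp flip: power_mult_distrib)
    have "1 / a ^ ?d * X * sqrt a ^ ?d \<le> 1 / a ^ ?d * (P * (sqrt a ^ (K + ?d) * M)) * sqrt a ^ ?d"
      using a s by (intro mult_right_mono mult_left_mono that) auto
    also have "\<dots> = P * sqrt a ^ K * M" using s unfolding aa power_add by (simp add: field_simps)
    finally show ?thesis .
  qed
  have "norm (hcoef a \<rho> D) = 1 / a ^ ?d * norm (LINT z|lborel. \<rho> z * (hemc a D z * gamc a z))"
    unfolding hcoef_def norm_mult norm_of_real using a by simp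
  then show "norm (hcoef a \<rho> D) * sqrt a ^ ?d \<le> C * real (mfact D) * sqrt a ^ K * (LINT w|lborel. (1 + norm (w::real^'n)) ^ (K + ?d) * gam 1 w)"
    using e[OF b] by simp
qed

text \<open>
  The polynomial Q is reproduced exactly, so only v - Q contributes, and every term of its expansion has
  total homogeneity N + 1 in (\<open>\<surd>a\<close>, z, h).\<close>

lemma hermite_remainder:
  fixes N :: nat
  obtains \<kappa> where "\<kappa> \<ge> 0" "\<And>a v Q C z (h :: real^'n::finite). a > 0 \<Longrightarrow> v \<in> borel_measurable borel \<Longrightarrow> polyn N Q \<Longrightarrow>
      \<forall>z. norm (v z - Q z) \<le> C * norm z ^ Suc N \<Longrightarrow>
      norm (v (z + h) - (\<Sum>(A, B)\<in>index_pairs N. hcoef a v (\<lambda>i. A i + B i) * hemc a A z * mpow (coord h) B / of_nat (mfact A * mfact B)))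
        \<le> C * \<kappa> * (sqrt a + norm z + norm h) ^ Suc N"
proof -
  define \<mu> where "\<mu> k = (LINT w|lborel. (1 + norm (w::real^'n)) ^ k * gam 1 w)" for k
  have \<mu>: "\<mu> k \<ge> 0" for k unfolding \<mu>_def by (rule integral_nonneg_AE) (simp add: gam_nonneg)
  define \<nu> where "\<nu> A B = real (mfact (\<lambda>i. A i + B i)) * \<mu> (Suc N + msize (\<lambda>i. A i + B i))" for A B :: "'n \<Rightarrow> nat"
  have \<nu>: "\<nu> A B \<ge> 0" for A B unfolding \<nu>_def by (intro mult_nonneg_nonneg \<mu>) simp
  define \<kappa> where "\<kappa> = 1 + (\<Sum>(A, B)\<in>index_pairs N. \<nu> A B)"
  show thesis
  proof (rule that[of \<kappa>])
    show "\<kappa> \<ge> 0" unfolding \<kappa>_def by (intro add_nonneg_nonneg sum_nonneg) (auto simp: \<nu>)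
    fix a C :: real and v Q :: "real^'n \<Rightarrow> complex" and z h :: "real^'n"
    assume a: "a > 0" and v[measurable]: "v \<in> borel_measurable borel" and Q: "polyn N Q" and "\<forall>z. norm (v z - Q z) \<le> C * norm z ^ Suc N"
    then have bd: "norm (v z - Q z) \<le> C * norm z ^ Suc N" for z by blast
    have C: "C \<ge> 0" using order_trans[OF norm_ge_zero bd[of "axis undefined 1"]] by (simp add: norm_axis_1)
    define \<rho> where "\<rho> z = v z - Q z" for z
    have Qm[measurable]: "Q \<in> borel_measurable borel"
      by (rule borel_measurable_continuous_onI[OF differentiable_imp_continuous_on[OF regular_SucD(1)[OF polyn_regular[OF Q]]]])
    have \<rho>m[measurable]: "\<rho> \<in> borel_measurable borel" unfolding \<rho>_def[abs_def] by measurable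
    have \<rho>: "norm (\<rho> z) \<le> C * norm z ^ Suc N" for z unfolding \<rho>_def by (rule bd)
    have hc: "hcoef a v D = hcoef a Q D + hcoef a \<rho> D" for D
    proof -
      have 1: "integrable lborel (\<lambda>z. Q z * (hemc a D z * gamc a z))"
        using schwartz_integrable[OF schwartz_moderate_gam[OF a, of "\<lambda>z. Q z * hemc a D z", OF regular_moderate_mult[OF polyn_regular[OF Q] regular_hem]]]
        by (simp add: mult.assoc)
      have "v z = Q z + \<rho> z" for z by (simp add: \<rho>_def)
      then show ?thesis unfolding hcoef_def
        by (simp only: distrib_right Bochner_Integration.integral_add[OF 1 hcoef_bound(1)[OF a \<rho>m C \<rho>]] distrib_left)
    qed
    let ?T = "sqrt a + norm z + norm h"
    let ?t = "\<lambda>c A B. c * hemc a A z * mpow (coord h) B / of_nat (mfact A * mfact B)"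
    have s: "sqrt a > 0" using a by simp
    have T: "sqrt a \<le> ?T" "sqrt a + norm z \<le> ?T" "norm h \<le> ?T" "?T \<ge> 0" using s by auto
    have "v (z + h) - (\<Sum>(A, B)\<in>index_pairs N. ?t (hcoef a v (\<lambda>i. A i + B i)) A B)
       = \<rho> (z + h) - (\<Sum>(A, B)\<in>index_pairs N. ?t (hcoef a \<rho> (\<lambda>i. A i + B i)) A B)"
    proof -
      have "(\<Sum>(A, B)\<in>index_pairs N. ?t (hcoef a v (\<lambda>i. A i + B i)) A B) =
        (\<Sum>(A, B)\<in>index_pairs N. ?t (hcoef a Q (\<lambda>i. A i + B i)) A B) + (\<Sum>(A, B)\<in>index_pairs N. ?t (hcoef a \<rho> (\<lambda>i. A i + B i)) A B)"
        unfolding hc by (simp add: sum.distrib[symmetric] split_beta distrib_right add_divide_distrib)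
      then show ?thesis unfolding hermite_expansion_polyn[OF a Q, symmetric] \<rho>_def by simp
    qed
    also have "norm \<dots> \<le> norm (\<rho> (z + h)) + norm (\<Sum>(A, B)\<in>index_pairs N. ?t (hcoef a \<rho> (\<lambda>i. A i + B i)) A B)"
      by (rule norm_triangle_ineq4)
    also have "\<dots> \<le> C * ?T ^ Suc N + (\<Sum>(A, B)\<in>index_pairs N. C * \<nu> A B * ?T ^ Suc N)"
    proof (rule add_mono)
      have "norm (z + h) \<le> ?T" using norm_triangle_ineq[of z h] s by linarith
      then show "norm (\<rho> (z + h)) \<le> C * ?T ^ Suc N"
        by (intro order_trans[OF \<rho>] mult_left_mono power_mono C) auto
      show "norm (\<Sum>(A, B)\<in>index_pairs N. ?t (hcoef a \<rho> (\<lambda>i. A i + B i)) A B) \<le> (\<Sum>(A, B)\<in>index_pairs N. C * \<nu> A B * ?T ^ Suc N)"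
      proof (rule sum_norm_le, clarify)
        fix A B :: "'n \<Rightarrow> nat" assume AB: "(A, B) \<in> index_pairs N"
        let ?D = "\<lambda>i. A i + B i"
        have d: "msize ?D = msize A + msize B" by (simp add: msize_def sum.distrib)
        have dN: "msize A + msize B \<le> N" using AB by (simp add: index_pairs_def)
        define k where "k = Suc N - msize ?D"
        have k: "Suc N = k + msize ?D" using dN d by (simp add: k_def)
        have hcb: "norm (hcoef a \<rho> ?D) \<le> C * \<nu> A B * ?T ^ k"
        proof -
          have "norm (hcoef a \<rho> ?D) * sqrt a ^ msize ?D \<le> C * \<nu> A B * sqrt a ^ k * sqrt a ^ msize ?D"
            using hcoef_bound(2)[OF a \<rho>m C(1) \<rho>, of ?D] unfolding \<nu>_def \<mu>_def mult.assoc power_add[symmetric] k[symmetric]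
            by (simp only: mult_ac)
          then have "norm (hcoef a \<rho> ?D) \<le> C * \<nu> A B * sqrt a ^ k" using s by simp
          also have "\<dots> \<le> C * \<nu> A B * ?T ^ k" using T s by (intro mult_left_mono power_mono mult_nonneg_nonneg C \<nu>) auto
          finally show ?thesis .
        qed
        have hb: "norm (hemc a A z) \<le> real (mfact A) * ?T ^ msize A"
          unfolding norm_of_real using T s by (intro order_trans[OF abs_hem_le[OF a]] mult_left_mono power_mono) auto
        have mb: "norm (mpow (coord h) B) \<le> real (mfact B) * ?T ^ msize B"
        proof -
          have "norm (mpow (coord h) B) \<le> norm h ^ msize B" by (rule norm_mpow_le) (simp add: component_le_norm_cart)
          also have "\<dots> \<le> ?T ^ msize B" using T by (intro power_mono) auto
          also have "\<dots> \<le> real (mfact B) * ?T ^ msize B"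
            using mult_right_mono[of 1 "real (mfact B)", OF _ zero_le_power[OF T(4), of "msize B"]] mfact_pos[of B] by simp
          finally show ?thesis .
        qed
        have "norm (hcoef a \<rho> ?D * hemc a A z * mpow (coord h) B) \<le> (C * \<nu> A B * ?T ^ k) * (real (mfact A) * ?T ^ msize A) * (real (mfact B) * ?T ^ msize B)"
          unfolding norm_mult using T(4) by (intro mult_mono hcb hb mb mult_nonneg_nonneg C \<nu>) auto
        also have "\<dots> = C * \<nu> A B * ?T ^ Suc N * real (mfact A * mfact B)"
          unfolding k d power_add by (simp add: mult_ac)
        finally have "norm (hcoef a \<rho> ?D * hemc a A z * mpow (coord h) B) / real (mfact A * mfact B) \<le> C * \<nu> A B * ?T ^ Suc N"
          using mfact_pos[of A] mfact_pos[of B] by (simp add: pos_divide_le_eq)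
        then show "norm (?t (hcoef a \<rho> ?D) A B) \<le> C * \<nu> A B * ?T ^ Suc N"
          unfolding norm_divide norm_of_nat .
      qed
    qed
    also have "\<dots> = C * \<kappa> * ?T ^ Suc N"
      by (simp add: \<kappa>_def sum_distrib_left sum_distrib_right distrib_left distrib_right split_beta del: power_Suc)
    finally show "norm (v (z + h) - (\<Sum>(A, B)\<in>index_pairs N. ?t (hcoef a v (\<lambda>i. A i + B i)) A B)) \<le> C * \<kappa> * ?T ^ Suc N" .
  qed
qed

section \<open>The expansion as an average over phase space\<close>

context wigner
begin

text \<open>
  The factor that the momentum derivatives of order B bring down from the oscillation.\<close>

definition osc :: "('n \<Rightarrow> nat) \<Rightarrow> real^'n \<Rightarrow> complex" where
  "osc B y = mpow (\<lambda>i. - 2 * pi * \<i> * complex_of_real (y $ i)) B"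

definition dens :: "('n \<Rightarrow> nat) \<Rightarrow> (real^'n) \<times> (real^'n) \<Rightarrow> complex" where
  "dens B p = osc B (snd p) * (complex_of_real (damp (snd p)) * amp p)"

lemma osc_measurable[measurable]: "osc B \<in> borel_measurable borel"
  unfolding osc_def[abs_def] by measurable

lemma dens_measurable[measurable]: "dens B \<in> borel_measurable borel"
  unfolding dens_def[abs_def] by measurable

lemma norm_dens: "\<exists>C\<ge>0. \<forall>p. norm (dens B p) \<le> C * ((1 + norm (snd p)) ^ msize B * damp (snd p))"
proof -
  obtain M where M: "M \<ge> 0" "\<And>x. norm (f x) \<le> M" using schwartz_bounded[OF f] by blast
  have "norm (dens B p) \<le> ((2 * pi) ^ msize B * (M * M)) * ((1 + norm (snd p)) ^ msize B * damp (snd p))" for p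
  proof -
    have o: "norm (osc B (snd p)) \<le> (2 * pi * (1 + norm (snd p))) ^ msize B"
      unfolding osc_def
      by (rule norm_mpow_le) (auto simp: norm_mult intro!: order_trans[OF component_le_norm_cart])
    have a: "norm (amp p) \<le> M * M" unfolding amp_def norm_mult complex_mod_cnj by (intro mult_mono M) (use M in auto)
    have d: "norm (complex_of_real (damp (snd p))) = damp (snd p)" using damp_bounds[of "snd p"] by simp
    have "norm (dens B p) \<le> (2 * pi * (1 + norm (snd p))) ^ msize B * (damp (snd p) * (M * M))"
      unfolding dens_def norm_mult[of "osc B (snd p)"] norm_mult[of _ "amp p"] d using damp_bounds[of "snd p"] M
      by (intro mult_mono o a mult_left_mono mult_nonneg_nonneg) auto
    then show ?thesis by (simp only: power_mult_distrib mult_ac)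
  qed
  then show ?thesis using M by (intro exI[of _ "(2 * pi) ^ msize B * (M * M)"]) auto
qed

lemma damp_poly_integrable: "integrable lborel (\<lambda>y::real^'n. (1 + norm y) ^ k * damp y)"
  unfolding damp_def by (rule gaussian_poly_integrable) (use pos in simp)

lemma integrable_translate:
  fixes g :: "real^'n \<Rightarrow> real" assumes "integrable lborel g" "g \<in> borel_measurable borel"
  shows "integrable lborel (\<lambda>u. g (u - x))"
  using lborel_integral_translate(2)[OF assms(2), of "- x"] assms(1) by simp

lemma dens_weight_integrable: "integrable lborel (\<lambda>p. norm (dens B p) / (1 + norm (fst p - x)) ^ (2 * CARD('n)))"
proof -
  obtain C where C: "C \<ge> 0" "\<And>p. norm (dens B p) \<le> C * ((1 + norm (snd p)) ^ msize B * damp (snd p))" using norm_dens by blast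
  show ?thesis
  proof (rule pair_integrable_lborel)
    show "integrable lborel (\<lambda>u. weight (u - x))" by (rule integrable_translate[OF integrable_weight weight_measurable])
    show "integrable lborel (\<lambda>y::real^'n. C * ((1 + norm y) ^ msize B * damp y))" by (intro integrable_mult_right damp_poly_integrable)
    show "(\<lambda>p. norm (dens B p) / (1 + norm (fst p - x)) ^ (2 * CARD('n))) \<in> borel_measurable borel" by measurable
    fix u y
    have "weight (u - x) * norm (dens B (u, y)) \<le> weight (u - x) * (C * ((1 + norm y) ^ msize B * damp y))"
      using C(2)[of "(u, y)"] weight_pos[of "u - x"] by (intro mult_left_mono) auto
    moreover have "norm (norm (dens B (u, y)) / (1 + norm (fst (u, y) - x)) ^ (2 * CARD('n))) = weight (u - x) * norm (dens B (u, y))"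
      by (simp add: weight_def abs_mult)
    ultimately show "norm (norm (dens B (u, y)) / (1 + norm (fst (u, y) - x)) ^ (2 * CARD('n))) \<le> weight (u - x) * (C * ((1 + norm y) ^ msize B * damp y))" by (simp only:)
  qed
qed

lemma gam_integrable: "integrable lborel (\<lambda>u::real^'n. gam var (u - x))"
  using gam_moment(1)[OF var_pos, of 0] by (intro integrable_translate) auto

lemma gam_dens_integrable: "integrable lborel (\<lambda>p. norm (snd p) ^ j * norm (gamc var (fst p - x) * dens B p))"
proof -
  obtain C where C: "C \<ge> 0" "\<And>p. norm (dens B p) \<le> C * ((1 + norm (snd p)) ^ msize B * damp (snd p))" using norm_dens by blast
  show ?thesis
  proof (rule pair_integrable_lborel)
    show "integrable lborel (\<lambda>u. gam var (u - x))" by (rule gam_integrable)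
    show "integrable lborel (\<lambda>y::real^'n. C * ((1 + norm y) ^ (j + msize B) * damp y))" by (intro integrable_mult_right damp_poly_integrable)
    show "(\<lambda>p. norm (snd p) ^ j * norm (gamc var (fst p - x) * dens B p)) \<in> borel_measurable borel" by measurable
    fix u y :: "real^'n"
    have g: "gam var (u - x) \<ge> 0" by (rule gam_nonneg[OF var_pos])
    have "norm y ^ j * (gam var (u - x) * norm (dens B (u, y))) \<le> (1 + norm y) ^ j * (gam var (u - x) * (C * ((1 + norm y) ^ msize B * damp y)))"
      using C(2)[of "(u, y)"] g by (intro mult_mono mult_left_mono power_mono) auto
    then show "norm (norm (snd (u, y)) ^ j * norm (gamc var (fst (u, y) - x) * dens B (u, y))) \<le> gam var (u - x) * (C * ((1 + norm y) ^ (j + msize B) * damp y))"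
      using g by (simp add: norm_mult abs_mult power_add mult_ac)
  qed
qed

lemma mderiv_wigner_momentum:
  "mderiv B (\<lambda>k. smoothed_wigner \<sigma>x \<sigma>k \<epsilon> f f x k) k = (LINT p|lborel. gamc var (fst p - x) * (chi (- k) (snd p) * dens B p))"
proof -
  let ?F = "\<lambda>B (k::real^'n). LINT p|lborel. chi (- k) (snd p) * (gamc var (fst p - x) * dens B p)"
  have "partial i (?F B) = ?F (B(i := Suc (B i)))" for i B
  proof
    fix k
    have m: "(\<lambda>p. gamc var (fst p - x) * dens B p) \<in> borel_measurable borel" by measurable
    have i: "integrable lborel (\<lambda>p. gamc var (fst p - x) * dens B p)"
      using gam_dens_integrable[of 0 x B] m by (simp add: integrable_norm_iff)
    have "partial i (?F B) k = (LINT p|lborel. chi (- k) (snd p) * ((- 2 * pi * \<i> * complex_of_real (snd p $ i)) * (gamc var (fst p - x) * dens B p)))"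
      by (rule partial_oscillation[OF _ i]) (measurable, use gam_dens_integrable[of 1 x B] in simp)
    also have "\<dots> = ?F (B(i := Suc (B i))) k"
      unfolding dens_def osc_def mpow_Suc by (simp only: mult_ac)
    finally show "partial i (?F B) k = ?F (B(i := Suc (B i))) k" .
  qed
  from mderiv_family0[where F="?F", OF this, of B]
  have "mderiv B (?F (\<lambda>_. 0)) k = ?F B k" by simp
  moreover have "?F (\<lambda>_. 0) = (\<lambda>k. smoothed_wigner \<sigma>x \<sigma>k \<epsilon> f f x k)"
    unfolding wigner_lborel wker_def dens_def osc_def by (simp add: mult_ac)
  ultimately show ?thesis by (simp add: mult.left_commute)
qed

text \<open>
  The momentum derivatives come first, as in the expansion; the position derivatives then only see the
  Gaussian.\<close>

lemma mderiv_wigner: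
  shows "integrable lborel (\<lambda>p. gder var A (fst p - x) * (chi (- k) (snd p) * dens B p))"
    and "mderiv A (\<lambda>x. mderiv B (\<lambda>k. smoothed_wigner \<sigma>x \<sigma>k \<epsilon> f f x k) k) x
     = (LINT p|lborel. gder var A (fst p - x) * (chi (- k) (snd p) * dens B p))"
proof -
  note [measurable] = chi_measurable
  have m: "(\<lambda>p. chi (- k) (snd p) * dens B p) \<in> borel_measurable lborel" by measurable
  have i: "integrable lborel (\<lambda>p. norm (chi (- k) (snd p) * dens B p) / (1 + norm (fst p - x)) ^ (2 * CARD('n)))" for x
    using dens_weight_integrable by (simp add: norm_mult)
  have fm: "fst \<in> (lborel :: ((real^'n) \<times> (real^'n)) measure) \<rightarrow>\<^sub>M borel" by measurable
  show "integrable lborel (\<lambda>p. gder var A (fst p - x) * (chi (- k) (snd p) * dens B p))"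
    by (rule average_has_vector_derivative(1)[OF fm m schwartz_gder[OF var_pos] i])
  show "mderiv A (\<lambda>x. mderiv B (\<lambda>k. smoothed_wigner \<sigma>x \<sigma>k \<epsilon> f f x k) k) x
     = (LINT p|lborel. gder var A (fst p - x) * (chi (- k) (snd p) * dens B p))"
    unfolding mderiv_wigner_momentum by (rule mderiv_average[OF var_pos fm m i bounded_linear_ident])
qed

text \<open>
  The Wigner density with the monomials of the Hermite expansion inserted.\<close>

definition moment :: "real^'n \<Rightarrow> real^'n \<Rightarrow> ('n \<Rightarrow> nat) \<Rightarrow> ('n \<Rightarrow> nat) \<Rightarrow> (real^'n) \<times> (real^'n) \<Rightarrow> complex" where
  "moment x k A B p = wker x k p * amp p * (hemc var A (fst p - x) * mpow (coord ((\<epsilon> / 2) *\<^sub>R snd p)) B)"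

lemma moment_eq:
  "moment x k A B p = (complex_of_real (var ^ msize A) * (\<i> * complex_of_real (\<epsilon> / (4 * pi))) ^ msize B)
     * (gder var A (fst p - x) * (chi (- k) (snd p) * dens B p))"
proof -
  have h: "mpow (coord ((\<epsilon> / 2) *\<^sub>R y)) B = (\<i> * complex_of_real (\<epsilon> / (4 * pi))) ^ msize B * osc B y" for y
  proof -
    have "coord ((\<epsilon> / 2) *\<^sub>R y) i = (\<i> * complex_of_real (\<epsilon> / (4 * pi))) * (- 2 * pi * \<i> * complex_of_real (y $ i))" for i
      by (simp add: complex_eq_iff)
    then have "mpow (coord ((\<epsilon> / 2) *\<^sub>R y)) B = mpow (\<lambda>i. (\<i> * complex_of_real (\<epsilon> / (4 * pi))) * (- 2 * pi * \<i> * complex_of_real (y $ i))) B"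
      by (simp only:)
    also have "\<dots> = mpow (\<lambda>i. \<i> * complex_of_real (\<epsilon> / (4 * pi))) B * osc B y" unfolding osc_def by (rule mpow_mult)
    also have "mpow (\<lambda>i. \<i> * complex_of_real (\<epsilon> / (4 * pi))) B = (\<i> * complex_of_real (\<epsilon> / (4 * pi))) ^ msize B"
      by (simp only: mpow_def power_sum[symmetric] msize_def)
    finally show ?thesis .
  qed
  have v: "complex_of_real (var ^ msize A) * complex_of_real (1 / var ^ msize A) = 1"
    unfolding of_real_mult[symmetric] using var_pos by simp
  have "complex_of_real (var ^ msize A) * gder var A z = hemc var A z * gamc var z" for z
    unfolding gder_def mult.assoc[symmetric] v by simp
  note vg = this
  have comb: "G * (ch * d) * a * (hm * (K * o')) = (v * K) * (g * (ch * (o' * (d * a))))" if "v * g = hm * G" for G ch d a hm K o' v g :: complex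
  proof -
    have "(v * K) * (g * (ch * (o' * (d * a)))) = (v * g) * (K * (ch * (o' * (d * a))))" by (simp only: mult_ac)
    then show ?thesis unfolding that by (simp only: mult_ac)
  qed
  show ?thesis unfolding moment_def h wker_def dens_def by (rule comb[OF vg])
qed

lemma moment_integrable: "integrable lborel (moment x k A B)"
  unfolding moment_eq[abs_def] by (intro integrable_mult_right mderiv_wigner(1))

lemma moment_integral:
  "(LINT p|lborel. moment x k A B p) = (complex_of_real (var ^ msize A) * (\<i> * complex_of_real (\<epsilon> / (4 * pi))) ^ msize B)
     * mderiv A (\<lambda>x. mderiv B (\<lambda>k. smoothed_wigner \<sigma>x \<sigma>k \<epsilon> f f x k) k) x"
  unfolding moment_eq mderiv_wigner(2) by (rule integral_mult_right_zero)

text \<open>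
  With l position and j momentum derivatives, the constant of the expansion is exactly what turns the
  derivatives into Hermite polynomials and into powers of \<open>\<epsilon>\<close> y / 2.\<close>

lemma expansion_constant:
  "complex_of_real (\<epsilon> ^ (l + j)) / (4 * pi * \<i>) ^ (l + j) * ((\<i> * complex_of_real (\<sigma>x\<^sup>2)) ^ l * (- 1) ^ j)
     = complex_of_real (var ^ l) * (\<i> * complex_of_real (\<epsilon> / (4 * pi))) ^ j"
proof -
  have 1: "complex_of_real \<epsilon> / (4 * pi * \<i>) * (\<i> * complex_of_real (\<sigma>x\<^sup>2)) = complex_of_real var"
    by (simp add: var_def field_simps)
  have 2: "complex_of_real \<epsilon> / (4 * pi * \<i>) * (- 1) = \<i> * complex_of_real (\<epsilon> / (4 * pi))"
    by (simp add: field_simps)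
  have "complex_of_real (\<epsilon> ^ (l + j)) / (4 * pi * \<i>) ^ (l + j) * ((\<i> * complex_of_real (\<sigma>x\<^sup>2)) ^ l * (- 1) ^ j)
    = (complex_of_real \<epsilon> / (4 * pi * \<i>) * (\<i> * complex_of_real (\<sigma>x\<^sup>2))) ^ l * (complex_of_real \<epsilon> / (4 * pi * \<i>) * (- 1)) ^ j"
  proof -
    have "e ^ (l + j) / q ^ (l + j) * (s ^ l * d ^ j) = (e / q * s) ^ l * (e / q * d) ^ j" for e q s d :: complex
      by (simp add: power_add power_mult_distrib power_divide)
    then show ?thesis unfolding of_real_power .
  qed
  also have "\<dots> = complex_of_real (var ^ l) * (\<i> * complex_of_real (\<epsilon> / (4 * pi))) ^ j" unfolding 1[unfolded of_real_power] 2 of_real_power ..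
  finally show ?thesis .
qed

lemma smoothed_expansion_moments:
  "smoothed_expansion N \<sigma>x \<epsilon> V (smoothed_wigner \<sigma>x \<sigma>k \<epsilon> f f) x k =
     (\<Sum>(A, B)\<in>index_pairs N. complex_of_real (mderiv (\<lambda>i. A i + B i) (smoothed_potential \<sigma>x \<epsilon> V) x) / of_nat (mfact A * mfact B)
        * (LINT p|lborel. moment x k A B p))"
proof -
  let ?t = "\<lambda>A B. complex_of_real (mderiv (\<lambda>i. A i + B i) (smoothed_potential \<sigma>x \<epsilon> V) x) / of_nat (mfact A * mfact B)"
  let ?w = "\<lambda>A B. mderiv A (\<lambda>x. mderiv B (\<lambda>k. smoothed_wigner \<sigma>x \<sigma>k \<epsilon> f f x k) k) x"
  have "smoothed_expansion N \<sigma>x \<epsilon> V (smoothed_wigner \<sigma>x \<sigma>k \<epsilon> f f) x k =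
    (\<Sum>m\<le>N. \<Sum>l\<le>m. \<Sum>A | msize A = l. \<Sum>B | msize B = m - l. ?t A B * (LINT p|lborel. moment x k A B p))"
    unfolding smoothed_expansion_def atLeast0AtMost
  proof (rule sum.cong[OF refl], subst sum_distrib_left, rule sum.cong[OF refl])
    fix m l :: nat assume "l \<in> {..m}"
    then have lm: "l + (m - l) = m" by simp
    have c: "complex_of_real (\<epsilon> ^ m) / (4 * pi * \<i>) ^ m * ((\<i> * complex_of_real (\<sigma>x\<^sup>2)) ^ l * (- 1) ^ (m - l))
      = complex_of_real (var ^ l) * (\<i> * complex_of_real (\<epsilon> / (4 * pi))) ^ (m - l)"
      using expansion_constant[of l "m - l"] unfolding lm .
    have "complex_of_real (\<epsilon> ^ m) / (4 * pi * \<i>) ^ m * ((\<i> * complex_of_real (\<sigma>x\<^sup>2)) ^ l * (- 1) ^ (m - l) * (\<Sum>A | msize A = l. \<Sum>B | msize B = m - l. ?t A B * ?w A B))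
      = (\<Sum>A | msize A = l. \<Sum>B | msize B = m - l. (complex_of_real (var ^ l) * (\<i> * complex_of_real (\<epsilon> / (4 * pi))) ^ (m - l)) * (?t A B * ?w A B))"
      unfolding mult.assoc[symmetric] unfolding mult.assoc[of "_ / _"] c sum_distrib_left by (simp only: mult.assoc)
    also have "\<dots> = (\<Sum>A | msize A = l. \<Sum>B | msize B = m - l. ?t A B * (LINT p|lborel. moment x k A B p))"
      by (intro sum.cong refl) (auto simp: moment_integral)
    finally show "complex_of_real (\<epsilon> ^ m) / (4 * pi * \<i>) ^ m * ((\<i> * complex_of_real (\<sigma>x\<^sup>2)) ^ l * (- 1) ^ (m - l) * (\<Sum>A | msize A = l. \<Sum>B | msize B = m - l. ?t A B * ?w A B))
      = (\<Sum>A | msize A = l. \<Sum>B | msize B = m - l. ?t A B * (LINT p|lborel. moment x k A B p))" .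
  qed
  also have "\<dots> = (\<Sum>(A, B)\<in>index_pairs N. ?t A B * (LINT p|lborel. moment x k A B p))" by (rule sum_index_pairs)
  finally show ?thesis .
qed

end

section \<open>The size of the remainder\<close>

text \<open>
  In the variables z / \<open>\<surd>\<epsilon>\<close> and \<open>\<surd>\<epsilon>\<close> y the powers of \<open>\<epsilon>\<close> come out in front, and the remaining
  polynomial is absorbed by the Gaussian in z and by half of the Gaussian in y. The other half is kept,
  since it has to make the integral over y converge.\<close>

lemma scaled_kernel_bound:
  fixes \<sigma>x \<sigma>k :: real
  assumes pos: "\<sigma>x > 0" "\<sigma>k > 0"
  obtains C where "C \<ge> 0" "\<And>\<epsilon> (z::real^'n::finite) (y::real^'n). \<epsilon> > 0 \<Longrightarrow>
     gam (\<epsilon> * \<sigma>x\<^sup>2 / (4 * pi)) z * exp (- (pi * \<epsilon> * \<sigma>k\<^sup>2 / 2) * (norm y)\<^sup>2) * (sqrt (\<epsilon> * \<sigma>x\<^sup>2 / (4 * pi)) + norm z + norm ((\<epsilon> / 2) *\<^sub>R y)) ^ K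
       \<le> C * (sqrt \<epsilon> ^ K / sqrt \<epsilon> ^ CARD('n)) * exp (- (pi * \<sigma>k\<^sup>2 / 4 * \<epsilon>) * (norm y)\<^sup>2)"
proof -
  define b where "b = sqrt (\<sigma>x\<^sup>2 / (4 * pi))"
  have b: "b > 0" using pos by (simp add: b_def)
  define c1 where "c1 = 1 / (2 * b\<^sup>2)"
  define c2 where "c2 = pi * \<sigma>k\<^sup>2 / 4"
  have c: "c1 > 0" "c2 > 0" using b pos by (simp_all add: c1_def c2_def)
  define E1 where "E1 = fact K * exp (1 + 1 / (4 * c1))"
  define E2 where "E2 = fact K * exp (1 + 1 / (4 * c2))"
  define g where "g = (1 / sqrt (2 * pi * b\<^sup>2)) ^ CARD('n)"
  have nn: "g \<ge> 0" "E1 \<ge> 0" "E2 \<ge> 0" using b by (simp_all add: g_def E1_def E2_def)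
  show thesis
  proof (rule that[of "g * (1 + b) ^ K * E1 * E2"])
    show "g * (1 + b) ^ K * E1 * E2 \<ge> 0" using nn b by simp
    fix \<epsilon> :: real and z y :: "real^'n" assume e: "\<epsilon> > 0"
    define \<delta> where "\<delta> = sqrt \<epsilon>"
    have \<delta>: "\<delta> > 0" "\<delta>\<^sup>2 = \<epsilon>" using e by (simp_all add: \<delta>_def)
    define s where "s = norm z / \<delta>"
    define t where "t = \<delta> * norm y"
    have st: "s \<ge> 0" "t \<ge> 0" using \<delta> by (simp_all add: s_def t_def)
    have sv: "sqrt (\<epsilon> * \<sigma>x\<^sup>2 / (4 * pi)) = \<delta> * b"
      by (simp add: \<delta>_def b_def flip: real_sqrt_mult)
    have v: "\<epsilon> * \<sigma>x\<^sup>2 / (4 * pi) = (\<delta> * b)\<^sup>2" unfolding sv[symmetric] using e by simp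
    have T: "\<delta> * b + norm z + norm ((\<epsilon> / 2) *\<^sub>R y) \<le> \<delta> * ((1 + b) * (1 + s) * (1 + t))"
    proof -
      have "norm ((\<epsilon> / 2) *\<^sub>R y) = \<delta> * (t / 2)" using e unfolding t_def \<delta>(2)[symmetric] by (simp add: power2_eq_square)
      moreover have "norm z = \<delta> * s" using \<delta> by (simp add: s_def)
      moreover have "b + s + t / 2 \<le> (1 + b) * (1 + s) * (1 + t)"
      proof -
        have "0 \<le> b * s" "0 \<le> b * t" "0 \<le> s * t" "0 \<le> b * s * t" using b st by auto
        then show ?thesis using st b unfolding distrib_left distrib_right by simp
      qed
      then have "\<delta> * (b + s + t / 2) \<le> \<delta> * ((1 + b) * (1 + s) * (1 + t))" using \<delta> by (intro mult_left_mono) auto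
      ultimately show ?thesis unfolding distrib_left by simp
    qed
    have G: "gam ((\<delta> * b)\<^sup>2) z = g / \<delta> ^ CARD('n) * exp (- c1 * s\<^sup>2)"
    proof -
      have "sqrt (2 * pi * (\<delta> * b)\<^sup>2) = \<delta> * sqrt (2 * pi * b\<^sup>2)" using \<delta>(1) b by (simp add: real_sqrt_mult power_mult_distrib)
      moreover have "- (1 / (2 * (\<delta> * b)\<^sup>2)) * (norm z)\<^sup>2 = - c1 * s\<^sup>2"
        using \<delta>(1) b by (simp add: c1_def s_def power_mult_distrib power_divide)
      ultimately show ?thesis unfolding gam_def g_def by (simp add: power_divide power_mult_distrib)
    qed
    have D: "exp (- (pi * \<epsilon> * \<sigma>k\<^sup>2 / 2) * (norm y)\<^sup>2) = exp (- c2 * t\<^sup>2) * exp (- c2 * t\<^sup>2)"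
      unfolding exp_add[symmetric] t_def c2_def power_mult_distrib \<delta>(2) by (simp add: field_simps)
    have D': "exp (- (pi * \<sigma>k\<^sup>2 / 4 * \<epsilon>) * (norm y)\<^sup>2) = exp (- c2 * t\<^sup>2)"
      unfolding t_def c2_def power_mult_distrib \<delta>(2) by (simp add: field_simps)
    have "(\<delta> * b + norm z + norm ((\<epsilon> / 2) *\<^sub>R y)) ^ K \<le> (\<delta> * ((1 + b) * (1 + s) * (1 + t))) ^ K"
      by (rule power_mono[OF T]) (use \<delta> b in simp)
    then have "gam ((\<delta> * b)\<^sup>2) z * (exp (- c2 * t\<^sup>2) * exp (- c2 * t\<^sup>2)) * (\<delta> * b + norm z + norm ((\<epsilon> / 2) *\<^sub>R y)) ^ K
        \<le> (g / \<delta> ^ CARD('n) * exp (- c1 * s\<^sup>2)) * (exp (- c2 * t\<^sup>2) * exp (- c2 * t\<^sup>2)) * (\<delta> * ((1 + b) * (1 + s) * (1 + t))) ^ K"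
      unfolding G using nn \<delta> by (intro mult_left_mono) auto
    also have "\<dots> = (g / \<delta> ^ CARD('n) * \<delta> ^ K * (1 + b) ^ K * exp (- c2 * t\<^sup>2)) * (((1 + s) ^ K * exp (- c1 * s\<^sup>2)) * ((1 + t) ^ K * exp (- c2 * t\<^sup>2)))"
      by (simp only: power_mult_distrib mult_ac)
    also have "\<dots> \<le> (g / \<delta> ^ CARD('n) * \<delta> ^ K * (1 + b) ^ K * exp (- c2 * t\<^sup>2)) * (E1 * E2)"
      unfolding E1_def E2_def using nn \<delta> b st
      by (intro mult_left_mono mult_mono power_gaussian_bound c st) auto
    finally show "gam (\<epsilon> * \<sigma>x\<^sup>2 / (4 * pi)) z * exp (- (pi * \<epsilon> * \<sigma>k\<^sup>2 / 2) * (norm y)\<^sup>2) * (sqrt (\<epsilon> * \<sigma>x\<^sup>2 / (4 * pi)) + norm z + norm ((\<epsilon> / 2) *\<^sub>R y)) ^ K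
       \<le> g * (1 + b) ^ K * E1 * E2 * (sqrt \<epsilon> ^ K / sqrt \<epsilon> ^ CARD('n)) * exp (- (pi * \<sigma>k\<^sup>2 / 4 * \<epsilon>) * (norm y)\<^sup>2)"
      unfolding D D' sv unfolding v \<delta>_def[symmetric] by (simp add: mult_ac)
  qed
qed

lemma gaussian_integral_scale:
  assumes e: "\<epsilon> > 0"
  shows "(LINT y|lborel. exp (- (c * \<epsilon>) * (norm (y::real^'n::finite))\<^sup>2)) = (LINT y|lborel. exp (- c * (norm (y::real^'n))\<^sup>2)) / sqrt \<epsilon> ^ CARD('n)"
proof -
  let ?f = "\<lambda>y::real^'n. exp (- (c * \<epsilon>) * (norm y)\<^sup>2)"
  have s: "1 / sqrt \<epsilon> \<noteq> 0" "sqrt \<epsilon> > 0" using e by auto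
  have sc: "?f (0 + (1 / sqrt \<epsilon>) *\<^sub>R y) = exp (- c * (norm y)\<^sup>2)" for y
    using e by (simp add: power_mult_distrib power_divide)
  have "(LINT y|lborel. ?f y) = \<bar>1 / sqrt \<epsilon>\<bar> ^ DIM(real^'n) *\<^sub>R (LINT y|lborel. ?f (0 + (1 / sqrt \<epsilon>) *\<^sub>R y))"
    by (rule lborel_integral_affine(1)[OF s(1)]) measurable
  then show ?thesis unfolding sc using s by (simp add: power_divide)
qed

context wigner
begin

text \<open>
  The product of the two shifted values is at most half the sum of their squares, and each shift is
  removed by a shear.\<close>

lemma amp_average:
  assumes c: "c > 0"
  shows "integrable lborel (\<lambda>p. exp (- c * (norm (snd p))\<^sup>2) * norm (amp p))"
    and "(LINT p|lborel. exp (- c * (norm (snd p))\<^sup>2) * norm (amp p)) \<le> (LINT y|lborel. exp (- c * (norm (y::real^'n))\<^sup>2)) * (LINT u|lborel. (norm (f u))\<^sup>2)"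
proof -
  obtain M where M: "M \<ge> 0" "\<And>x. norm (f x) \<le> M" using schwartz_bounded[OF f] by blast
  have f2: "integrable lborel (\<lambda>u. (norm (f u))\<^sup>2)"
  proof (rule Bochner_Integration.integrable_bound)
    show "integrable lborel (\<lambda>u. M * norm (f u))" by (intro integrable_mult_right integrable_norm schwartz_integrable f)
    show "AE u in lborel. norm ((norm (f u))\<^sup>2) \<le> norm (M * norm (f u))"
      using M by (auto simp: power2_eq_square abs_mult intro!: mult_right_mono)
  qed measurable
  define G where "G p = exp (- c * (norm (snd p))\<^sup>2) * (norm (f (fst p)))\<^sup>2" for p :: "(real^'n) \<times> (real^'n)"
  have [measurable]: "(\<lambda>p::(real^'n) \<times> (real^'n). f (fst p)) \<in> borel_measurable borel"
    by (rule measurable_compose[OF fst_borel_measurable f_meas])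
  have Gm[measurable]: "G \<in> borel_measurable borel" unfolding G_def[abs_def] by measurable
  have Gi: "integrable lborel G"
    by (rule pair_integrable_lborel[OF f2 gaussian_integrable[OF c] Gm]) (simp add: G_def abs_mult)
  have GI: "(LINT p|lborel. G p) = (LINT y|lborel. exp (- c * (norm (y::real^'n))\<^sup>2)) * (LINT u|lborel. (norm (f u))\<^sup>2)"
    unfolding iterated_integral_lborel[OF Gi] unfolding G_def fst_conv snd_conv integral_mult_left_zero integral_mult_right_zero ..
  define H where "H h p = G (fst p + h *\<^sub>R snd p, snd p)" for h p
  have Hi: "integrable lborel (H h)" for h unfolding H_def[abs_def] using integral_shear(2)[OF Gm] Gi by blast
  have HI: "(LINT p|lborel. H h p) = (LINT p|lborel. G p)" for h unfolding H_def by (rule integral_shear(1)[OF Gm])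
  let ?L = "\<lambda>p. exp (- c * (norm (snd p))\<^sup>2) * norm (amp p)"
  let ?R = "\<lambda>p. (H (\<epsilon> / 2) p + H (- (\<epsilon> / 2)) p) / 2"
  have Ri: "integrable lborel ?R" by (intro integrable_divide Bochner_Integration.integrable_add Hi)
  have le: "?L p \<le> ?R p" for p
  proof -
    let ?a = "norm (f (fst p + (\<epsilon> / 2) *\<^sub>R snd p))" and ?b = "norm (f (fst p - (\<epsilon> / 2) *\<^sub>R snd p))"
    have "?a * ?b \<le> (?a\<^sup>2 + ?b\<^sup>2) / 2" using sum_squares_bound[of ?a ?b] by simp
    then have "exp (- c * (norm (snd p))\<^sup>2) * (?a * ?b) \<le> exp (- c * (norm (snd p))\<^sup>2) * ((?a\<^sup>2 + ?b\<^sup>2) / 2)" by (rule mult_left_mono) simp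
    then show ?thesis by (simp add: amp_def norm_mult H_def G_def distrib_left add_divide_distrib)
  qed
  show Li: "integrable lborel ?L"
  proof (rule Bochner_Integration.integrable_bound[OF Ri])
    show "AE p in lborel. norm (?L p) \<le> norm (?R p)"
    proof (rule AE_I2)
      fix p show "norm (?L p) \<le> norm (?R p)" using le[of p] order_trans[OF le[of p] abs_ge_self] by (simp add: abs_mult)
    qed
  qed measurable
  have "(LINT p|lborel. ?L p) \<le> (LINT p|lborel. ?R p)" by (rule integral_mono[OF Li Ri le])
  also have "\<dots> = (LINT p|lborel. G p)" using Hi by (simp add: HI)
  finally show "(LINT p|lborel. ?L p) \<le> (LINT y|lborel. exp (- c * (norm (y::real^'n))\<^sup>2)) * (LINT u|lborel. (norm (f u))\<^sup>2)" unfolding GI .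
qed

end

text \<open>
  The potential enters only through a replacement with the properties supplied by
  potential_representation.\<close>

locale wigner_potential = wigner \<sigma>x \<sigma>k \<epsilon> f for \<sigma>x \<sigma>k \<epsilon> :: real and f :: "real^'n::finite \<Rightarrow> complex" +
  fixes V :: "real^'n \<Rightarrow> real" and V' :: "real^'n \<Rightarrow> complex" and N :: nat and C :: real
  assumes V: "tempered_fun V" and V'_measurable[measurable]: "V' \<in> borel_measurable borel" and V'_moderate: "moderate V'"
    and V'_pairing: "\<And>\<Phi>. schwartz \<Phi> \<Longrightarrow> (LINT x|lebesgue. complex_of_real (V x) * \<Phi> x) = (LINT x|lborel. V' x * \<Phi> x)"
    and V'_approx: "\<And>x. \<exists>Q. polyn N Q \<and> (\<forall>z. norm (V' (x + z) - Q z) \<le> C * norm z ^ Suc N)"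
begin

lemma smoothed_potential_average:
  "complex_of_real (smoothed_potential \<sigma>x \<epsilon> V x) = (LINT w|lborel. gamc var (w - x) * V' w)"
proof -
  have e: "(sqrt 2 / (sqrt \<epsilon> * \<sigma>x)) ^ CARD('n) * (exp (- 2 * pi * (norm (x - w))\<^sup>2 / (\<epsilon> * \<sigma>x\<^sup>2)) * V w) = V w * gam var (w - x)" for w
    unfolding wigner_prefactor[symmetric, of "w - x"] norm_minus_commute[of x w] by (simp add: mult_ac)
  have s: "schwartz (\<lambda>w. gamc var (w - x))"
    using schwartz_cmult[OF schwartz_gaussian[of "1 / (2 * var)" x], of "complex_of_real ((1 / sqrt (2 * pi * var)) ^ CARD('n))"] var_pos
    by (simp add: gam_def[abs_def])
  have "smoothed_potential \<sigma>x \<epsilon> V x = (LINT w|lebesgue. V w * gam var (w - x))"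
    unfolding smoothed_potential_def integral_mult_right_zero[symmetric] e ..
  then have "complex_of_real (smoothed_potential \<sigma>x \<epsilon> V x) = (LINT w|lebesgue. complex_of_real (V w) * gamc var (w - x))"
    by (simp only: integral_complex_of_real[symmetric] of_real_mult)
  then show ?thesis unfolding V'_pairing[OF s] by (simp only: mult.commute)
qed

text \<open>
  Derivatives fall on the Gaussian. The average of the replacement is real because it equals the smoothed
  potential, so its imaginary part is zero and stays so under differentiation.\<close>

lemma mderiv_smoothed_potential:
  "complex_of_real (mderiv D (smoothed_potential \<sigma>x \<epsilon> V) x) = hcoef var (\<lambda>z. V' (x + z)) D"
proof -
  obtain m B where B: "\<And>w. norm (V' w) \<le> B * (1 + norm w) ^ m" using V'_moderate unfolding moderate_def by blast
  have B0: "B \<ge> 0" using order_trans[OF norm_ge_zero B[of 0]] by simp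
  have int: "integrable lborel (\<lambda>w. norm (V' w) / (1 + norm (w - x)) ^ (m + 2 * CARD('n)))" for x
  proof (rule Bochner_Integration.integrable_bound)
    show "integrable lborel (\<lambda>w. B * (1 + norm x) ^ m * weight (w - x))"
      by (intro integrable_mult_right integrable_translate integrable_weight weight_measurable)
    show "AE w in lborel. norm (norm (V' w) / (1 + norm (w - x)) ^ (m + 2 * CARD('n))) \<le> norm (B * (1 + norm x) ^ m * weight (w - x))"
    proof (rule AE_I2)
      fix w
      have p: "1 + norm (w - x) > 0" by (simp add: add_pos_nonneg)
      have "norm w \<le> norm (w - x) + norm x" using norm_triangle_ineq[of "w - x" x] by simp
      then have "1 + norm w \<le> (1 + norm x) * (1 + norm (w - x))"
        using mult_nonneg_nonneg[OF norm_ge_zero[of x] norm_ge_zero[of "w - x"]] unfolding distrib_left distrib_right by linarith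
      then have "(1 + norm w) ^ m \<le> ((1 + norm x) * (1 + norm (w - x))) ^ m" by (intro power_mono) auto
      then have "norm (V' w) \<le> B * ((1 + norm x) ^ m * (1 + norm (w - x)) ^ m)"
        using B0 by (intro order_trans[OF B] mult_left_mono) (simp_all only: power_mult_distrib)
      then have "norm (V' w) / (1 + norm (w - x)) ^ (m + 2 * CARD('n)) \<le> B * ((1 + norm x) ^ m * (1 + norm (w - x)) ^ m) / (1 + norm (w - x)) ^ (m + 2 * CARD('n))"
        by (rule divide_right_mono) (use p in simp)
      also have "\<dots> = B * (1 + norm x) ^ m * weight (w - x)"
        using p unfolding weight_def power_add by (simp add: field_simps)
      finally have le: "norm (V' w) / (1 + norm (w - x)) ^ (m + 2 * CARD('n)) \<le> B * (1 + norm x) ^ m * weight (w - x)" .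
      have "norm a \<le> norm b" if "a \<le> b" "0 \<le> a" for a b :: real using that by simp
      from this[OF le] show "norm (norm (V' w) / (1 + norm (w - x)) ^ (m + 2 * CARD('n))) \<le> norm (B * (1 + norm x) ^ m * weight (w - x))"
        using p by simp
    qed
  qed measurable
  have mm: "V' \<in> borel_measurable lborel" "(\<lambda>w::real^'n. w) \<in> lborel \<rightarrow>\<^sub>M borel" by measurable
  let ?I = "\<lambda>x. LINT w|lborel. gder var D (w - x) * V' w"
  have re: "mderiv D (\<lambda>x. Re (LINT w|lborel. gamc var (w - x) * V' w)) x = Re (?I x)"
    by (rule mderiv_average[OF var_pos mm(2,1) int bounded_linear_Re])
  have im: "mderiv D (\<lambda>x. Im (LINT w|lborel. gamc var (w - x) * V' w)) x = Im (?I x)"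
    by (rule mderiv_average[OF var_pos mm(2,1) int bounded_linear_Im])
  have "mderiv D (\<lambda>x::real^'n. 0::real) x = 0"
    using mderiv_family0[where F="\<lambda>_ _. 0 :: real", of D] by (simp add: partial_const)
  then have I: "complex_of_real (mderiv D (smoothed_potential \<sigma>x \<epsilon> V) x) = ?I x"
    using re im unfolding smoothed_potential_average[symmetric] by (simp add: complex_eq_iff)
  have gm: "(\<lambda>w. gder var D (w - x) * V' w) \<in> borel_measurable borel"
    using schwartz_measurable[OF schwartz_gder[OF var_pos]] by measurable
  have "?I x = (LINT z|lborel. gder var D z * V' (x + z))"
    using lborel_integral_translate(1)[OF gm, of x] by (simp add: add.commute)
  also have "\<dots> = hcoef var (\<lambda>z. V' (x + z)) D"
    unfolding hcoef_def integral_mult_right_zero[symmetric] gder_def by (simp only: mult_ac)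
  finally show ?thesis unfolding I .
qed

definition expterm :: "real^'n \<Rightarrow> (real^'n) \<times> (real^'n) \<Rightarrow> complex" where
  "expterm x p = (\<Sum>(A, B)\<in>index_pairs N. hcoef var (\<lambda>z. V' (x + z)) (\<lambda>i. A i + B i) * hemc var A (fst p - x) * mpow (coord ((\<epsilon> / 2) *\<^sub>R snd p)) B / of_nat (mfact A * mfact B))"

definition remainder :: "real^'n \<Rightarrow> real^'n \<Rightarrow> complex" where
  "remainder x k = smoothed_wigner \<sigma>x \<sigma>k \<epsilon> (\<lambda>x. complex_of_real (V x) * f x) f x k
     - smoothed_expansion N \<sigma>x \<epsilon> V (smoothed_wigner \<sigma>x \<sigma>k \<epsilon> f f) x k"

lemma wigner_V':
  shows "integrable lborel (\<lambda>p. wker x k p * (V' (fst p + (\<epsilon> / 2) *\<^sub>R snd p) * amp p))"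
    and "smoothed_wigner \<sigma>x \<sigma>k \<epsilon> (\<lambda>x. complex_of_real (V x) * f x) f x k = (LINT p|lborel. wker x k p * (V' (fst p + (\<epsilon> / 2) *\<^sub>R snd p) * amp p))"
proof -
  have i: "integrable lborel (\<lambda>q. V' q * f q)" by (rule moderate_schwartz_integrable[OF V'_measurable V'_moderate f])
  show "integrable lborel (\<lambda>p. wker x k p * (V' (fst p + (\<epsilon> / 2) *\<^sub>R snd p) * amp p))" by (rule wigner_pairing(1)[OF V'_measurable i])
  show "smoothed_wigner \<sigma>x \<sigma>k \<epsilon> (\<lambda>x. complex_of_real (V x) * f x) f x k = (LINT p|lborel. wker x k p * (V' (fst p + (\<epsilon> / 2) *\<^sub>R snd p) * amp p))"
    unfolding wigner_potential_pairing(2)[OF V] V'_pairing[OF schwartz_Phi] wigner_pairing(2)[OF V'_measurable i] ..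
qed

lemma expansion_V':
  shows "integrable lborel (\<lambda>p. wker x k p * (expterm x p * amp p))"
    and "smoothed_expansion N \<sigma>x \<epsilon> V (smoothed_wigner \<sigma>x \<sigma>k \<epsilon> f f) x k = (LINT p|lborel. wker x k p * (expterm x p * amp p))"
proof -
  let ?c = "\<lambda>A B. hcoef var (\<lambda>z. V' (x + z)) (\<lambda>i. A i + B i) / of_nat (mfact A * mfact B)"
  have e: "(\<lambda>p. wker x k p * (expterm x p * amp p)) = (\<lambda>p. \<Sum>q\<in>index_pairs N. ?c (fst q) (snd q) * moment x k (fst q) (snd q) p)"
    by (simp add: fun_eq_iff expterm_def moment_def split_beta sum_distrib_left sum_distrib_right mult_ac)
  have i: "integrable lborel (\<lambda>p. ?c A B * moment x k A B p)" for A B by (intro integrable_mult_right moment_integrable)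
  show "integrable lborel (\<lambda>p. wker x k p * (expterm x p * amp p))" unfolding e by (intro Bochner_Integration.integrable_sum i)
  show "smoothed_expansion N \<sigma>x \<epsilon> V (smoothed_wigner \<sigma>x \<sigma>k \<epsilon> f f) x k = (LINT p|lborel. wker x k p * (expterm x p * amp p))"
    unfolding e smoothed_expansion_moments mderiv_smoothed_potential
    by (subst Bochner_Integration.integral_sum[OF i]) (simp only: case_prod_unfold integral_mult_right_zero)
qed

text \<open>
  The assumptions on \<open>\<kappa>\<close> and B are the conclusions of hermite_remainder and scaled_kernel_bound. They are
  carried along so that the constants can be chosen before \<open>\<epsilon>\<close> and f.\<close>

lemma remainder_bound:
  assumes \<kappa>: "\<And>a v Q C z (h :: real^'n). a > 0 \<Longrightarrow> v \<in> borel_measurable borel \<Longrightarrow> polyn N Q \<Longrightarrow>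
      \<forall>z. norm (v z - Q z) \<le> C * norm z ^ Suc N \<Longrightarrow>
      norm (v (z + h) - (\<Sum>(A, B)\<in>index_pairs N. hcoef a v (\<lambda>i. A i + B i) * hemc a A z * mpow (coord h) B / of_nat (mfact A * mfact B)))
        \<le> C * \<kappa> * (sqrt a + norm z + norm h) ^ Suc N"
    and C5: "\<And>(z::real^'n) (y::real^'n). gam var z * damp y * (sqrt var + norm z + norm ((\<epsilon> / 2) *\<^sub>R y)) ^ Suc N \<le> B * exp (- c * (norm y)\<^sup>2)"
    and c: "c > 0" and nn: "C * \<kappa> \<ge> 0" "B \<ge> 0"
  shows "norm (remainder x k) \<le> C * \<kappa> * B * ((LINT y|lborel. exp (- c * (norm (y::real^'n))\<^sup>2)) * (LINT u|lborel. (norm (f u))\<^sup>2))"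
proof -
  obtain Q where Q: "polyn N Q" "\<forall>z. norm (V' (x + z) - Q z) \<le> C * norm z ^ Suc N" using V'_approx[of x] by blast
  let ?F = "\<lambda>p. wker x k p * (V' (fst p + (\<epsilon> / 2) *\<^sub>R snd p) * amp p) - wker x k p * (expterm x p * amp p)"
  let ?G = "\<lambda>p. C * \<kappa> * B * (exp (- c * (norm (snd p))\<^sup>2) * norm (amp p))"
  have Fi: "integrable lborel ?F" by (intro Bochner_Integration.integrable_diff wigner_V'(1) expansion_V'(1))
  have Gi: "integrable lborel ?G" by (intro integrable_mult_right amp_average(1) c)
  have le: "norm (?F p) \<le> ?G p" for p
  proof -
    let ?z = "fst p - x" and ?h = "(\<epsilon> / 2) *\<^sub>R snd p"
    let ?T = "(sqrt var + norm ?z + norm ?h) ^ Suc N"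
    have m: "(\<lambda>z. V' (x + z)) \<in> borel_measurable borel" by measurable
    have "norm (V' (x + (?z + ?h)) - expterm x p) \<le> C * \<kappa> * ?T"
      unfolding expterm_def by (rule \<kappa>[OF var_pos m Q])
    then have R: "norm (V' (fst p + ?h) - expterm x p) \<le> C * \<kappa> * ?T" by (simp add: algebra_simps)
    have w: "norm (wker x k p) = gam var ?z * damp (snd p)"
      using gam_nonneg[OF var_pos, of ?z] damp_bounds[of "snd p"] by (simp add: wker_def norm_mult)
    have w0: "0 \<le> gam var ?z * damp (snd p)" using gam_nonneg[OF var_pos, of ?z] damp_bounds[of "snd p"] by simp
    have "?F p = wker x k p * ((V' (fst p + ?h) - expterm x p) * amp p)" by (simp add: algebra_simps)
    then have "norm (?F p) = (gam var ?z * damp (snd p)) * norm (V' (fst p + ?h) - expterm x p) * norm (amp p)"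
      by (simp only: norm_mult w mult.assoc)
    also have "\<dots> \<le> (gam var ?z * damp (snd p)) * (C * \<kappa> * ?T) * norm (amp p)"
      by (intro mult_right_mono mult_left_mono R w0) simp
    also have "\<dots> = C * \<kappa> * norm (amp p) * (gam var ?z * damp (snd p) * ?T)" by (simp only: mult_ac)
    also have "\<dots> \<le> C * \<kappa> * norm (amp p) * (B * exp (- c * (norm (snd p))\<^sup>2))"
      by (rule mult_left_mono[OF C5]) (use nn in simp)
    finally show ?thesis by (simp only: mult_ac)
  qed
  have "remainder x k = (LINT p|lborel. ?F p)"
    unfolding remainder_def wigner_V'(2) expansion_V'(2)
    by (rule Bochner_Integration.integral_diff[symmetric, OF wigner_V'(1) expansion_V'(1)])
  then have "norm (remainder x k) \<le> (LINT p|lborel. norm (?F p))" by (simp only: integral_norm_bound)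
  also have "\<dots> \<le> (LINT p|lborel. ?G p)" by (rule integral_mono[OF integrable_norm[OF Fi] Gi le])
  also have "\<dots> = C * \<kappa> * B * (LINT p|lborel. exp (- c * (norm (snd p))\<^sup>2) * norm (amp p))" by (rule integral_mult_right_zero)
  also have "\<dots> \<le> C * \<kappa> * B * ((LINT y|lborel. exp (- c * (norm (y::real^'n))\<^sup>2)) * (LINT u|lborel. (norm (f u))\<^sup>2))"
    using nn by (intro mult_left_mono amp_average(2) c) simp
  finally show ?thesis .
qed

text \<open>
  The essential supremum of a function that is not measurable is infinite by convention, so the pointwise
  bound alone would not suffice.\<close>

lemma remainder_measurable: "(\<lambda>q. remainder (fst q) (snd q)) \<in> borel_measurable borel"
proof -
  have wm: "(\<lambda>(q, p). wker (fst q) (snd q) p * h q p) \<in> borel_measurable (borel \<Otimes>\<^sub>M lborel)"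
    if [measurable]: "(\<lambda>(q, p). h q p) \<in> borel_measurable (borel \<Otimes>\<^sub>M lborel)" for h
    unfolding wker_def chi_def by measurable
  have 1: "(\<lambda>q. LINT p|lborel. wker (fst q) (snd q) p * (V' (fst p + (\<epsilon> / 2) *\<^sub>R snd p) * amp p)) \<in> borel_measurable borel"
    by (rule lborel.borel_measurable_lebesgue_integral, rule wm) measurable
  have 2: "(\<lambda>q. LINT p|lborel. moment (fst q) (snd q) A B p) \<in> borel_measurable borel" for A B
    unfolding moment_def mult.assoc
    by (rule lborel.borel_measurable_lebesgue_integral, rule wm) measurable
  have 3: "(\<lambda>q :: (real^'n) \<times> (real^'n). hcoef var (\<lambda>z. V' (fst q + z)) D) \<in> borel_measurable borel" for D
    unfolding hcoef_def
    by (intro borel_measurable_times borel_measurable_const lborel.borel_measurable_lebesgue_integral) measurable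
  show ?thesis
    unfolding remainder_def wigner_V'(2) smoothed_expansion_moments mderiv_smoothed_potential split_beta
    by (intro borel_measurable_diff borel_measurable_sum borel_measurable_times borel_measurable_divide borel_measurable_const 1 2 3)
qed

lemma Linf_remainder:
  assumes "\<And>x k. norm (remainder x k) \<le> b" shows "Linf_norm remainder \<le> ereal b"
  unfolding Linf_norm_def
proof (rule esssup_I)
  have "(\<lambda>z. ereal (norm (remainder (fst z) (snd z)))) \<in> borel_measurable borel"
    using remainder_measurable by measurable
  then show "(\<lambda>z. ereal (norm (remainder (fst z) (snd z)))) \<in> borel_measurable lebesgue"
    by (intro measurable_completion) simp
qed (use assms in simp)

end

section \<open>Approximation of the potential by differential operators\<close>

theorem theorem1p6:
  fixes N :: nat
  assumes "N \<ge> 1"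
  shows "\<exists>M2::real. M2 \<le> min (- real CARD('n::finite) - 1) (- 3) \<and>
    (\<forall>(\<sigma>x::real) (\<sigma>k::real). \<sigma>x > 0 \<longrightarrow> \<sigma>k > 0 \<longrightarrow> \<sigma>x\<^sup>2 \<le> 2 \<longrightarrow>
      (\<forall>V :: real^'n \<Rightarrow> real. let Vhat = distr_fourier (distr_of V) in
        tempered_fun V \<longrightarrow>
        sing_supp Vhat \<subseteq> {0} \<longrightarrow>
        (\<exists>C1 M1. C1 > 0 \<and> 0 \<le> M1 \<and> M1 \<le> real N + 1 \<and> bounded_at_origin Vhat C1 M1) \<longrightarrow>
        (\<exists>C2>0. \<forall>k. norm k > 1 \<longrightarrow> norm (distr_value Vhat k) \<le> C2 * norm k powr M2) \<longrightarrow>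
        (\<forall>f :: real \<Rightarrow> real^'n \<Rightarrow> complex.
          (\<forall>\<epsilon>\<in>{0<..<1}. schwartz (f \<epsilon>)) \<longrightarrow>
          (\<exists>M0>0. \<forall>\<epsilon>\<in>{0<..<1}. L2_norm_fun (f \<epsilon>) \<le> M0) \<longrightarrow>
          (let w = (\<lambda>\<epsilon>. smoothed_wigner \<sigma>x \<sigma>k \<epsilon> (f \<epsilon>) (f \<epsilon>));
               WV = (\<lambda>\<epsilon>. smoothed_wigner \<sigma>x \<sigma>k \<epsilon> (\<lambda>x. complex_of_real (V x) * f \<epsilon> x) (f \<epsilon>))
           in (\<forall>\<epsilon>\<in>{0<..<1}. \<forall>x k. schwartz (wigner_symbol \<sigma>x \<epsilon> (w \<epsilon>) x k) \<and>
                  WV \<epsilon> x k = Vhat (wigner_symbol \<sigma>x \<epsilon> (w \<epsilon>) x k)) \<and>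
              (\<exists>r. (\<forall>\<epsilon>\<in>{0<..<1}. \<forall>x k.
                      WV \<epsilon> x k = smoothed_expansion N \<sigma>x \<epsilon> V (w \<epsilon>) x k + r \<epsilon> x k) \<and>
                   (\<exists>C. \<forall>\<^sub>F \<epsilon> in at_right 0.
                      Linf_norm (r \<epsilon>)
                        \<le> ereal (C * \<epsilon> powr ((real N + 1) / 2 - real CARD('n)))))))))"
(* decay that leaves |k|^(N + 1) times the transform integrable at infinity, with room to spare *)
proof (unfold Let_def, rule exI[of _ "- (2 * real CARD('n) + real N + 4)"], rule conjI, simp, intro allI impI)
  fix \<sigma>x \<sigma>k :: real and V :: "real^'n \<Rightarrow> real" and f :: "real \<Rightarrow> real^'n \<Rightarrow> complex"
  assume s: "\<sigma>x > 0" "\<sigma>k > 0" and V: "tempered_fun V" and ss: "sing_supp (distr_fourier (distr_of V)) \<subseteq> {0}"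
    and lo: "\<exists>C1 M1. C1 > 0 \<and> 0 \<le> M1 \<and> M1 \<le> real N + 1 \<and> bounded_at_origin (distr_fourier (distr_of V)) C1 M1"
    and hi: "\<exists>C2>0. \<forall>k. norm k > 1 \<longrightarrow> norm (distr_value (distr_fourier (distr_of V)) k) \<le> C2 * norm k powr (- (2 * real CARD('n) + real N + 4))"
    and f: "\<forall>\<epsilon>\<in>{0<..<1}. schwartz (f \<epsilon>)" and L2: "\<exists>M0>0. \<forall>\<epsilon>\<in>{0<..<1}. L2_norm_fun (f \<epsilon>) \<le> M0"
  obtain C1 M1 where C1: "C1 > 0" "M1 \<le> real N + 1" "bounded_at_origin (distr_fourier (distr_of V)) C1 M1" using lo by blast
  obtain C2 where C2: "C2 > 0" "\<And>k. norm k > 1 \<Longrightarrow> norm (distr_value (distr_fourier (distr_of V)) k) \<le> C2 * norm k powr (- (2 * real CARD('n) + real N + 4))"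
    using hi by blast
  obtain M0 where M0: "M0 > 0" "\<And>\<epsilon>. \<epsilon> \<in> {0<..<1} \<Longrightarrow> L2_norm_fun (f \<epsilon>) \<le> M0" using L2 by blast
  obtain V' C where V': "V' \<in> borel_measurable borel" "moderate V'"
    "\<And>\<Phi>. schwartz \<Phi> \<Longrightarrow> (LINT x|lebesgue. complex_of_real (V x) * \<Phi> x) = (LINT x|lborel. V' x * \<Phi> x)"
    "\<And>x. \<exists>Q. polyn N Q \<and> (\<forall>z. norm (V' (x + z) - Q z) \<le> C * norm z ^ Suc N)"
    by (rule potential_representation[OF V ss C1 C2(1)]) (erule C2(2), rule that)
  have C0: "C \<ge> 0"
  proof -
    obtain Q where "\<And>z. norm (V' (0 + z) - Q z) \<le> C * norm z ^ Suc N" using V'(4)[of 0] by blast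
    from order_trans[OF norm_ge_zero this[of "axis undefined 1"]] show ?thesis by (simp add: norm_axis_1)
  qed
  have wp: "wigner_potential \<sigma>x \<sigma>k \<epsilon> (f \<epsilon>) V V' N C" if "\<epsilon> \<in> {0<..<1}" for \<epsilon>
    by unfold_locales (use that s f V V' in auto)
  have w: "wigner \<sigma>x \<sigma>k \<epsilon> (f \<epsilon>)" if "\<epsilon> \<in> {0<..<1}" for \<epsilon>
    by unfold_locales (use that s f in auto)
  obtain \<kappa> where \<kappa>: "\<kappa> \<ge> 0" "\<And>a v Q C z (h :: real^'n). a > 0 \<Longrightarrow> v \<in> borel_measurable borel \<Longrightarrow> polyn N Q \<Longrightarrow>
      \<forall>z. norm (v z - Q z) \<le> C * norm z ^ Suc N \<Longrightarrow>
      norm (v (z + h) - (\<Sum>(A, B)\<in>index_pairs N. hcoef a v (\<lambda>i. A i + B i) * hemc a A z * mpow (coord h) B / of_nat (mfact A * mfact B)))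
        \<le> C * \<kappa> * (sqrt a + norm z + norm h) ^ Suc N"
    by (rule hermite_remainder[where N=N and 'n='n]) (rule that)
  obtain C5 where C5: "C5 \<ge> 0" "\<And>\<epsilon> (z::real^'n) (y::real^'n). \<epsilon> > 0 \<Longrightarrow>
     gam (\<epsilon> * \<sigma>x\<^sup>2 / (4 * pi)) z * exp (- (pi * \<epsilon> * \<sigma>k\<^sup>2 / 2) * (norm y)\<^sup>2) * (sqrt (\<epsilon> * \<sigma>x\<^sup>2 / (4 * pi)) + norm z + norm ((\<epsilon> / 2) *\<^sub>R y)) ^ Suc N
       \<le> C5 * (sqrt \<epsilon> ^ Suc N / sqrt \<epsilon> ^ CARD('n)) * exp (- (pi * \<sigma>k\<^sup>2 / 4 * \<epsilon>) * (norm y)\<^sup>2)"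
    by (rule scaled_kernel_bound[OF s, where K="Suc N" and 'n='n]) (rule that)
  define r where "r \<epsilon> = wigner_potential.remainder \<sigma>x \<sigma>k \<epsilon> (f \<epsilon>) V N" for \<epsilon>
  define G where "G = (LINT y|lborel. exp (- (pi * \<sigma>k\<^sup>2 / 4) * (norm (y::real^'n))\<^sup>2))"
  have G: "G \<ge> 0" unfolding G_def by (rule integral_nonneg_AE) simp
  have bound: "norm (r \<epsilon> x k) \<le> (C * \<kappa> * C5 * G * M0\<^sup>2) * \<epsilon> powr ((real N + 1) / 2 - real CARD('n))" if e: "\<epsilon> \<in> {0<..<1}" for \<epsilon> x k
  proof -
    interpret wigner_potential \<sigma>x \<sigma>k \<epsilon> "f \<epsilon>" V V' N C by (rule wp[OF e])
    have e0: "\<epsilon> > 0" using e by simp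
    let ?B = "C5 * (sqrt \<epsilon> ^ Suc N / sqrt \<epsilon> ^ CARD('n))" and ?c = "pi * \<sigma>k\<^sup>2 / 4 * \<epsilon>"
    have l2: "(LINT u|lborel. (norm (f \<epsilon> u))\<^sup>2) \<le> M0\<^sup>2"
    proof -
      have "(LINT u|lebesgue. (norm (f \<epsilon> u))\<^sup>2) = (LINT u|lborel. (norm (f \<epsilon> u))\<^sup>2)" by (rule integral_completion) measurable
      then show ?thesis using M0(2)[OF e] unfolding L2_norm_fun_def by (simp add: sqrt_le_D)
    qed
    have "norm (remainder x k) \<le> C * \<kappa> * ?B * ((LINT y|lborel. exp (- ?c * (norm (y::real^'n))\<^sup>2)) * (LINT u|lborel. (norm (f \<epsilon> u))\<^sup>2))"
    proof (rule remainder_bound[OF \<kappa>(2)])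
      show "gam var z * damp y * (sqrt var + norm z + norm ((\<epsilon> / 2) *\<^sub>R y)) ^ Suc N \<le> ?B * exp (- ?c * (norm y)\<^sup>2)" for z y :: "real^'n"
        using C5(2)[OF e0, of z y] unfolding var_def damp_def .
    qed (use e0 s C0 \<kappa>(1) C5(1) in auto)
    also have "\<dots> = C * \<kappa> * ?B * (G / sqrt \<epsilon> ^ CARD('n) * (LINT u|lborel. (norm (f \<epsilon> u))\<^sup>2))"
      unfolding G_def gaussian_integral_scale[OF e0] ..
    also have "\<dots> \<le> C * \<kappa> * ?B * (G / sqrt \<epsilon> ^ CARD('n) * M0\<^sup>2)"
      using e0 C0 \<kappa>(1) C5(1) G by (intro mult_left_mono l2) auto
    also have "\<dots> = (C * \<kappa> * C5 * G * M0\<^sup>2) * (sqrt \<epsilon> ^ Suc N / (sqrt \<epsilon> ^ CARD('n) * sqrt \<epsilon> ^ CARD('n)))" by simp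
    also have "sqrt \<epsilon> ^ Suc N / (sqrt \<epsilon> ^ CARD('n) * sqrt \<epsilon> ^ CARD('n)) = \<epsilon> powr ((real N + 1) / 2 - real CARD('n))"
    proof -
      have "sqrt \<epsilon> ^ Suc N = \<epsilon> powr ((real N + 1) / 2)"
        using e0 by (simp add: powr_half_sqrt[symmetric] powr_powr add.commute flip: powr_realpow power_Suc)
      moreover have "sqrt \<epsilon> ^ CARD('n) * sqrt \<epsilon> ^ CARD('n) = \<epsilon> powr real CARD('n)"
        using e0 by (simp add: powr_realpow flip: power_mult_distrib)
      ultimately show ?thesis by (simp add: powr_diff)
    qed
    finally show ?thesis unfolding r_def .
  qed
  show "(\<forall>\<epsilon>\<in>{0<..<1}. \<forall>x k. schwartz (wigner_symbol \<sigma>x \<epsilon> (smoothed_wigner \<sigma>x \<sigma>k \<epsilon> (f \<epsilon>) (f \<epsilon>)) x k) \<and>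
      smoothed_wigner \<sigma>x \<sigma>k \<epsilon> (\<lambda>x. complex_of_real (V x) * f \<epsilon> x) (f \<epsilon>) x k = distr_fourier (distr_of V) (wigner_symbol \<sigma>x \<epsilon> (smoothed_wigner \<sigma>x \<sigma>k \<epsilon> (f \<epsilon>) (f \<epsilon>)) x k)) \<and>
    (\<exists>r. (\<forall>\<epsilon>\<in>{0<..<1}. \<forall>x k. smoothed_wigner \<sigma>x \<sigma>k \<epsilon> (\<lambda>x. complex_of_real (V x) * f \<epsilon> x) (f \<epsilon>) x k
        = smoothed_expansion N \<sigma>x \<epsilon> V (smoothed_wigner \<sigma>x \<sigma>k \<epsilon> (f \<epsilon>) (f \<epsilon>)) x k + r \<epsilon> x k) \<and>
      (\<exists>C. \<forall>\<^sub>F \<epsilon> in at_right 0. Linf_norm (r \<epsilon>) \<le> ereal (C * \<epsilon> powr ((real N + 1) / 2 - real CARD('n)))))"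
  proof (intro conjI ballI allI exI[of _ r])
    fix \<epsilon> x k assume e: "\<epsilon> \<in> {0<..<1::real}"
    show "schwartz (wigner_symbol \<sigma>x \<epsilon> (smoothed_wigner \<sigma>x \<sigma>k \<epsilon> (f \<epsilon>) (f \<epsilon>)) x k)"
      by (rule wigner.schwartz_wigner_symbol[OF w[OF e]])
    show "smoothed_wigner \<sigma>x \<sigma>k \<epsilon> (\<lambda>x. complex_of_real (V x) * f \<epsilon> x) (f \<epsilon>) x k = distr_fourier (distr_of V) (wigner_symbol \<sigma>x \<epsilon> (smoothed_wigner \<sigma>x \<sigma>k \<epsilon> (f \<epsilon>) (f \<epsilon>)) x k)"
      by (rule wigner.wigner_potential_pairing(1)[OF w[OF e] V])
    show "smoothed_wigner \<sigma>x \<sigma>k \<epsilon> (\<lambda>x. complex_of_real (V x) * f \<epsilon> x) (f \<epsilon>) x k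
        = smoothed_expansion N \<sigma>x \<epsilon> V (smoothed_wigner \<sigma>x \<sigma>k \<epsilon> (f \<epsilon>) (f \<epsilon>)) x k + r \<epsilon> x k"
      unfolding r_def wigner_potential.remainder_def[OF wp[OF e]] by simp
  next
    have "\<forall>\<^sub>F \<epsilon> in at_right 0. \<epsilon> \<in> {0<..<1::real}" by (rule eventually_at_right_less[THEN eventually_mp[rotated]]) (auto simp: eventually_at_right_field intro!: exI[of _ 1])
    then have "\<forall>\<^sub>F \<epsilon> in at_right 0. Linf_norm (r \<epsilon>) \<le> ereal ((C * \<kappa> * C5 * G * M0\<^sup>2) * \<epsilon> powr ((real N + 1) / 2 - real CARD('n)))"
      by eventually_elim (unfold r_def, rule wigner_potential.Linf_remainder[OF wp], assumption, rule bound[unfolded r_def])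
    then show "\<exists>C. \<forall>\<^sub>F \<epsilon> in at_right 0. Linf_norm (r \<epsilon>) \<le> ereal (C * \<epsilon> powr ((real N + 1) / 2 - real CARD('n)))" by blast
  qed
qed

end
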